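(* For every $\beta>0$ and for any distribution of the (i.i.d., symmetric) couplings that is continuous with $\mathbb{R}$ as support, the ROSt $Q_J$ constructed from a metastate $\kappa_J$ of the Edwards–Anderson model on $\mathbb{Z}^d$ with periodic boundary conditions and from the edge overlap $R$ is stochastically stable, for $\nu$-almost all $J$.
   Context: Edges are unordered nearest-neighbor pairs $\{x,y\}$ of $\mathbb{Z}^d$; for finite $\Lambda\subset\mathbb{Z}^d$, $\Lambda^*$ is the set of edges with both endpoints in $\Lambda$. The couplings $J=(J_{xy})$, indexed by all edges of $\mathbb{Z}^d$, are i.i.d. with a common symmetric law on $\mathbb{R}$; their joint (product) law is $\nu(dJ)$. The hypothesis on the couplings is that their distribution is continuous and its support is $\mathbb{R}$. For a box $\Lambda$, the Edwards–Anderson (EA) Hamiltonian on $\{-1,+1\}^\Lambda$ is $H_{\Lambda,J}(\sigma)=-\sum_{\{x,y\}}J_{xy}\sigma_x\sigma_y$, summed over the edges of $\Lambda^*$ and the additional wrap-around edges giving $\Lambda$ periodic boundary conditions (the edge from $x\in\Lambda$ to $x+e_i$ taken modulo $\Lambda$ carries the coupling $J_{x,x+e_i}$). The Gibbs measure is $G_{\Lambda,\beta,J}(\sigma)=e^{-\beta H_{\Lambda,J}(\sigma)}/Z_{\Lambda,J}(\beta)$, with $Z_{\Lambda,J}(\beta)=\sum_\sigma e^{-\beta H_{\Lambda,J}(\sigma)}$. Metastate: let $(\Lambda_n)$ be a sequence of boxes converging to $\mathbb{Z}^d$ along which the laws $\nu(dJ)\prod_{i\in\mathbb{N}}G_{\Lambda_n,\beta,J}$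 of $(J,\{\sigma^i\}_{i\in\mathbb{N}})$ converge in the sense of finite-dimensional distributions (on the couplings and on the spins of the replicas) to a law $M$ on $(J,\{\sigma^i\}_{i\in\mathbb{N}})$, $\sigma^i\in\{-1,+1\}^{\mathbb{Z}^d}$ (such sequences exist by compactness). By exchangeability and de Finetti's theorem, $M=\nu(dJ)\int\kappa_J(d\Gamma)\prod_{i\in\mathbb{N}}\Gamma$, where, for $\nu$-almost all $J$, $\kappa_J$ is a probability measure on the space of Borel probability measures $\Gamma$ on $\{-1,+1\}^{\mathbb{Z}^d}$ (product topology). Any such $\kappa_J$ is called a metastate. The edge overlap is $R(\sigma,\sigma')=\lim_{W\to\mathbb{Z}^d}\frac1{|W^*|}\sum_{\{x,y\}\in W^*}\sigma_x\sigma_y\sigma'_x\sigma'_y$, the limit being over finite sets $W$ growing to $\mathbb{Z}^d$ (e.g. cubes centered at the origin); by translation invariance of $M$ and the ergodic theorem it exists almost surely under $M$ for pairs of replicas. A Random Overlap Structure (ROSt) is a random $\mathbb{N}\times\mathbb{N}$ covariance matrix $\{q_{ij}\}$ with $1$'s on the diagonal whose law is invariant under $q_{ij}\mapsto q_{\pi(i)\pi(j)}$ for every permutation $\pi$ of finitely many indices. The ROSt $Q_J=\{q_{ij}(J)\}$ has law determined by $\mathbb{E}[F(q_{ij}(J):1\le i<j\le s)]=\int\kappa_J(d\Gamma)\,\Gamma^{\times s}\big(F(R(\sigma^i,\sigma^j):1\le i<j\le s)\big)$ for all $s\in\mathbb{N}$ and all continuous $F$, where $\Gamma^{\times s}$ is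 the $s$-fold product measure. Sampling measure: by the Dovbysh–Sudakov theorem, for every ROSt there is a random probability measure $\mu$ on the unit ball $\mathcal{B}$ of a Hilbert space (with inner product $\cdot$) such that, conditionally on $\mu$, $\{q_{ij}:i\ne j\}$ has the same law as $\{v^i\cdot v^j:i\neq j\}$ with $(v^i)$ i.i.d. of law $\mu$. It is called the sampling measure of the ROSt, and is unique up to isometries of the Hilbert space (possibly depending on the realization of $\mu$). Stochastic stability: a ROSt with sampling measure $\mu$ is stochastically stable if for all $\lambda>0$, $s\in\mathbb{N}$, the ROSt defined from the sampling measure $\mu(dv)e^{\lambda l(v)-\frac{\lambda^2}{2}\|v\|^2}/\mu(e^{\lambda l(v)-\frac{\lambda^2}{2}\|v\|^2})$ has the same law as the original ROSt; that is, for all continuous functions $F(\vec v)=F(v^i\cdot v^j:1\le i<j\le s)$ on $s$ replicas $\vec v=(v^1,\dots,v^s)$, $$E_l\,\mathbb{E}\left[\frac{\mu^{\times s}\Big(F(\vec v)\prod_{i=1}^s e^{\lambda l(v^i)-\frac{\lambda^2}{2}\|v^i\|^2}\Big)}{\mu\Big(e^{\lambda l(v)-\frac{\lambda^2}{2}\|v\|^2}\Big)^s}\right]=\mathbb{E}\big[\mu^{\times s}(F(\vec v))\big],$$ where $(l(v),v\in\mathcal{B})$ is a centered (isonormal) Gaussian field independent of $\mu$ with $E_l[l(v)l(v')]=v\cdot v'$, and $E_l$ is expectation over this field. *)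

theory Defs
  imports "HOL-Probability.Probability"
begin

section \<open>Lattice, couplings and spin configurations\<close>

type_synonym 'd site = "int ^ 'd"
type_synonym 'd edge = "(int ^ 'd) set"
type_synonym 'd config = "int ^ 'd \<Rightarrow> real"

definition edges :: "('d::finite) edge set" where
  "edges = {{x, y} | x y. (\<Sum>i\<in>UNIV. \<bar>x $ i - y $ i\<bar>) = 1}"

definition edges_in :: "('d::finite) site set \<Rightarrow> 'd edge set" where
  "edges_in \<Lambda> = {e \<in> edges. e \<subseteq> \<Lambda>}"

definition lattice_box :: "('d::finite) site \<Rightarrow> 'd site \<Rightarrow> 'd site set" where
  "lattice_box a b = {x. \<forall>i. a $ i \<le> x $ i \<and> x $ i \<le> b $ i}"

definition topological_support :: "('a::topological_space) measure \<Rightarrow> 'a set" where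
  "topological_support \<rho> = {x. \<forall>U. open U \<and> x \<in> U \<longrightarrow> 0 < emeasure \<rho> U}"

definition coupling_law :: "real measure \<Rightarrow> (('d::finite) edge \<Rightarrow> real) measure" where
  "coupling_law \<rho> = PiM edges (\<lambda>_. \<rho>)"

definition config_space :: "('d::finite) config measure" where
  "config_space = PiM UNIV (\<lambda>_. count_space {-1, 1})"

abbreviation replicas :: "'a measure \<Rightarrow> (nat \<Rightarrow> 'a) measure" where
  "replicas \<Gamma> \<equiv> PiM UNIV (\<lambda>_. \<Gamma>)"


section \<open>The Edwards--Anderson Gibbs measure on a periodic box\<close>

definition torus_step :: "('d::finite) site \<Rightarrow> 'd site \<Rightarrow> 'd \<Rightarrow> 'd site \<Rightarrow> 'd site" where
  "torus_step a b i x =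
     (\<chi> j. if j = i then (if x $ i = b $ i then a $ i else x $ i + 1) else x $ j)"

text \<open>Summing over all \<open>x\<close> in the box and all directions \<open>i\<close> lists each edge inside the box and each
  wrap-around edge once; the latter carry the coupling of the lattice edge \<open>{x, x + e\<^sub>i}\<close>
  sticking out of the box.\<close>
definition hamiltonian ::
    "('d::finite) site \<Rightarrow> 'd site \<Rightarrow> ('d edge \<Rightarrow> real) \<Rightarrow> 'd config \<Rightarrow> real" where
  "hamiltonian a b J \<sigma> =
     - (\<Sum>x\<in>lattice_box a b. \<Sum>i\<in>UNIV. J {x, x + axis i 1} * \<sigma> x * \<sigma> (torus_step a b i x))"

definition partition_function ::
    "('d::finite) site \<Rightarrow> 'd site \<Rightarrow> real \<Rightarrow> ('d edge \<Rightarrow> real) \<Rightarrow> real" where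
  "partition_function a b \<beta> J =
     (\<Sum>\<sigma> \<in> lattice_box a b \<rightarrow>\<^sub>E {-1, 1}. exp (- \<beta> * hamiltonian a b J \<sigma>))"

definition gibbs ::
    "('d::finite) site \<Rightarrow> 'd site \<Rightarrow> real \<Rightarrow> ('d edge \<Rightarrow> real) \<Rightarrow> 'd config measure" where
  "gibbs a b \<beta> J = point_measure (lattice_box a b \<rightarrow>\<^sub>E {-1, 1})
     (\<lambda>\<sigma>. ennreal (exp (- \<beta> * hamiltonian a b J \<sigma>) / partition_function a b \<beta> J))"

text \<open>To compare boxes, box configurations are extended by \<open>1\<close> to the whole lattice. The choice is
  immaterial: only limits along boxes that eventually contain any given site are taken.\<close>
definition gibbs_ext ::
    "('d::finite) site \<Rightarrow> 'd site \<Rightarrow> real \<Rightarrow> ('d edge \<Rightarrow> real) \<Rightarrow> 'd config measure" where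
  "gibbs_ext a b \<beta> J =
     distr (gibbs a b \<beta> J) config_space (\<lambda>\<sigma> x. if x \<in> lattice_box a b then \<sigma> x else 1)"


section \<open>Metastates\<close>

text \<open>The joint law \<open>\<nu>(dJ) K\<^sub>J\<close> of couplings and replicas.\<close>
definition joint_law ::
    "(('d::finite) edge \<Rightarrow> real) measure \<Rightarrow> (('d edge \<Rightarrow> real) \<Rightarrow> (nat \<Rightarrow> 'd config) measure)
     \<Rightarrow> (('d edge \<Rightarrow> real) \<times> (nat \<Rightarrow> 'd config)) measure" where
  "joint_law \<nu> K =
     do { J \<leftarrow> \<nu>; \<sigma> \<leftarrow> K J; return (\<nu> \<Otimes>\<^sub>M replicas config_space) (J, \<sigma>) }"

text \<open>Weak convergence of the marginals on finitely many couplings and finitely many spins of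
  finitely many replicas; continuity is for the product topology.\<close>
definition fdd_tendsto ::
    "(nat \<Rightarrow> ((('d::finite) edge \<Rightarrow> real) \<times> (nat \<Rightarrow> 'd config)) measure)
     \<Rightarrow> (('d edge \<Rightarrow> real) \<times> (nat \<Rightarrow> 'd config)) measure \<Rightarrow> bool" where
  "fdd_tendsto L M \<longleftrightarrow>
     (\<forall>f :: ('d edge \<Rightarrow> real) \<times> (nat \<Rightarrow> 'd config) \<Rightarrow> real.
        continuous_on UNIV f \<and> bounded (range f) \<and>
        (\<exists>E I V. finite E \<and> E \<subseteq> edges \<and> finite I \<and> finite V \<and>
           (\<forall>J J' \<sigma> \<sigma>'. (\<forall>e\<in>E. J e = J' e) \<and> (\<forall>i\<in>I. \<forall>x\<in>V. \<sigma> i x = \<sigma>' i x)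
              \<longrightarrow> f (J, \<sigma>) = f (J', \<sigma>')))
        \<longrightarrow> (\<lambda>n. \<integral>z. f z \<partial>L n) \<longlonglongrightarrow> (\<integral>z. f z \<partial>M))"

definition boxes_to_lattice :: "(nat \<Rightarrow> ('d::finite) site) \<Rightarrow> (nat \<Rightarrow> 'd site) \<Rightarrow> bool" where
  "boxes_to_lattice a b \<longleftrightarrow> (\<forall>x. \<forall>\<^sub>F n in sequentially. x \<in> lattice_box (a n) (b n))"

definition is_metastate ::
    "real measure \<Rightarrow> real \<Rightarrow> ((('d::finite) edge \<Rightarrow> real) \<Rightarrow> 'd config measure measure) \<Rightarrow> bool" where
  "is_metastate \<rho> \<beta> \<kappa> \<longleftrightarrow>
     \<kappa> \<in> coupling_law \<rho> \<rightarrow>\<^sub>M prob_algebra (prob_algebra config_space) \<and>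
     (\<exists>a b M. boxes_to_lattice a b \<and>
        fdd_tendsto
          (\<lambda>n. joint_law (coupling_law \<rho>) (\<lambda>J. replicas (gibbs_ext (a n) (b n) \<beta> J))) M \<and>
        M = joint_law (coupling_law \<rho>) (\<lambda>J. do { \<Gamma> \<leftarrow> \<kappa> J; replicas \<Gamma> }))"


section \<open>Random overlap structures\<close>

text \<open>A ROSt is represented by its law on arrays.\<close>
definition array_space :: "(nat \<times> nat \<Rightarrow> real) measure" where
  "array_space = PiM UNIV (\<lambda>_. borel)"

definition is_rost :: "(nat \<times> nat \<Rightarrow> real) measure \<Rightarrow> bool" where
  "is_rost Q \<longleftrightarrow>
     Q \<in> space (prob_algebra array_space) \<and>
     (AE q in Q. (\<forall>i. q (i, i) = 1) \<and> (\<forall>i j. q (i, j) = q (j, i)) \<and>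
        (\<forall>n c. 0 \<le> (\<Sum>i<n. \<Sum>j<n. c i * c j * q (i, j)))) \<and>
     (\<forall>\<pi> A. finite A \<and> \<pi> permutes A \<longrightarrow>
        distr Q array_space (\<lambda>q (i, j). q (\<pi> i, \<pi> j)) = Q)"

definition overlap_array :: "('a \<Rightarrow> 'a \<Rightarrow> real) \<Rightarrow> (nat \<Rightarrow> 'a) \<Rightarrow> nat \<times> nat \<Rightarrow> real" where
  "overlap_array R x = (\<lambda>(i, j). if i = j then 1 else R (x i) (x j))"

text \<open>The array with unit diagonal and off-diagonal entries \<open>R (x i) (x j)\<close>, where, given the random
  measure \<open>m\<close> of law \<open>P\<close>, the \<open>x i\<close> are i.i.d. with law \<open>m\<close>.\<close>
definition overlap_array_law ::
    "('a \<Rightarrow> 'a \<Rightarrow> real) \<Rightarrow> 'a measure measure \<Rightarrow> (nat \<times> nat \<Rightarrow> real) measure" where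
  "overlap_array_law R P =
     do { m \<leftarrow> P; x \<leftarrow> replicas m; return array_space (overlap_array R x) }"

definition edge_overlap :: "('d::finite) config \<Rightarrow> 'd config \<Rightarrow> real" where
  "edge_overlap \<sigma> \<sigma>' =
     lim (\<lambda>n::nat. let W = lattice_box (\<chi> i. - int n) (\<chi> i. int n) in
       (\<Sum>e\<in>edges_in W. \<Prod>x\<in>e. \<sigma> x * \<sigma>' x) / real (card (edges_in W)))"

definition ea_rost ::
    "((('d::finite) edge \<Rightarrow> real) \<Rightarrow> 'd config measure measure) \<Rightarrow> ('d edge \<Rightarrow> real)
     \<Rightarrow> (nat \<times> nat \<Rightarrow> real) measure" where
  "ea_rost \<kappa> J = overlap_array_law edge_overlap (\<kappa> J)"


section \<open>Sampling measures and stochastic stability\<close>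

text \<open>Hilbert spaces are separable (class \<open>polish_space\<close>), so that the inner product is measurable
  for the product \<open>\<sigma>\<close>-algebra. A random measure on the unit ball is represented by its law \<open>P\<close>.
  The array law has diagonal \<open>1\<close> on both sides, so the equation only concerns \<open>i \<noteq> j\<close>.\<close>
definition is_sampling_measure ::
    "('h::{real_inner, polish_space}) measure measure \<Rightarrow> (nat \<times> nat \<Rightarrow> real) measure \<Rightarrow> bool" where
  "is_sampling_measure P Q \<longleftrightarrow>
     P \<in> space (prob_algebra (prob_algebra (restrict_space borel (cball 0 1)))) \<and>
     overlap_array_law (\<bullet>) P = Q"

text \<open>Possibly degenerate.\<close>
definition centered_normal :: "real measure \<Rightarrow> bool" where
  "centered_normal N \<longleftrightarrow>
     N = return borel 0 \<or> (\<exists>s>0. N = density lborel (\<lambda>x. ennreal (normal_density 0 s x)))"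

text \<open>Joint measurability is what gives the integrals of \<open>exp (t * l v)\<close> over \<open>v\<close> a meaning.\<close>
definition isonormal_field ::
    "'w measure \<Rightarrow> (('h::{real_inner, polish_space}) \<Rightarrow> 'w \<Rightarrow> real) \<Rightarrow> bool" where
  "isonormal_field \<Omega> l \<longleftrightarrow>
     prob_space \<Omega> \<and>
     (\<lambda>(v, \<omega>). l v \<omega>) \<in> borel_measurable (restrict_space borel (cball 0 1) \<Otimes>\<^sub>M \<Omega>) \<and>
     (\<forall>S c. finite S \<and> S \<subseteq> cball 0 1 \<longrightarrow>
        centered_normal (distr \<Omega> borel (\<lambda>\<omega>. \<Sum>v\<in>S. c v * l v \<omega>))) \<and>
     (\<forall>v\<in>cball 0 1. \<forall>v'\<in>cball 0 1. (\<integral>\<omega>. l v \<omega> * l v' \<omega> \<partial>\<Omega>) = v \<bullet> v')"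

definition tilt ::
    "real \<Rightarrow> (('h::real_inner) \<Rightarrow> 'w \<Rightarrow> real) \<Rightarrow> 'w \<Rightarrow> 'h \<Rightarrow> real" where
  "tilt t l \<omega> v = exp (t * l v \<omega> - t\<^sup>2 / 2 * (norm v)\<^sup>2)"

text \<open>The sampling measure is unique up to isometries and the field is unique in law, so quantifying
  over all sampling measures \<open>P\<close> in \<open>'h\<close> and all realizations \<open>(\<Omega>, l)\<close> of the field on \<open>'w\<close> expresses
  the condition for ``the'' sampling measure and field. Independence of the field and the sampling
  measure is built into the iterated integral.\<close>
definition stochastically_stable ::
    "('h::{real_inner, polish_space}) itself \<Rightarrow> 'w itself \<Rightarrow> (nat \<times> nat \<Rightarrow> real) measure \<Rightarrow> bool" where
  "stochastically_stable _ _ Q \<longleftrightarrow>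
     is_rost Q \<and>
     (\<forall>(P :: 'h measure measure) (\<Omega> :: 'w measure) (l :: 'h \<Rightarrow> 'w \<Rightarrow> real).
        is_sampling_measure P Q \<and> isonormal_field \<Omega> l \<longrightarrow>
        (\<forall>t>0. \<forall>s::nat. \<forall>F :: (nat \<times> nat \<Rightarrow> real) \<Rightarrow> real.
           continuous_on UNIV F \<and>
           (\<forall>q q'. (\<forall>i j. i < j \<and> j < s \<longrightarrow> q (i, j) = q' (i, j)) \<longrightarrow> F q = F q') \<longrightarrow>
           (\<integral>\<omega>. (\<integral>\<mu>.
                (\<integral>v. F (\<lambda>(i, j). v i \<bullet> v j) * (\<Prod>i<s. tilt t l \<omega> (v i)) \<partial>PiM {..<s} (\<lambda>_. \<mu>))
                  / (\<integral>v. tilt t l \<omega> v \<partial>\<mu>) ^ s \<partial>P) \<partial>\<Omega>)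
           = (\<integral>\<mu>. (\<integral>v. F (\<lambda>(i, j). v i \<bullet> v j) \<partial>PiM {..<s} (\<lambda>_. \<mu>)) \<partial>P)))"

end

theory Submission
 imports Defs
begin

text \<open>Fixing the couplings in a finite set \<open>A\<close> to prescribed values \<open>k\<close> reweights the finite volume Gibbs
measures and makes them independent of the couplings in \<open>A\<close>; both properties pass to the metastate.
By translation invariance and the ergodic theorem the overlaps are independent of the couplings. As the
law of the couplings charges every neighbourhood of \<open>k\<close>, where fixing the couplings changes little, the
law of the overlaps is not affected by the reweighting, for almost all couplings and all \<open>k\<close>: it is
invariant under weights \<open>exp (\<Sum>e. h e * edge_spin sg e)\<close>. With i.i.d. Gaussian \<open>h\<close> the exponent is
a Gaussian field whose covariance is the edge overlap in a finite cube. Trigonometric polynomials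
approximate the exponential in mean square, and their Gaussian moments are continuous functions of the
covariances. Hence the expectations for this field converge, as the cube grows, to those for the
isonormal field on the sampling measure.\<close>

text \<open>The tilted weights are unbounded and their normalization is random, so convergence of
  overlap arrays does not by itself yield convergence of the ratios. Two devices repair this. The
  trigonometric approximation takes values in some \<open>[k, K]\<close> with \<open>k > 0\<close>;
  then \<open>1 / z ^ s\<close> can be replaced by polynomials in the normalization
  \<open>z\<close>, and each factor \<open>z\<close> is an expectation over one more replica, so
  that only moments of finitely many replicas remain. Moreover, the overlap array has diagonal
  \<open>1\<close>, whereas \<open>v \<bullet> v\<close> may be smaller and is not an entry of it.
  So an independent Gaussian of variance \<open>1 - v \<bullet> v\<close> is averaged in: this turns
  \<open>exp (t * z - t^2 / 2)\<close> with standard normal \<open>z\<close> into the required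
  weight at \<open>v\<close>, and the moments contain off-diagonal overlaps only. The exceptional
  set of couplings must serve uncountably many \<open>k\<close>, even \<open>k\<close> that depend
  on the couplings; rational \<open>k\<close> and total variation bounds provide this.\<close>

abbreviation (input) "bm == borel_measurable"
abbreviation (input) "cfg == config_space"
abbreviation (input) LIMSEQ_ascii (infixr "---->" 60) where "X ----> L == X \<longlonglongrightarrow> L"
abbreviation (input) measurable_ascii (infixr "->M" 60) where "M ->M N == M \<rightarrow>\<^sub>M N"
abbreviation (input) pair_measure_ascii (infixr "**M" 80) where "M **M N == M \<Otimes>\<^sub>M N"
lemmas mcomp = measurable_compose and space_eqI = sets_eq_imp_space_eq
lemmas mcs = measurable_cong_sets[OF _ refl]
lemmas integrable_add = Bochner_Integration.integrable_add
 and integrable_bound = Bochner_Integration.integrable_bound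
 and integrable_diff = Bochner_Integration.integrable_diff
 and integrable_sum = Bochner_Integration.integrable_sum
 and integral_add = Bochner_Integration.integral_add
 and integral_cong = Bochner_Integration.integral_cong
 and integral_sum = Bochner_Integration.integral_sum

section \<open>Pointwise convergence of averages over cubes\<close>

definition cube :: "nat => ('d::finite) site set" where
 "cube n = lattice_box (\<chi> i. - int n) (\<chi> i. int n)"

lemma mem_cube: "x : cube n \<longleftrightarrow> (\<forall>i. \<bar>x $ i\<bar> <= int n)"
proof -
 have "- int n <= x $ i & x $ i <= int n \<longleftrightarrow> \<bar>x $ i\<bar> <= int n" for i by linarith
 then show ?thesis by (simp add: cube_def lattice_box_def)
qed

lemma lattice_box_eq_image:
 "lattice_box a b = (%f. \<chi> i. f i) ` (PiE UNIV (%i. {a $ i..b $ i}))"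
proof (intro set_eqI iffI)
 fix x assume "x : lattice_box a b"
 then have "(%i. x $ i) : PiE UNIV (%i. {a $ i..b $ i})"
  by (auto simp: lattice_box_def)
 then show "x : (%f. \<chi> i. f i) ` (PiE UNIV (%i. {a $ i..b $ i}))"
  by (rule rev_image_eqI) simp
qed (auto simp: lattice_box_def PiE_iff)

lemma finite_lattice_box [simp]: "finite (lattice_box a b)"
 unfolding lattice_box_eq_image by (intro finite_imageI finite_PiE) auto

lemma card_lattice_box: "card (lattice_box a b) = (PROD i:UNIV. nat (b $ i - a $ i + 1))"
proof -
 have "inj_on (%f. \<chi> i. f i) (PiE UNIV (%i. {a $ i..b $ i}))"
  by (auto simp: inj_on_def vec_eq_iff fun_eq_iff)
 then have "card (lattice_box a b) = card (PiE UNIV (%i. {a $ i..b $ i}))"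
  unfolding lattice_box_eq_image by (rule card_image)
 also have "... = (PROD i:UNIV. nat (b $ i - a $ i + 1))"
  by (subst card_PiE) (auto intro!: prod.cong)
 finally show ?thesis .
qed

lemma finite_cube [simp]: "finite (cube n)"
 by (simp add: cube_def)

lemma card_cube: "card (cube n :: ('d::finite) site set) = (2 * n + 1) ^ CARD('d)"
proof -
 have "nat (int n - - int n + 1) = 2 * n + 1" by simp
 then show ?thesis by (simp add: cube_def card_lattice_box)
qed

lemma card_cube_pos [simp]: "card (cube n :: ('d::finite) site set) > 0"
 by (simp add: card_cube)

lemma zero_in_cube [simp]: "0 : cube n" by (simp add: mem_cube)

lemma cube_add: "x : cube m ==> y : cube n ==> x + y : cube (m + n)"
 unfolding mem_cube by (metis add_mono abs_triangle_ineq order_trans of_nat_add vector_add_component)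

lemma cube_minus: "x : cube m ==> - x : cube m"
 by (simp add: mem_cube)

lemma cube_mono: "m <= n ==> cube m \<subseteq> cube n"
proof
 fix x :: "(int, 'a) vec" assume "m <= n" "x : cube m"
 then have "\<bar>x $ i\<bar> <= int m" "int m <= int n" for i by (auto simp: mem_cube)
 then show "x : cube n" unfolding mem_cube by (meson order_trans)
qed

lemma ex_mem_cube: "\<exists>r. x : cube r"
proof
 show "x : cube (nat (SUM i:UNIV. \<bar>x $ i\<bar>))"
  by (auto simp: mem_cube intro!: member_le_sum sum_nonneg)
qed

lemma card_cube_double: "card (cube (2 * n) :: ('d::finite) site set) <= 2 ^ CARD('d) * card (cube n :: 'd site set)"
 unfolding card_cube power_mult_distrib[symmetric] by (intro power_mono) auto

text \<open>The Folner property: a boundary layer of fixed width \<open>r\<close> is negligible in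
  volume. The errors of translations and of repeated averages are controlled by this
  quotient.\<close>

lemma card_cube_ratio:
 "(%k. real (card (cube (k + r) :: ('d::finite) site set)) / real (card (cube k :: 'd site set))) ----> 1"
proof -
 have "(%k. (2 * (real k + real r) + 1) / (2 * real k + 1)) ----> 1"
  by real_asymp
 from tendsto_power[OF this, of "CARD('d)"] show ?thesis
  by (simp add: card_cube power_divide algebra_simps)
qed

text \<open>Both index sets lie in \<open>cube (k + r)\<close> and have as many points as
  \<open>cube k\<close>, so each sum differs from the sum over the large cube by at most
  \<open>C\<close> times the number of missing points.\<close>

lemma sum_translate_diff:
 fixes \<phi> :: "('d::finite) site => real"
 assumes "!!x. \<bar>\<phi> x\<bar> <= C" "x : cube r"
 shows "\<bar>(SUM y:cube k. \<phi> (x + y)) - (SUM y:cube k. \<phi> y)\<bar>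
  <= 2 * C * (real (card (cube (k + r) :: 'd site set)) - real (card (cube k :: 'd site set)))"
proof -
 have aux: "\<bar>(SUM y:cube (k + r). \<phi> y) - (SUM y:S. \<phi> y)\<bar>
   <= C * (real (card (cube (k + r) :: 'd site set)) - real (card (cube k :: 'd site set)))"
  if S: "S \<subseteq> cube (k + r)" "card S = card (cube k :: 'd site set)" for S
 proof -
  have "(SUM y:cube (k + r). \<phi> y) - (SUM y:S. \<phi> y) = (SUM y:cube (k + r) - S. \<phi> y)"
   using S by (simp add: sum_diff)
  also have "\<bar>...\<bar> <= (SUM y:cube (k + r) - S. C)"
   using assms(1) by (intro order_trans[OF sum_abs] sum_mono) auto
  also have "... = C * real (card (cube (k + r) - S))" by simp
  also have "real (card (cube (k + r) - S)) = real (card (cube (k + r) :: 'd site set)) - real (card (cube k :: 'd site set))"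
   using S card_mono[OF finite_cube S(1)] by (subst card_Diff_subset) (auto intro: finite_subset)
  finally show ?thesis .
 qed
 have inj: "inj_on ((+) x) (cube k)" by simp
 have "(SUM y:cube k. \<phi> (x + y)) = (SUM y:(+) x ` cube k. \<phi> y)"
  by (simp add: sum.reindex)
 moreover have "(+) x ` cube k \<subseteq> cube (k + r)"
  using cube_add[OF assms(2)] by (auto simp: add.commute)
 moreover have "card ((+) x ` cube k) = card (cube k :: 'd site set)"
  by (simp add: card_image)
 ultimately show ?thesis
  using aux[of "(+) x ` cube k"] aux[OF cube_mono[of k "k + r"] refl]
  unfolding mult.assoc[of 2] by linarith
qed

text \<open>Greedy selection: a center \<open>x\<close> of largest radius is kept, and every center
  whose cube meets that of \<open>x\<close> is dropped. A dropped \<open>y\<close> has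
  \<open>r y <= r x\<close>, so it lies within \<open>r x + r y <= 2 * r x\<close> of
  \<open>x\<close>; the remaining centers are treated by induction.\<close>

lemma vitali_cubes:
 fixes E :: "('d::finite) site set"
 assumes "finite E"
 shows "\<exists>S\<subseteq>E. (\<forall>x\<in>S. \<forall>y\<in>S. x ~= y --> (+) x ` cube (r x) \<inter> (+) y ` cube (r y) = {})
  & E \<subseteq> (\<Union>x\<in>S. (+) x ` cube (2 * r x))"
 using assms
proof (induction "card E" arbitrary: E rule: less_induct)
 case less
 show ?case
 proof (cases "E = {}")
  case False
  then have "Max (r ` E) : r ` E" using less.prems by (intro Max_in) auto
  then obtain x where x0: "x : E" "r x = Max (r ` E)" by auto
  have x: "x : E" "!!y. y : E ==> r y <= r x"
   using x0 less.prems by (auto intro!: Max_ge)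
  define E' where "E' = {y\<in>E. (+) x ` cube (r x) \<inter> (+) y ` cube (r y) = {}}"
  have "x \<notin> E'"
   using zero_in_cube[of "r x"] unfolding E'_def by blast
  then have "E' \<subset> E" using x by (auto simp: E'_def)
  then have "card E' < card E" using less.prems by (simp add: psubset_card_mono)
  moreover have "finite E'" using less.prems by (simp add: E'_def)
  ultimately obtain S where "S \<subseteq> E' \<and>
   (\<forall>x\<in>S. \<forall>y\<in>S. x ~= y --> (+) x ` cube (r x) \<inter> (+) y ` cube (r y) = {})
   & E' \<subseteq> (\<Union>x\<in>S. (+) x ` cube (2 * r x))"
   using less.hyps[of E'] by (elim meta_impE exE) simp_all
  then have S: "S \<subseteq> E'"
   "\<forall>x\<in>S. \<forall>y\<in>S. x ~= y --> (+) x ` cube (r x) \<inter> (+) y ` cube (r y) = {}"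
   "E' \<subseteq> (\<Union>x\<in>S. (+) x ` cube (2 * r x))"
   by simp_all
  show ?thesis
  proof (intro exI[of _ "insert x S"] conjI)
   show "insert x S \<subseteq> E" using S x by (auto simp: E'_def)
   show "\<forall>y\<in>insert x S. \<forall>z\<in>insert x S. y ~= z --> (+) y ` cube (r y) \<inter> (+) z ` cube (r z) = {}"
    using S(1,2) unfolding E'_def by (simp add: subset_iff) (metis Int_commute)
   show "E \<subseteq> (\<Union>x\<in>insert x S. (+) x ` cube (2 * r x))"
   proof
    fix y assume y: "y : E"
    show "y : (\<Union>x\<in>insert x S. (+) x ` cube (2 * r x))"
    proof (cases "y : E'")
     case False
     then obtain u v where uv: "u : cube (r x)" "v : cube (r y)" "x + u = y + v"
      using y by (auto simp: E'_def)
     have "u + - v : cube (r x + r y)" using uv by (intro cube_add cube_minus)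
     then have "u - v : cube (2 * r x)" using cube_mono[of "r x + r y" "2 * r x"] x(2)[OF y] by auto
     moreover have "y = x + (u - v)" using uv(3) by (simp add: algebra_simps)
     ultimately show ?thesis by blast
    next
     case True
     with S(3) obtain z where "z : S" "y : (+) z ` cube (2 * r z)" by (meson UN_E subsetD)
     then show ?thesis by (intro UN_I[of z]) simp_all
    qed
   qed
  qed
 qed auto
qed

text \<open>A maximal inequality on the lattice: the doubled cubes cover \<open>E\<close> and have
  at most \<open>2 ^ CARD('d)\<close> times the volume of the disjoint ones, on each of which
  \<open>\<phi>\<close> has average at least \<open>t\<close>.\<close>

lemma vitali_sum_bound:
 fixes \<phi> :: "('d::finite) site => real" and t :: real
 assumes nonneg: "!!x. \<phi> x >= 0" and t: "t >= 0" and E: "E \<subseteq> cube N" and r: "!!x. x : E ==> r x <= K"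
  and large: "!!x. x : E ==> t * card (cube (r x) :: 'd site set) <= (SUM y:cube (r x). \<phi> (x + y))"
 shows "t * card E <= 2 ^ CARD('d) * (SUM y:cube (N + K). \<phi> y)"
proof -
 have fE: "finite E" using E by (rule finite_subset) simp
 obtain S where "S \<subseteq> E & (\<forall>x\<in>S. \<forall>y\<in>S. x ~= y --> (+) x ` cube (r x) \<inter> (+) y ` cube (r y) = {})
  & E \<subseteq> (\<Union>x\<in>S. (+) x ` cube (2 * r x))"
  using vitali_cubes[OF fE, of r] ..
 then have S: "S \<subseteq> E" "\<forall>x\<in>S. \<forall>y\<in>S. x ~= y --> (+) x ` cube (r x) \<inter> (+) y ` cube (r y) = {}"
  "E \<subseteq> (\<Union>x\<in>S. (+) x ` cube (2 * r x))"
  by simp_all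
 have fS: "finite S" using S(1) fE by (rule finite_subset)
 have "card E <= card (\<Union>x\<in>S. (+) x ` cube (2 * r x))"
  using S fS by (intro card_mono) auto
 also have "... <= (SUM x:S. card ((+) x ` cube (2 * r x)))"
  by (rule card_UN_le[OF fS])
 also have "... = (SUM x:S. card (cube (2 * r x) :: 'd site set))"
  by (simp add: card_image)
 also have "... <= (SUM x:S. 2 ^ CARD('d) * card (cube (r x) :: 'd site set))"
  by (intro sum_mono card_cube_double)
 finally have "real (card E) <= real (SUM x:S. 2 ^ CARD('d) * card (cube (r x) :: 'd site set))"
  by (rule of_nat_mono)
 also have "... = (SUM x:S. 2 ^ CARD('d) * real (card (cube (r x) :: 'd site set)))"
  by simp
 finally have "real (card E) <= (SUM x:S. 2 ^ CARD('d) * real (card (cube (r x) :: 'd site set)))" .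
 then have "t * card E <= t * (SUM x:S. 2 ^ CARD('d) * real (card (cube (r x) :: 'd site set)))"
  using t by (intro mult_left_mono)
 also have "... = 2 ^ CARD('d) * (SUM x:S. t * real (card (cube (r x) :: 'd site set)))"
  by (simp add: sum_distrib_left algebra_simps)
 also have "... <= 2 ^ CARD('d) * (SUM x:S. SUM y:cube (r x). \<phi> (x + y))"
  using large S by (intro mult_left_mono sum_mono) auto
 also have "(SUM x:S. SUM y:cube (r x). \<phi> (x + y)) = (SUM x:S. SUM y:(+) x ` cube (r x). \<phi> y)"
  by (simp add: sum.reindex)
 also have "... = (SUM y:(\<Union>x\<in>S. (+) x ` cube (r x)). \<phi> y)"
  using S fS by (subst sum.UNION_disjoint) auto
 also have "... <= (SUM y:cube (N + K). \<phi> y)"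
 proof (intro sum_mono2)
  show "(\<Union>x\<in>S. (+) x ` cube (r x)) \<subseteq> cube (N + K)"
  proof safe
   fix x y :: "'d site" assume "x : S" "y : cube (r x)"
   then show "x + y : cube (N + K)"
    using E S(1) r cube_mono[of "r x" K] by (intro cube_add) auto
  qed
 qed (use nonneg in auto)
 finally show ?thesis by simp
qed

section \<open>The maximal inequality for measure preserving actions of the lattice\<close>

locale lattice_action = prob_space M for M :: "'a measure" +
 fixes T :: "('d::finite) site => 'a => 'a"
 assumes T_measurable [measurable]: "T x : M ->M M"
  and distr_T: "distr M M (T x) = M"
  and T_add: "w : space M ==> T x (T y w) = T (x + y) w"
begin

definition avg :: "nat => ('a => real) => 'a => real" where
 "avg n f w = (SUM x:cube n. f (T x w)) / real (card (cube n :: 'd site set))"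

lemma T_space: "w : space M ==> T x w : space M"
 using measurable_space[OF T_measurable] .

lemma avg_measurable [measurable]: "f : bm M ==> avg n f : bm M"
 unfolding avg_def[abs_def]
 by (rule borel_measurable_divide[OF borel_measurable_sum[OF mcomp[OF T_measurable]] borel_measurable_const])

lemma integral_T: "f : bm M ==> (LINT w|M. f (T x w)) = (LINT w|M. (f w :: real))"
 using integral_distr[of "T x" M M f] by (simp add: distr_T)

lemma avg_bound:
 assumes "!!w. w : space M ==> \<bar>f w\<bar> <= C" "w : space M"
 shows "\<bar>avg n f w\<bar> <= C"
proof -
 have "\<bar>SUM x:cube n. f (T x w)\<bar> <= (SUM x:(cube n :: 'd site set). C)"
  using assms T_space by (intro order_trans[OF sum_abs] sum_mono) auto
 then show ?thesis
  by (simp add: avg_def divide_simps mult.commute)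
qed

lemma bounded_integrable:
 assumes "f : bm M" "!!w. w : space M ==> \<bar>f w\<bar> <= (C::real)"
 shows "integrable M f"
 using assms by (intro integrable_const_bound[of _ C]) auto

text \<open>Transference: the lattice inequality is applied to \<open>y \<mapsto> h (T y w)\<close>
  along an orbit, with \<open>E\<close> the points of \<open>cube N\<close> at which the maximal
  function exceeds \<open>t\<close>. Integration uses the invariance of \<open>M\<close>; after
  division by the volume of \<open>cube N\<close>, the volume of \<open>cube (N + K)\<close>
  contributes a factor that tends to \<open>1\<close>.\<close>

lemma maximal_finite:
 assumes h[measurable]: "h : bm M" and h0: "!!w. w : space M ==> 0 <= h w & h w <= C" and t: "t > 0"
 shows "t * prob {w : space M. \<exists>n\<le>K. avg n h w > t} <= 2 ^ CARD('d) * expectation h"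
proof -
 define U where "U = {w : space M. \<exists>n\<le>K. avg n h w > t}"
 have U[measurable]: "U : sets M" unfolding U_def by measurable
 have inth: "integrable M h" using h0 by (intro bounded_integrable[of _ C]) auto
 \<comment> \<open>\<open>N\<close> is the size of the observed window. The radii are at most
   \<open>K\<close>, so all cubes centered in the window stay in
   \<open>cube (N + K)\<close>.\<close>
 have key: "t * prob U * card (cube N :: 'd site set) <= 2 ^ CARD('d) * (card (cube (N + K) :: 'd site set) * expectation h)" for N
 proof -
  have pw: "t * (SUM x:cube N. indicator U (T x w)) <= 2 ^ CARD('d) * (SUM y:cube (N + K). h (T y w))"
   if w: "w : space M" for w
  proof -
   define E where "E = {x : cube N. T x w : U}"
   define r where "r x = (SOME n. n <= K & avg n h (T x w) > t)" for x
   have r: "r x <= K & avg (r x) h (T x w) > t" if "x : E" for x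
    unfolding r_def by (rule someI_ex) (use that in \<open>auto simp: E_def U_def\<close>)
   have "t * card E <= 2 ^ CARD('d) * (SUM y:cube (N + K). h (T y w))"
   proof (rule vitali_sum_bound[where r = r])
    fix x assume x: "x : E"
    have "t <= avg (r x) h (T x w)" using r[OF x] by simp
    then show "t * card (cube (r x) :: 'd site set) <= (SUM y:cube (r x). h (T (x + y) w))"
     by (simp add: avg_def T_add w add.commute pos_le_divide_eq)
   qed (use r h0 T_space w t in \<open>auto simp: E_def\<close>)
   moreover have "(SUM x:cube N. indicator U (T x w)) = real (card E)"
    by (simp add: E_def indicator_def sum.If_cases Int_def)
   ultimately show ?thesis by simp
  qed
  have int1: "integrable M (%w. indicator U (T x w) :: real)" for x
   by (intro bounded_integrable[of _ 1]) (auto simp: indicator_def)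
  have int2: "integrable M (%w. h (T x w))" for x
   using h0 T_space by (intro bounded_integrable[of _ C]) auto
  have "expectation (%w. t * (SUM x:cube N. indicator U (T x w))) <= expectation (%w. 2 ^ CARD('d) * (SUM y:cube (N + K). h (T y w)))"
   using int1 int2 pw by (intro integral_mono) auto
  moreover have "expectation (%w. t * (SUM x:cube N. indicator U (T x w))) = t * prob U * card (cube N :: 'd site set)"
  proof -
   have "expectation (%w. indicator U (T x w)) = prob U" for x
    using integral_T[of "indicator U" x] by simp
   then show ?thesis using int1 by (simp add: integral_sum)
  qed
  moreover have "expectation (%w. 2 ^ CARD('d) * (SUM y:cube (N + K). h (T y w))) = 2 ^ CARD('d) * (card (cube (N + K) :: 'd site set) * expectation h)"
   using int2 by (simp add: integral_T)
  ultimately show ?thesis by linarith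
 qed
 have "t * prob U <= 2 ^ CARD('d) * expectation h * (real (card (cube (N + K) :: 'd site set)) / real (card (cube N :: 'd site set)))" for N
  using key[of N] by (simp add: divide_simps algebra_simps)
 moreover have "(%N. 2 ^ CARD('d) * expectation h * (real (card (cube (N + K) :: 'd site set)) / real (card (cube N :: 'd site set))))
   ----> 2 ^ CARD('d) * expectation h * 1"
  by (intro tendsto_mult_left card_cube_ratio)
 ultimately have "t * prob U <= 2 ^ CARD('d) * expectation h * 1"
  by (intro LIMSEQ_le_const) auto
 then show ?thesis by (simp add: U_def)
qed

lemma maximal:
 assumes h[measurable]: "h : bm M" and h0: "!!w. w : space M ==> 0 <= h w & h w <= C" and t: "t > 0"
 shows "t * prob {w : space M. \<exists>n. avg n h w > t} <= 2 ^ CARD('d) * expectation h"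
proof -
 have "(%K. prob {w : space M. \<exists>n\<le>K. avg n h w > t}) ----> prob (\<Union>K. {w : space M. \<exists>n\<le>K. avg n h w > t})"
  by (intro finite_Lim_measure_incseq) (auto simp: incseq_def intro: order_trans)
 moreover have "(\<Union>K. {w : space M. \<exists>n\<le>K. avg n h w > t}) = {w : space M. \<exists>n. avg n h w > t}"
  by auto
 ultimately have "(%K. t * prob {w : space M. \<exists>n\<le>K. avg n h w > t}) ----> t * prob {w : space M. \<exists>n. avg n h w > t}"
  by (intro tendsto_mult_left) simp
 then show ?thesis
  by (rule LIMSEQ_le_const2) (use maximal_finite[OF assms] in auto)
qed

end

lemma cube_nonempty [simp]: "cube n ~= {}" using zero_in_cube by blast

section \<open>The mean and the pointwise ergodic theorem\<close>

context lattice_action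
begin

lemma avg_shift:
 assumes "!!w. w : space M ==> \<bar>f w\<bar> <= C" "w : space M" "x : cube r"
 shows "\<bar>avg k f (T x w) - avg k f w\<bar>
  <= 2 * C * (real (card (cube (k + r) :: 'd site set)) / real (card (cube k :: 'd site set)) - 1)"
proof -
 let ?c = "real (card (cube k :: 'd site set))"
 have "avg k f (T x w) - avg k f w = ((SUM y:cube k. f (T (x + y) w)) - (SUM y:cube k. f (T y w))) / ?c"
  using assms(2) by (simp add: avg_def T_add diff_divide_distrib add.commute)
 also have "\<bar>...\<bar> <= 2 * C * (real (card (cube (k + r) :: 'd site set)) - ?c) / ?c"
  using sum_translate_diff[of "%y. f (T y w)" C x r k] assms T_space by (simp add: abs_divide divide_right_mono)
 also have "... = 2 * C * (real (card (cube (k + r) :: 'd site set)) / ?c - 1)"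
  by (simp add: field_simps)
 finally show ?thesis .
qed

lemma folner_tendsto:
 "(%k. 2 * C * (real (card (cube (k + r) :: 'd site set)) / real (card (cube k :: 'd site set)) - 1)) ----> 0"
 by (rule tendsto_eq_intros card_cube_ratio refl | simp)+

lemma avg_shift_tendsto:
 assumes "!!w. w : space M ==> \<bar>f w\<bar> <= C" "w : space M"
 shows "(%k. avg k f (T x w) - avg k f w) ----> 0"
proof -
 obtain r where "x : cube r" using ex_mem_cube by blast
 then show ?thesis
  using avg_shift[OF assms(1) assms(2)]
  by (intro tendsto_rabs_zero_cancel[OF tendsto_sandwich[OF _ _ tendsto_const folner_tendsto[of C r]]]) auto
qed

text \<open>After exchange of the two sums, \<open>avg k (avg n f)\<close> is the mean over
  \<open>y\<close> in \<open>cube n\<close> of \<open>avg k f\<close> at the points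
  \<open>T y w\<close>, each of which \<open>avg_shift\<close> compares with
  \<open>avg k f w\<close>.\<close>

lemma avg_avg:
 assumes f: "!!w. w : space M ==> \<bar>f w\<bar> <= C" and w: "w : space M"
 shows "\<bar>avg k (avg n f) w - avg k f w\<bar>
  <= 2 * C * (real (card (cube (k + n) :: 'd site set)) / real (card (cube k :: 'd site set)) - 1)"
proof -
 let ?e = "2 * C * (real (card (cube (k + n) :: 'd site set)) / real (card (cube k :: 'd site set)) - 1)"
 let ?n = "real (card (cube n :: 'd site set))"
 have "avg k (avg n f) w = (SUM x:cube k. SUM y:cube n. f (T x (T y w))) / (?n * real (card (cube k :: 'd site set)))"
  using w by (simp add: avg_def T_add add.commute sum_divide_distrib[symmetric])
 also have "... = (SUM y:cube n. avg k f (T y w)) / ?n"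
  by (subst sum.swap) (simp add: avg_def sum_divide_distrib[symmetric])
 finally have "avg k (avg n f) w - avg k f w = (SUM y:cube n. avg k f (T y w) - avg k f w) / ?n"
  by (simp add: sum_subtractf field_simps)
 also have "\<bar>...\<bar> <= (SUM y:(cube n :: 'd site set). ?e) / ?n"
 proof -
  have "\<bar>SUM y:cube n. avg k f (T y w) - avg k f w\<bar> <= (SUM y:(cube n :: 'd site set). ?e)"
  proof (rule order_trans[OF sum_abs sum_mono])
   fix y :: "'d site" assume "y : cube n"
   then show "\<bar>avg k f (T y w) - avg k f w\<bar> <= ?e" using f w by (intro avg_shift) auto
  qed
  then have "\<bar>SUM y:cube n. avg k f (T y w) - avg k f w\<bar> / ?n <= (SUM y:(cube n :: 'd site set). ?e) / ?n"
   by (rule divide_right_mono) simp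
  then show ?thesis by (simp only: abs_divide abs_of_nat)
 qed
 also have "... = ?e" by simp
 finally show ?thesis .
qed

text \<open>The Cauchy-Schwarz inequality inside the cube, then invariance of \<open>M\<close> for
  each summand.\<close>

lemma expectation_avg_square:
 assumes h[measurable]: "h : bm M" and hC: "!!w. w : space M ==> \<bar>h w\<bar> <= C"
 shows "expectation (%w. (avg k h w)\<^sup>2) <= expectation (%w. (h w)\<^sup>2)"
proof -
 let ?c = "real (card (cube k :: 'd site set))"
 have sq: "\<bar>(u)\<^sup>2\<bar> <= C\<^sup>2" if "\<bar>u\<bar> <= C" for u :: real
  using that by (simp add: abs_le_square_iff[symmetric])
 have "expectation (%w. (avg k h w)\<^sup>2) <= expectation (%w. (SUM x:(cube k :: 'd site set). (h (T x w))\<^sup>2) / ?c)"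
 proof (intro integral_mono)
  show "integrable M (%w. (avg k h w)\<^sup>2)"
   using hC by (intro bounded_integrable[of _ "C\<^sup>2"] sq avg_bound) auto
  show "integrable M (%w. (SUM x:(cube k :: 'd site set). (h (T x w))\<^sup>2) / ?c)"
   using hC T_space
   by (intro integrable_divide integrable_sum bounded_integrable[of _ "C\<^sup>2"] sq) auto
  fix w
  have "(SUM x:(cube k :: 'd site set). h (T x w))\<^sup>2 <= (SUM x:(cube k :: 'd site set). (h (T x w))\<^sup>2) * ?c"
   using sum_squared_le_sum_of_squares[of "%x. h (T x w)" "cube k"] by simp
  then show "(avg k h w)\<^sup>2 <= (SUM x:(cube k :: 'd site set). (h (T x w))\<^sup>2) / ?c"
   by (simp add: avg_def power_divide divide_simps power2_eq_square mult.assoc)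
 qed
 also have "... = expectation (%w. (h w)\<^sup>2)"
 proof -
  have "integrable M (%w. (h (T x w))\<^sup>2)" for x
   using hC T_space by (intro bounded_integrable[of _ "C\<^sup>2"] sq) auto
  moreover have "expectation (%w. (h (T x w))\<^sup>2) = expectation (%w. (h w)\<^sup>2)" for x
   using integral_T[of "%w. (h w)\<^sup>2" x] by simp
  ultimately show ?thesis by simp
 qed
 finally show ?thesis .
qed

text \<open>The averages are a minimizing sequence for the second moment \<open>S\<close>, and the
  parallelogram law makes such a sequence Cauchy, as for the point of least norm in a convex set.
  The midpoint of two averages is not below the infimum \<open>de\<close> either, because its own
  averages approach those of \<open>f\<close> and averaging does not increase
  \<open>S\<close>.\<close>

lemma mean_cauchy:
 assumes f[measurable]: "f : bm M" and fC: "!!w. w : space M ==> \<bar>f w\<bar> <= C" and e: "e > 0"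
 shows "\<exists>N. \<forall>n\<ge>N. \<forall>m\<ge>N. expectation (%w. (avg n f w - avg m f w)\<^sup>2) < e"
proof -
 have C0: "C >= 0" using fC not_empty by (metis abs_ge_zero ex_in_conv order_trans)
 define S where "S h = expectation (%w. (h w)\<^sup>2)" for h :: "'a => real"
 define de where "de = (INF k. S (avg k f))"
 have sq: "\<bar>(u)\<^sup>2\<bar> <= C\<^sup>2" if "\<bar>u\<bar> <= C" for u :: real
  using that by (simp add: abs_le_square_iff[symmetric])
 have ab: "\<bar>avg n f w\<bar> <= C" if "w : space M" for n w
  using avg_bound[OF fC that] .
 have intsq: "integrable M (%w. (h w)\<^sup>2)" if "h : bm M" "!!w. w : space M ==> \<bar>h w\<bar> <= C" for h
  using that by (intro bounded_integrable[of _ "C\<^sup>2"] sq) auto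
 have bdd: "bdd_below (range (%k. S (avg k f)))"
  by (rule bdd_belowI[of _ 0]) (auto simp: S_def)
 have de_le: "de <= S (avg k f)" for k
  unfolding de_def by (intro cINF_lower bdd) auto
 have compare: "S (avg k f) <= S h + 2 * C * r k"
  if [measurable]: "h : bm M" and hC: "!!w. w : space M ==> \<bar>h w\<bar> <= C"
   and r: "!!w. w : space M ==> \<bar>avg k h w - avg k f w\<bar> <= r k" for h and r :: "nat => real" and k
 proof -
  have "S (avg k f) <= expectation (%w. (avg k h w)\<^sup>2 + 2 * C * r k)"
   unfolding S_def
  proof (intro integral_mono)
   fix w assume w: "w : space M"
   have "(avg k f w)\<^sup>2 - (avg k h w)\<^sup>2 = (avg k f w - avg k h w) * (avg k f w + avg k h w)"
    by (simp add: power2_eq_square algebra_simps)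
   also have "... <= \<bar>avg k f w - avg k h w\<bar> * \<bar>avg k f w + avg k h w\<bar>"
    by (metis abs_ge_self abs_mult)
   also have "... <= r k * (2 * C)"
    using r[OF w] ab[OF w, of k] avg_bound[of h C w k] hC w by (intro mult_mono) (auto simp: abs_minus_commute)
   finally show "(avg k f w)\<^sup>2 <= (avg k h w)\<^sup>2 + 2 * C * r k" by (simp add: algebra_simps)
  qed (use hC in \<open>auto intro!: intsq ab avg_bound\<close>)
  also have "... = S (avg k h) + 2 * C * r k"
   unfolding S_def using hC by (subst integral_add) (auto intro!: intsq avg_bound simp: prob_space)
  also have "S (avg k h) <= S h"
   unfolding S_def using hC by (intro expectation_avg_square) auto
  finally show ?thesis by simp
 qed
 have de_lower: "de <= S h"
  if [measurable]: "h : bm M" and hC: "!!w. w : space M ==> \<bar>h w\<bar> <= C"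
   and ex: "\<exists>r. (\<forall>k. \<forall>w\<in>space M. \<bar>avg k h w - avg k f w\<bar> <= r k) & r ----> 0" for h
 proof -
  obtain r where r: "!!w k. w : space M ==> \<bar>avg k h w - avg k f w\<bar> <= r k" and r0: "r ----> 0"
   using ex by auto
  have "(%k. S h + 2 * C * r k) ----> S h + 2 * C * 0"
   by (intro tendsto_intros r0)
  moreover have "de <= S h + 2 * C * r k" for k
   by (rule order_trans[OF de_le compare]) (use that(1) hC r in auto)
  ultimately have "de <= S h + 2 * C * 0"
   by (intro LIMSEQ_le_const) auto
  then show ?thesis by simp
 qed
 define F where "F n k = 2 * C * (real (card (cube (k + n) :: 'd site set)) / real (card (cube k :: 'd site set)) - 1)" for n k
 have F0: "F n ----> 0" for n unfolding F_def[abs_def] by (rule folner_tendsto)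
 have F: "\<bar>avg k (avg n f) w - avg k f w\<bar> <= F n k" if "w : space M" for n k w
  unfolding F_def by (rule avg_avg[OF fC that])
 \<comment> \<open>Half of the margin \<open>e / 4\<close> goes to the choice of \<open>n0\<close>,
   half to the error made by averaging \<open>avg n0 f\<close> once more.\<close>
 have "\<exists>n0. S (avg n0 f) < de + e / 8"
  unfolding de_def using e cINF_less_iff[OF _ bdd, of "de + e / 8"] by (simp add: de_def)
 then obtain n0 where n0: "S (avg n0 f) < de + e / 8" by blast
 have "(%k. 2 * C * F n0 k) ----> 2 * C * 0" by (intro tendsto_intros F0)
 then have "eventually (%k. 2 * C * F n0 k < e / 8) sequentially"
  using e by (intro order_tendstoD(2)[where a = "e / 8"]) auto
 then obtain N where N: "!!k. k >= N ==> 2 * C * F n0 k < e / 8"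
  by (auto simp: eventually_sequentially)
 have close: "S (avg k f) < de + e / 4" if "k >= N" for k
  proof -
  have "S (avg k f) <= S (avg n0 f) + 2 * C * F n0 k"
   by (rule compare) (use F ab in auto)
  then show ?thesis using N[OF that] n0 by simp
 qed
 show ?thesis
 proof (intro exI[of _ N] allI impI)
  fix n m assume nm: "n >= N" "m >= N"
  define h where "h w = (avg n f w + avg m f w) / 2" for w
  have h[measurable]: "h : bm M" unfolding h_def[abs_def] by measurable
  have hb: "\<bar>h w\<bar> <= C" if "w : space M" for w
   using ab[OF that, of n] ab[OF that, of m] by (auto simp: h_def)
  have "de <= S h"
  proof (rule de_lower, goal_cases)
   case 3
   have "(%k. (F n k + F m k) / 2) ----> 0"
    using tendsto_divide[OF tendsto_add[OF F0[of n] F0[of m]] tendsto_const[of 2]] by simp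
   moreover have "\<bar>avg k h w - avg k f w\<bar> <= (F n k + F m k) / 2" if w: "w : space M" for w k
   proof -
    have hk: "avg k h w = (avg k (avg n f) w + avg k (avg m f) w) / 2"
     by (simp add: avg_def[of k] h_def sum.distrib add_divide_distrib sum_divide_distrib mult.commute)
    have "\<bar>(a + b) / 2 - c\<bar> <= (x + y) / 2" if "\<bar>a - c\<bar> <= x" "\<bar>b - c\<bar> <= y" for a b c x y :: real
     using that unfolding abs_le_iff by (auto simp: field_simps)
    from this[OF F[OF w, of k n] F[OF w, of k m]] show ?thesis unfolding hk .
   qed
   ultimately show ?case by (intro exI[of _ "%k. (F n k + F m k) / 2"]) auto
  qed (use h hb in auto)
  \<comment> \<open>The parallelogram law. The upper bound \<open>de + e / 4\<close> for both
    averages and the lower bound \<open>de\<close> for the midpoint leave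
    \<open>4 * (e / 4)\<close>.\<close>
  moreover have "expectation (%w. (avg n f w - avg m f w)\<^sup>2) = 2 * S (avg n f) + 2 * S (avg m f) - 4 * S h"
  proof -
   have "(avg n f w - avg m f w)\<^sup>2 = 2 * (avg n f w)\<^sup>2 + 2 * (avg m f w)\<^sup>2 - 4 * (h w)\<^sup>2" for w
    by (simp add: h_def power2_eq_square field_simps)
   moreover have "integrable M (%w. (avg k f w)\<^sup>2)" for k using ab by (intro intsq) auto
   moreover have "integrable M (%w. (h w)\<^sup>2)" using hb by (intro intsq) auto
   ultimately show ?thesis by (simp add: S_def)
  qed
  ultimately show "expectation (%w. (avg n f w - avg m f w)\<^sup>2) < e"
   using close[OF nm(1)] close[OF nm(2)] by simp
 qed
qed

text \<open>The mean theorem yields an almost sure limit \<open>g\<close> along a subsequence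
  \<open>r\<close>, and \<open>g\<close> is invariant. Then \<open>avg n f - g\<close> is, up to a
  boundary error, the \<open>n\<close>-average of \<open>avg (r i) f - g\<close>; the maximal
  inequality bounds these averages by \<open>e\<close> for all \<open>n\<close> at once, outside a
  set whose probability vanishes as \<open>i\<close> grows.\<close>

theorem pointwise_ergodic:
 assumes f[measurable]: "f : bm M" and fC: "!!w. w : space M ==> \<bar>f w\<bar> <= C"
 shows "AE w in M. convergent (%n. avg n f w)"
proof -
 have C0: "C >= 0" using fC not_empty by (metis abs_ge_zero ex_in_conv order_trans)
 have ab: "\<bar>avg n f w\<bar> <= C" if "w : space M" for n w
  using avg_bound[OF fC that] .
 have inta: "integrable M (avg n f)" for n
  using ab by (intro bounded_integrable[of _ C]) auto
 have "\<exists>N. \<forall>i\<ge>N. \<forall>j\<ge>N. (LINT w|M. norm (avg i f w - avg j f w)) < e" if e: "e > 0" for e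
 proof -
  obtain N where N: "!!n m. n >= N ==> m >= N ==> expectation (%w. (avg n f w - avg m f w)\<^sup>2) < e\<^sup>2 / 4"
   using mean_cauchy[OF f fC, of "e\<^sup>2 / 4"] e by auto
  have "(LINT w|M. norm (avg i f w - avg j f w)) < e" if ij: "i >= N" "j >= N" for i j
  proof -
   have int2: "integrable M (%w. (avg i f w - avg j f w)\<^sup>2)"
   proof (rule bounded_integrable[of _ "(2 * C)\<^sup>2"])
    fix w assume "w : space M"
    from ab[OF this, of i] ab[OF this, of j] have "\<bar>avg i f w - avg j f w\<bar> <= \<bar>2 * C\<bar>" by linarith
    then show "\<bar>(avg i f w - avg j f w)\<^sup>2\<bar> <= (2 * C)\<^sup>2" by (simp add: abs_le_square_iff)
   qed measurable
   \<comment> \<open>The inequality \<open>\<bar>u\<bar> <= e / 2 + u^2 / (2 * e)\<close> trades the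
     first moment for the second.\<close>
   have "(LINT w|M. norm (avg i f w - avg j f w)) <= (LINT w|M. e / 2 + (avg i f w - avg j f w)\<^sup>2 / (2 * e))"
   proof (intro integral_mono)
    fix w
    have "0 <= (\<bar>avg i f w - avg j f w\<bar> - e)\<^sup>2" by simp
    then show "norm (avg i f w - avg j f w) <= e / 2 + (avg i f w - avg j f w)\<^sup>2 / (2 * e)"
     using e by (simp add: power2_diff field_simps) (simp add: power2_eq_square)
   qed (use int2 inta in auto)
   also have "... = e / 2 + expectation (%w. (avg i f w - avg j f w)\<^sup>2) / (2 * e)"
    using int2 by (subst integral_add) (auto simp: prob_space)
   also have "... < e / 2 + (e\<^sup>2 / 4) / (2 * e)"
    using N[OF ij] e by (intro add_strict_left_mono divide_strict_right_mono) auto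
   also have "... <= e" using e by (simp add: field_simps power2_eq_square)
   finally show ?thesis .
  qed
  then show ?thesis by blast
 qed
 from cauchy_L1_AE_cauchy_subseq[OF inta this] obtain r where
  r: "strict_mono r" "AE w in M. Cauchy (%i. avg (r i) f w)" by blast
 define OM0 where "OM0 = {w : space M. convergent (%i. avg (r i) f w)}"
 have [measurable]: "OM0 : sets M"
  unfolding OM0_def Cauchy_convergent_iff[symmetric] by measurable
 \<comment> \<open>The value \<open>0\<close> off \<open>OM0\<close> makes \<open>g\<close>
   measurable and, as \<open>OM0\<close> is invariant, invariant at every point of
   \<open>space M\<close>.\<close>
 define g where "g w = (if w : OM0 then lim (%i. avg (r i) f w) else 0)" for w
 have g_lim: "(%i. avg (r i) f w) ----> g w" if "w : OM0" for w
  using that by (simp add: g_def OM0_def convergent_LIMSEQ_iff)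
 have gm[measurable]: "g : bm M"
 proof (rule borel_measurable_LIMSEQ_real)
  show "(%i. indicator OM0 w * avg (r i) f w) ----> g w" if "w : space M" for w
   using g_lim[of w] by (cases "w : OM0") (auto simp: g_def)
 qed measurable
 have gC: "\<bar>g w\<bar> <= C" if "w : space M" for w
 proof (cases "w : OM0")
  case True
  show ?thesis
   using tendsto_rabs[OF g_lim[OF True]] ab[OF that] by (intro LIMSEQ_le_const2) auto
 qed (use C0 in \<open>simp add: g_def\<close>)
 have trans: "(%i. avg (r i) f (T x w)) ----> l" if "w : space M" "(%i. avg (r i) f w) ----> l" for w x l
 proof -
  have "(%i. avg (r i) f (T x w) - avg (r i) f w) ----> 0"
   using LIMSEQ_subseq_LIMSEQ[OF avg_shift_tendsto[OF fC that(1)] r(1)] by (simp add: comp_def)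
  from tendsto_add[OF this that(2)] show ?thesis by simp
 qed
 have g_inv: "g (T x w) = g w" if w: "w : space M" for x w
 proof -
  have 1: "T x w : OM0" "g (T x w) = g w" if "w : OM0" "w : space M" for w x
  proof -
   from trans[OF that(2) g_lim[OF that(1)]] have *: "(%i. avg (r i) f (T x w)) ----> g w" .
   then show "T x w : OM0" using that T_space by (auto simp: OM0_def convergent_def)
   from LIMSEQ_unique[OF g_lim[OF this] *] show "g (T x w) = g w" .
  qed
  show ?thesis
  proof (cases "w : OM0")
   case True
   then show ?thesis using 1(2) w by simp
  next
   case False
   have "T x w \<notin> OM0"
   proof
    assume "T x w : OM0"
    from trans[OF T_space[OF w] g_lim[OF this], of "- x"] have "(%i. avg (r i) f (T 0 w)) ----> g (T x w)"
     using w by (simp add: T_add)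
    from trans[OF T_space[OF w] this, of 0] False
    have "(%i. avg (r i) f (T 0 w)) ----> g (T x w)" using w by (simp add: T_add)
    \<comment> \<open>\<open>T 0\<close> need not be the identity, so convergence at
      \<open>T 0 w\<close> is carried back to \<open>w\<close> by the asymptotic invariance of
      averages.\<close>
    moreover have "(%i. avg (r i) f (T 0 w) - avg (r i) f w) ----> 0"
     using LIMSEQ_subseq_LIMSEQ[OF avg_shift_tendsto[OF fC w] r(1)] by (simp add: comp_def)
    ultimately have "(%i. avg (r i) f w) ----> g (T x w)"
     using tendsto_diff by fastforce
    then show False using False w by (auto simp: OM0_def convergent_def)
   qed
   then show ?thesis using False by (simp add: g_def)
  qed
 qed
 have OM0_AE: "AE w in M. w : OM0"
  using r(2) AE_space by eventually_elim (simp add: OM0_def Cauchy_convergent_iff)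
 have diffC: "\<bar>avg n f w - g w\<bar> <= 2 * C" if "w : space M" for n w
  using ab[OF that, of n] gC[OF that] by linarith
 have L1: "(%i. expectation (%w. \<bar>avg (r i) f w - g w\<bar>)) ----> expectation (%w. 0)"
 proof (rule integral_dominated_convergence[where w = "%_. 2 * C"])
  show "AE w in M. (%i. \<bar>avg (r i) f w - g w\<bar>) ----> 0"
   using OM0_AE
  proof eventually_elim
   case (elim w)
   from g_lim[OF elim] show ?case
    using LIM_zero tendsto_rabs_zero by blast
  qed
  show "AE w in M. norm \<bar>avg (r i) f w - g w\<bar> <= 2 * C" for i
   using AE_space by eventually_elim (use diffC in auto)
 qed auto
 have g_avg: "avg n g w = g w" if "w : space M" for n w
  using g_inv[OF that] by (simp add: avg_def)
 define U where "U e i = {w : space M. \<exists>n. avg n (%w. \<bar>avg (r i) f w - g w\<bar>) w > e}" for e i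
 have Um: "U e i : sets M" for e i
 proof -
  have [measurable]: "avg n (%w. \<bar>avg (r i) f w - g w\<bar>) : bm M" for n
   by (intro avg_measurable) measurable
  show ?thesis unfolding U_def by measurable
 qed
 have good: "AE w in M. \<exists>i. w \<notin> U e i" if e: "e > 0" for e
 proof -
  have "prob (\<Inter>i. U e i) <= 2 ^ CARD('d) / e * expectation (%w. \<bar>avg (r i) f w - g w\<bar>)" for i
  proof -
   have "prob (\<Inter>i. U e i) <= prob (U e i)"
    by (intro finite_measure_mono Um) auto
   moreover have "e * prob (U e i) <= 2 ^ CARD('d) * expectation (%w. \<bar>avg (r i) f w - g w\<bar>)"
    unfolding U_def using diffC e by (intro maximal[where C = "2 * C"]) auto
   ultimately show ?thesis using e by (simp add: field_simps) (meson mult_left_mono less_imp_le order_trans)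
  qed
  moreover have "(%i. 2 ^ CARD('d) / e * expectation (%w. \<bar>avg (r i) f w - g w\<bar>)) ----> 2 ^ CARD('d) / e * 0"
   using L1 by (intro tendsto_mult_left) simp
  ultimately have "prob (\<Inter>i. U e i) <= 2 ^ CARD('d) / e * 0"
   by (intro LIMSEQ_le_const) auto
  then have "prob (\<Inter>i. U e i) = 0" by (simp add: measure_le_0_iff)
  then have "(\<Inter>i. U e i) : null_sets M"
   using Um by (auto intro!: null_setsI simp: emeasure_eq_measure)
  from AE_not_in[OF this] show ?thesis by eventually_elim auto
 qed
 have "AE w in M. \<forall>k. \<exists>i. w \<notin> U (1 / Suc k) i"
  by (subst AE_all_countable) (auto intro!: good)
 then have "AE w in M. (%n. avg n f w) ----> g w"
  using AE_space
 proof eventually_elim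
  case (elim w)
  show ?case
  proof (rule LIMSEQ_I)
   fix e :: real assume "e > 0"
   then obtain k where k: "1 / Suc k < e / 2" using nat_approx_posE[of "e / 2"] by auto
   from elim obtain i where i: "w \<notin> U (1 / Suc k) i" by blast
   have "(%n. avg n (avg (r i) f) w - avg n f w) ----> 0"
    using avg_avg[OF fC elim(2), where n = "r i"]
    by (intro tendsto_rabs_zero_cancel[OF tendsto_sandwich[OF _ _ tendsto_const folner_tendsto[of C "r i"]]]) auto
   then obtain N where N: "!!n. n >= N ==> \<bar>avg n (avg (r i) f) w - avg n f w\<bar> < e / 2"
    using LIMSEQ_D[of _ 0 "e / 2"] \<open>e > 0\<close> by fastforce
   show "\<exists>no. \<forall>n\<ge>no. norm (avg n f w - g w) < e"
   proof (intro exI[of _ N] allI impI)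
    fix n assume n: "n >= N"
    have "\<bar>avg n (avg (r i) f) w - g w\<bar> = \<bar>avg n (avg (r i) f) w - avg n g w\<bar>"
     using g_avg[OF elim(2)] by simp
    also have "... <= avg n (%w. \<bar>avg (r i) f w - g w\<bar>) w"
     unfolding avg_def[of n] diff_divide_distrib[symmetric] sum_subtractf[symmetric] abs_divide
     by (simp add: divide_right_mono)
    also have "... <= 1 / Suc k" using i elim(2) by (auto simp: U_def not_less)
    finally show "norm (avg n f w - g w) < e" using N[OF n] k by (simp add: abs_if split: if_splits)
   qed
  qed
 qed
 then show ?thesis by eventually_elim (auto simp: convergent_def)
qed
end

section \<open>Replicas and reweighted measures\<close>

text \<open>Measurability is tested on cylinders, where the product measure is a finite product of
  evaluations of \<open>m\<close>.\<close>

lemma measurable_PiM_kernel [measurable]: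
 "(%m. PiM I (%_. m)) : prob_algebra X ->M prob_algebra (PiM I (%_. X))"
proof (rule measurable_prob_algebra_generated[OF sets_PiM Int_stable_prod_algebra prod_algebra_sets_into_space])
 fix m assume m: "m : space (prob_algebra X)"
 then show "prob_space (PiM I (%_. m))" by (auto simp: space_prob_algebra intro!: prob_space_PiM)
 show "sets (PiM I (%_. m)) = sets (PiM I (%_. X))"
  using m by (intro sets_PiM_cong) (auto simp: space_prob_algebra)
next
 fix A assume "A : prod_algebra I (%_. X)"
 then obtain J E where A: "A = prod_emb I (%_. X) J (PiE J E)" and J: "finite J" "J \<subseteq> I"
  and E: "!!j. j : J ==> E j : sets X"
  by (force elim!: prod_algebraE)
 have "(%m. PROD j:J. emeasure m (E j)) : bm (prob_algebra X)"
  unfolding prob_algebra_def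
  by (intro borel_measurable_prod_ennreal measurable_restrict_space1 measurable_emeasure_subprob_algebra E)
 moreover have "emeasure (PiM I (%_. m)) A = (PROD j:J. emeasure m (E j))" if "m : space (prob_algebra X)" for m
 proof -
  from that have m: "prob_space m" "sets m = sets X" by (auto simp: space_prob_algebra)
  have "A = prod_emb I (%_. m) J (PiE J E)"
   by (simp add: A prod_emb_def space_eqI[OF m(2)])
  then show ?thesis using J E m by (simp add: emeasure_PiM_emb)
 qed
 ultimately show "(%m. emeasure (PiM I (%_. m)) A) : bm (prob_algebra X)"
  by (subst measurable_cong) auto
qed

text \<open>The pushforward of \<open>L x\<close> along \<open>y \<mapsto> (x, y)\<close> turns the
  integrand into one fixed function, so that measurability of an integral as a function of the
  measure applies.\<close>

lemma measurable_integral_kernel: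
 fixes f :: "'a => 'b => real"
 assumes f[measurable]: "(%(x, y). f x y) : bm (M **M N)"
  and L: "L : M ->M prob_algebra N"
 shows "(%x. \<integral>y. f x y \<partial>L x) : bm M"
proof -
 note L'[measurable] = measurable_prob_algebraD[OF L]
 note integral_measurable_subprob_algebra[measurable] measurable_distr2[measurable]
 have "(%x. integral\<^sup>L (distr (L x) (M **M N) (%y. (x, y))) (%(x, y). f x y)) : bm M"
  by measurable
 then show ?thesis
 proof (rule measurable_cong[THEN iffD1, rotated])
  fix x assume x: "x : space M"
  have "sets (L x) = sets N" using measurable_space[OF L x] by (simp add: space_prob_algebra)
  then have "(%y. (x, y)) : L x ->M M **M N"
   using measurable_Pair1'[OF x, of N] measurable_cong_sets[of "L x" N "M **M N" "M **M N"] by blast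
  from integral_distr[OF this f]
  show "integral\<^sup>L (distr (L x) (M **M N) (%y. (x, y))) (%(x, y). f x y) = (LINT y|L x. f x y)"
   by simp
 qed
qed

lemma prob_space_PiM_const: "prob_space m ==> prob_space (PiM I (%_. m))"
 by (intro prob_space_PiM) auto

lemma distr_PiM_const_restrict:
 assumes "prob_space m" "J \<subseteq> I"
 shows "distr (PiM I (%_. m)) (PiM J (%_. m)) (%x. restrict x J) = PiM J (%_. m)"
 using distr_PiM_reindex[of I "%_. m" "%i. i" J] assms by (auto simp: restrict_def)

lemma integral_PiM_const_prod:
 fixes f :: "'i => 'a => real"
 assumes "prob_space m" "finite J" and f: "!!i. i : J ==> integrable m (f i)"
 shows "(LINT x|PiM J (%_. m). (PROD i:J. f i (x i))) = (PROD i:J. \<integral>x. f i x \<partial>m)"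
proof -
 interpret prob_space m by fact
 interpret product_sigma_finite "%_. m" by unfold_locales
 show ?thesis using assms by (intro product_integral_prod) auto
qed

lemma integral_replicas_restrict:
 fixes f :: "('i => 'a) => real"
 assumes "prob_space m" "f : bm (PiM J (%_. m))" "J \<subseteq> I"
 shows "(LINT x|PiM I (%_. m). f (restrict x J)) = (LINT x|PiM J (%_. m). f x)"
proof -
 have "(%x. restrict x J) : PiM I (%_. m) ->M PiM J (%_. m)"
  using assms(3) by (intro measurable_restrict_subset)
 then show ?thesis
  using assms by (subst distr_PiM_const_restrict[symmetric, of m J I]) (simp_all add: integral_distr)
qed

lemma integral_replicas_prod:
 fixes f :: "'i => 'a => real"
 assumes m: "prob_space m" and J: "finite J" "J \<subseteq> I" and f: "!!i. i : J ==> integrable m (f i)"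
 shows "(LINT x|PiM I (%_. m). (PROD i:J. f i (x i))) = (PROD i:J. \<integral>x. f i x \<partial>m)"
proof -
 have [measurable]: "f i : bm m" if "i : J" for i using f[OF that] by simp
 have "(%x. PROD i:J. f i (x i)) : bm (PiM J (%_. m))"
  by measurable
 from integral_replicas_restrict[OF m this J(2)] integral_PiM_const_prod[OF m J(1) f]
 show ?thesis by (simp cong: prod.cong)
qed

lemma PiM_density:
 assumes I: "finite I" and m: "prob_space m" and p[measurable]: "p : bm m" and mp: "prob_space (density m p)"
 shows "PiM I (%_. density m p) = density (PiM I (%_. m)) (%x. PROD i:I. p (x i))"
proof -
 interpret prob_space m by fact
 interpret P: prob_space "density m p" by fact
 interpret product_sigma_finite "%_. m" by unfold_locales
 interpret D: product_sigma_finite "%_. density m p" by unfold_locales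
 show ?thesis
 proof (rule D.PiM_eqI[OF I, symmetric])
  show "sets (density (PiM I (%_. m)) (%x. PROD i:I. p (x i))) = sets (PiM I (%_. density m p))"
   by (simp cong: sets_PiM_cong)
  fix A assume A: "!!i. i : I ==> A i : sets (density m p)"
  then have A'[measurable]: "!!i. i : I ==> A i : sets m" by simp
  have "emeasure (density (PiM I (%_. m)) (%x. PROD i:I. p (x i))) (PiE I A)
   = (\<integral>\<^sup>+x. (PROD i:I. p (x i)) * indicator (PiE I A) x \<partial>PiM I (%_. m))"
   using I A' by (intro emeasure_density sets_PiM_I_finite) auto
  also have "... = (\<integral>\<^sup>+x. (PROD i:I. p (x i) * indicator (A i) (x i)) \<partial>PiM I (%_. m))"
  proof (intro nn_integral_cong)
   fix x assume x: "x : space (PiM I (%_. m))"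
   have "indicator (PiE I A) x = (PROD i:I. indicator (A i) (x i) :: ennreal)"
    using x I by (auto simp: indicator_def space_PiM PiE_iff prod.If_cases Ball_def)
   then show "(PROD i:I. p (x i)) * indicator (PiE I A) x = (PROD i:I. p (x i) * indicator (A i) (x i))"
    by (simp add: prod.distrib)
  qed
  also have "... = (PROD i:I. \<integral>\<^sup>+x. p x * indicator (A i) x \<partial>m)"
   using I A' by (intro product_nn_integral_prod) auto
  also have "... = (PROD i:I. emeasure (density m p) (A i))"
   using A' by (intro prod.cong) (auto simp: emeasure_density)
  finally show "emeasure (density (PiM I (%_. m)) (%x. PROD i:I. p (x i))) (PiE I A) = (PROD i:I. emeasure (density m p) (A i))" .
 qed
qed

text \<open>Telescoping: the factors are exchanged one at a time, so the \<open>i\<close>-th term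
  has factors of \<open>a\<close> before \<open>i\<close>, the difference at \<open>i\<close> and
  factors of \<open>b\<close> after it.\<close>

lemma abs_prod_diff_le:
 fixes a b :: "nat => real"
 assumes "!!i. 0 <= a i" "!!i. 0 <= b i"
 shows "\<bar>(PROD i<s. a i) - (PROD i<s. b i)\<bar> <= (SUM i<s. PROD j<s. if j < i then a j else if j = i then \<bar>a j - b j\<bar> else b j)"
proof (induction s)
 case (Suc s)
 let ?f = "%i j. if j < i then a j else if j = i then \<bar>a j - b j\<bar> else b j"
 have "(PROD i<Suc s. a i) - (PROD i<Suc s. b i) = ((PROD i<s. a i) - (PROD i<s. b i)) * b s + (PROD i<s. a i) * (a s - b s)"
  by (simp add: algebra_simps)
 also have "\<bar>...\<bar> <= \<bar>(PROD i<s. a i) - (PROD i<s. b i)\<bar> * b s + (PROD i<s. a i) * \<bar>a s - b s\<bar>"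
  using assms by (intro order_trans[OF abs_triangle_ineq]) (simp add: abs_mult prod_nonneg abs_prod)
 also have "... <= (SUM i<s. PROD j<s. ?f i j) * b s + (PROD i<s. a i) * \<bar>a s - b s\<bar>"
  using assms Suc by (intro add_mono mult_right_mono) auto
 also have "... = (SUM i<Suc s. PROD j<Suc s. ?f i j)"
  by (auto simp: sum_distrib_right intro!: arg_cong2[where f = "(+)"] arg_cong2[where f = "(*)"] sum.cong prod.cong)
 finally show ?case .
qed simp

text \<open>In each of the \<open>s\<close> telescoping terms all factors but one integrate to
  \<open>1\<close>, and the remaining one gives the distance of the densities.\<close>

lemma PiM_density_tv:
 assumes m: "prob_space m" and p: "integrable m p" "!!x. 0 <= p x" "(LINT x|m. p x) = (1::real)"
  and q: "integrable m q" "!!x. 0 <= q x" "(LINT x|m. q x) = (1::real)"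
  and G[measurable]: "G : bm (PiM {..<s} (%_. m))"
  and GC: "!!x. x : space (PiM {..<s} (%_. m)) ==> \<bar>G x\<bar> <= C"
 shows "\<bar>(LINT x|PiM {..<s} (%_. density m p). G x) - (LINT x|PiM {..<s} (%_. density m q). G x)\<bar>
  <= C * real s * (LINT x|m. \<bar>p x - q x\<bar>)"
proof -
 let ?P = "PiM {..<s} (%_. m)"
 interpret prob_space m by fact
 interpret product_sigma_finite "%_. m" by unfold_locales
 interpret P: prob_space ?P using m by (rule prob_space_PiM_const)
 have C0: "C >= 0" using GC P.not_empty by (metis abs_ge_zero ex_in_conv order_trans)
 have pm[measurable]: "p : bm m" and qm[measurable]: "q : bm m" using p q by auto
 have dens: "prob_space (density m r)" "PiM {..<s} (%_. density m r) = density ?P (%x. ennreal (PROD i<s. r (x i)))"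
  "integrable ?P (%x. PROD i<s. r (x i))"
  if r: "integrable m r" "!!x. 0 <= r x" "(LINT x|m. r x) = (1::real)" for r
 proof -
  have [measurable]: "r : bm m" using r by auto
  show *: "prob_space (density m r)"
   using r by (intro prob_spaceI) (simp add: emeasure_density nn_integral_eq_integral cong: nn_integral_cong_simp)
  show "PiM {..<s} (%_. density m r) = density ?P (%x. ennreal (PROD i<s. r (x i)))"
   using PiM_density[OF _ m _ *, of "{..<s}"] r by (simp add: prod_ennreal)
  show "integrable ?P (%x. PROD i<s. r (x i))"
   using r by (intro product_integrable_prod) auto
 qed
 have ig: "(LINT x|PiM {..<s} (%_. density m r). G x) = (LINT x|?P. (PROD i<s. r (x i)) * G x)"
  "integrable ?P (%x. (PROD i<s. r (x i)) * G x)"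
  if r: "integrable m r" "!!x. 0 <= r x" "(LINT x|m. r x) = (1::real)" for r
 proof -
  have [measurable]: "r : bm m" using r by auto
  show "(LINT x|PiM {..<s} (%_. density m r). G x) = (LINT x|?P. (PROD i<s. r (x i)) * G x)"
   unfolding dens(2)[OF r] using r by (subst integral_real_density) (auto simp: prod_nonneg)
  show "integrable ?P (%x. (PROD i<s. r (x i)) * G x)"
  proof (rule integrable_bound[of _ "%x. (PROD i<s. r (x i)) * C"])
   show "integrable ?P (%x. (PROD i<s. r (x i)) * C)" using dens(3)[OF r] by simp
   show "AE x in ?P. norm ((PROD i<s. r (x i)) * G x) <= norm ((PROD i<s. r (x i)) * C)"
    using AE_space
   proof eventually_elim
    case (elim x)
    then show ?case using GC[OF elim] C0 by (simp add: abs_mult mult_left_mono)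
   qed
  qed measurable
 qed
 let ?f = "%i j x. if j < i then p x else if j = i then \<bar>p x - q x\<bar> else q x"
 have intf: "integrable m (?f i j)" for i j :: nat
  using p(1) q(1) integrable_abs[OF integrable_diff[OF p(1) q(1)]]
  by (cases "j < i"; cases "j = i") simp_all
 have intff: "integrable ?P (%x. PROD j<s. ?f i j (x j))" for i
  using intf by (intro product_integrable_prod) auto
 have val: "(LINT x|?P. (PROD j<s. ?f i j (x j))) = (LINT x|m. \<bar>p x - q x\<bar>)" if "i < s" for i
 proof -
  have "(LINT x|?P. (PROD j<s. ?f i j (x j))) = (PROD j<s. \<integral>x. ?f i j x \<partial>m)"
   using intf by (intro product_integral_prod) auto
  also have "... = (PROD j<s. if j = i then (LINT x|m. \<bar>p x - q x\<bar>) else 1)"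
  proof (rule prod.cong[OF refl])
   fix j
   show "(LINT x|m. ?f i j x) = (if j = i then (LINT x|m. \<bar>p x - q x\<bar>) else 1)"
    using p(3) q(3) by (cases "j < i"; cases "j = i") simp_all
  qed
  also have "... = (LINT x|m. \<bar>p x - q x\<bar>)" using that by simp
  finally show ?thesis .
 qed
 have "\<bar>(LINT x|?P. (PROD i<s. p (x i)) * G x) - (LINT x|?P. (PROD i<s. q (x i)) * G x)\<bar>
   = \<bar>\<integral>x. (PROD i<s. p (x i)) * G x - (PROD i<s. q (x i)) * G x \<partial>?P\<bar>"
  using ig(2)[OF p] ig(2)[OF q] by simp
 also have "... <= (LINT x|?P. \<bar>(PROD i<s. p (x i)) * G x - (PROD i<s. q (x i)) * G x\<bar>)"
  by (rule integral_abs_bound)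
 also have "... <= (LINT x|?P. C * (SUM i<s. PROD j<s. ?f i j (x j)))"
 proof (intro integral_mono)
  fix x assume x: "x : space ?P"
  have "\<bar>(PROD i<s. p (x i)) * G x - (PROD i<s. q (x i)) * G x\<bar> = \<bar>(PROD i<s. p (x i)) - (PROD i<s. q (x i))\<bar> * \<bar>G x\<bar>"
   by (simp add: left_diff_distrib[symmetric] abs_mult)
  also have "... <= (SUM i<s. PROD j<s. ?f i j (x j)) * C"
   using abs_prod_diff_le[of "%i. p (x i)" "%i. q (x i)" s] p q GC[OF x] by (intro mult_mono) (auto intro: sum_nonneg prod_nonneg)
  finally show "\<bar>(PROD i<s. p (x i)) * G x - (PROD i<s. q (x i)) * G x\<bar> <= C * (SUM i<s. PROD j<s. ?f i j (x j))"
   by (simp add: mult.commute)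
 qed (use ig(2)[OF p] ig(2)[OF q] intff in auto)
 also have "... = C * (SUM i<s. \<integral>x. (PROD j<s. ?f i j (x j)) \<partial>?P)"
  using intff by simp
 also have "... = C * real s * (LINT x|m. \<bar>p x - q x\<bar>)"
  using val by simp
 finally show ?thesis unfolding ig(1)[OF p] ig(1)[OF q] .
qed

section \<open>Reweighted probability measures\<close>

definition reweight :: "('a => real) => 'a measure => 'a measure" where
 "reweight w m = density m (%x. ennreal (w x / (LINT x|m. w x)))"

lemma sets_reweight [simp, measurable_cong]: "sets (reweight w m) = sets m"
 by (simp add: reweight_def)

lemma integral_pos_of_pos:
 fixes w :: "'a => real"
 assumes "prob_space m" "integrable m w" "!!x. x : space m ==> w x > 0"
 shows "(LINT x|m. w x) > 0"
proof -
 interpret prob_space m by fact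
 have "(LINT x|m. w x) ~= 0"
 proof
  assume "(LINT x|m. w x) = 0"
  then have "AE x in m. w x = 0"
   using assms by (subst (asm) integral_nonneg_eq_0_iff_AE) (auto intro!: AE_I2 less_imp_le)
  then have "AE x in m. False" using AE_space by eventually_elim (use assms(3) in fastforce)
  then show False by simp
 qed
 moreover have "(LINT x|m. w x) >= 0" using assms by (intro integral_nonneg_AE AE_I2) (auto intro: less_imp_le)
 ultimately show ?thesis by simp
qed

context
 fixes m :: "'a measure" and w :: "'a => real"
 assumes m: "prob_space m" and w: "integrable m w" "!!x. w x > 0"
begin

lemma reweight_density:
 "integrable m (%x. w x / (LINT x|m. w x))" "0 <= w x / (LINT x|m. w x)" "(LINT x|m. w x / (LINT x|m. w x)) = 1"
 using w integral_pos_of_pos[OF m w(1)] by (auto intro!: divide_nonneg_pos less_imp_le)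

lemma prob_space_reweight: "prob_space (reweight w m)"
 using reweight_density w(1) unfolding reweight_def
 by (intro prob_spaceI) (simp add: emeasure_density nn_integral_eq_integral cong: nn_integral_cong_simp)

lemma integral_reweight:
 assumes "f : bm m"
 shows "(LINT x|reweight w m. f x) = (LINT x|m. f x * w x) / (LINT x|m. w x)"
proof -
 have "(LINT x|reweight w m. f x) = (LINT x|m. w x / (LINT x|m. w x) * f x)"
  unfolding reweight_def using w(1) assms reweight_density(2) by (subst integral_real_density) auto
 also have "... = (LINT x|m. f x * w x / (LINT x|m. w x))" by (simp add: mult.commute)
 finally show ?thesis by simp
qed

lemma integral_PiM_reweight:
 assumes G: "G : bm (PiM {..<s::nat} (%_. m))"
 shows "(LINT x|PiM {..<s} (%_. reweight w m). G x)
  = (LINT x|PiM {..<s} (%_. m). G x * (PROD i<s. w (x i))) / (LINT x|m. w x) ^ s"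
proof -
 let ?Z = "\<integral>x. w x \<partial>m"
 have wm[measurable]: "w : bm m" using w by auto
 note G[measurable]
 have "PiM {..<s} (%_. reweight w m) = density (PiM {..<s} (%_. m)) (%x. ennreal (PROD i<s. w (x i) / ?Z))"
  unfolding reweight_def
  using PiM_density[OF _ m _ prob_space_reweight[unfolded reweight_def], of "{..<s}"] reweight_density(2)
  by (simp add: prod_ennreal)
 then have "(LINT x|PiM {..<s} (%_. reweight w m). G x) = (LINT x|PiM {..<s} (%_. m). (PROD i<s. w (x i) / ?Z) * G x)"
  using reweight_density(2) by (simp add: integral_real_density prod_nonneg)
 also have "... = (LINT x|PiM {..<s} (%_. m). G x * (PROD i<s. w (x i)) / ?Z ^ s)"
  by (intro integral_cong refl) (simp add: prod_dividef)
 finally show ?thesis by simp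
qed

text \<open>The factor \<open>2\<close> is the price of normalization:
  \<open>w / Z - v / Y = (w - v) / Z + v * (Y - Z) / (Z * Y)\<close>, and the first moment of each
  term is at most that of \<open>w - v\<close> divided by \<open>Z\<close>.\<close>

lemma reweight_tv:
 assumes G: "G : bm (PiM {..<s::nat} (%_. m))"
  and GC: "!!x. x : space (PiM {..<s} (%_. m)) ==> \<bar>G x\<bar> <= C"
  and v: "integrable m v" "!!x. v x > (0::real)"
 shows "\<bar>(LINT x|PiM {..<s} (%_. reweight w m). G x) - (LINT x|PiM {..<s} (%_. reweight v m). G x)\<bar>
  <= C * real s * (2 * (LINT x|m. \<bar>w x - v x\<bar>) / (LINT x|m. w x))"
proof -
 interpret P: prob_space "PiM {..<s} (%_. m)" using m by (rule prob_space_PiM_const)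
 have C0: "C >= 0" using GC P.not_empty by (metis abs_ge_zero ex_in_conv order_trans)
 let ?Z = "\<integral>x. w x \<partial>m" and ?Y = "\<integral>x. v x \<partial>m"
 have Z: "?Z > 0" "?Y > 0" using integral_pos_of_pos[OF m] w v by auto
 have pv: "integrable m (%x. v x / ?Y)" "!!x. 0 <= v x / ?Y" "(LINT x|m. v x / ?Y) = 1"
  using v Z by (auto intro!: divide_nonneg_pos less_imp_le)
 have "(LINT x|m. \<bar>w x / ?Z - v x / ?Y\<bar>) <= (LINT x|m. \<bar>w x - v x\<bar> / ?Z + v x * (\<bar>?Y - ?Z\<bar> / (?Z * ?Y)))"
 proof (intro integral_mono)
  fix x
  have "w x / ?Z - v x / ?Y = (w x - v x) / ?Z + v x * ((?Y - ?Z) / (?Z * ?Y))"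
   using Z by (simp add: field_simps)
  also have "\<bar>...\<bar> <= \<bar>w x - v x\<bar> / ?Z + v x * (\<bar>?Y - ?Z\<bar> / (?Z * ?Y))"
   using Z v(2)[of x] by (intro order_trans[OF abs_triangle_ineq]) (simp add: abs_mult abs_divide)
  finally show "\<bar>w x / ?Z - v x / ?Y\<bar> <= \<bar>w x - v x\<bar> / ?Z + v x * (\<bar>?Y - ?Z\<bar> / (?Z * ?Y))" .
 qed (use w v in auto)
 also have "... = (LINT x|m. \<bar>w x - v x\<bar>) / ?Z + \<bar>?Y - ?Z\<bar> / ?Z"
  using w v Z by simp
 also have "\<bar>?Y - ?Z\<bar> <= (LINT x|m. \<bar>w x - v x\<bar>)"
  using integral_abs_bound[of m "%x. w x - v x"] w v by (simp add: abs_minus_commute)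
 finally have "(LINT x|m. \<bar>w x / ?Z - v x / ?Y\<bar>) <= 2 * (LINT x|m. \<bar>w x - v x\<bar>) / ?Z"
  using Z by (simp add: divide_right_mono add_divide_distrib[symmetric] flip: mult_2)
 moreover have "\<bar>(LINT x|PiM {..<s} (%_. reweight w m). G x) - (LINT x|PiM {..<s} (%_. reweight v m). G x)\<bar>
  <= C * real s * (LINT x|m. \<bar>w x / ?Z - v x / ?Y\<bar>)"
  unfolding reweight_def by (rule PiM_density_tv[OF m reweight_density pv G GC])
 ultimately show ?thesis
  using C0 by (meson mult_left_mono mult_nonneg_nonneg of_nat_0_le_iff order_trans)
qed

text \<open>A relative error of the weights asks for no lower bound on the normalization, since
  \<open>c * w\<close> integrates to \<open>c\<close> times it.\<close>

lemma reweight_close: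
 assumes G: "G : bm (PiM {..<s::nat} (%_. m))"
  and GC: "!!x. x : space (PiM {..<s} (%_. m)) ==> \<bar>G x\<bar> <= C"
  and v: "v : bm m" "!!x. v x > (0::real)"
  and c: "!!x. x : space m ==> \<bar>w x - v x\<bar> <= c * w x"
 shows "\<bar>(LINT x|PiM {..<s} (%_. reweight w m). G x) - (LINT x|PiM {..<s} (%_. reweight v m). G x)\<bar>
  <= C * real s * (2 * c)"
proof -
 interpret P: prob_space "PiM {..<s} (%_. m)" using m by (rule prob_space_PiM_const)
 have C0: "C >= 0" using GC P.not_empty by (metis abs_ge_zero ex_in_conv order_trans)
 have iv: "integrable m v"
 proof (rule integrable_bound[of _ "%x. (1 + c) * w x"])
  show "AE x in m. norm (v x) <= norm ((1 + c) * w x)"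
  proof (rule AE_I2)
   fix x assume "x : space m"
   from c[OF this] v(2)[of x] have "\<bar>v x\<bar> <= (1 + c) * w x" by (simp add: algebra_simps)
   then show "norm (v x) <= norm ((1 + c) * w x)" by simp
  qed
 qed (use w v in auto)
 have "(LINT x|m. \<bar>w x - v x\<bar>) <= (LINT x|m. c * w x)"
  using w iv c by (intro integral_mono) auto
 then have "2 * (LINT x|m. \<bar>w x - v x\<bar>) / (LINT x|m. w x) <= 2 * c"
  using integral_pos_of_pos[OF m] w by (simp add: divide_le_eq)
 then show ?thesis using reweight_tv[OF G GC iv v(2)] C0
  by (meson mult_left_mono mult_nonneg_nonneg of_nat_0_le_iff order_trans)
qed

end

lemma measurable_reweight:
 fixes w :: "'a => 'b => real"
 assumes w[measurable]: "(%(x, y). w x y) : bm (M **M N)" and L: "L : M ->M prob_algebra N"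
  and pos: "!!x y. w x y > 0" and int: "!!x. x : space M ==> integrable (L x) (w x)"
 shows "(%x. reweight (w x) (L x)) : M ->M prob_algebra N"
proof -
 have LN: "prob_space (L x)" "sets (L x) = sets N" if "x : space M" for x
  using measurable_space[OF L that] by (auto simp: space_prob_algebra)
 have Z[measurable]: "(%x. \<integral>y. w x y \<partial>L x) : bm M"
  by (rule measurable_integral_kernel[OF w L])
 show ?thesis
 proof (rule measurable_prob_algebraI)
  show "prob_space (reweight (w x) (L x))" if "x : space M" for x
   using that LN int pos by (intro prob_space_reweight) auto
  show "(%x. reweight (w x) (L x)) : M ->M subprob_algebra N"
  proof (rule measurable_subprob_algebra)
   show "subprob_space (reweight (w x) (L x))" if "x : space M" for x
    using that LN int pos by (intro prob_space_imp_subprob_space prob_space_reweight) auto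
   show "sets (reweight (w x) (L x)) = sets N" if "x : space M" for x using LN[OF that] by simp
   fix A assume A[measurable]: "A : sets N"
   have *: "(%x. \<integral>\<^sup>+y. ennreal (w x y / (LINT y|L x. w x y)) * indicator A y \<partial>L x) : bm M"
    by (rule nn_integral_measurable_subprob_algebra2[OF _ measurable_prob_algebraD[OF L]]) measurable
   show "(%x. emeasure (reweight (w x) (L x)) A) : bm M"
   proof (subst measurable_cong[OF _])
    fix x assume x: "x : space M"
    have "w x : bm N" using w x by (rule measurable_Pair2[of "%(x, y). w x y", simplified, OF _ _])
    then have "w x : bm (L x)" using LN(2)[OF x] measurable_cong_sets[of "L x" N borel borel] by blast
    then show "emeasure (reweight (w x) (L x)) A = (\<integral>\<^sup>+y. ennreal (w x y / (LINT y|L x. w x y)) * indicator A y \<partial>L x)"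
     using A LN(2)[OF x] unfolding reweight_def by (subst emeasure_density) auto
   qed (fact *)
  qed
 qed
qed

section \<open>Convergence of ratios from convergence of moments\<close>

lemma integral_div_power_approx:
 fixes f g :: "'a => real"
 assumes M: "prob_space M" and [measurable]: "f : bm M" "g : bm M"
  and f: "!!x. x : space M ==> \<bar>f x\<bar> <= C" and k: "0 < k" and g: "!!x. x : space M ==> k <= g x & g x <= K"
  and p: "!!z. z : {k..K} ==> \<bar>1 / z ^ s - (SUM j<=J. a j * z ^ j)\<bar> < de"
 shows "\<bar>(LINT x|M. f x / g x ^ s) - (SUM j<=J. a j * (LINT x|M. f x * g x ^ j))\<bar> <= C * de"
proof -
 interpret M: prob_space M by (rule M)
 have C0: "C >= 0" using f M.not_empty by (metis abs_ge_zero ex_in_conv order_trans)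
 have ib: "integrable M h" if "h : bm M" "!!x. x : space M ==> \<bar>h x\<bar> <= B"
  for h :: "'a => real" and B
  using that by (intro M.integrable_const_bound[of _ B]) auto
 have Zb: "\<bar>z ^ j\<bar> <= K ^ j" "\<bar>1 / z ^ j\<bar> <= 1 / k ^ j" if "k <= z & z <= K" for z j
  using that k by (auto simp: power_abs intro!: power_mono divide_left_mono)
 define P where "P z = (SUM j<=J. a j * z ^ j)" for z
 have i1: "integrable M (%x. f x * g x ^ j)" for j
  using f g C0 by (intro ib[of _ "C * K ^ j"]) (auto simp: abs_mult intro!: mult_mono Zb)
 have i2: "integrable M (%x. f x / g x ^ s)"
 proof (rule ib[of _ "C * (1 / k ^ s)"])
  fix x assume x: "x : space M"
  have "\<bar>f x\<bar> * \<bar>1 / g x ^ s\<bar> <= C * (1 / k ^ s)"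
   using f[OF x] g[OF x] C0 by (intro mult_mono Zb) auto
  then show "\<bar>f x / g x ^ s\<bar> <= C * (1 / k ^ s)" by (simp add: abs_mult)
 qed measurable
 have eq: "f x * P (g x) = (SUM j<=J. a j * (f x * g x ^ j))" for x
  by (simp add: P_def sum_distrib_left algebra_simps)
 have I: "(LINT x|M. f x * P (g x)) = (SUM j<=J. a j * (LINT x|M. f x * g x ^ j))"
  unfolding eq using i1 by simp
 have i3: "integrable M (%x. f x * P (g x))" unfolding eq using i1 by simp
 have "\<bar>(LINT x|M. f x / g x ^ s) - (LINT x|M. f x * P (g x))\<bar> = \<bar>\<integral>x. f x / g x ^ s - f x * P (g x) \<partial>M\<bar>"
  using i2 i3 by simp
 also have "... <= (LINT x|M. \<bar>f x / g x ^ s - f x * P (g x)\<bar>)" by (rule integral_abs_bound)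
 also have "... <= (LINT x|M. C * de)"
 proof (intro integral_mono)
  fix x assume x: "x : space M"
  have "f x / g x ^ s - f x * P (g x) = f x * (1 / g x ^ s - P (g x))" by (simp add: algebra_simps)
  also have "\<bar>...\<bar> <= C * de"
   unfolding abs_mult using f[OF x] p[of "g x"] g[OF x] C0 by (intro mult_mono) (auto simp: P_def)
  finally show "\<bar>f x / g x ^ s - f x * P (g x)\<bar> <= C * de" .
 qed (use i2 i3 in auto)
 also have "... = C * de" by (simp add: M.prob_space)
 finally show ?thesis unfolding I .
qed

text \<open>On \<open>[k, K]\<close> the function \<open>1 / z ^ s\<close> is a uniform limit of
  polynomials, so the ratio is approximated, uniformly in \<open>n\<close>, by finite combinations
  of the moments in \<open>mom\<close>. In the applications \<open>Z\<close> is a normalization, and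
  its powers are expectations over additional replicas.\<close>

lemma moments_limit:
 fixes A :: "nat => 'a => real" and A' :: "'b => real"
 assumes N: "!!n. prob_space (N n)" and N': "prob_space N'"
  and meas: "!!n. A n : bm (N n)" "!!n. Z n : bm (N n)"
   "A' : bm N'" "Z' : bm N'"
  and C: "!!n x. x : space (N n) ==> \<bar>A n x\<bar> <= C" "!!x. x : space N' ==> \<bar>A' x\<bar> <= C"
  and k: "0 < k" and Z: "!!n x. x : space (N n) ==> k <= Z n x & Z n x <= K" "!!x. x : space N' ==> k <= Z' x & Z' x <= K"
  and mom: "!!j. (%n. \<integral>x. A n x * Z n x ^ j \<partial>N n) ----> (LINT x|N'. A' x * Z' x ^ j)"
 shows "(%n. \<integral>x. A n x / Z n x ^ s \<partial>N n) ----> (LINT x|N'. A' x / Z' x ^ s)"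
proof (rule LIMSEQ_I)
 fix e :: real assume e: "e > 0"
 interpret N: prob_space "N n" for n by (rule N)
 interpret N': prob_space N' by (rule N')
 have C0: "C >= 0" using C(2) N'.not_empty by (metis abs_ge_zero ex_in_conv order_trans)
 \<comment> \<open>The polynomial costs at most \<open>C * de <= e / 4\<close> on each side and the
   moments cost \<open>e / 4\<close>; the summand \<open>1\<close> covers
   \<open>C = 0\<close>.\<close>
 define de where "de = e / (4 * (C + 1))"
 have de: "de > 0" using e C0 by (simp add: de_def)
 have "continuous_on {k..K} (%z. 1 / z ^ s)" using k by (intro continuous_intros) auto
 from Stone_Weierstrass_real_polynomial_function[OF compact_Icc this de]
 obtain p where p: "real_polynomial_function p" "!!z. z : {k..K} ==> \<bar>1 / z ^ s - p z\<bar> < de"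
  by auto
 then obtain a J where pa: "p = (%z. SUM j<=J. a j * z ^ j)"
  unfolding real_polynomial_function_iff_sum by auto
 have Cd: "C * de <= e / 4" using C0 e by (simp add: de_def field_simps)
 have "(%n. SUM j<=J. a j * (LINT x|N n. A n x * Z n x ^ j)) ----> (SUM j<=J. a j * (LINT x|N'. A' x * Z' x ^ j))"
  by (intro tendsto_sum tendsto_mult_left mom)
 from LIMSEQ_D[OF this, of "e / 4"] e obtain n0 where
  n0: "!!n. n >= n0 ==> \<bar>(SUM j<=J. a j * (LINT x|N n. A n x * Z n x ^ j)) - (SUM j<=J. a j * (LINT x|N'. A' x * Z' x ^ j))\<bar> < e / 4"
  by auto
 show "\<exists>n0. \<forall>n\<ge>n0. norm ((LINT x|N n. A n x / Z n x ^ s) - (LINT x|N'. A' x / Z' x ^ s)) < e"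
 proof (intro exI[of _ n0] allI impI)
  fix n assume n: "n >= n0"
  show "norm ((LINT x|N n. A n x / Z n x ^ s) - (LINT x|N'. A' x / Z' x ^ s)) < e"
  proof -
   have "\<bar>(LINT x|N n. A n x / Z n x ^ s) - (SUM j<=J. a j * (LINT x|N n. A n x * Z n x ^ j))\<bar> <= C * de"
    using N meas C k Z p(2) unfolding pa by (intro integral_div_power_approx[where k = k and K = K]) auto
   moreover have "\<bar>(LINT x|N'. A' x / Z' x ^ s) - (SUM j<=J. a j * (LINT x|N'. A' x * Z' x ^ j))\<bar> <= C * de"
    using N' meas C k Z p(2) unfolding pa by (intro integral_div_power_approx[where k = k and K = K]) auto
   ultimately show ?thesis using n0[OF n] Cd e unfolding real_norm_def by linarith
  qed
 qed
qed

section \<open>Functions that determine measures on couplings and replicas\<close>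

text \<open>Factors of cylinder functions of the couplings. Continuity admits them in
  \<open>fdd_tendsto\<close>; compact support confines the couplings to a bounded set, where
  truncation at a high level has no effect.\<close>

definition bump :: "(real => real) set" where
 "bump = {u. continuous_on UNIV u & (\<forall>x. 0 <= u x & u x <= 1) & (\<exists>K. \<forall>x. \<bar>x\<bar> > K --> u x = 0)}"

lemma bump_measurable: "u : bump ==> u : bm borel"
 by (auto simp: bump_def intro: borel_measurable_continuous_onI)

lemma bump_bounds: "u : bump ==> 0 <= u x" "u : bump ==> u x <= 1"
 by (auto simp: bump_def)

text \<open>For growing \<open>k\<close> these functions tend to the indicator of
  \<open>{a<..}\<close>; the term \<open>real k - \<bar>x\<bar>\<close> cuts them off to compact
  support.\<close>

lemma bump_ray: "(%x. max 0 (min 1 (min (real k * (x - a)) (real k - \<bar>x\<bar>)))) : bump"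
proof -
 have "continuous_on UNIV (%x. max 0 (min 1 (min (real k * (x - a)) (real k - \<bar>x\<bar>))))"
  by (intro continuous_intros)
 then show ?thesis by (auto simp: bump_def intro!: exI[of _ "real k"])
qed

lemma measure_eqI_bump_real:
 assumes fin: "finite_measure M" "finite_measure N" and sets[measurable_cong]: "sets M = sets borel" "sets N = sets borel"
  and eq: "!!u. u : bump ==> (LINT x|M. u x) = (LINT x|N. u x)"
 shows "M = (N :: real measure)"
proof (rule measure_eqI_lessThan)
 interpret M: finite_measure M by fact
 interpret N: finite_measure N by fact
 show "sets M = sets borel" "sets N = sets borel" by fact+
 fix a :: real
 show "emeasure M {a<..} < \<infinity>" using M.emeasure_finite[of "{a<..}"] by (auto simp: less_top[symmetric])
 define u where "u k x = max 0 (min 1 (min (real k * (x - a)) (real k - \<bar>x\<bar>)))" for k x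
 have u: "u k : bump" for k unfolding u_def[abs_def] by (rule bump_ray)
 have lim: "(%k. u k x) ----> indicator {a<..} x" for x
 proof (cases "x > a")
  case True
  obtain n where n: "real n > 1 / (x - a)" "real n > 1 + \<bar>x\<bar>"
   using reals_Archimedean2[of "max (1 / (x - a)) (1 + \<bar>x\<bar>)"] by auto
  have "u k x = 1" if "k >= n" for k
  proof -
   have "real k >= 1 / (x - a)" "real k >= 1 + \<bar>x\<bar>" using n that by auto
   then have "real k * (x - a) >= 1" "real k - \<bar>x\<bar> >= 1" using True by (auto simp: field_simps)
   then show ?thesis by (simp add: u_def)
  qed
  then show ?thesis using True by (intro tendsto_eventually) (auto simp: eventually_sequentially)
 next
  case False
  then have "u k x = 0" for k
   using mult_nonneg_nonpos[of "real k" "x - a"] by (auto simp: u_def max_def min_def)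
  then show ?thesis using False by simp
 qed
 have m: "(%k. \<integral>x. u k x \<partial>L) ----> measure L {a<..}" if "finite_measure L" and [measurable_cong]: "sets L = sets borel" for L
 proof -
  interpret finite_measure L by fact
  have [measurable]: "u k : bm borel" for k using u by (rule bump_measurable)
  have "(%k. \<integral>x. u k x \<partial>L) ----> (LINT x|L. indicator {a<..} x)"
   using bump_bounds[OF u] lim by (intro integral_dominated_convergence[where w = "%_. 1"]) auto
  then show ?thesis by (simp add: space_eqI[OF that(2)])
 qed
 have "measure M {a<..} = measure N {a<..}"
  using m[OF fin(1) sets(1)] m[OF fin(2) sets(2)] eq[OF u] by (simp add: LIMSEQ_unique)
 then show "emeasure M {a<..} = emeasure N {a<..}"
  by (simp add: M.emeasure_eq_measure N.emeasure_eq_measure)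
qed

text \<open>The factors \<open>g1\<close> and \<open>g2\<close> are absorbed as densities, so that
  the claim becomes an equality of two finite measures on the line, the images under
  \<open>X1\<close> and \<open>X2\<close>.\<close>

lemma integral_indicator_from_bump:
 fixes g1 :: "'a => real" and g2 :: "'b => real"
 assumes fin: "finite_measure M1" "finite_measure M2"
  and [measurable]: "X1 : bm M1" "X2 : bm M2" "g1 : bm M1" "g2 : bm M2"
  and g: "!!z. 0 <= g1 z & g1 z <= 1" "!!z. 0 <= g2 z & g2 z <= 1"
  and eq: "!!v. v : bump ==> (LINT z|M1. v (X1 z) * g1 z) = (LINT z|M2. v (X2 z) * g2 z)"
  and B: "B : sets borel"
 shows "(LINT z|M1. indicator B (X1 z) * g1 z) = (LINT z|M2. indicator B (X2 z) * g2 z)"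
proof -
 define D1 where "D1 = distr (density M1 g1) borel X1"
 define D2 where "D2 = distr (density M2 g2) borel X2"
 have f1: "finite_measure (density M1 g1)" 
 proof -
  interpret finite_measure M1 by fact
  have "(\<integral>\<^sup>+x. ennreal (g1 x) * indicator (space M1) x \<partial>M1) <= (\<integral>\<^sup>+x. 1 \<partial>M1)"
   using g by (intro nn_integral_mono) (auto simp: indicator_def ennreal_le_1)
  also have "... < \<infinity>" using emeasure_finite[of "space M1"] by (auto simp: less_top[symmetric])
  finally show ?thesis by (intro finite_measureI) (auto simp: emeasure_density)
 qed
 have f2: "finite_measure (density M2 g2)" 
 proof -
  interpret finite_measure M2 by fact
  have "(\<integral>\<^sup>+x. ennreal (g2 x) * indicator (space M2) x \<partial>M2) <= (\<integral>\<^sup>+x. 1 \<partial>M2)"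
   using g by (intro nn_integral_mono) (auto simp: indicator_def ennreal_le_1)
  also have "... < \<infinity>" using emeasure_finite[of "space M2"] by (auto simp: less_top[symmetric])
  finally show ?thesis by (intro finite_measureI) (auto simp: emeasure_density)
 qed
 have i1: "(LINT x|D1. v x) = (LINT z|M1. v (X1 z) * g1 z)" if [measurable]: "v : bm borel" for v :: "real => real"
  unfolding D1_def using g by (simp add: integral_distr integral_real_density mult.commute)
 have i2: "(LINT x|D2. v x) = (LINT z|M2. v (X2 z) * g2 z)" if [measurable]: "v : bm borel" for v :: "real => real"
  unfolding D2_def using g by (simp add: integral_distr integral_real_density mult.commute)
 have "D1 = D2"
  unfolding D1_def D2_def
 proof (rule measure_eqI_bump_real, fold D1_def D2_def)
  show "finite_measure D1" "finite_measure D2"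
   unfolding D1_def D2_def using f1 f2 by (auto intro!: finite_measure.finite_measure_distr)
  show "sets D1 = sets borel" "sets D2 = sets borel" by (auto simp: D1_def D2_def)
  show "(LINT x|D1. u x) = (LINT x|D2. u x)" if "u : bump" for u
   using eq[OF that] by (simp add: i1 i2 bump_measurable[OF that])
 qed
 with i1[of "indicator B"] i2[of "indicator B"] B show ?thesis by simp
qed

text \<open>The coordinates are turned from bumps into indicators one at a time. The induction is
  over the finished set \<open>E1\<close> with arbitrary bumps on \<open>E2\<close>, so that the
  coordinate \<open>e\<close> under treatment can be counted among the bumps in the induction
  hypothesis.\<close>

lemma indicator_from_bump_prod:
 assumes fin: "finite_measure M1" "finite_measure M2"
  and sets: "sets M1 = sets (PiM I (%_. borel :: real measure) **M Y)" "sets M2 = sets (PiM I (%_. borel :: real measure) **M Y)"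
  and C: "C : sets Y"
  and eq: "!!E u. finite E ==> E \<subseteq> I ==> (!!e. e : E ==> u e : bump) ==>
   (LINT z|M1. (PROD e:E. u e (fst z e)) * indicator C (snd z)) = (LINT z|M2. (PROD e:E. u e (fst z e)) * indicator C (snd z))"
  and "finite E1" "finite E2" "E1 \<subseteq> I" "E2 \<subseteq> I" "E1 \<inter> E2 = {}"
  and "!!e. e : E1 ==> A e : sets borel" "!!e. e : E2 ==> u e : bump"
 shows "(LINT z|M1. (PROD e:E1. indicator (A e) (fst z e)) * ((PROD e:E2. u e (fst z e)) * indicator C (snd z)))
  = (LINT z|M2. (PROD e:E1. indicator (A e) (fst z e)) * ((PROD e:E2. u e (fst z e)) * indicator C (snd z)))"
 using assms(7-)
proof (induction E1 arbitrary: E2 u rule: finite_induct)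
 case empty
 then show ?case using eq by simp
next
 case (insert e E1)
 note sets[measurable_cong] C[measurable]
 have [measurable]: "(%z. fst z e) : bm M1" "(%z. fst z e) : bm M2" if "e : I" for e
  using that by measurable
 let ?g = "%z. (PROD e:E1. indicator (A e) (fst z e)) * ((PROD e:E2. u e (fst z e)) * indicator C (snd z)) :: real"
 have um: "u e : bm borel" if "e : E2" for e using insert.prems that by (intro bump_measurable) auto
 have g_meas: "?g : bm M" if sM: "sets M = sets (PiM I (%_. borel :: real measure) **M Y)" for M
 proof -
  note sM[measurable_cong]
  have coord[measurable]: "(%z. fst z e) : bm M" if "e : I" for e using that by measurable
  have "(%z. indicator (A e) (fst z e) :: real) : bm M" if "e : E1" for e
   using insert.prems that by (intro mcomp[OF coord borel_measurable_indicator]) auto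
  moreover have "(%z. u e (fst z e)) : bm M" if "e : E2" for e
   using insert.prems that by (intro mcomp[OF coord um]) auto
  ultimately show ?thesis by (intro borel_measurable_times borel_measurable_prod) auto
 qed
 have gb: "0 <= ?g z & ?g z <= 1" for z
  using insert.prems bump_bounds
  by (auto intro!: mult_nonneg_nonneg prod_nonneg mult_le_one prod_le_1 simp: indicator_def)
 have "(LINT z|M1. indicator (A e) (fst z e) * ?g z) = (LINT z|M2. indicator (A e) (fst z e) * ?g z)"
 proof (rule integral_indicator_from_bump[OF fin])
  fix v assume v: "v : bump"
  have pe: "(PROD e':insert e E2. (u(e := v)) e' (fst z e')) = v (fst z e) * (PROD e:E2. u e (fst z e))" for z :: "('a => real) \<times> 'b"
  proof -
   have "e \<notin> E2" using insert.prems by auto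
   then have "(PROD e':E2. (u(e := v)) e' (fst z e')) = (PROD e:E2. u e (fst z e))" by (intro prod.cong) auto
   with \<open>e \<notin> E2\<close> insert.prems show ?thesis by simp
  qed
  have eqz: "(PROD e:E1. indicator (A e) (fst z e)) * ((PROD e':insert e E2. (u(e := v)) e' (fst z e')) * indicator C (snd z))
    = v (fst z e) * ?g z" for z
   unfolding pe by (simp only: mult_ac)
  have "(LINT z|M1. (PROD e:E1. indicator (A e) (fst z e)) * ((PROD e':insert e E2. (u(e := v)) e' (fst z e')) * indicator C (snd z)))
   = (LINT z|M2. (PROD e:E1. indicator (A e) (fst z e)) * ((PROD e':insert e E2. (u(e := v)) e' (fst z e')) * indicator C (snd z)))"
   using insert.prems insert.hyps v by (intro insert.IH) auto
  then show "(LINT z|M1. v (fst z e) * ?g z) = (LINT z|M2. v (fst z e) * ?g z)" unfolding eqz .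
 qed (use insert.prems gb g_meas sets in auto)
 then show ?case using insert.hyps by (simp add: mult.assoc)
qed

text \<open>Indicators of finitely many coordinates are reached from bumps; together with the
  generator \<open>\<C>\<close> of the second factor they form an intersection stable generator of
  the product.\<close>

lemma measure_eqI_bump:
 assumes fin: "finite_measure M1" "finite_measure M2"
  and sets: "sets M1 = sets (PiM I (%_. borel :: real measure) **M Y)" "sets M2 = sets (PiM I (%_. borel :: real measure) **M Y)"
  and Y: "sets Y = sigma_sets (space Y) \<C>" "Int_stable \<C>" "\<C> \<subseteq> Pow (space Y)" "space Y : \<C>"
  and eq: "!!E u C. finite E ==> E \<subseteq> I ==> (!!e. e : E ==> u e : bump) ==> C : \<C> ==>
   (LINT z|M1. (PROD e:E. u e (fst z e)) * indicator C (snd z)) = (LINT z|M2. (PROD e:E. u e (fst z e)) * indicator C (snd z))"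
 shows "M1 = M2"
proof -
 interpret M1: finite_measure M1 by fact
 interpret M2: finite_measure M2 by fact
 define OM where "OM = space (PiM I (%_. borel :: real measure) **M Y)"
 define R where "R E A C = {z : OM. (\<forall>e\<in>E. fst z e : A e) & snd z : C}" for E :: "'a set" and A :: "'a => real set" and C
 define G where "G = {R E A C | E A C. finite E & E \<subseteq> I & (\<forall>e\<in>E. A e : sets borel) & C : \<C>}"
 have CY: "C : sets Y" if "C : \<C>" for C using that Y by auto
 have Rm: "R E A C : sets (PiM I (%_. borel :: real measure) **M Y)"
  if "finite E" "E \<subseteq> I" "\<forall>e\<in>E. A e : sets borel" "C : \<C>" for E A C
 proof -
  have [measurable]: "C : sets Y" using CY that by auto
  have "{z : OM. fst z e : A e} : sets (PiM I (%_. borel :: real measure) **M Y)" if "e : E" for e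
   using that \<open>E \<subseteq> I\<close> \<open>\<forall>e\<in>E. A e : sets borel\<close> unfolding OM_def
   by (intro measurable_sets_Collect[of "%z. fst z e" _ borel "%x. x : A e"]) auto
  then have "{z : OM. \<forall>e\<in>E. fst z e : A e} : sets (PiM I (%_. borel :: real measure) **M Y)"
   using that unfolding OM_def by (intro sets.sets_Collect_finite_All) auto
  moreover have "{z : OM. snd z : C} : sets (PiM I (%_. borel :: real measure) **M Y)"
   unfolding OM_def by measurable
  moreover have "R E A C = {z : OM. \<forall>e\<in>E. fst z e : A e} \<inter> {z : OM. snd z : C}" by (auto simp: R_def)
  ultimately show ?thesis by auto
 qed
 have G_sub: "G \<subseteq> Pow OM" by (auto simp: G_def R_def)
 \<comment> \<open>\<open>G\<close> generates because both projections are measurable for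
   \<open>sigma OM G\<close>, so that the identity is measurable into the product.\<close>
 have sG: "sets (PiM I (%_. borel :: real measure) **M Y) = sigma_sets OM G"
 proof
  show "sigma_sets OM G \<subseteq> sets (PiM I (%_. borel :: real measure) **M Y)"
   unfolding OM_def by (rule sets.sigma_sets_subset) (use Rm in \<open>auto simp: G_def\<close>)
  let ?S = "sigma OM G"
  have spS: "space ?S = OM" using G_sub by (rule space_measure_of)
  have inG: "R E A C : sets ?S" if "finite E" "E \<subseteq> I" "\<forall>e\<in>E. A e : sets borel" "C : \<C>" for E A C
   using that G_sub by (auto simp: G_def)
  have f1: "fst : ?S ->M PiM I (%_. borel :: real measure)"
  proof (rule measurable_PiM_single')
   show "(%om. fst om e) : ?S ->M borel" if "e : I" for e
   proof (rule measurableI)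
    fix B :: "real set" assume "B : sets borel"
    then have "R {e} (%_. B) (space Y) : sets ?S" using that Y by (intro inG) auto
    moreover have "(%om. fst om e) -` B \<inter> space ?S = R {e} (%_. B) (space Y)"
     unfolding spS by (auto simp: R_def OM_def space_pair_measure)
    ultimately show "(%om. fst om e) -` B \<inter> space ?S : sets ?S" by simp
   qed auto
   show "(%om i. fst om i) : space ?S \<rightarrow> I \<rightarrow>\<^sub>E space borel"
    unfolding spS by (auto simp: OM_def space_pair_measure space_PiM)
  qed
  have f2: "snd : ?S ->M Y"
  proof (rule measurable_sigma_sets[OF Y(1) Y(3)])
   show "snd : space ?S \<rightarrow> space Y" unfolding spS by (auto simp: OM_def space_pair_measure)
   fix C assume "C : \<C>"
   then have "R {} (%_. UNIV) C : sets ?S" by (intro inG) auto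
   moreover have "snd -` C \<inter> space ?S = R {} (%_. UNIV) C" unfolding spS by (auto simp: R_def)
   ultimately show "snd -` C \<inter> space ?S : sets ?S" by simp
  qed
  from measurable_Pair[OF f1 f2] have id: "(%z. z) : ?S ->M PiM I (%_. borel :: real measure) **M Y" by simp
  show "sets (PiM I (%_. borel :: real measure) **M Y) \<subseteq> sigma_sets OM G"
  proof
   fix X assume X: "X : sets (PiM I (%_. borel :: real measure) **M Y)"
   have "(%z. z) -` X \<inter> space ?S : sets ?S" by (rule measurable_sets[OF id X])
   moreover have "(%z. z) -` X \<inter> space ?S = X" using sets.sets_into_space[OF X] unfolding spS by (auto simp: OM_def)
   ultimately show "X : sigma_sets OM G" using G_sub by simp
  qed
 qed
 have "Int_stable G"
 proof (rule Int_stableI)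
  fix a b assume "a : G" "b : G"
  then obtain E A C E' A' C' where a: "a = R E A C" "finite E" "E \<subseteq> I" "\<forall>e\<in>E. A e : sets borel" "C : \<C>"
   and b: "b = R E' A' C'" "finite E'" "E' \<subseteq> I" "\<forall>e\<in>E'. A' e : sets borel" "C' : \<C>"
   by (auto simp: G_def)
  have "a \<inter> b = R (E \<union> E') (%e. (if e : E then A e else UNIV) \<inter> (if e : E' then A' e else UNIV)) (C \<inter> C')"
   unfolding a b R_def by (auto split: if_splits)
  moreover have "C \<inter> C' : \<C>" using Y(2) a b by (auto dest: Int_stableD)
  moreover have "\<forall>e\<in>E \<union> E'. (if e : E then A e else UNIV) \<inter> (if e : E' then A' e else UNIV) : sets borel"
   using a b by (auto intro!: sets.Int)
  ultimately show "a \<inter> b : G" using a b unfolding G_def by blast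
 qed
 then show ?thesis
 proof (rule measure_eqI_generator_eq[OF _ G_sub])
  show "sets M1 = sigma_sets OM G" "sets M2 = sigma_sets OM G" using sets sG by auto
  show "range (%_::nat. OM) \<subseteq> G"
  proof -
   have "OM = R {} (%_. UNIV) (space Y)" by (auto simp: R_def OM_def space_pair_measure)
   then show ?thesis using Y(4) unfolding G_def by blast
  qed
  show "(\<Union>i::nat. OM) = OM" by simp
  show "emeasure M1 OM ~= \<infinity>" by simp
  fix X assume "X : G"
  then obtain E A C where X: "X = R E A C" "finite E" "E \<subseteq> I" "\<forall>e\<in>E. A e : sets borel" "C : \<C>"
   by (auto simp: G_def)
  have sp: "space M1 = OM" "space M2 = OM" using sets by (auto simp: OM_def dest: space_eqI)
  have ind: "indicator X z = (PROD e:E. indicator (A e) (fst z e)) * ((PROD e:{}. (%_. 0) (fst z e)) * indicator C (snd z) :: real)" if "z : OM" for z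
   using that X(2) by (auto simp: X R_def indicator_def prod.If_cases Ball_def)
  have XM: "X : sets M1" "X : sets M2" using Rm X sets by auto
  have "measure M1 X = (LINT z|M1. indicator X z)" using XM by (simp add: Int_absorb2 sets.sets_into_space)
  also have "... = (LINT z|M1. (PROD e:E. indicator (A e) (fst z e)) * ((PROD e:{}. (%_. 0) (fst z e)) * indicator C (snd z)))"
   using ind sp by (intro integral_cong) auto
  also have "... = (LINT z|M2. (PROD e:E. indicator (A e) (fst z e)) * ((PROD e:{}. (%_. 0) (fst z e)) * indicator C (snd z)))"
   using X CY eq by (intro indicator_from_bump_prod[where u = "%_ _. 0", OF fin sets]) auto
  also have "... = (LINT z|M2. indicator X z)"
   using ind sp by (intro integral_cong) auto
  also have "... = measure M2 X" using XM by (simp add: Int_absorb2 sets.sets_into_space)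
  finally show "emeasure M1 X = emeasure M2 X" by (simp add: M1.emeasure_eq_measure M2.emeasure_eq_measure)
 qed
qed

text \<open>A spin has two values, so events that only prescribe the value \<open>1\<close> generate
  everything, and the intersection of two of them is \<open>cyl\<close> of the union of the index
  sets.\<close>

definition cyl :: "(nat \<times> ('d::finite) site) set => (nat => 'd config) set" where
 "cyl D = {sg : space (replicas cfg). \<forall>(i, x)\<in>D. sg i x = 1}"

lemma space_config [simp]: "space (cfg :: ('d::finite) config measure) = {sg. \<forall>x. sg x : {-1, 1}}"
 by (auto simp: config_space_def space_PiM PiE_def Pi_def)

lemma space_replicas_config: "space (replicas (cfg :: ('d::finite) config measure)) = {sg. \<forall>i x. sg i x : {-1, 1}}"
 by (auto simp: space_PiM PiE_def Pi_def)

lemma measurable_configI: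
 assumes "!!x. (%om. f om x) : S ->M count_space {-1, 1}"
 shows "f : S ->M (cfg :: ('d::finite) config measure)"
proof -
 have "(%om x. f om x) : S ->M PiM UNIV (%_. count_space {-1, 1})"
 proof (rule measurable_PiM_single')
  have "f x y : {-1, 1}" if "x : space S" for x y
   using measurable_space[OF assms that] by simp
  then show "(%om i. f om i) : space S \<rightarrow> UNIV \<rightarrow>\<^sub>E space (count_space {- 1, 1})" by auto
 qed (rule assms)
 then show ?thesis by (simp add: config_space_def)
qed

lemma spin_measurable_count: "(%sg. sg x) : (cfg :: ('d::finite) config measure) ->M count_space {-1, 1}"
 unfolding config_space_def by measurable

lemma spin_measurable [measurable]: "(%sg. sg x) : bm (cfg :: ('d::finite) config measure)"
 by (rule mcomp[OF spin_measurable_count]) simp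

lemma replica_config_generator:
 "sets (replicas (cfg :: ('d::finite) config measure))
  = sigma_sets (space (replicas cfg)) {cyl D | D. finite D}" (is "sets ?Y = sigma_sets ?OM ?G")
 "Int_stable {cyl D | D :: (nat \<times> 'd site) set. finite D}"
 "{cyl D | D :: (nat \<times> 'd site) set. finite D} \<subseteq> Pow (space (replicas cfg))"
 "space (replicas cfg) : {cyl D | D :: (nat \<times> 'd site) set. finite D}"
proof -
 show sub: "?G \<subseteq> Pow ?OM" by (auto simp: cyl_def)
 show "space (replicas cfg) : ?G" by (rule CollectI, rule exI[of _ "{}"]) (auto simp: cyl_def)
 show "Int_stable ?G"
 proof (rule Int_stableI)
  fix a b assume "a : ?G" "b : ?G"
  then obtain D D' where "a = cyl D" "finite D" "b = cyl D'" "finite D'" by auto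
  then show "a \<inter> b : ?G" by (intro CollectI exI[of _ "D \<union> D'"]) (auto simp: cyl_def)
 qed
 have meas: "cyl D : sets ?Y" if "finite D" for D :: "(nat \<times> 'd site) set"
 proof -
  have "{sg : ?OM. sg (fst d) (snd d) = 1} : sets ?Y" for d :: "nat \<times> 'd site" by measurable
  then have "{sg : ?OM. \<forall>d\<in>D. sg (fst d) (snd d) = 1} : sets ?Y"
   using that by (intro sets.sets_Collect_finite_All) auto
  then show ?thesis by (simp add: cyl_def case_prod_beta)
 qed
 show "sets ?Y = sigma_sets ?OM ?G"
 proof
  show "sigma_sets ?OM ?G \<subseteq> sets ?Y" using meas by (intro sets.sigma_sets_subset) auto
  let ?S = "sigma ?OM ?G"
  have spS: "space ?S = ?OM" using sub by (rule space_measure_of)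
  have one: "{sg : ?OM. sg i x = 1} : sets ?S" for i and x :: "'d site"
  proof -
   have "{sg : ?OM. sg i x = 1} = cyl {(i, x)}" by (auto simp: cyl_def)
   then show ?thesis using sub by auto
  qed
  have coord: "(%sg. sg i x) : ?S ->M count_space {-1, 1 :: real}" for i and x :: "'d site"
  proof (rule measurable_count_space_eq_countable[THEN iffD2])
   show "(%sg. sg i x) : space ?S \<rightarrow> {-1, 1} & (\<forall>a\<in>{-1, 1}. (%sg. sg i x) -` {a} \<inter> space ?S : sets ?S)"
   proof (intro conjI ballI)
    show "(%sg. sg i x) : space ?S \<rightarrow> {-1, 1}" unfolding spS by (auto simp: space_replicas_config)
    fix a :: real assume "a : {-1, 1}"
    have "(%sg. sg i x) -` {1} \<inter> space ?S = {sg : ?OM. sg i x = 1}" unfolding spS by auto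
    moreover have "(%sg. sg i x) -` {-1} \<inter> space ?S = space ?S - {sg : ?OM. sg i x = 1}"
     unfolding spS by (auto simp: space_replicas_config)
    ultimately show "(%sg. sg i x) -` {a} \<inter> space ?S : sets ?S"
     using one[of i x] \<open>a : _\<close> by (auto simp del: space_measure_of sets_measure_of intro: sets.compl_sets)
   qed
  qed auto
  have id: "(%sg. sg) : ?S ->M ?Y"
  proof (rule measurable_PiM_single')
   show "(%sg. sg i) : ?S ->M cfg" for i
    by (rule measurable_configI) (rule coord)
   show "(%sg i. sg i) : space ?S \<rightarrow> UNIV \<rightarrow>\<^sub>E space cfg" unfolding spS by (auto simp: space_replicas_config)
  qed
  show "sets ?Y \<subseteq> sigma_sets ?OM ?G"
  proof
   fix X assume X: "X : sets ?Y"
   have "(%z. z) -` X \<inter> space ?S : sets ?S" by (rule measurable_sets[OF id X])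
   moreover have "(%z. z) -` X \<inter> space ?S = X" using sets.sets_into_space[OF X] unfolding spS by auto
   ultimately show "X : sigma_sets ?OM ?G" using sub by simp
  qed
 qed
qed

section \<open>Edges and edge overlaps\<close>

lemma axis_component: "axis i (1::int) $ j = (if j = i then 1 else 0)"
 by (simp add: axis_def)

lemma step_neq: "x ~= x + axis i (1::int)" "x + axis i (1::int) ~= x"
proof -
 have "x + axis i (1::int) ~= x"
 proof
  assume "x + axis i (1::int) = x"
  then have "axis i (1::int) $ i = 0" by simp
  then show False by (simp add: axis_component)
 qed
 then show "x ~= x + axis i (1::int)" "x + axis i (1::int) ~= x" by metis+
qed

lemma step_edge [simp]: "{x, x + axis i 1} : edges"
proof -
 have "(SUM j:UNIV. \<bar>x $ j - (x + axis i 1) $ j\<bar>) = (SUM j:UNIV. if j = i then 1 else 0)"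
  by (intro sum.cong) (auto simp: axis_component)
 then show ?thesis unfolding edges_def by (intro CollectI exI[of _ x] exI[of _ "x + axis i 1"]) simp
qed

lemma edge_inj: "{x, x + axis i (1::int)} = {y, y + axis j 1} \<longleftrightarrow> x = y & i = j"
proof
 assume eq: "{x, x + axis i (1::int)} = {y, y + axis j 1}"
 then consider "x = y" "x + axis i 1 = y + axis j 1" | "x = y + axis j 1" "x + axis i 1 = y"
  by (auto simp: doubleton_eq_iff)
 then show "x = y & i = j"
 proof cases
  case 1
  then have "axis i (1::int) = axis j 1" by simp
  then show ?thesis using 1 by (simp add: axis_eq_axis)
 next
  case 2
  then have "axis j (1::int) + axis i 1 = 0" by (metis add.assoc add_cancel_left_right)
  then have "(axis j (1::int) + axis i 1) $ i = 0" by simp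
  then show ?thesis by (auto simp: axis_component split: if_splits)
 qed
qed auto

text \<open>Distance \<open>1\<close> between integer points leaves one coordinate that differs, by
  \<open>1\<close>, so an edge is a lower endpoint with a direction. By \<open>edge_inj\<close> this
  description is unique, and sums over edges become sums over sites and directions.\<close>

lemma edges_eq: "(edges :: ('d::finite) edge set) = (%(x, i). {x, x + axis i 1}) ` UNIV"
proof
 show "(edges :: 'd edge set) \<subseteq> (%(x, i). {x, x + axis i 1}) ` UNIV"
 proof
  fix e :: "'d edge" assume "e : edges"
  then obtain x y where e: "e = {x, y}" and s: "(SUM i:UNIV. \<bar>x $ i - y $ i\<bar>) = 1" by (auto simp: edges_def)
  obtain i where i: "x $ i ~= y $ i"
  proof (rule ccontr)
   assume "~ thesis"
   then have "x $ i = y $ i" for i using that by blast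
   then show False using s by simp
  qed
  have split: "\<bar>x $ i - y $ i\<bar> + (SUM j:UNIV - {i}. \<bar>x $ j - y $ j\<bar>) = 1"
   using s by (subst (asm) sum.remove[of UNIV i]) auto
  moreover have "(SUM j:UNIV - {i}. \<bar>x $ j - y $ j\<bar>) >= 0" by (intro sum_nonneg) auto
  ultimately have 1: "\<bar>x $ i - y $ i\<bar> = 1" and 0: "(SUM j:UNIV - {i}. \<bar>x $ j - y $ j\<bar>) = 0" using i by linarith+
  from 0 have rest: "x $ j = y $ j" if "j ~= i" for j
   using that by (subst (asm) sum_nonneg_eq_0_iff) auto
  from 1 have "y $ i = x $ i + 1 | x $ i = y $ i + 1" by linarith
  then have "y = x + axis i 1 | x = y + axis i 1"
   using rest by (auto simp: vec_eq_iff axis_component)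
  then show "e : (%(x, i). {x, x + axis i 1}) ` UNIV" by (auto simp: e image_iff insert_commute)
 qed
qed auto

lemma edgeE:
 assumes "e : edges" obtains x i where "e = {x, x + axis i 1}"
 using assms by (auto simp: edges_eq)

lemma inj_edge: "inj_on (%(x, i). {x, x + axis i (1::int)}) A"
 by (auto simp: inj_on_def edge_inj)

definition edge_spin :: "('d::finite) config => 'd edge => real" where
 "edge_spin sg e = (PROD x:e. sg x)"

lemma edge_spin_step: "edge_spin sg {x, x + axis i 1} = sg x * sg (x + axis i 1)"
 using step_neq(1)[of x i] by (simp add: edge_spin_def)

lemma edge_spin_sign:
 assumes "sg : space cfg" "e : edges" shows "edge_spin sg e : {-1, 1}"
proof -
 obtain x i where e: "e = {x, x + axis i 1}" using edgeE[OF assms(2)] .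
 have "sg x : {-1, 1}" "sg (x + axis i 1) : {-1, 1}" using assms(1) by auto
 then show ?thesis unfolding e edge_spin_step by auto
qed

lemma edge_spin_measurable [measurable]:
 "(%sg. edge_spin sg e) : bm (cfg :: ('d::finite) config measure)"
 unfolding edge_spin_def by (intro borel_measurable_prod spin_measurable)

definition cube_edges :: "nat => ('d::finite) edge set" where
 "cube_edges n = edges_in (cube n)"

text \<open>The lower endpoints of those edges of the cube that have direction
  \<open>i\<close>.\<close>

definition half_cube :: "nat => 'd => ('d::finite) site set" where
 "half_cube n i = {x : cube n. x $ i < int n}"

lemma finite_edges_in [simp]: "finite \<Lambda> ==> finite (edges_in \<Lambda>)"
 unfolding edges_in_def by (rule finite_subset[of _ "Pow \<Lambda>"]) auto

lemma finite_cube_edges [simp]: "finite (cube_edges n)" by (simp add: cube_edges_def)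

lemma cube_edges_subset: "cube_edges n \<subseteq> edges" by (auto simp: cube_edges_def edges_in_def)

lemma cube_edges_eq: "(cube_edges n :: ('a::finite) edge set) = (%(x, i). {x, x + axis i 1}) ` (SIGMA x:cube n. {i. x $ i < int n})"
proof -
 have "x + axis i 1 : cube n \<longleftrightarrow> x $ i < int n" if x: "x : cube n" for x and i :: 'a
 proof
  assume "x + axis i 1 : cube n"
  then have "\<bar>(x + axis i 1) $ i\<bar> <= int n" unfolding mem_cube by blast
  then show "x $ i < int n" by (simp add: axis_component)
 next
  show "x $ i < int n ==> x + axis i 1 : cube n"
  proof -
   assume lt: "x $ i < int n"
   have "\<bar>(x + axis i 1) $ j\<bar> <= int n" for j
   proof -
    have "\<bar>x $ j\<bar> <= int n" using x by (simp add: mem_cube)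
    then show ?thesis using lt by (cases "j = i") (simp_all add: axis_component)
   qed
   then show ?thesis unfolding mem_cube by blast
  qed
 qed
 note step = this
 show ?thesis
 proof
  show "(cube_edges n :: 'a edge set) \<subseteq> (%(x, i). {x, x + axis i 1}) ` (SIGMA x:cube n. {i. x $ i < int n})"
  proof
   fix e :: "'a edge" assume e: "e : cube_edges n"
   then obtain x i where xi: "e = {x, x + axis i 1}" by (auto simp: cube_edges_def edges_in_def elim: edgeE)
   with e have "x : cube n" "x + axis i 1 : cube n" by (auto simp: cube_edges_def edges_in_def)
   with step[of x i] show "e : (%(x, i). {x, x + axis i 1}) ` (SIGMA x:cube n. {i. x $ i < int n})"
    unfolding xi by (intro image_eqI[of _ _ "(x, i)"]) auto
  qed
  show "(%(x, i). {x, x + axis i 1}) ` (SIGMA x:cube n. {i. x $ i < int n}) \<subseteq> (cube_edges n :: 'a edge set)"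
   using step by (auto simp: cube_edges_def edges_in_def)
 qed
qed

lemma sum_cube_edges:
 fixes g :: "('d::finite) edge => 'a::comm_monoid_add"
 shows "(SUM e:cube_edges n. g e) = (SUM i:UNIV. SUM x:half_cube n i. g {x, x + axis i 1})"
proof -
 have "(SUM e:cube_edges n. g e) = (\<Sum>(x, i)\<in>(SIGMA x:cube n. {i. x $ i < int n}). g {x, x + axis i 1})"
  unfolding cube_edges_eq by (subst sum.reindex[OF inj_edge]) (simp add: case_prod_beta comp_def)
 also have "... = (SUM x:cube n. \<Sum>i | x $ i < int n. g {x, x + axis i 1})"
  by (subst sum.Sigma) auto
 also have "... = (SUM i:UNIV. \<Sum>x | x : cube n & x $ i < int n. g {x, x + axis i 1})"
  using sum.swap_restrict[of "cube n" UNIV "%x i. g {x, x + axis i 1}" "%x i. x $ i < int n"] by simp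
 finally show ?thesis by (simp add: half_cube_def)
qed

lemma card_half_cube: "card (half_cube n i :: ('d::finite) site set) * (2 * n + 1) = 2 * n * card (cube n :: 'd site set)"
proof -
 have "half_cube n i = lattice_box (\<chi> j. - int n) (\<chi> j. if j = i then int n - 1 else int n)"
 proof (intro set_eqI)
  fix x :: "'d site"
  have "x : half_cube n i \<longleftrightarrow> (\<forall>j. (- int n <= x $ j & x $ j <= int n) & (j = i --> x $ j < int n))"
   by (auto simp: half_cube_def cube_def lattice_box_def)
  also have "... \<longleftrightarrow> (\<forall>j. - int n <= x $ j & x $ j <= (if j = i then int n - 1 else int n))"
   by (intro iff_allI) auto
  finally show "x : half_cube n i \<longleftrightarrow> x : lattice_box (\<chi> j. - int n) (\<chi> j. if j = i then int n - 1 else int n)"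
   by (simp add: lattice_box_def)
 qed
 then have "card (half_cube n i :: 'd site set) = (PROD j:UNIV. nat ((if j = i then int n - 1 else int n) + int n + 1))"
  by (simp add: card_lattice_box)
 also have "... = (PROD j:UNIV. if j = i then 2 * n else 2 * n + 1)"
  by (intro prod.cong) auto
 also have "... = 2 * n * (PROD j:UNIV - {i}. 2 * n + 1)"
  by (subst prod.remove[of UNIV i]) (auto intro!: prod.cong)
 also have "(PROD j:(UNIV - {i} :: 'd set). 2 * n + 1) * (2 * n + 1) = (PROD j:(UNIV :: 'd set). 2 * n + 1)"
  by (subst prod.remove[of UNIV i]) (auto simp: mult.commute)
 then have "2 * n * (PROD j:(UNIV - {i} :: 'd set). 2 * n + 1) * (2 * n + 1) = 2 * n * card (cube n :: 'd site set)"
  unfolding mult.assoc by (simp only: card_cube prod_constant)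
 finally show ?thesis .
qed

lemma half_cube_ratio:
 "(%n. real (card (half_cube n i :: ('d::finite) site set)) / real (card (cube n :: 'd site set))) ----> 1"
proof -
 have "real (card (half_cube n i :: 'd site set)) / real (card (cube n :: 'd site set)) = 2 * real n / (2 * real n + 1)" for n
 proof -
  have "real (card (half_cube n i :: 'd site set)) * (2 * real n + 1) = 2 * real n * real (card (cube n :: 'd site set))"
   using arg_cong[OF card_half_cube[of n i], of real] by (simp add: algebra_simps)
  moreover have "2 * real n + 1 > 0" by simp
  ultimately show ?thesis by (subst frac_eq_eq) auto
 qed
 moreover have "(%n. 2 * real n / (2 * real n + 1)) ----> 1" by real_asymp
 ultimately show ?thesis by simp
qed

lemma finite_half_cube [simp]: "finite (half_cube n i)" by (simp add: half_cube_def)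

text \<open>The overlap averages over edges inside a cube, the ergodic theorem over sites with all
  \<open>CARD('d)\<close> edges that leave them upward. The edges that stick out of the cube are a
  vanishing fraction, and there are asymptotically \<open>CARD('d)\<close> edges per site.\<close>

lemma edge_average_tendsto:
 fixes g :: "('d::finite) edge => real"
 assumes g: "!!e. e : edges ==> \<bar>g e\<bar> <= 1"
  and lim: "(%n. (SUM x:cube n. SUM i:UNIV. g {x, x + axis i 1}) / real (card (cube n :: 'd site set))) ----> L"
 shows "(%n. (SUM e:cube_edges n. g e) / real (card (cube_edges n :: 'd edge set))) ----> L / real CARD('d)"
proof -
 let ?c = "%n. real (card (cube n :: 'd site set))"
 let ?b = "%n i. real (card (half_cube n i :: 'd site set))"
 let ?err = "%n i. (SUM x:cube n - half_cube n i. g {x, x + axis i 1}) / ?c n"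
 have e0: "(%n. ?err n i) ----> 0" for i
 proof (rule Lim_null_comparison)
  show "\<forall>\<^sub>F n in sequentially. norm (?err n i) <= 1 - ?b n i / ?c n"
  proof (rule always_eventually, rule allI)
   fix n
   have sub: "half_cube n i \<subseteq> (cube n :: 'd site set)" by (auto simp: half_cube_def)
   have "\<bar>SUM x:cube n - half_cube n i. g {x, x + axis i 1}\<bar> <= (SUM x:(cube n - half_cube n i :: 'd site set). 1)"
    using g by (intro order_trans[OF sum_abs] sum_mono) auto
   also have "... = ?c n - ?b n i"
    using sub card_mono[OF finite_cube sub] by (simp add: card_Diff_subset of_nat_diff)
   finally have "\<bar>SUM x:cube n - half_cube n i. g {x, x + axis i 1}\<bar> / ?c n <= (?c n - ?b n i) / ?c n"
    by (intro divide_right_mono) auto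
   then show "norm (?err n i) <= 1 - ?b n i / ?c n" by (simp add: diff_divide_distrib)
  qed
  show "(%n. 1 - ?b n i / ?c n) ----> 0"
   using tendsto_diff[OF tendsto_const half_cube_ratio[of i], of 1] by simp
 qed
 have num: "(SUM e:cube_edges n. g e) / ?c n
  = (SUM x:cube n. SUM i:UNIV. g {x, x + axis i 1}) / ?c n - (SUM i:UNIV. ?err n i)" for n
 proof -
  have "(SUM x:half_cube n i. g {x, x + axis i 1})
    = (SUM x:cube n. g {x, x + axis i 1}) - (SUM x:cube n - half_cube n i. g {x, x + axis i 1})" for i
   by (subst sum_diff) (auto simp: half_cube_def)
  then show ?thesis
   unfolding sum_cube_edges
   by (subst sum.swap[of _ _ "cube n"]) (simp add: sum_subtractf sum_divide_distrib[symmetric] diff_divide_distrib)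
 qed
 have "(%n. (SUM e:cube_edges n. g e) / ?c n) ----> L - (SUM i:(UNIV :: 'd set). 0)"
  unfolding num by (intro tendsto_diff lim tendsto_sum e0)
 moreover have "(%n. real (card (cube_edges n :: 'd edge set)) / ?c n) ----> (SUM i:(UNIV :: 'd set). 1)"
 proof -
  have "real (card (cube_edges n :: 'd edge set)) / ?c n = (SUM i:UNIV. ?b n i / ?c n)" for n
   using sum_cube_edges[of "%_ :: 'd edge. 1 :: real" n] by (simp add: sum_divide_distrib)
  then show ?thesis by (simp only:) (intro tendsto_sum half_cube_ratio)
 qed
 ultimately have "(%n. ((SUM e:cube_edges n. g e) / ?c n) / (real (card (cube_edges n :: 'd edge set)) / ?c n)) ----> (L - (SUM i:(UNIV :: 'd set). 0)) / (SUM i:(UNIV :: 'd set). 1)"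
  by (intro tendsto_divide) auto
 then show ?thesis by simp
qed

section \<open>Overlaps in finite cubes\<close>

definition overlap_avg :: "nat => ('d::finite) config => 'd config => real" where
 "overlap_avg n sg sg' = (SUM e:cube_edges n. edge_spin sg e * edge_spin sg' e) / real (card (cube_edges n :: 'd edge set))"

lemma edge_overlap_eq: "edge_overlap sg sg' = lim (%n. overlap_avg n sg sg')"
 by (simp add: edge_overlap_def overlap_avg_def cube_edges_def cube_def edge_spin_def prod.distrib Let_def)

lemma overlap_avg_commute: "overlap_avg n sg sg' = overlap_avg n sg' sg"
 by (simp add: overlap_avg_def mult.commute)

lemma edge_overlap_commute: "edge_overlap sg sg' = edge_overlap sg' sg"
 by (simp add: edge_overlap_eq overlap_avg_commute[of _ sg])

lemma overlap_avg_measurable [measurable]: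
 "(%(sg, sg'). overlap_avg n sg sg') : bm (cfg **M (cfg :: ('d::finite) config measure))"
 unfolding overlap_avg_def by measurable

lemma edge_overlap_measurable [measurable]:
 "(%(sg, sg'). edge_overlap sg sg') : bm (cfg **M (cfg :: ('d::finite) config measure))"
 unfolding edge_overlap_eq case_prod_beta
 by (intro borel_measurable_lim_metric mcomp[OF _ overlap_avg_measurable[unfolded case_prod_beta]]) auto

lemma overlap_avg_bound:
 assumes "sg : space cfg" "sg' : space cfg"
 shows "\<bar>overlap_avg n sg sg'\<bar> <= 1"
proof -
 have "\<bar>SUM e:cube_edges n. edge_spin sg e * edge_spin sg' e\<bar> <= (SUM e:(cube_edges n :: 'a edge set). 1)"
 proof (rule order_trans[OF sum_abs sum_mono])
  fix e :: "'a edge" assume "e : cube_edges n"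
  then have "e : edges" using cube_edges_subset by auto
  from edge_spin_sign[OF assms(1) this] edge_spin_sign[OF assms(2) this]
  show "\<bar>edge_spin sg e * edge_spin sg' e\<bar> <= 1" by auto
 qed
 then show ?thesis by (simp add: overlap_avg_def abs_divide divide_le_eq)
qed

text \<open>Edge spins square to \<open>1\<close>. The cube of radius \<open>0\<close> has no edge,
  and its average is \<open>0\<close> by division by zero; this is why limits along cubes are later
  taken over \<open>Suc n\<close>.\<close>

lemma overlap_avg_self:
 assumes "sg : space cfg" "n > 0"
 shows "overlap_avg n sg sg = 1"
proof -
 have "edge_spin sg e * edge_spin sg e = 1" if "e : cube_edges n" for e
  using edge_spin_sign[OF assms(1), of e] subsetD[OF cube_edges_subset that] by auto
 moreover have "cube_edges n ~= ({} :: 'a edge set)"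
 proof -
  have "(0, i) : (SIGMA x:cube n. {i. x $ i < int n})" for i :: 'a using assms(2) by simp
  then show ?thesis unfolding cube_edges_eq by blast
 qed
 ultimately show ?thesis by (simp add: overlap_avg_def)
qed

section \<open>Joint laws and i.i.d. couplings\<close>

text \<open>The form of \<open>joint_law\<close> for an arbitrary second space;
  \<open>TM_limit\<close> uses it with random measures in place of replicas.\<close>

definition kprod :: "'a measure => ('a => 'b measure) => 'b measure => ('a \<times> 'b) measure" where
 "kprod nu K N = do { J \<leftarrow> nu; sg \<leftarrow> K J; return (nu **M N) (J, sg) }"

lemma joint_law_eq_kprod: "joint_law nu K = kprod nu K (replicas cfg)"
 by (simp add: joint_law_def kprod_def)

lemma kprod:
 assumes nu: "prob_space nu" and K: "K : nu ->M prob_algebra N"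
 shows sets_kprod: "sets (kprod nu K N) = sets (nu **M N)"
  and prob_space_kprod: "prob_space (kprod nu K N)"
  and integral_kprod: "!!f B. f : bm (nu **M N) ==> (!!z. z : space (nu **M N) ==> \<bar>f z\<bar> <= (B::real)) ==>
   (LINT z|kprod nu K N. f z) = (LINT J|nu. (LINT sg|K J. f (J, sg)))"
  and AE_kprod: "!!P. Measurable.pred (nu **M N) P ==>
   (AE z in kprod nu K N. P z) \<longleftrightarrow> (AE J in nu. AE sg in K J. P (J, sg))"
proof -
 let ?S = "nu **M N"
 interpret nu: prob_space nu by fact
 note K[measurable]
 define L where "L J = K J \<bind> (%sg. return ?S (J, sg))" for J
 have KJ: "prob_space (K J)" "sets (K J) = sets N" if "J : space nu" for J
  using measurable_space[OF K that] by (auto simp: space_prob_algebra)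
 have Pm: "(%sg. (J, sg)) : K J ->M ?S" if "J : space nu" for J
  using measurable_Pair1'[OF that, of N] measurable_cong_sets[OF KJ(2)[OF that] refl, of ?S] by blast
 have L: "L J = distr (K J) ?S (%sg. (J, sg))" if "J : space nu" for J
  unfolding L_def using prob_space.not_empty[OF KJ(1)[OF that]] Pm[OF that]
  by (intro bind_return_distr') auto
 have Lm: "L : nu ->M prob_algebra ?S"
  unfolding L_def by (rule measurable_bind_prob_space2[OF K]) measurable
 have J: "kprod nu K N = nu \<bind> L" by (simp add: kprod_def L_def[abs_def])
 have nup: "nu : space (prob_algebra nu)" by (simp add: space_prob_algebra nu)
 show "sets (kprod nu K N) = sets ?S" unfolding J by (rule sets_bind'[OF nup Lm])
 show "prob_space (kprod nu K N)" unfolding J by (rule prob_space_bind'[OF nup Lm])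
 have Ls: "L : nu ->M subprob_algebra ?S" by (rule measurable_prob_algebraD[OF Lm])
 show "(LINT z|kprod nu K N. f z) = (LINT J|nu. (LINT sg|K J. f (J, sg)))"
  if f: "f : bm ?S" and B: "!!z. z : space ?S ==> \<bar>f z\<bar> <= B" for f :: "_ => real" and B
 proof -
  have "(LINT z|kprod nu K N. f z) = (LINT J|nu. (LINT z|L J. f z))"
   unfolding J
  proof (rule integral_bind[OF f _ Ls nu.finite_measure_axioms, where B' = 1])
   show "AE J in nu. emeasure (L J) (space (L J)) <= ennreal 1"
    using measurable_space[OF Lm] by (intro AE_I2) (auto simp: space_prob_algebra prob_space.emeasure_space_1)
  qed (rule B)
  also have "... = (LINT J|nu. (LINT sg|K J. f (J, sg)))"
   by (intro integral_cong refl) (simp add: L integral_distr[OF Pm f])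
  finally show ?thesis .
 qed
 show "(AE z in kprod nu K N. P z) \<longleftrightarrow> (AE J in nu. AE sg in K J. P (J, sg))"
  if P: "Measurable.pred ?S P" for P
 proof -
  have "(AE z in kprod nu K N. P z) \<longleftrightarrow> (AE J in nu. AE z in L J. P z)"
   unfolding J by (rule AE_bind[OF Ls P])
  also have "... \<longleftrightarrow> (AE J in nu. AE sg in K J. P (J, sg))"
  proof (rule AE_cong)
   fix J assume J: "J : space nu"
   show "(AE z in L J. P z) \<longleftrightarrow> (AE sg in K J. P (J, sg))"
    unfolding L[OF J] using P by (subst AE_distr_iff[OF Pm[OF J]]) auto
  qed
  finally show ?thesis .
 qed
qed

lemma joint_law:
 assumes nu: "prob_space nu" and K: "K : nu ->M prob_algebra (replicas cfg)"
 shows sets_joint_law: "sets (joint_law nu K) = sets (nu **M replicas cfg)"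
  and prob_space_joint_law: "prob_space (joint_law nu K)"
  and integral_joint_law: "!!f B. f : bm (nu **M replicas cfg) ==> (!!z. \<bar>f z\<bar> <= (B::real)) ==>
   (LINT z|joint_law nu K. f z) = (LINT J|nu. (LINT sg|K J. f (J, sg)))"
  and AE_joint_law: "!!P. Measurable.pred (nu **M replicas cfg) P ==>
   (AE z in joint_law nu K. P z) \<longleftrightarrow> (AE J in nu. AE sg in K J. P (J, sg))"
 unfolding joint_law_eq_kprod
 using sets_kprod[OF assms] prob_space_kprod[OF assms] integral_kprod[OF assms] AE_kprod[OF assms]
 by blast+

locale coupling =
 fixes \<rho> :: "real measure" and dim :: "'d::finite itself"
 assumes \<rho>: "real_distribution \<rho>"
begin

definition nu :: "('d edge => real) measure" where "nu = coupling_law \<rho>"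

lemma sets_\<rho> [measurable_cong]: "sets \<rho> = sets borel"
 using \<rho> by (simp add: real_distribution.events_eq_borel)

lemma prob_\<rho>: "prob_space \<rho>" using \<rho> by (simp add: real_distribution_def)

lemma prob_nu: "prob_space nu"
 unfolding nu_def coupling_law_def by (intro prob_space_PiM prob_\<rho>)

sublocale nu: prob_space nu by (rule prob_nu)

lemma sets_nu [measurable_cong]: "sets nu = sets (PiM edges (%_. borel))"
 unfolding nu_def coupling_law_def by (intro sets_PiM_cong refl sets_\<rho>)

lemma space_nu: "space nu = extensional edges"
 using space_eqI[OF sets_nu] by (simp add: space_PiM PiE_UNIV_domain PiE_def)

lemma coupling_measurable [measurable]: "e : edges ==> (%J. J e) : bm nu"
 by (subst mcs[OF sets_nu]) measurable

lemma indep_couplings: "nu.indep_vars (%_. borel) (%e J. J e) edges"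
proof -
 have "distr nu (PiM edges (%_. borel)) (%J. \<lambda>e\<in>edges. J e) = distr nu nu (%J. J)"
 proof (rule distr_cong)
  show "sets (PiM edges (%_. borel)) = sets nu" by (simp add: sets_nu)
  show "(\<lambda>e\<in>edges. J e) = J" if "J : space nu" for J
   using that by (simp add: space_nu extensional_restrict)
 qed simp
 also have "... = PiM edges (%e. \<rho>)" by (simp add: distr_id nu_def coupling_law_def)
 also have "... = PiM edges (%e. distr nu borel (%J. J e))"
 proof (rule PiM_cong[OF refl])
  fix e :: "'d edge" assume "e : edges"
  then have "distr nu \<rho> (%J. J e) = \<rho>"
   unfolding nu_def coupling_law_def by (intro distr_PiM_component prob_\<rho>)
  moreover have "distr nu borel (%J. J e) = distr nu \<rho> (%J. J e)"
   by (intro distr_cong) (auto simp: sets_\<rho>)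
  ultimately show "\<rho> = distr nu borel (%J. J e)" by simp
 qed
 finally have "distr nu (PiM edges (%_. borel)) (%J. \<lambda>e\<in>edges. J e) = PiM edges (%e. distr nu borel (%J. J e))" .
 moreover have "(edges :: 'd edge set) ~= {}" using step_edge by blast
 ultimately show ?thesis
  using nu.indep_vars_iff_distr_eq_PiM'[of "edges :: 'd edge set" "%e J. J e" "%_. borel", OF _ coupling_measurable]
  by simp
qed

lemma integral_indep_couplings:
 fixes f g :: "('d edge => real) => real"
 assumes AB: "A \<inter> B = {}" "A \<subseteq> edges" "B \<subseteq> edges"
  and f: "f : bm (PiM A (%_. borel))" "!!J. \<bar>f J\<bar> <= C"
  and g: "g : bm (PiM B (%_. borel))" "!!J. \<bar>g J\<bar> <= D"
 shows "(LINT J|nu. f (restrict J A) * g (restrict J B)) = (LINT J|nu. f (restrict J A)) * (LINT J|nu. g (restrict J B))"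
proof -
 have iv: "nu.indep_var (PiM A (%_. borel)) (%J. restrict J A) (PiM B (%_. borel)) (%J. restrict J B)"
  using nu.indep_var_restrict[OF indep_couplings AB] by (simp add: restrict_def)
 have [measurable]: "(%J. restrict J A) : nu ->M PiM A (%_. borel)" "(%J. restrict J B) : nu ->M PiM B (%_. borel)"
  using iv by (auto simp: nu.indep_var_eq)
 note f(1)[measurable] g(1)[measurable]
 have "nu.indep_var borel (f \<circ> (%J. restrict J A)) borel (g \<circ> (%J. restrict J B))"
  by (rule nu.indep_var_compose[OF iv f(1) g(1)])
 moreover have "integrable nu (%J. f (restrict J A))" "integrable nu (%J. g (restrict J B))"
  by (rule nu.integrable_const_bound[where B = C], use f(2) in simp, measurable)
   (rule nu.integrable_const_bound[where B = D], use g(2) in simp, measurable)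
 ultimately show ?thesis
  using nu.indep_var_lebesgue_integral[of "%J. f (restrict J A)" "%J. g (restrict J B)"] by (simp add: comp_def)
qed

lemma distr_permute_couplings:
 assumes p: "bij_betw p edges edges"
 shows "distr nu nu (%J. \<lambda>e\<in>edges. J (p e)) = nu"
 using distr_PiM_reindex[of edges "%_. \<rho>" p edges] prob_\<rho> p
 by (auto simp: nu_def coupling_law_def bij_betw_def)

end

section \<open>Gibbs measures in a box: periodicity and fixed couplings\<close>

text \<open>The factor that one replica contributes to the indicator of \<open>cyl\<close>.\<close>

definition up :: "('d::finite) site set => 'd config => real" where
 "up D sg = (if \<forall>x\<in>D. sg x = 1 then 1 else 0)"

lemma up_bounds: "0 <= up D sg" "up D sg <= 1" by (auto simp: up_def)

lemma up_measurable [measurable]: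
 assumes "finite D" shows "up D : bm (cfg :: ('d::finite) config measure)"
proof -
 have "up D sg = (PROD x:D. if sg x = 1 then 1 else 0)" for sg
 proof (cases "\<forall>x\<in>D. sg x = 1")
  case False
  then obtain x where x: "x : D" "sg x ~= 1" by auto
  then have "(PROD x:D. if sg x = 1 then 1 else 0) = (0 :: real)"
   using assms by (intro prod_zero bexI[of _ x]) auto
  then show ?thesis using False unfolding up_def by simp
 qed (simp add: up_def)
 then have "up D = (%sg. PROD x:D. if sg x = 1 then 1 else 0)" by (simp add: fun_eq_iff)
 moreover have "(%sg. PROD x:D. if sg x = 1 then 1 else 0 :: real) : bm cfg"
  by measurable
 ultimately show ?thesis by simp
qed

definition box_ext :: "('d::finite) site => 'd site => 'd config => 'd config" where
 "box_ext a b sg = (%x. if x : lattice_box a b then sg x else 1)"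

lemma finite_box_configs [simp]: "finite (lattice_box a b \<rightarrow>\<^sub>E {-1, 1 :: real})"
 by (intro finite_PiE) auto

lemma box_configs_nonempty: "lattice_box a b \<rightarrow>\<^sub>E {-1, 1 :: real} ~= {}"
 by (simp add: PiE_eq_empty_iff)

lemma partition_pos: "partition_function a b \<beta> J > 0"
 unfolding partition_function_def using box_configs_nonempty by (intro sum_pos) auto

lemma box_ext_space: "sg : lattice_box a b \<rightarrow>\<^sub>E {-1, 1} ==> box_ext a b sg : space cfg"
 by (auto simp: box_ext_def PiE_iff)

lemma box_ext_measurable: "box_ext a b : gibbs a b \<beta> J ->M cfg"
proof -
 have "sets (gibbs a b \<beta> J) = sets (count_space (lattice_box a b \<rightarrow>\<^sub>E {-1, 1}))"
  by (simp add: gibbs_def sets_point_measure)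
 moreover have "box_ext a b : count_space (lattice_box a b \<rightarrow>\<^sub>E {-1, 1}) ->M cfg"
  using box_ext_space[of _ a b] by (simp add: measurable_count_space_eq1 Pi_iff del: space_config)
 ultimately show ?thesis using measurable_cong_sets by blast
qed

lemma gibbs_ext_eq: "gibbs_ext a b \<beta> J = distr (gibbs a b \<beta> J) cfg (box_ext a b)"
 by (simp add: gibbs_ext_def box_ext_def[abs_def])

lemma sets_gibbs_ext [simp]: "sets (gibbs_ext a b \<beta> J) = sets cfg"
 by (simp add: gibbs_ext_eq)

lemma emeasure_gibbs_ext:
 assumes B: "B : sets cfg"
 shows "emeasure (gibbs_ext a b \<beta> J) B = (SUM sg:lattice_box a b \<rightarrow>\<^sub>E {-1, 1}.
  ennreal (exp (- \<beta> * hamiltonian a b J sg) / partition_function a b \<beta> J) * indicator B (box_ext a b sg))"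
proof -
 have "emeasure (gibbs_ext a b \<beta> J) B = (\<integral>\<^sup>+sg. indicator B sg \<partial>gibbs_ext a b \<beta> J)"
  using B by simp
 also have "... = (\<integral>\<^sup>+sg. indicator B (box_ext a b sg) \<partial>gibbs a b \<beta> J)"
  unfolding gibbs_ext_eq using B by (subst nn_integral_distr[OF box_ext_measurable]) auto
 also have "... = (SUM sg:lattice_box a b \<rightarrow>\<^sub>E {-1, 1}.
  ennreal (exp (- \<beta> * hamiltonian a b J sg) / partition_function a b \<beta> J) * indicator B (box_ext a b sg))"
  unfolding gibbs_def by (subst nn_integral_point_measure_finite) auto
 finally show ?thesis .
qed

lemma prob_space_gibbs_ext: "prob_space (gibbs_ext a b \<beta> J)"
proof (rule prob_spaceI)
 have "emeasure (gibbs_ext a b \<beta> J) (space (gibbs_ext a b \<beta> J)) = emeasure (gibbs_ext a b \<beta> J) (space cfg)"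
  by (simp add: gibbs_ext_eq)
 also have "... = (SUM sg:lattice_box a b \<rightarrow>\<^sub>E {-1, 1}.
  ennreal (exp (- \<beta> * hamiltonian a b J sg) / partition_function a b \<beta> J))"
  unfolding emeasure_gibbs_ext[OF sets.top]
 proof (intro sum.cong refl)
  fix sg :: "'a config" assume "sg : lattice_box a b \<rightarrow>\<^sub>E {-1, 1}"
  from box_ext_space[OF this] show "ennreal (exp (- \<beta> * hamiltonian a b J sg) / partition_function a b \<beta> J) * indicator (space cfg) (box_ext a b sg)
   = ennreal (exp (- \<beta> * hamiltonian a b J sg) / partition_function a b \<beta> J)"
   by (simp only: indicator_simps mult_1_right)
 qed
 also have "... = ennreal (SUM sg:lattice_box a b \<rightarrow>\<^sub>E {-1, 1}. exp (- \<beta> * hamiltonian a b J sg) / partition_function a b \<beta> J)"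
  using partition_pos[of a b \<beta> J] by (intro sum_ennreal divide_nonneg_pos) auto
 also have "(SUM sg:lattice_box a b \<rightarrow>\<^sub>E {-1, 1}. exp (- \<beta> * hamiltonian a b J sg) / partition_function a b \<beta> J) = 1"
  using partition_pos[of a b \<beta> J] by (simp add: sum_divide_distrib[symmetric] partition_function_def)
 finally show "emeasure (gibbs_ext a b \<beta> J) (space (gibbs_ext a b \<beta> J)) = 1" by simp
qed

lemma integral_gibbs_ext:
 assumes f: "f : bm cfg"
 shows "(LINT sg|gibbs_ext a b \<beta> J. (f sg :: real)) = (SUM sg:lattice_box a b \<rightarrow>\<^sub>E {-1, 1}.
  f (box_ext a b sg) * exp (- \<beta> * hamiltonian a b J sg)) / partition_function a b \<beta> J"
proof -
 have "(LINT sg|gibbs_ext a b \<beta> J. f sg) = (LINT sg|gibbs a b \<beta> J. f (box_ext a b sg))"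
  unfolding gibbs_ext_eq by (rule integral_distr[OF box_ext_measurable f])
 also have "... = (SUM sg:lattice_box a b \<rightarrow>\<^sub>E {-1, 1}.
  exp (- \<beta> * hamiltonian a b J sg) / partition_function a b \<beta> J * f (box_ext a b sg))"
  unfolding gibbs_def using partition_pos[of a b \<beta> J]
  by (subst lebesgue_integral_point_measure_finite) (auto intro!: divide_nonneg_pos)
 finally show ?thesis by (simp add: sum_divide_distrib mult.commute)
qed

lemma hamiltonian_measurable [measurable]:
 "(%J. hamiltonian a b J sg) : bm (PiM edges (%_. borel))"
 unfolding hamiltonian_def by measurable

lemma gibbs_ext_kernel: "gibbs_ext a b \<beta> : PiM edges (%_. borel) ->M prob_algebra cfg"
proof (rule measurable_prob_algebraI[OF prob_space_gibbs_ext measurable_subprob_algebra])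
 show "subprob_space (gibbs_ext a b \<beta> J)" for J
  using prob_space_gibbs_ext by (rule prob_space_imp_subprob_space)
 fix B assume "B : sets (cfg :: 'a config measure)"
 moreover have "(%J. SUM sg:lattice_box a b \<rightarrow>\<^sub>E {-1, 1}.
  ennreal (exp (- \<beta> * hamiltonian a b J sg) / partition_function a b \<beta> J) * indicator B (box_ext a b sg)) : bm (PiM edges (%_. borel))"
  unfolding partition_function_def by measurable
 ultimately show "(%J. emeasure (gibbs_ext a b \<beta> J) B) : bm (PiM edges (%_. borel))"
  by (simp add: emeasure_gibbs_ext)
qed simp

lemma torus_step_mem: "x : lattice_box a b ==> torus_step a b i x : lattice_box a b"
proof -
 assume x: "x : lattice_box a b"
 have "a $ j <= torus_step a b i x $ j & torus_step a b i x $ j <= b $ j" for j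
 proof -
  have "a $ j <= x $ j" "x $ j <= b $ j" using x by (auto simp: lattice_box_def)
  then show ?thesis by (auto simp: torus_step_def)
 qed
 then show ?thesis by (simp add: lattice_box_def)
qed

lemma torus_step_inj: "inj_on (torus_step a b i) (lattice_box a b)"
proof (rule inj_onI)
 fix x y assume x: "x : lattice_box a b" and y: "y : lattice_box a b" and eq: "torus_step a b i x = torus_step a b i y"
 have "x $ j = y $ j" for j
 proof (cases "j = i")
  case True
  have "(if x $ i = b $ i then a $ i else x $ i + 1) = (if y $ i = b $ i then a $ i else y $ i + 1)"
   using arg_cong[OF eq, of "%v. v $ i"] by (simp add: torus_step_def)
  moreover have "a $ i <= x $ i" "a $ i <= y $ i" using x y by (auto simp: lattice_box_def)
  ultimately show ?thesis using True by (auto split: if_splits)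
 next
  case False
  then show ?thesis using arg_cong[OF eq, of "%v. v $ j"] by (simp add: torus_step_def)
 qed
 then show "x = y" by (simp add: vec_eq_iff)
qed

lemma torus_step_image: "torus_step a b i ` lattice_box a b = lattice_box a b"
 by (rule endo_inj_surj[OF finite_lattice_box _ torus_step_inj]) (auto intro: torus_step_mem)

lemma torus_step_commute: "torus_step a b i (torus_step a b j x) = torus_step a b j (torus_step a b i x)"
 by (auto simp: torus_step_def vec_eq_iff)

lemma torus_step_shift:
 assumes "x + axis i 1 : lattice_box a b" shows "torus_step a b i x = x + axis i 1"
proof -
 have "x $ i + 1 <= b $ i" using assms by (auto simp: lattice_box_def axis_component dest!: spec[of _ i])
 then show ?thesis by (auto simp: torus_step_def vec_eq_iff axis_component)
qed

text \<open>The step on the torus, extended by the identity outside the box to a bijection of the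
  whole lattice, so that it induces a permutation of all edges.\<close>

definition torus_site :: "('d::finite) site => 'd site => 'd => 'd site => 'd site" where
 "torus_site a b j x = (if x : lattice_box a b then torus_step a b j x else x)"

lemma bij_torus_site: "bij (torus_site a b j)"
proof (rule bijI)
 show "inj (torus_site a b j)"
 proof (rule injI)
  fix x y assume "torus_site a b j x = torus_site a b j y"
  then show "x = y"
   using inj_onD[OF torus_step_inj[of a b j], of x y] torus_step_mem[of x a b j] torus_step_mem[of y a b j]
   by (cases "x : lattice_box a b"; cases "y : lattice_box a b") (auto simp: torus_site_def)
 qed
 have "y : range (torus_site a b j)" for y
 proof (cases "y : lattice_box a b")
  case True
  then obtain x where "x : lattice_box a b" "y = torus_step a b j x"
   using torus_step_image[of a b j] by (metis imageE)
  then show ?thesis by (intro range_eqI[of _ _ x]) (simp add: torus_site_def)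
 next
  case False
  then show ?thesis by (intro range_eqI[of _ _ y]) (simp add: torus_site_def)
 qed
 then show "surj (torus_site a b j)" by blast
qed

text \<open>An edge moves with its lower endpoint and keeps its direction. This is not the image of
  the edge as a set: in \<open>hamiltonian\<close> a wrap-around edge carries the coupling of the
  lattice edge that sticks out of the box.\<close>

definition torus_edge :: "('d::finite) site => 'd site => 'd => 'd edge => 'd edge" where
 "torus_edge a b j e = (case inv (%(x, i). {x, x + axis i 1}) e of (x, i) =>
  {torus_site a b j x, torus_site a b j x + axis i 1})"

lemma torus_edge_step: "torus_edge a b j {x, x + axis i 1} = {torus_site a b j x, torus_site a b j x + axis i 1}"
 using inv_f_f[OF inj_edge[of UNIV], of "(x, i)"] by (simp add: torus_edge_def)

lemma bij_torus_edge: "bij_betw (torus_edge a b j) edges edges"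
proof (rule bij_betw_imageI)
 show "inj_on (torus_edge a b j) edges"
 proof (rule inj_onI)
  fix e e' :: "'a edge" assume "e : edges" "e' : edges" and eq: "torus_edge a b j e = torus_edge a b j e'"
  then obtain x i y k where e: "e = {x, x + axis i 1}" "e' = {y, y + axis k 1}" by (metis edgeE)
  have "torus_site a b j x = torus_site a b j y & i = k"
   using eq unfolding e torus_edge_step edge_inj .
  then show "e = e'" using bij_is_inj[OF bij_torus_site[of a b j]] by (auto simp: e dest: injD)
 qed
 show "torus_edge a b j ` edges = edges"
 proof
  show "torus_edge a b j ` edges \<subseteq> edges" by (auto elim!: edgeE simp: torus_edge_step)
  show "edges \<subseteq> torus_edge a b j ` edges"
  proof
   fix e :: "'a edge" assume "e : edges"
   then obtain x i where e: "e = {x, x + axis i 1}" by (rule edgeE)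
   obtain y where "x = torus_site a b j y" using bij_is_surj[OF bij_torus_site] by (metis surjE)
   then have "e = torus_edge a b j {y, y + axis i 1}" by (simp add: e torus_edge_step)
   then show "e : torus_edge a b j ` edges" by simp
  qed
 qed
qed

definition torus_config :: "('d::finite) site => 'd site => 'd => 'd config => 'd config" where
 "torus_config a b j sg = (\<lambda>x\<in>lattice_box a b. sg (torus_step a b j x))"

lemma bij_torus_config: "bij_betw (torus_config a b j) (lattice_box a b \<rightarrow>\<^sub>E {-1, 1}) (lattice_box a b \<rightarrow>\<^sub>E {-1, 1})"
proof -
 let ?X = "lattice_box a b \<rightarrow>\<^sub>E {-1, 1 :: real}"
 have inj: "inj_on (torus_config a b j) ?X"
 proof (rule inj_onI)
  fix sg ta assume s: "sg : ?X" and t: "ta : ?X" and eq: "torus_config a b j sg = torus_config a b j ta"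
  show "sg = ta"
  proof (rule PiE_ext[OF s t])
   fix y assume "y : lattice_box a b"
   then obtain x where x: "x : lattice_box a b" "y = torus_step a b j x"
    using torus_step_image[of a b j] by (metis imageE)
   show "sg y = ta y" using fun_cong[OF eq, of x] x by (simp add: torus_config_def)
  qed
 qed
 have sub: "torus_config a b j ` ?X \<subseteq> ?X"
 proof (rule image_subsetI)
  fix sg assume "sg : ?X"
  then have "sg (torus_step a b j x) : {-1, 1}" if "x : lattice_box a b" for x
   using torus_step_mem[OF that, of j] by (auto simp only: PiE_iff)
  then show "torus_config a b j sg : ?X" by (auto simp: torus_config_def)
 qed
 show ?thesis using endo_inj_surj[OF finite_box_configs sub inj] inj by (simp add: bij_betw_def)
qed

text \<open>Periodic boundary conditions make the box homogeneous: the sum over sites is reindexed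
  along the bijection \<open>torus_step\<close> in direction \<open>j\<close>, which commutes with
  the steps in all directions.\<close>

lemma hamiltonian_torus:
 "hamiltonian a b (\<lambda>e\<in>edges. J (torus_edge a b j e)) (torus_config a b j sg) = hamiltonian a b J sg"
proof -
 let ?L = "lattice_box a b" and ?s = "torus_step a b j"
 have "(SUM x:?L. SUM i:UNIV. (\<lambda>e\<in>edges. J (torus_edge a b j e)) {x, x + axis i 1} * torus_config a b j sg x * torus_config a b j sg (torus_step a b i x))
  = (SUM x:?L. SUM i:UNIV. J {?s x, ?s x + axis i 1} * sg (?s x) * sg (torus_step a b i (?s x)))"
 proof (intro sum.cong refl)
  fix x i assume x: "x : ?L"
  have "torus_config a b j sg (torus_step a b i x) = sg (torus_step a b i (?s x))"
   using torus_step_mem[OF x, of i] by (simp add: torus_config_def torus_step_commute)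
  then show "(\<lambda>e\<in>edges. J (torus_edge a b j e)) {x, x + axis i 1} * torus_config a b j sg x * torus_config a b j sg (torus_step a b i x)
   = J {?s x, ?s x + axis i 1} * sg (?s x) * sg (torus_step a b i (?s x))"
   using x by (simp add: torus_edge_step torus_site_def torus_config_def)
 qed
 also have "... = (SUM x:?s ` ?L. SUM i:UNIV. J {x, x + axis i 1} * sg x * sg (torus_step a b i x))"
  by (subst sum.reindex[OF torus_step_inj]) simp
 finally show ?thesis by (simp add: hamiltonian_def torus_step_image)
qed

lemma gibbs_torus:
 assumes D: "finite D" "D \<subseteq> lattice_box a b"
 shows "(LINT sg|gibbs_ext a b \<beta> (\<lambda>e\<in>edges. J (torus_edge a b j e)). up D sg)
  = (LINT sg|gibbs_ext a b \<beta> J. up (torus_step a b j ` D) sg)"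
proof -
 let ?J = "\<lambda>e\<in>edges. J (torus_edge a b j e)" and ?X = "lattice_box a b \<rightarrow>\<^sub>E {-1, 1 :: real}"
 have Z: "partition_function a b \<beta> ?J = partition_function a b \<beta> J"
  unfolding partition_function_def
  by (subst sum.reindex_bij_betw[OF bij_torus_config[of a b j], symmetric]) (simp only: hamiltonian_torus)
 have u: "up D (box_ext a b (torus_config a b j sg)) = up (torus_step a b j ` D) (box_ext a b sg)" for sg
  using D torus_step_mem[of _ a b j] by (auto simp: up_def box_ext_def torus_config_def subset_iff)
 have "(SUM sg:?X. up D (box_ext a b sg) * exp (- \<beta> * hamiltonian a b ?J sg))
  = (SUM sg:?X. up (torus_step a b j ` D) (box_ext a b sg) * exp (- \<beta> * hamiltonian a b J sg))"
  by (subst sum.reindex_bij_betw[OF bij_torus_config[of a b j], symmetric]) (simp only: hamiltonian_torus u)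
 then show ?thesis using D by (simp add: integral_gibbs_ext Z)
qed

definition override :: "('d::finite) edge set => ('d edge => real) => ('d edge => real) => 'd edge => real" where
 "override A k J e = (if e : A then k e else J e)"

text \<open>The Hamiltonian is linear in the couplings, and for an edge with both endpoints in the
  box the torus step from the lower endpoint is the lattice step.\<close>

lemma hamiltonian_override:
 assumes A: "A \<subseteq> edges_in (lattice_box a b)"
 shows "hamiltonian a b (override A k J) sg
  = hamiltonian a b J sg - (SUM e:A. (k e - J e) * edge_spin (box_ext a b sg) e)"
proof -
 let ?L = "lattice_box a b" and ?E = "%(x, i). {x, x + axis i (1::int)}"
 define S where "S = {(x, i). x : ?L & {x, x + axis i 1} : A}"
 have "finite (?L \<times> (UNIV :: 'a set))" by simp
 then have fS: "finite S" by (rule finite_subset[rotated]) (auto simp: S_def)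
 have inA: "x : ?L & x + axis i 1 : ?L" if "{x, x + axis i 1} : A" for x i
  using that A by (auto simp: edges_in_def)
 have AS: "A = ?E ` S"
 proof
  show "A \<subseteq> ?E ` S"
  proof
   fix e assume e: "e : A"
   then obtain x i where "e = {x, x + axis i 1}" using A by (auto simp: edges_in_def elim!: edgeE dest!: subsetD)
   then show "e : ?E ` S" using e inA by (intro image_eqI[of _ _ "(x, i)"]) (auto simp: S_def)
  qed
 qed (auto simp: S_def)
 have d: "override A k J {x, x + axis i 1} * sg x * sg (torus_step a b i x)
  = J {x, x + axis i 1} * sg x * sg (torus_step a b i x)
  + (if {x, x + axis i 1} : A then (k {x, x + axis i 1} - J {x, x + axis i 1}) * edge_spin (box_ext a b sg) {x, x + axis i 1} else 0)"
  if "x : ?L" for x i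
  using inA[of x i] torus_step_shift[of x i a b]
  by (auto simp: override_def edge_spin_step box_ext_def algebra_simps)
 have "(SUM x:?L. SUM i:UNIV. if {x, x + axis i 1} : A then (k {x, x + axis i 1} - J {x, x + axis i 1}) * edge_spin (box_ext a b sg) {x, x + axis i 1} else 0)
  = (\<Sum>(x, i)\<in>?L \<times> UNIV. if {x, x + axis i 1} : A then (k {x, x + axis i 1} - J {x, x + axis i 1}) * edge_spin (box_ext a b sg) {x, x + axis i 1} else 0)"
  by (simp add: sum.cartesian_product)
 also have "... = (\<Sum>(x, i)\<in>S. (k {x, x + axis i 1} - J {x, x + axis i 1}) * edge_spin (box_ext a b sg) {x, x + axis i 1})"
  by (rule sum.mono_neutral_cong_right) (auto simp: S_def split: if_splits)
 also have "... = (SUM e:A. (k e - J e) * edge_spin (box_ext a b sg) e)"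
  unfolding AS by (subst sum.reindex[OF inj_edge]) (simp add: case_prod_beta comp_def)
 finally show ?thesis
  by (simp add: hamiltonian_def d sum.distrib cong: sum.cong)
qed

text \<open>The weight moves the couplings on \<open>A\<close> from \<open>J\<close> to
  \<open>k\<close>. The right-hand side does not depend on \<open>J\<close> on \<open>A\<close>;
  this independence is what is carried over to infinite volume.\<close>

lemma gibbs_override:
 assumes A: "A \<subseteq> edges_in (lattice_box a b)" and f: "f : bm cfg"
 shows "(LINT sg|gibbs_ext a b \<beta> J. f sg * exp (\<beta> * (SUM e:A. (k e - J e) * edge_spin sg e)))
  / (LINT sg|gibbs_ext a b \<beta> J. exp (\<beta> * (SUM e:A. (k e - J e) * edge_spin sg e)))
  = (LINT sg|gibbs_ext a b \<beta> (override A k J). (f sg :: real))"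
proof -
 let ?w = "%sg. exp (\<beta> * (SUM e:A. (k e - J e) * edge_spin sg e))"
 have w: "exp (- \<beta> * hamiltonian a b (override A k J) sg) = ?w (box_ext a b sg) * exp (- \<beta> * hamiltonian a b J sg)" for sg
  unfolding hamiltonian_override[OF A] by (simp add: exp_add[symmetric] algebra_simps)
 have wm: "?w : bm cfg" by measurable
 have 1: "(LINT sg|gibbs_ext a b \<beta> J. ?w sg) = partition_function a b \<beta> (override A k J) / partition_function a b \<beta> J"
  unfolding integral_gibbs_ext[OF wm] partition_function_def[of a b \<beta> "override A k J"] w ..
 have 2: "(LINT sg|gibbs_ext a b \<beta> J. f sg * ?w sg) = (SUM sg:lattice_box a b \<rightarrow>\<^sub>E {-1, 1}.
  f (box_ext a b sg) * exp (- \<beta> * hamiltonian a b (override A k J) sg)) / partition_function a b \<beta> J"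
  using f wm by (subst integral_gibbs_ext) (auto simp only: w mult.assoc borel_measurable_times)
 show ?thesis
  unfolding 1 2 integral_gibbs_ext[OF f]
  using partition_pos[of a b \<beta> J] by simp
qed

section \<open>Metastates\<close>

lemma replicas_kernel: "(%m. replicas m) : prob_algebra X ->M prob_algebra (replicas X)"
 by (rule measurable_PiM_kernel)

lemma bind_replicas:
 assumes P: "P : space (prob_algebra (prob_algebra X))"
 shows sets_bind_replicas: "sets (P \<bind> (%m. replicas m)) = sets (replicas X)"
  and prob_space_bind_replicas: "prob_space (P \<bind> (%m. replicas m))"
  and integral_bind_replicas: "!!f B. f : bm (replicas X) ==>
   (!!x. x : space (replicas X) ==> \<bar>f x\<bar> <= (B::real)) ==>
   (LINT x|(P \<bind> (%m. replicas m)). f x) = (LINT m|P. (LINT x|replicas m. f x))"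
  and AE_bind_replicas: "!!Q. Measurable.pred (replicas X) Q ==>
   (AE x in P \<bind> (%m. replicas m). Q x) \<longleftrightarrow> (AE m in P. AE x in replicas m. Q x)"
proof -
 from P have PP: "prob_space P" "sets P = sets (prob_algebra X)" by (auto simp: space_prob_algebra)
 interpret prob_space P by fact
 have K: "(%m. replicas m) : P ->M prob_algebra (replicas X)"
  using replicas_kernel mcs[OF PP(2)] by blast
 note Ks = measurable_prob_algebraD[OF K]
 show "sets (P \<bind> (%m. replicas m)) = sets (replicas X)"
  by (rule sets_bind'[OF P replicas_kernel])
 show "prob_space (P \<bind> (%m. replicas m))"
  by (rule prob_space_bind'[OF P replicas_kernel])
 show "(LINT x|(P \<bind> (%m. replicas m)). f x) = (LINT m|P. (LINT x|replicas m. f x))"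
  if f: "f : bm (replicas X)" "!!x. x : space (replicas X) ==> \<bar>f x\<bar> <= B" for f :: "_ => real" and B
 proof (rule integral_bind[OF f Ks finite_measure_axioms, where B' = 1])
  show "AE m in P. emeasure (replicas m) (space (replicas m)) <= ennreal 1"
   using measurable_space[OF K] by (intro AE_I2) (auto simp: space_prob_algebra prob_space.emeasure_space_1)
 qed
 show "(AE x in P \<bind> (%m. replicas m). Q x) \<longleftrightarrow> (AE m in P. AE x in replicas m. Q x)"
  if "Measurable.pred (replicas X) Q" for Q
  by (rule AE_bind[OF Ks that])
qed

section \<open>Test functions for the limit of Gibbs measures\<close>

text \<open>\<open>fdd_tendsto\<close> is about bounded functions that are continuous on all real
  arrays, not only on signs. Truncation of the couplings at \<open>Q\<close> and of the spins at
  \<open>1\<close> provides the bounds; on signs \<open>clip 1\<close> is the identity.\<close>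

definition clip :: "real => real => real" where "clip Q x = max (- Q) (min Q x)"

lemma clip_abs: "Q >= 0 ==> \<bar>clip Q x\<bar> <= Q" by (auto simp: clip_def)
lemma clip_id: "\<bar>x\<bar> <= Q ==> clip Q x = x" by (auto simp: clip_def)
lemma clip_measurable [measurable]: "clip Q : bm borel" unfolding clip_def by measurable

lemma continuous_on_clip [continuous_intros]: "continuous_on S f ==> continuous_on S (%x. clip Q (f x))"
 unfolding clip_def by (intro continuous_intros)

definition edge_weight :: "real => ('d::finite) edge set => ('d edge => real) => 'd config => real" where
 "edge_weight \<beta> A h sg = exp (\<beta> * (SUM e:A. h e * edge_spin sg e))"

lemma edge_weight_pos [simp]: "edge_weight \<beta> A h sg > 0" by (simp add: edge_weight_def)

lemma edge_weight_measurable [measurable]: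
 "edge_weight \<beta> A h : bm (cfg :: ('d::finite) config measure)"
 unfolding edge_weight_def[abs_def] by measurable

lemma edge_weight_exponent_bound:
 assumes "sg : space cfg" "A \<subseteq> edges" "!!e. e : A ==> \<bar>h e\<bar> <= H e"
 shows "\<bar>\<beta> * (SUM e:A. h e * edge_spin sg e)\<bar> <= \<bar>\<beta>\<bar> * (SUM e:A. H e)"
proof -
 have "\<bar>SUM e:A. h e * edge_spin sg e\<bar> <= (SUM e:A. H e)"
 proof (rule order_trans[OF sum_abs sum_mono])
  fix e assume e: "e : A"
  then have "\<bar>edge_spin sg e\<bar> = 1" using edge_spin_sign[OF assms(1) subsetD[OF assms(2) e]] by auto
  then show "\<bar>h e * edge_spin sg e\<bar> <= H e" using assms(3)[OF e] by (simp add: abs_mult)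
 qed
 then show ?thesis by (simp add: abs_mult mult_left_mono)
qed

lemma edge_weight_bounds:
 assumes "sg : space cfg" "A \<subseteq> edges" "!!e. e : A ==> \<bar>h e\<bar> <= H e"
 shows "exp (- (\<bar>\<beta>\<bar> * (SUM e:A. H e))) <= edge_weight \<beta> A h sg" "edge_weight \<beta> A h sg <= exp (\<bar>\<beta>\<bar> * (SUM e:A. H e))"
proof -
 have "\<bar>\<beta> * (SUM e:A. h e * edge_spin sg e)\<bar> <= \<bar>\<beta>\<bar> * (SUM e:A. H e)"
  by (rule edge_weight_exponent_bound) (use assms in auto)
 then show "exp (- (\<bar>\<beta>\<bar> * (SUM e:A. H e))) <= edge_weight \<beta> A h sg" "edge_weight \<beta> A h sg <= exp (\<bar>\<beta>\<bar> * (SUM e:A. H e))"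
  unfolding edge_weight_def exp_le_cancel_iff by linarith+
qed

lemma edge_weight_integrable:
 assumes "prob_space m" "sets m = sets cfg" "A \<subseteq> edges"
 shows "integrable m (edge_weight \<beta> A h)"
proof -
 interpret prob_space m by fact
 have [measurable]: "edge_weight \<beta> A h : bm m"
  using edge_weight_measurable mcs[OF assms(2)] by blast
 have "\<bar>edge_weight \<beta> A h sg\<bar> <= exp (\<bar>\<beta>\<bar> * (SUM e:A. \<bar>h e\<bar>))" if "sg : space m" for sg
  using edge_weight_bounds(2)[of sg A h "%e. \<bar>h e\<bar>" \<beta>] that space_eqI[OF assms(2)] assms(3) less_imp_le[OF edge_weight_pos[of \<beta> A h sg]]
  by simp
 then show ?thesis by (intro integrable_const_bound[of _ "exp (\<bar>\<beta>\<bar> * (SUM e:A. \<bar>h e\<bar>))"] AE_I2) auto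
qed

text \<open>The boxes that \<open>is_metastate\<close> provides are fixed as \<open>a\<close> and
  \<open>b\<close>, and the limit law is written out.\<close>

locale metastate = coupling \<rho> dim for \<rho> :: "real measure" and dim :: "'d::finite itself" +
 fixes \<beta> :: real and \<kappa> :: "('d edge => real) => 'd config measure measure" and a b :: "nat => 'd site"
 assumes \<beta>: "\<beta> > 0"
  and support: "topological_support \<rho> = UNIV"
  and \<kappa>: "\<kappa> : nu ->M prob_algebra (prob_algebra cfg)"
  and boxes: "boxes_to_lattice a b"
  and fdd: "fdd_tendsto (%n. joint_law nu (%J. replicas (gibbs_ext (a n) (b n) \<beta> J)))
    (joint_law nu (%J. \<kappa> J \<bind> (%GA. replicas GA)))"
begin

definition K :: "('d edge => real) => (nat => 'd config) measure" where "K J = \<kappa> J \<bind> (%GA. replicas GA)"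
definition M :: "(('d edge => real) \<times> (nat => 'd config)) measure" where "M = joint_law nu K"
definition G :: "nat => ('d edge => real) => 'd config measure" where "G n J = gibbs_ext (a n) (b n) \<beta> J"

lemma \<kappa>_prob: "J : space nu ==> \<kappa> J : space (prob_algebra (prob_algebra cfg))"
 by (rule measurable_space[OF \<kappa>])

lemma K_kernel: "K : nu ->M prob_algebra (replicas cfg)"
 unfolding K_def by (rule measurable_bind_prob_space[OF \<kappa> replicas_kernel])

lemma G_kernel: "G n : nu ->M prob_algebra cfg"
 unfolding G_def using gibbs_ext_kernel mcs[OF sets_nu] by blast

lemma GR_kernel: "(%J. replicas (G n J)) : nu ->M prob_algebra (replicas cfg)"
 by (rule mcomp[OF G_kernel replicas_kernel])

lemma G_prob: "prob_space (G n J)" "sets (G n J) = sets cfg"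
 by (auto simp: G_def prob_space_gibbs_ext)

lemma sets_M [measurable_cong]: "sets M = sets (nu **M replicas cfg)"
 unfolding M_def by (rule sets_joint_law[OF prob_nu K_kernel])

lemma sets_M': "sets M = sets (PiM edges (%_. borel) **M replicas cfg)"
 using sets_M sets_pair_measure_cong[OF sets_nu refl] by simp

sublocale M: prob_space M
 unfolding M_def by (rule prob_space_joint_law[OF prob_nu K_kernel])

lemma in_prob_config:
 assumes "GA : space (prob_algebra cfg)"
 shows "prob_space GA" "sets GA = sets cfg" "space GA = space cfg"
 using assms space_eqI[of GA cfg] by (simp_all add: space_prob_algebra del: space_config)

text \<open>The weight of \<open>gibbs_override\<close> for couplings truncated at
  \<open>Q\<close>.\<close>

definition tilt_weight :: "real => 'd edge set => ('d edge => real) => ('d edge => real) => 'd config => real" where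
 "tilt_weight Q A k J = edge_weight \<beta> A (%e. k e - clip Q (J e))"

text \<open>The indicator of spin \<open>1\<close> is written as \<open>(1 + \<sigma>) / 2\<close>
  and spins are truncated, which makes the function continuous and bounded on all real arrays;
  \<open>test_eq\<close> gives its meaning on signs. The factor \<open>i\<close> involves replica
  \<open>i\<close> only, so that the integral over replicas is a product.\<close>

definition test :: "('d edge set \<times> ('d edge => real => real)) => nat => (nat => 'd site set) => real => 'd edge set
 => ('d edge => real) => ('d edge => real) \<times> (nat => 'd config) => real" where
 "test Eu N D Q A k z = (PROD e:fst Eu. snd Eu e (fst z e)) *
  (PROD i<N. (PROD x:D i. (1 + clip 1 (snd z i x)) / 2) *
    exp (\<beta> * (SUM e:A. (k e - clip Q (fst z e)) * (PROD x:e. clip 1 (snd z i x)))))"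

lemma test_eq:
 assumes sg: "sg : space (replicas cfg)" and D: "!!i. i < N ==> finite (D i)"
 shows "test (E, u) N D Q A k (J, sg) = (PROD e:E. u e (J e)) * (PROD i<N. up (D i) (sg i) * tilt_weight Q A k J (sg i))"
proof -
 have c: "clip 1 (sg i x) = sg i x" "sg i x : {-1, 1}" for i x
 proof -
  show "sg i x : {-1, 1}" using sg by (auto simp: space_replicas_config)
  then show "clip 1 (sg i x) = sg i x" by (intro clip_id) auto
 qed
 have "(PROD x:D i. (1 + clip 1 (sg i x)) / 2) = up (D i) (sg i)" if "i < N" for i
 proof (cases "\<forall>x\<in>D i. sg i x = 1")
  case True
  then show ?thesis by (simp add: up_def clip_def)
 next
  case False
  then obtain x where x: "x : D i" "sg i x = -1" using c(2) by blast
  then have "(PROD x:D i. (1 + clip 1 (sg i x)) / 2) = 0"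
   using D[OF that] by (intro prod_zero bexI[of _ x]) (auto simp: clip_def)
  then show ?thesis using False by (auto simp: up_def)
 qed
 then show ?thesis
  by (simp add: test_def tilt_weight_def edge_weight_def edge_spin_def c(1))
qed

lemma test_continuous:
 assumes "!!e. e : E ==> u e : bump"
 shows "continuous_on UNIV (test (E, u) N D Q A k)"
proof -
 have f: "continuous_on UNIV (%z :: ('d edge => real) \<times> (nat => 'd config). fst z e)" for e
  by (rule continuous_on_compose2[OF continuous_on_product_coordinates[of e] continuous_on_fst[OF continuous_on_id]]) auto
 have s1: "continuous_on UNIV (%z :: ('d edge => real) \<times> (nat => 'd config). snd z i)" for i
  by (rule continuous_on_compose2[OF continuous_on_product_coordinates[of i] continuous_on_snd[OF continuous_on_id]]) auto
 have s: "continuous_on UNIV (%z :: ('d edge => real) \<times> (nat => 'd config). snd z i x)" for i x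
  by (rule continuous_on_compose2[OF continuous_on_product_coordinates[of x] s1]) auto
 have u: "continuous_on UNIV (%z :: ('d edge => real) \<times> (nat => 'd config). u e (fst z e))" if "e : E" for e
  using assms[OF that] by (intro continuous_on_compose2[OF _ f[of e], of UNIV "u e"]) (auto simp: bump_def)
 have d: "continuous_on UNIV (%z :: ('d edge => real) \<times> (nat => 'd config). (1 + clip 1 (snd z i x)) / 2)" for i x
  by (rule continuous_on_divide[OF continuous_on_add[OF continuous_on_const continuous_on_clip[OF s]] continuous_on_const]) simp
 have c: "continuous_on UNIV (%z :: ('d edge => real) \<times> (nat => 'd config).
   exp (\<beta> * (SUM e:A. (k e - clip Q (fst z e)) * (PROD x:e. clip 1 (snd z i x)))))" for i
  by (rule continuous_on_exp[OF continuous_on_mult[OF continuous_on_const continuous_on_sum[OF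
    continuous_on_mult[OF continuous_on_diff[OF continuous_on_const continuous_on_clip[OF f]] continuous_on_prod[OF continuous_on_clip[OF s]]]]]])
 let ?P = "%z :: ('d edge => real) \<times> (nat => 'd config). PROD e:E. u e (fst z e)"
 let ?D = "%i (z :: ('d edge => real) \<times> (nat => 'd config)). PROD x:D i. (1 + clip 1 (snd z i x)) / 2"
 let ?W = "%i (z :: ('d edge => real) \<times> (nat => 'd config)). exp (\<beta> * (SUM e:A. (k e - clip Q (fst z e)) * (PROD x:e. clip 1 (snd z i x))))"
 have P: "continuous_on UNIV ?P" by (rule continuous_on_prod) (rule u)
 have DD: "continuous_on UNIV (?D i)" for i by (rule continuous_on_prod) (rule d)
 have "continuous_on UNIV (%z. ?D i z * ?W i z)" for i by (rule continuous_on_mult[OF DD c])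
 then have "continuous_on UNIV (%z. PROD i<N. ?D i z * ?W i z)" by (rule continuous_on_prod)
 from continuous_on_mult[OF P this] show ?thesis unfolding test_def[abs_def] fst_conv snd_conv .
qed

lemma test_bounded:
 assumes u: "!!e. e : E ==> u e : bump" and Q: "Q >= 0"
 shows "\<bar>test (E, u) N D Q A k z\<bar> <= exp (\<beta> * (SUM e:A. \<bar>k e\<bar> + Q)) ^ N"
proof -
 have 1: "\<bar>PROD e:E. u e (fst z e)\<bar> <= 1"
  unfolding abs_prod using bump_bounds[OF u] by (intro prod_le_1) auto
 have 2: "\<bar>PROD x:D i. (1 + clip 1 (snd z i x)) / 2\<bar> <= 1" for i
  unfolding abs_prod
 proof (intro prod_le_1 conjI)
  fix x
  have "\<bar>clip 1 (snd z i x)\<bar> <= 1" by (rule clip_abs) simp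
  then show "\<bar>(1 + clip 1 (snd z i x)) / 2\<bar> <= 1" by auto
 qed simp
 have 3: "exp (\<beta> * (SUM e:A. (k e - clip Q (fst z e)) * (PROD x:e. clip 1 (snd z i x)))) <= exp (\<beta> * (SUM e:A. \<bar>k e\<bar> + Q))" for i
 proof -
  have "(k e - clip Q (fst z e)) * (PROD x:e. clip 1 (snd z i x)) <= \<bar>k e\<bar> + Q" for e
  proof -
   have "\<bar>PROD x:e. clip 1 (snd z i x)\<bar> <= 1"
    unfolding abs_prod by (intro prod_le_1) (auto intro: clip_abs)
   moreover have "\<bar>k e - clip Q (fst z e)\<bar> <= \<bar>k e\<bar> + Q" using clip_abs[OF Q, of "fst z e"] by linarith
   ultimately have "\<bar>k e - clip Q (fst z e)\<bar> * \<bar>PROD x:e. clip 1 (snd z i x)\<bar> <= (\<bar>k e\<bar> + Q) * 1"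
    by (intro mult_mono) auto
   then have "\<bar>(k e - clip Q (fst z e)) * (PROD x:e. clip 1 (snd z i x))\<bar> <= \<bar>k e\<bar> + Q"
    unfolding abs_mult by simp
   then show ?thesis by (rule abs_le_D1)
  qed
  then show ?thesis using \<beta> by (simp add: sum_mono)
 qed
 have "\<bar>PROD i<N. (PROD x:D i. (1 + clip 1 (snd z i x)) / 2) *
    exp (\<beta> * (SUM e:A. (k e - clip Q (fst z e)) * (PROD x:e. clip 1 (snd z i x))))\<bar> <= (PROD i<N. 1 * exp (\<beta> * (SUM e:A. \<bar>k e\<bar> + Q)))"
  unfolding abs_prod
 proof (intro prod_mono conjI)
  fix i
  show "\<bar>(PROD x:D i. (1 + clip 1 (snd z i x)) / 2) * exp (\<beta> * (SUM e:A. (k e - clip Q (fst z e)) * (PROD x:e. clip 1 (snd z i x))))\<bar>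
   <= 1 * exp (\<beta> * (SUM e:A. \<bar>k e\<bar> + Q))"
   unfolding abs_mult abs_exp_cancel by (intro mult_mono 2 3) auto
 qed simp
 then have "\<bar>test (E, u) N D Q A k z\<bar> <= 1 * (PROD i<N. 1 * exp (\<beta> * (SUM e:A. \<bar>k e\<bar> + Q)))"
  unfolding test_def fst_conv snd_conv abs_mult[of "prod _ E"] by (intro mult_mono 1) auto
 then show ?thesis by simp
qed

lemma test_measurable:
 assumes u: "!!e. e : E ==> u e : bump" and E: "E \<subseteq> edges" and A: "A \<subseteq> edges"
 shows "test (E, u) N D Q A k : bm (nu **M replicas cfg)"
proof -
 have f: "(%z. fst z e) : bm (nu **M replicas (cfg :: 'd config measure))" if "e : edges" for e
  by (rule mcomp[OF measurable_fst coupling_measurable[OF that]])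
 have s: "(%z. snd z i x) : bm (nu **M replicas (cfg :: 'd config measure))" for i x
  by measurable
 have "(%z. u e (fst z e)) : bm (nu **M replicas (cfg :: 'd config measure))" if "e : E" for e
  using that E by (intro mcomp[OF f bump_measurable[OF u]]) auto
 moreover have "(%z. clip Q (fst z e)) : bm (nu **M replicas (cfg :: 'd config measure))" if "e : A" for e
  using that A by (intro mcomp[OF f clip_measurable]) auto
 moreover have "(%z. clip 1 (snd z i x)) : bm (nu **M replicas (cfg :: 'd config measure))" for i x
  by (rule mcomp[OF s clip_measurable])
 ultimately show ?thesis
  unfolding test_def[abs_def] fst_conv snd_conv
  by (intro borel_measurable_times borel_measurable_prod mcomp[OF _ borel_measurable_exp] borel_measurable_sum
    borel_measurable_diff borel_measurable_divide borel_measurable_add borel_measurable_const) auto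
qed

lemma tilt_weight_measurable [measurable]:
 "tilt_weight Q A k J : bm (cfg :: 'd config measure)"
 unfolding tilt_weight_def by measurable

lemma tilt_weight_bounds:
 assumes "sg : space cfg" "A \<subseteq> edges" "Q >= 0"
 shows "exp (- (\<beta> * (SUM e:A. \<bar>k e\<bar> + Q))) <= tilt_weight Q A k J sg" "tilt_weight Q A k J sg <= exp (\<beta> * (SUM e:A. \<bar>k e\<bar> + Q))"
proof -
 have "\<bar>k e - clip Q (J e)\<bar> <= \<bar>k e\<bar> + Q" for e
  using clip_abs[OF assms(3), of "J e"] by linarith
 then show "exp (- (\<beta> * (SUM e:A. \<bar>k e\<bar> + Q))) <= tilt_weight Q A k J sg" "tilt_weight Q A k J sg <= exp (\<beta> * (SUM e:A. \<bar>k e\<bar> + Q))"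
  using edge_weight_bounds[OF assms(1,2), of "%e. k e - clip Q (J e)" "%e. \<bar>k e\<bar> + Q" \<beta>] \<beta>
  by (auto simp: tilt_weight_def)
qed

lemma up_tilt_bounds:
 assumes "sg : space cfg" "A \<subseteq> edges" "Q >= 0"
 shows "0 <= up D sg * tilt_weight Q A k J sg" "up D sg * tilt_weight Q A k J sg <= exp (\<beta> * (SUM e:A. \<bar>k e\<bar> + Q))"
proof -
 have p: "0 < tilt_weight Q A k J sg" by (simp add: tilt_weight_def)
 then show "0 <= up D sg * tilt_weight Q A k J sg" using up_bounds[of D sg] by simp
 have "up D sg * tilt_weight Q A k J sg <= 1 * tilt_weight Q A k J sg"
  using up_bounds[of D sg] p by (intro mult_right_mono) auto
 then show "up D sg * tilt_weight Q A k J sg <= exp (\<beta> * (SUM e:A. \<bar>k e\<bar> + Q))"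
  using tilt_weight_bounds(2)[OF assms, of k J] by linarith
qed

lemma integral_test_replicas:
 assumes GA: "GA : space (prob_algebra cfg)" and D: "!!i. i < N ==> finite (D i)" and A: "A \<subseteq> edges" and Q: "Q >= 0"
 shows "(LINT sg|replicas GA. test (E, u) N D Q A k (J, sg))
  = (PROD e:E. u e (J e)) * (PROD i<N. \<integral>sg. up (D i) sg * tilt_weight Q A k J sg \<partial>GA)"
proof -
 note GA' = in_prob_config[OF GA]
 interpret GA: prob_space GA by (rule GA')
 have sp: "space (replicas GA) = space (replicas cfg)" by (simp add: space_PiM GA')
 have "(LINT sg|replicas GA. test (E, u) N D Q A k (J, sg))
  = (LINT sg|replicas GA. (PROD e:E. u e (J e)) * (PROD i<N. up (D i) (sg i) * tilt_weight Q A k J (sg i)))"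
  using sp D by (intro integral_cong refl test_eq) auto
 also have "... = (PROD e:E. u e (J e)) * (LINT sg|replicas GA. (PROD i<N. up (D i) (sg i) * tilt_weight Q A k J (sg i)))"
  by simp
 also have "(LINT sg|replicas GA. (PROD i<N. up (D i) (sg i) * tilt_weight Q A k J (sg i)))
  = (PROD i<N. \<integral>sg. up (D i) sg * tilt_weight Q A k J sg \<partial>GA)"
 proof (rule integral_replicas_prod[OF GA'(1)])
  fix i assume "i : {..<N}"
  then have "(%sg. up (D i) sg * tilt_weight Q A k J sg) : bm cfg"
   using D by (intro borel_measurable_times up_measurable tilt_weight_measurable) auto
  then have m: "(%sg. up (D i) sg * tilt_weight Q A k J sg) : bm GA"
   using mcs[OF GA'(2)] by blast
  have "norm (up (D i) sg * tilt_weight Q A k J sg) <= exp (\<beta> * (SUM e:A. \<bar>k e\<bar> + Q))" if "sg : space GA" for sg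
   using up_tilt_bounds[of sg A Q "D i" k J] that A Q unfolding GA'(3) by simp
  then show "integrable GA (%sg. up (D i) sg * tilt_weight Q A k J sg)"
   by (intro GA.integrable_const_bound[OF AE_I2 m]) auto
 qed auto
 finally show ?thesis .
qed

lemma integral_test_K:
 assumes J: "J : space nu" and D: "!!i. i < N ==> finite (D i)" and A: "A \<subseteq> edges" and Q: "Q >= 0"
  and u: "!!e. e : E ==> u e : bump" and E: "E \<subseteq> edges"
 shows "(LINT sg|K J. test (E, u) N D Q A k (J, sg))
  = (PROD e:E. u e (J e)) * (LINT GA|\<kappa> J. (PROD i<N. \<integral>sg. up (D i) sg * tilt_weight Q A k J sg \<partial>GA))"
proof -
 have "(LINT sg|K J. test (E, u) N D Q A k (J, sg)) = (LINT GA|\<kappa> J. (LINT sg|replicas GA. test (E, u) N D Q A k (J, sg)))"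
  unfolding K_def
 proof (rule integral_bind_replicas[OF \<kappa>_prob[OF J]])
  show "(%sg. test (E, u) N D Q A k (J, sg)) : bm (replicas cfg)"
   by (rule mcomp[OF measurable_Pair1'[OF J] test_measurable[OF u E A]])
  show "\<bar>test (E, u) N D Q A k (J, x)\<bar> <= exp (\<beta> * (SUM e:A. \<bar>k e\<bar> + Q)) ^ N" for x
   by (rule test_bounded[OF u Q])
 qed
 also have "... = (LINT GA|\<kappa> J. (PROD e:E. u e (J e)) * (PROD i<N. \<integral>sg. up (D i) sg * tilt_weight Q A k J sg \<partial>GA))"
 proof (intro integral_cong refl)
  fix GA assume "GA : space (\<kappa> J)"
  then have "GA : space (prob_algebra cfg)" using \<kappa>_prob[OF J] by (auto simp: space_prob_algebra dest: space_eqI)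
  from integral_test_replicas[OF this D A Q] show "(LINT sg|replicas GA. test (E, u) N D Q A k (J, sg)) =
   (PROD e:E. u e (J e)) * (PROD i<N. \<integral>sg. up (D i) sg * tilt_weight Q A k J sg \<partial>GA)" by auto
 qed
 finally show ?thesis by simp
qed

text \<open>Given the random measure the replicas are independent, so convergence of the joint laws
  becomes convergence of mixed moments of single-replica integrals, localized in the couplings by
  the bumps.\<close>

lemma test_limit:
 fixes N :: nat
 assumes fin: "finite E" "finite A" "!!i. i < N ==> finite (D i)" and E: "E \<subseteq> edges" and A: "A \<subseteq> edges"
  and u: "!!e. e : E ==> u e : bump" and Q: "Q >= 0"
 shows "(%n. \<integral>J. (PROD e:E. u e (J e)) * (PROD i<N. \<integral>sg. up (D i) sg * tilt_weight Q A k J sg \<partial>G n J) \<partial>nu)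
  ----> (LINT J|nu. (PROD e:E. u e (J e)) * (LINT GA|\<kappa> J. (PROD i<N. \<integral>sg. up (D i) sg * tilt_weight Q A k J sg \<partial>GA)))"
proof -
 let ?f = "test (E, u) N D Q A k"
 have "continuous_on UNIV ?f" by (rule test_continuous[OF u])
 moreover have "bounded (range ?f)"
 proof -
  have "\<bar>?f z\<bar> <= exp (\<beta> * (SUM e:A. \<bar>k e\<bar> + Q)) ^ N" for z by (rule test_bounded[OF u Q])
  then show ?thesis by (auto simp: bounded_iff)
 qed
 moreover have "\<exists>E I V. finite E & E \<subseteq> edges & finite I & finite V \<and>
     (\<forall>J J' sg sg'. (\<forall>e\<in>E. J e = J' e) & (\<forall>i\<in>I. \<forall>x\<in>V. sg i x = sg' i x) --> ?f (J, sg) = ?f (J', sg'))"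
 proof (intro exI conjI allI impI)
  have "finite e" if "e : A" for e using that A by (auto elim!: edgeE dest!: subsetD)
  then show "finite ((\<Union>i<N. D i) \<union> \<Union>A)" using fin by auto
  show "finite (E \<union> A)" "E \<union> A \<subseteq> edges" "finite {..<N}" using fin E A by auto
  fix J J' :: "'d edge => real" and sg sg' :: "nat => 'd config"
  assume eq: "(\<forall>e\<in>E \<union> A. J e = J' e) & (\<forall>i\<in>{..<N}. \<forall>x\<in>(\<Union>i<N. D i) \<union> \<Union>A. sg i x = sg' i x)"
  have "(PROD e:E. u e (J e)) = (PROD e:E. u e (J' e))" using eq by (intro prod.cong) auto
  moreover have sp: "sg i x = sg' i x" if "i < N" "x : (\<Union>i<N. D i) \<union> \<Union>A" for i x
   using eq that by blast
  have "(PROD x:D i. (1 + clip 1 (sg i x)) / 2) = (PROD x:D i. (1 + clip 1 (sg' i x)) / 2)" if "i < N" for i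
  proof (rule prod.cong[OF refl])
   fix x assume "x : D i"
   then have "sg i x = sg' i x" using that by (intro sp) auto
   then show "(1 + clip 1 (sg i x)) / 2 = (1 + clip 1 (sg' i x)) / 2" by simp
  qed
  moreover have "(SUM e:A. (k e - clip Q (J e)) * (PROD x:e. clip 1 (sg i x))) = (SUM e:A. (k e - clip Q (J' e)) * (PROD x:e. clip 1 (sg' i x)))"
   if "i < N" for i
  proof (rule sum.cong[OF refl])
   fix e assume e: "e : A"
   have "(PROD x:e. clip 1 (sg i x)) = (PROD x:e. clip 1 (sg' i x))"
   proof (rule prod.cong[OF refl])
    fix x assume "x : e"
    then have "sg i x = sg' i x" using that e by (intro sp) auto
    then show "clip 1 (sg i x) = clip 1 (sg' i x)" by simp
   qed
   moreover have "J e = J' e" using eq e by blast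
   ultimately show "(k e - clip Q (J e)) * (PROD x:e. clip 1 (sg i x)) = (k e - clip Q (J' e)) * (PROD x:e. clip 1 (sg' i x))" by simp
  qed
  ultimately show "?f (J, sg) = ?f (J', sg')" by (simp add: test_def)
 qed
 ultimately have "(%n. \<integral>z. ?f z \<partial>joint_law nu (%J. replicas (gibbs_ext (a n) (b n) \<beta> J)))
  ----> (LINT z|joint_law nu (%J. \<kappa> J \<bind> (%GA. replicas GA)). ?f z)"
  using fdd unfolding fdd_tendsto_def by blast
 moreover have "(LINT z|joint_law nu (%J. replicas (gibbs_ext (a n) (b n) \<beta> J)). ?f z)
  = (LINT J|nu. (PROD e:E. u e (J e)) * (PROD i<N. \<integral>sg. up (D i) sg * tilt_weight Q A k J sg \<partial>G n J))" for n
 proof -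
  have "(LINT z|joint_law nu (%J. replicas (G n J)). ?f z) = (LINT J|nu. (LINT sg|replicas (G n J). ?f (J, sg)))"
   by (rule integral_joint_law[OF prob_nu GR_kernel test_measurable[OF u E A] test_bounded[OF u Q]])
  also have "... = (LINT J|nu. (PROD e:E. u e (J e)) * (PROD i<N. \<integral>sg. up (D i) sg * tilt_weight Q A k J sg \<partial>G n J))"
   using G_prob fin A Q by (intro integral_cong refl integral_test_replicas) (auto simp: space_prob_algebra)
  finally show ?thesis by (simp add: G_def)
 qed
 moreover have "(LINT z|joint_law nu (%J. \<kappa> J \<bind> (%GA. replicas GA)). ?f z)
  = (LINT J|nu. (PROD e:E. u e (J e)) * (LINT GA|\<kappa> J. (PROD i<N. \<integral>sg. up (D i) sg * tilt_weight Q A k J sg \<partial>GA)))"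
 proof -
  have "(LINT z|joint_law nu K. ?f z) = (LINT J|nu. (LINT sg|K J. ?f (J, sg)))"
   by (rule integral_joint_law[OF prob_nu K_kernel test_measurable[OF u E A] test_bounded[OF u Q]])
  also have "... = (LINT J|nu. (PROD e:E. u e (J e)) * (LINT GA|\<kappa> J. (PROD i<N. \<integral>sg. up (D i) sg * tilt_weight Q A k J sg \<partial>GA)))"
   using fin A Q u E by (intro integral_cong refl integral_test_K) auto
  finally show ?thesis by (simp add: K_def[abs_def])
 qed
 ultimately show ?thesis by simp
qed

end

section \<open>Translation invariance of the joint law\<close>

definition shift_couplings :: "('d::finite) site => ('d edge => real) => 'd edge => real" where
 "shift_couplings x J = (\<lambda>e\<in>edges. J ((+) x ` e))"

definition shift_configs :: "('d::finite) site => (nat => 'd config) => nat => 'd config" where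
 "shift_configs x sg = (%i y. sg i (x + y))"

lemma shift_edge_step: "(+) x ` {y, y + axis i (1::int)} = {x + y, x + y + axis i 1}"
 by (simp add: add.assoc)

lemma shift_edge_mem: "e : edges ==> (+) x ` e : edges"
 by (erule edgeE) (simp only: shift_edge_step step_edge)

lemma inj_shift_edge: "inj ((`) ((+) (x :: ('d::finite) site)))"
 by (rule injI) (simp add: inj_image_eq_iff)

lemma shift_configs_add: "shift_configs x (shift_configs y sg) = shift_configs (x + y) sg"
 by (simp add: shift_configs_def fun_eq_iff add.assoc add.left_commute)

lemma shift_configs_measurable [measurable]:
 "shift_configs x : replicas (cfg :: ('d::finite) config measure) ->M replicas cfg"
proof (rule measurable_PiM_single')
 show "(%sg. shift_configs x sg i) : replicas (cfg :: 'd config measure) ->M cfg" for i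
 proof -
  have 1: "(%sg. sg i) : replicas (cfg :: 'd config measure) ->M cfg" by measurable
  show ?thesis
   unfolding shift_configs_def by (rule measurable_configI) (rule mcomp[OF 1 spin_measurable_count])
 qed
 show "(%om i. shift_configs x om i) : space (replicas (cfg :: 'd config measure)) \<rightarrow> UNIV \<rightarrow>\<^sub>E space cfg"
  by (auto simp: space_replicas_config shift_configs_def)
qed

lemma cyl_indicator:
 assumes sg: "sg : space (replicas cfg)" and D: "fst ` D \<subseteq> {..<N::nat}"
 shows "indicator (cyl D) sg = (PROD i<N. up (D `` {i}) (sg i))"
proof (cases "sg : cyl D")
 case True
 then have "up (D `` {i}) (sg i) = 1" for i by (auto simp: cyl_def up_def)
 with True show ?thesis by simp
next
 case False
 then obtain i x where ix: "(i, x) : D" "sg i x ~= 1" using sg by (auto simp: cyl_def)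
 then have "up (D `` {i}) (sg i) = 0" by (auto simp: up_def)
 moreover have "i < N" using ix D by auto
 ultimately have "(PROD i<N. up (D `` {i}) (sg i)) = 0" by (intro prod_zero) auto
 then show ?thesis using False by simp
qed

context metastate
begin

lemma space_M: "space M = space nu \<times> space (replicas cfg)"
 using space_eqI[OF sets_M] unfolding space_pair_measure .

lemma space_MD: "z : space M ==> fst z : space nu" "z : space M ==> snd z : space (replicas cfg)"
 unfolding space_M by (erule mem_Times_iff[THEN iffD1, THEN conjunct1], erule mem_Times_iff[THEN iffD1, THEN conjunct2])

lemma cyl_test:
 assumes sg: "sg : space (replicas cfg)" and D: "finite D" "fst ` D \<subseteq> {..<N::nat}"
 shows "(PROD e:E. u e (J e)) * indicator (cyl D) sg = test (E, u) N (%i. D `` {i}) 0 {} (%_. 0) (J, sg)"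
proof -
 have "finite (D `` {i})" for i using D(1) by auto
 then have "test (E, u) N (%i. D `` {i}) 0 {} (%_. 0) (J, sg)
   = (PROD e:E. u e (J e)) * (PROD i<N. up (D `` {i}) (sg i) * tilt_weight 0 {} (%_. 0) J (sg i))"
  by (intro test_eq[OF sg])
 then show ?thesis by (simp add: cyl_indicator[OF sg D(2)] tilt_weight_def edge_weight_def)
qed

lemma integral_M_cyl:
 assumes fin: "finite E" and E: "E \<subseteq> edges" and u: "!!e. e : E ==> u e : bump" and D: "finite D" "fst ` D \<subseteq> {..<N::nat}"
 shows "(%n. \<integral>J. (PROD e:E. u e (J e)) * (PROD i<N. \<integral>sg. up (D `` {i}) sg \<partial>G n J) \<partial>nu)
  ----> (LINT z|M. (PROD e:E. u e (fst z e)) * indicator (cyl D) (snd z))"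
proof -
 let ?D = "%i. D `` {i}"
 have "(LINT z|M. (PROD e:E. u e (fst z e)) * indicator (cyl D) (snd z)) = (LINT z|M. test (E, u) N ?D 0 {} (%_. 0) z)"
 proof (intro integral_cong refl)
  fix z assume "z : space M"
  then have "snd z : space (replicas cfg)" by (rule space_MD)
  from cyl_test[OF this D, of u "fst z" E] show "(PROD e:E. u e (fst z e)) * indicator (cyl D) (snd z) = test (E, u) N ?D 0 {} (%_. 0) z"
   unfolding prod.collapse .
 qed
 also have "... = (LINT J|nu. (LINT sg|K J. test (E, u) N ?D 0 {} (%_. 0) (J, sg)))"
  unfolding M_def
  by (rule integral_joint_law[OF prob_nu K_kernel test_measurable[OF u E] test_bounded[OF u]]) auto
 also have "... = (LINT J|nu. (PROD e:E. u e (J e)) * (LINT GA|\<kappa> J. (PROD i<N. \<integral>sg. up (?D i) sg * tilt_weight 0 {} (%_. 0) J sg \<partial>GA)))"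
  using u E D by (intro integral_cong refl integral_test_K) auto
 finally have eq: "(LINT z|M. (PROD e:E. u e (fst z e)) * indicator (cyl D) (snd z))
  = (LINT J|nu. (PROD e:E. u e (J e)) * (LINT GA|\<kappa> J. (PROD i<N. \<integral>sg. up (?D i) sg * tilt_weight 0 {} (%_. 0) J sg \<partial>GA)))" .
 have "(%n. \<integral>J. (PROD e:E. u e (J e)) * (PROD i<N. \<integral>sg. up (?D i) sg * tilt_weight 0 {} (%_. 0) J sg \<partial>G n J) \<partial>nu)
  ----> (LINT z|M. (PROD e:E. u e (fst z e)) * indicator (cyl D) (snd z))"
  unfolding eq using fin E u D by (intro test_limit) auto
 then show ?thesis by (simp add: tilt_weight_def edge_weight_def)
qed

text \<open>For sites that stay in the box after the shift, translation by \<open>axis j 1\<close>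
  coincides with the torus step, which permutes the i.i.d. couplings and respects the Gibbs
  measures.\<close>

lemma gibbs_shift:
 fixes D :: "(nat \<times> 'd site) set" and N :: nat
 assumes E: "E \<subseteq> edges" and u: "!!e. e : E ==> u e : bump" and D: "finite D"
  and inE: "!!e y. e : E ==> y : e ==> y : lattice_box (a n) (b n) & axis j 1 + y : lattice_box (a n) (b n)"
  and inD: "!!i y. (i, y) : D ==> y : lattice_box (a n) (b n) & axis j 1 + y : lattice_box (a n) (b n)"
 shows "(LINT J|nu. (PROD e:E. u e (J ((+) (axis j 1) ` e))) * (PROD i<N. \<integral>sg. up ((+) (axis j 1) ` (D `` {i})) sg \<partial>G n J))
  = (LINT J|nu. (PROD e:E. u e (J e)) * (PROD i<N. \<integral>sg. up (D `` {i}) sg \<partial>G n J))"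
proof -
 let ?p = "torus_edge (a n) (b n) j" and ?L = "lattice_box (a n) (b n)"
 let ?P = "%J. \<lambda>e\<in>edges. J (?p e)"
 let ?F = "%J. (PROD e:E. u e (J e)) * (PROD i<N. \<integral>sg. up (D `` {i}) sg \<partial>G n J)"
 have Fm: "?F : bm nu"
 proof (intro borel_measurable_times borel_measurable_prod)
  show "(%J. u e (J e)) : bm nu" if "e : E" for e
   using that E by (intro mcomp[OF coupling_measurable bump_measurable[OF u]]) auto
  show "(%J. \<integral>sg. up (D `` {i}) sg \<partial>G n J) : bm nu" for i
  proof (rule measurable_integral_kernel[OF _ G_kernel])
   have "finite (D `` {i})" using D by auto
   note [measurable] = up_measurable[OF this]
   show "(%(J, sg). up (D `` {i}) sg) : bm (nu **M cfg)" by measurable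
  qed
 qed
 have pm: "?P : nu ->M nu"
 proof (subst measurable_cong_sets[OF refl sets_nu], rule measurable_restrict)
  fix e :: "'d edge" assume "e : edges"
  then have "?p e : edges" using bij_torus_edge[of "a n" "b n" j] by (auto simp: bij_betw_def)
  then show "(%J. J (?p e)) : bm nu" by (rule coupling_measurable)
 qed
 have pe: "?p e = (+) (axis j 1) ` e" if "e : E" for e
 proof -
  from that E have "e : edges" by auto
  then obtain x i where e: "e = {x, x + axis i 1}" by (rule edgeE)
  then have "x : ?L" "axis j 1 + x : ?L" using inE[OF that, of x] by auto
  then have "torus_site (a n) (b n) j x = axis j 1 + x"
   using torus_step_shift[of x j "a n" "b n"] by (simp add: torus_site_def add.commute)
  then show ?thesis unfolding e torus_edge_step shift_edge_step by simp
 qed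
 have pD: "torus_step (a n) (b n) j ` (D `` {i}) = (+) (axis j 1) ` (D `` {i})" for i
  using inD[of i] by (intro image_cong refl) (auto simp: torus_step_shift add.commute)
 have "(LINT J|nu. ?F J) = (LINT J|distr nu nu ?P. ?F J)"
  by (subst distr_permute_couplings[OF bij_torus_edge]) simp
 also have "... = (LINT J|nu. ?F (?P J))" by (rule integral_distr[OF pm Fm])
 also have "... = (LINT J|nu. (PROD e:E. u e (J ((+) (axis j 1) ` e))) * (PROD i<N. \<integral>sg. up ((+) (axis j 1) ` (D `` {i})) sg \<partial>G n J))"
 proof (rule integral_cong[OF refl])
  fix J :: "'d edge => real"
  have "(PROD e:E. u e (?P J e)) = (PROD e:E. u e (J ((+) (axis j 1) ` e)))"
   using E pe by (intro prod.cong) auto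
  moreover have "(LINT sg|G n (?P J). up (D `` {i}) sg) = (LINT sg|G n J. up ((+) (axis j 1) ` (D `` {i})) sg)" for i
  proof -
   have "finite (D `` {i})" "D `` {i} \<subseteq> ?L" using D inD by auto
   then show ?thesis unfolding G_def pD[symmetric] by (rule gibbs_torus)
  qed
  ultimately show "?F (?P J) = (PROD e:E. u e (J ((+) (axis j 1) ` e))) * (PROD i<N. \<integral>sg. up ((+) (axis j 1) ` (D `` {i})) sg \<partial>G n J)"
   by (simp only:)
 qed
 finally show ?thesis by simp
qed

definition shift :: "'d site => ('d edge => real) \<times> (nat => 'd config) => ('d edge => real) \<times> (nat => 'd config)" where
 "shift x z = (shift_couplings x (fst z), shift_configs x (snd z))"

lemma shift_couplings_measurable [measurable]: "shift_couplings x : nu ->M nu"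
proof (subst measurable_cong_sets[OF refl sets_nu], unfold shift_couplings_def, rule measurable_restrict)
 fix e :: "'d edge" assume "e : edges"
 then show "(%J. J ((+) x ` e)) : bm nu" by (intro coupling_measurable shift_edge_mem)
qed

lemma shift_measurable [measurable]: "shift x : M ->M M"
proof -
 have "shift x : nu **M replicas cfg ->M nu **M replicas cfg"
  unfolding shift_def[abs_def] by measurable
 then show ?thesis using measurable_cong_sets[OF sets_M sets_M] by blast
qed

lemma shift_add: "z : space M ==> shift x (shift y z) = shift (x + y) z"
proof -
 have "shift_couplings x (shift_couplings y J) = shift_couplings (x + y) J" for J
  by (auto simp: shift_couplings_def fun_eq_iff shift_edge_mem image_image add.assoc add.left_commute intro!: arg_cong[of _ _ J])
 then show ?thesis by (simp add: shift_def shift_configs_add)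
qed

lemma shift_0: "z : space M ==> shift 0 z = z"
proof -
 assume "z : space M"
 then have "fst z : extensional edges"
  using space_MD(1) by (simp add: space_nu)
 then have "shift_couplings 0 (fst z) = fst z"
  by (auto simp: shift_couplings_def fun_eq_iff extensional_def)
 then show ?thesis by (simp add: shift_def shift_configs_def prod_eq_iff)
qed

text \<open>For cylinder functions the identity holds in every box that contains the observed sites
  and their translates, hence in the limit \<open>M\<close>; cylinder functions determine the
  law.\<close>

lemma shift_axis_invariant: "distr M M (shift (axis j 1)) = M"
proof (rule measure_eqI_bump[where \<C> = "{cyl D | D. finite D}"])
 let ?x = "axis j (1::int)"
 show "finite_measure (distr M M (shift ?x))" by (rule M.finite_measure_distr) measurable
 show "finite_measure M" by (rule M.finite_measure_axioms)
 show "sets (distr M M (shift ?x)) = sets (PiM edges (%_. borel) **M replicas cfg)" by (simp add: sets_M')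
 show "sets M = sets (PiM edges (%_. borel) **M replicas cfg)" by (rule sets_M')
 fix E :: "'d edge set" and u :: "'d edge => real => real" and C
 assume E: "finite E" "E \<subseteq> edges" and u: "!!e. e : E ==> u e : bump" and C: "C : {cyl D | D :: (nat \<times> 'd site) set. finite D}"
 then obtain D :: "(nat \<times> 'd site) set" where D: "finite D" "C = cyl D" by auto
 \<comment> \<open>The shift is moved from the arguments to the index sets: a cylinder function of
   the shifted arrays is a cylinder function of the original arrays with translated edges and
   sites.\<close>
 define E' where "E' = (`) ((+) ?x) ` E"
 define u' where "u' e = u ((+) (- ?x) ` e)" for e
 define D' where "D' = (%(i, y). (i, ?x + y)) ` D"
 obtain N where N: "fst ` D \<subseteq> {..<N}"
  using D(1) finite_nat_bounded[of "fst ` D"] by auto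
 have fE: "finite e" if "e : E" for e using that E(2) by (auto elim!: edgeE dest!: subsetD)
 have N': "fst ` D' \<subseteq> {..<N}" using N by (auto simp: D'_def)
 have bk: "(+) (- ?x) ` (+) ?x ` e = e" for e by (simp add: image_image)
 have u': "u' e' : bump" if "e' : E'" for e' using that u bk by (auto simp: E'_def u'_def)
 have pE': "(PROD e:E'. u' e (J e)) = (PROD e:E. u e (J ((+) ?x ` e)))" for J
  unfolding E'_def u'_def by (subst prod.reindex[OF inj_on_subset[OF inj_shift_edge]]) (simp_all only: comp_def bk subset_UNIV)
 have D'i: "D' `` {i} = (+) ?x ` (D `` {i})" for i by (auto simp: D'_def image_iff)
 have 1: "(%n. \<integral>J. (PROD e:E'. u' e (J e)) * (PROD i<N. \<integral>sg. up (D' `` {i}) sg \<partial>G n J) \<partial>nu)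
  ----> (LINT z|M. (PROD e:E'. u' e (fst z e)) * indicator (cyl D') (snd z))"
  using E D u' N' by (intro integral_M_cyl) (auto simp: E'_def D'_def shift_edge_mem)
 have 2: "(%n. \<integral>J. (PROD e:E. u e (J e)) * (PROD i<N. \<integral>sg. up (D `` {i}) sg \<partial>G n J) \<partial>nu)
  ----> (LINT z|M. (PROD e:E. u e (fst z e)) * indicator (cyl D) (snd z))"
  using E D u N by (intro integral_M_cyl) auto
 define V where "V = \<Union>E \<union> snd ` D"
 have fV: "finite V" using E D fE by (auto simp: V_def)
 have "\<forall>\<^sub>F n in sequentially. \<forall>y\<in>V \<union> (+) ?x ` V. y : lattice_box (a n) (b n)"
  using boxes fV unfolding boxes_to_lattice_def by (subst eventually_ball_finite_distrib) auto
 then have "\<forall>\<^sub>F n in sequentially. (LINT J|nu. (PROD e:E'. u' e (J e)) * (PROD i<N. \<integral>sg. up (D' `` {i}) sg \<partial>G n J))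
  = (LINT J|nu. (PROD e:E. u e (J e)) * (PROD i<N. \<integral>sg. up (D `` {i}) sg \<partial>G n J))"
 proof eventually_elim
  case (elim n)
  have "y : lattice_box (a n) (b n) & ?x + y : lattice_box (a n) (b n)" if "y : V" for y
   using elim that by blast
  then show ?case
   unfolding pE' D'i using E D u by (intro gibbs_shift) (auto simp: V_def image_iff, force+)
 qed
 from Lim_transform_eventually[OF 1 this] 2
 have "(LINT z|M. (PROD e:E'. u' e (fst z e)) * indicator (cyl D') (snd z)) = (LINT z|M. (PROD e:E. u e (fst z e)) * indicator (cyl D) (snd z))"
  by (rule LIMSEQ_unique)
 moreover have "(LINT z|distr M M (shift ?x). (PROD e:E. u e (fst z e)) * indicator (cyl D) (snd z))
  = (LINT z|M. (PROD e:E'. u' e (fst z e)) * indicator (cyl D') (snd z))"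
 proof -
  have cyl_m: "cyl D : sets (replicas cfg)"
   using replica_config_generator(1)[where 'd = 'd] D(1) by auto
  have "(%z. (PROD e:E. u e (fst z e)) * indicator (cyl D) (snd z) :: real) : bm (nu **M replicas cfg)"
  proof (intro borel_measurable_times borel_measurable_prod)
   fix e assume "e : E"
   then show "(%z. u e (fst z e)) : bm (nu **M replicas cfg)"
    using E by (intro mcomp[OF mcomp[OF measurable_fst coupling_measurable] bump_measurable[OF u]]) auto
  next
   show "(%z. indicator (cyl D) (snd z) :: real) : bm (nu **M replicas cfg)"
    using cyl_m by measurable
  qed
  then have m: "(%z. (PROD e:E. u e (fst z e)) * indicator (cyl D) (snd z) :: real) : bm M"
   using mcs[OF sets_M] by blast
  show ?thesis
   unfolding integral_distr[OF shift_measurable m]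
  proof (intro integral_cong refl)
   fix z assume "z : space M"
   then have s: "snd z : space (replicas cfg)" by (rule space_MD)
   have "shift_configs ?x (snd z) : cyl D \<longleftrightarrow> snd z : cyl D'"
    using s measurable_space[OF shift_configs_measurable s, of ?x]
    by (auto simp: cyl_def shift_configs_def D'_def)
   moreover have "(PROD e:E. u e (shift_couplings ?x (fst z) e)) = (PROD e:E'. u' e (fst z e))"
    unfolding pE' using E by (intro prod.cong) (auto simp: shift_couplings_def)
   ultimately show "(PROD e:E. u e (fst (shift ?x z) e)) * indicator (cyl D) (snd (shift ?x z))
    = (PROD e:E'. u' e (fst z e)) * (indicator (cyl D') (snd z) :: real)"
    by (simp add: shift_def indicator_def)
  qed
 qed
 ultimately show "(LINT z|distr M M (shift ?x). (PROD e:E. u e (fst z e)) * indicator C (snd z))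
  = (LINT z|M. (PROD e:E. u e (fst z e)) * indicator C (snd z))"
  by (simp add: D(2))
qed (rule replica_config_generator)+

text \<open>The translations that preserve \<open>M\<close> form a subgroup, and it contains all
  unit vectors.\<close>

lemma shift_invariant: "distr M M (shift x) = M"
proof -
 define S where "S = {x. distr M M (shift x) = M}"
 have add: "x + y : S" if "x : S" "y : S" for x y
 proof -
  have "distr M M (shift (x + y)) = distr M M (shift x \<circ> shift y)"
   by (intro distr_cong) (auto simp: shift_add)
  also have "... = distr (distr M M (shift y)) M (shift x)" by (subst distr_distr) auto
  finally show ?thesis using that by (simp add: S_def)
 qed
 have zero: "0 : S"
  unfolding S_def using distr_cong[of M M M M "shift 0" "%z. z"] shift_0 by (simp add: distr_id)
 have neg: "- x : S" if "x : S" for x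
 proof -
  have "distr M M (shift (- x)) = distr (distr M M (shift x)) M (shift (- x))" using that by (simp add: S_def)
  also have "... = distr M M (shift (- x) \<circ> shift x)" by (subst distr_distr) auto
  also have "... = distr M M (shift 0)" by (intro distr_cong) (auto simp: shift_add)
  finally show ?thesis using zero by (simp add: S_def)
 qed
 have nat: "axis j (int n) : S" for j :: 'd and n
 proof (induction n)
  case 0
  have "axis j (0::int) = 0" by (simp add: axis_def vec_eq_iff)
  then show ?case using zero by (simp only: of_nat_0)
 next
  case (Suc n)
  have "axis j (int (Suc n)) = axis j (int n) + axis j 1" by (simp add: axis_def vec_eq_iff)
  then show ?case using add[OF Suc] shift_axis_invariant by (simp add: S_def)
 qed
 have ax: "axis j t : S" for j :: 'd and t :: int
 proof (cases "t >= 0")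
  case True
  then show ?thesis using nat[of j "nat t"] by simp
 next
  case False
  have "axis j t = - axis j (int (nat (- t)))" using False by (auto simp: axis_def vec_eq_iff)
  show ?thesis unfolding \<open>axis j t = _\<close> by (rule neg[OF nat])
 qed
 have "finite F ==> (SUM j:F. axis j (x $ j)) : S" for F :: "'d set"
  by (induction F rule: finite_induct) (auto intro: zero add ax)
 moreover have "(SUM j:UNIV. axis j (x $ j)) = x"
  by (simp add: vec_eq_iff axis_def sum.delta)
 ultimately show ?thesis using finite[of "UNIV :: 'd set"] by (metis (mono_tags) S_def mem_Collect_eq)
qed

sublocale shift: lattice_action M shift
 by unfold_locales (auto simp: shift_invariant shift_add)

end

lemma edge_spin_shift: "edge_spin (shift_configs x sg i) e = edge_spin (sg i) ((+) x ` e)"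
 unfolding edge_spin_def shift_configs_def by (subst prod.reindex) auto

section \<open>Limits of overlaps and their independence of the couplings\<close>

lemma overlap_array_measurable:
 assumes R: "(%(x, y). R x y) : bm (X **M X)"
 shows "overlap_array R : replicas X ->M array_space"
 unfolding array_space_def
proof (rule measurable_PiM_single')
 fix p :: "nat \<times> nat"
 have pr: "(%x. (x (fst p), x (snd p))) : replicas X ->M X **M X" by measurable
 have "(%x. if fst p = snd p then 1 else R (x (fst p)) (x (snd p))) : bm (replicas X)"
  using mcomp[OF pr R] by simp
 then show "(%x. overlap_array R x p) : bm (replicas X)"
  by (simp add: overlap_array_def case_prod_beta)
qed auto

definition ov :: "(nat => ('d::finite) config) => nat \<times> nat => real" where
 "ov = overlap_array edge_overlap"

lemma ov_measurable [measurable]: "ov : replicas (cfg :: ('d::finite) config measure) ->M array_space"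
 unfolding ov_def by (rule overlap_array_measurable) measurable

context coupling
begin

text \<open>Products over edge sets that contain \<open>A\<close> suffice, because bumps that equal
  \<open>1\<close> on growing intervals fill in missing coordinates. The densities \<open>g\<close>
  and \<open>c\<close> then define the same measure.\<close>

lemma AE_const_from_bump:
 assumes g[measurable]: "g : bm nu" and gb: "!!J. 0 <= g J & g J <= (1::real)" and c: "0 <= c" "c <= 1"
  and A: "finite A" "A \<subseteq> edges"
  and eq: "!!E u. finite E ==> A \<subseteq> E ==> E \<subseteq> edges ==> (!!e. e : E ==> u e : bump) ==>
   (LINT J|nu. (PROD e:E. u e (J e)) * g J) = (LINT J|nu. (PROD e:E. u e (J e))) * c"
 shows "AE J in nu. g J = c"
proof -
 let ?Y = "count_space (UNIV :: unit set)"
 let ?S = "PiM edges (%_. borel :: real measure) **M ?Y"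
 have um: "(%J. PROD e:E. u e (J e)) : bm nu" if "E \<subseteq> edges" "!!e. e : E ==> u e : bump" for E u
  using that by (intro borel_measurable_prod mcomp[OF coupling_measurable bump_measurable]) auto
 have ub: "0 <= (PROD e:E. u e (J e))" "(PROD e:E. u e (J e)) <= 1" if "!!e. e : E ==> u e : bump"
  for E :: "'d edge set" and u J
  using that bump_bounds by (auto intro!: prod_nonneg prod_le_1)
 have eq': "(LINT J|nu. (PROD e:E. u e (J e)) * g J) = (LINT J|nu. (PROD e:E. u e (J e))) * c"
  if E: "finite E" "E \<subseteq> edges" and u: "!!e. e : E ==> u e : bump" for E u
 proof -
  define p where "p m x = max 0 (min 1 (real m - \<bar>x\<bar>))" for m x
  define v where "v m e = (if e : E then u e else p m)" for m e
  have p: "p m : bump" for m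
  proof -
   have "continuous_on UNIV (p m)" unfolding p_def[abs_def] by (intro continuous_intros)
   then show ?thesis by (auto simp: bump_def p_def intro!: exI[of _ "real m"])
  qed
  have v: "v m e : bump" for m e using u p by (cases "e : E") (auto simp: v_def)
  have plim: "(%m. p m x) ----> 1" for x
  proof -
   obtain n where n: "real n > 1 + \<bar>x\<bar>" using reals_Archimedean2 by blast
   have "p m x = 1" if "m >= n" for m using n that by (auto simp: p_def)
   then show ?thesis by (intro tendsto_eventually) (auto simp: eventually_sequentially)
  qed
  have lim: "(%m. PROD e:E \<union> A. v m e (J e)) ----> (PROD e:E. u e (J e))" for J
  proof -
   have "(%m. PROD e:E \<union> A. v m e (J e)) ----> (PROD e:E \<union> A. if e : E then u e (J e) else 1)"
    by (intro tendsto_prod) (auto simp: v_def plim)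
   also have "(PROD e:E \<union> A. if e : E then u e (J e) else 1) = (PROD e:E. u e (J e))"
    using E A by (intro prod.mono_neutral_cong_right) auto
   finally show ?thesis .
  qed
  have EA: "finite (E \<union> A)" "A \<subseteq> E \<union> A" "E \<union> A \<subseteq> edges" using E A by auto
  have 1: "(%m. \<integral>J. (PROD e:E \<union> A. v m e (J e)) * g J \<partial>nu) ----> (LINT J|nu. (PROD e:E. u e (J e)) * g J)"
  proof (rule integral_dominated_convergence[where w = "%_. 1"])
   show "(%J. (PROD e:E. u e (J e)) * g J) : bm nu" using um[OF E(2) u] by measurable
   show "(%J. (PROD e:E \<union> A. v m e (J e)) * g J) : bm nu" for m using um[OF EA(3) v] by measurable
   show "AE J in nu. (%m. (PROD e:E \<union> A. v m e (J e)) * g J) ----> (PROD e:E. u e (J e)) * g J"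
    by (intro AE_I2 tendsto_mult_right lim)
   show "AE J in nu. norm ((PROD e:E \<union> A. v m e (J e)) * g J) <= 1" for m
    using ub[of "E \<union> A" "v m"] v gb by (intro AE_I2) (auto simp: abs_mult intro!: mult_le_one)
  qed simp
  have 2: "(%m. (LINT J|nu. (PROD e:E \<union> A. v m e (J e))) * c) ----> (LINT J|nu. (PROD e:E. u e (J e))) * c"
  proof (intro tendsto_mult_right integral_dominated_convergence[where w = "%_. 1"])
   show "(%J. (PROD e:E. u e (J e))) : bm nu" by (rule um[OF E(2) u])
   show "(%J. (PROD e:E \<union> A. v m e (J e))) : bm nu" for m by (rule um[OF EA(3) v])
   show "AE J in nu. (%m. (PROD e:E \<union> A. v m e (J e))) ----> (PROD e:E. u e (J e))"
    by (intro AE_I2 lim)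
   show "AE J in nu. norm (PROD e:E \<union> A. v m e (J e)) <= 1" for m
    using ub[of "E \<union> A" "v m"] v by (intro AE_I2) auto
  qed simp
  show ?thesis using LIMSEQ_unique[OF 1] 2 eq[OF EA v] by simp
 qed
 \<comment> \<open>A second factor with one point makes \<open>measure_eqI_bump\<close> applicable
   to measures on couplings alone.\<close>
 define mk where "mk h = distr (density nu (%J. ennreal (h J))) ?S (%J. (J, ()))" for h :: "('d edge => real) => real"
 have pairm: "(%J. (J, ())) : nu ->M ?S"
 proof (rule measurable_Pair)
  show "(%x. x) : nu ->M PiM edges (%_. borel)" by (rule measurable_ident_sets[OF sets_nu])
 qed simp
 have fin: "finite_measure (density nu (%J. ennreal (h J)))"
  if [measurable]: "h : bm nu" and "!!J. 0 <= h J & h J <= 1" for h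
 proof (rule finite_measureI)
  have "(\<integral>\<^sup>+x. ennreal (h x) * indicator (space nu) x \<partial>nu) <= (\<integral>\<^sup>+x. 1 \<partial>nu)"
   using that by (intro nn_integral_mono) (auto simp: indicator_def ennreal_le_1)
  then show "emeasure (density nu (%J. ennreal (h J))) (space (density nu (%J. ennreal (h J)))) ~= \<infinity>"
   by (subst emeasure_density) (auto simp: nu.emeasure_space_1 top_unique cong: if_cong)
 qed
 have int: "(LINT z|mk h. (PROD e:E. u e (fst z e)) * indicator C (snd z)) = (LINT J|nu. (PROD e:E. u e (J e)) * h J) * indicator C ()"
  if [measurable]: "h : bm nu" and h: "!!J. 0 <= h J & h J <= 1" and E: "E \<subseteq> edges" and u: "!!e. e : E ==> u e : bump"
  for h E u and C :: "unit set"
 proof -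
  have m: "(%z. (PROD e:E. u e (fst z e)) * indicator C (snd z) :: real) : bm ?S"
  proof (intro borel_measurable_times borel_measurable_prod)
   show "(%z. u e (fst z e)) : bm ?S" if "e : E" for e
   proof -
    have "e : edges" using E that by auto
    then have "(%z. fst z e) : bm ?S"
     by (rule mcomp[OF measurable_fst measurable_component_singleton])
    then show ?thesis by (rule mcomp[OF _ bump_measurable[OF u[OF that]]])
   qed
  qed measurable
  have "(LINT z|mk h. (PROD e:E. u e (fst z e)) * indicator C (snd z))
   = (LINT J|density nu (%J. ennreal (h J)). (PROD e:E. u e (J e)) * indicator C ())"
   unfolding mk_def using pairm m by (subst integral_distr) auto
  also have "... = (LINT J|nu. h J * ((PROD e:E. u e (J e)) * indicator C ()))"
   using h um[OF E u] by (intro integral_real_density) auto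
  also have "... = (LINT J|nu. ((PROD e:E. u e (J e)) * h J) * indicator C ())"
   by (intro integral_cong refl) (simp only: mult_ac)
  finally show ?thesis by simp
 qed
 have "mk g = mk (%_. c)"
 proof (rule measure_eqI_bump[where \<C> = "Pow UNIV"])
  show "finite_measure (mk g)" "finite_measure (mk (%_. c))"
   unfolding mk_def using gb c pairm by (auto intro!: finite_measure.finite_measure_distr fin)
  show "sets ?Y = sigma_sets (space ?Y) (Pow UNIV)"
   unfolding sets_count_space space_count_space by (auto intro: sigma_sets.Basic)
  show "Int_stable (Pow (UNIV :: unit set))" by (auto simp: Int_stable_def)
  fix E :: "'d edge set" and u :: "'d edge => real => real" and C :: "unit set" assume E: "finite E" "E \<subseteq> edges" and u: "!!e. e : E ==> u e : bump"
  show "(LINT z|mk g. (PROD e:E. u e (fst z e)) * indicator C (snd z)) = (LINT z|mk (%_. c). (PROD e:E. u e (fst z e)) * indicator C (snd z))"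
  proof -
   have 1: "(LINT z|mk g. (PROD e:E. u e (fst z e)) * indicator C (snd z)) = (LINT J|nu. (PROD e:E. u e (J e)) * g J) * indicator C ()"
    by (rule int[OF g gb E(2) u])
   have 2: "(LINT z|mk (%_. c). (PROD e:E. u e (fst z e)) * indicator C (snd z)) = (LINT J|nu. (PROD e:E. u e (J e)) * c) * indicator C ()"
    by (rule int[OF _ _ E(2) u]) (use c in auto)
   have 3: "(LINT J|nu. (PROD e:E. u e (J e)) * g J) = (LINT J|nu. (PROD e:E. u e (J e))) * c" by (rule eq'[OF E u])
   show ?thesis unfolding 1 2 3 by simp
  qed
 qed (simp_all add: mk_def)
 have "density nu (%J. ennreal (g J)) = density nu (%J. ennreal c)"
 proof (rule measure_eqI)
  fix B assume B: "B : sets (density nu (%J. ennreal (g J)))"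
  then have B': "B \<times> UNIV : sets ?S" by (intro pair_measureI) (auto simp: sets_nu)
  have em: "emeasure (mk h) (B \<times> UNIV) = emeasure (density nu (%J. ennreal (h J))) B" for h
  proof -
   have "(%J. (J, ())) -` (B \<times> UNIV) \<inter> space (density nu (%J. ennreal (h J))) = B"
    using sets.sets_into_space[OF B] by auto
   then show ?thesis unfolding mk_def using pairm B' by (subst emeasure_distr) auto
  qed
  then show "emeasure (density nu (%J. ennreal (g J))) B = emeasure (density nu (%J. ennreal c)) B"
   using em[of g] em[of "%_. c"] unfolding \<open>mk g = mk (%_. c)\<close> by (simp only:)
 qed simp
 then have "AE J in nu. ennreal (g J) = ennreal c"
  by (subst (asm) nu.density_unique_iff) auto
 then show ?thesis by eventually_elim (use gb c in \<open>simp add: ennreal_inj\<close>)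
qed

end

context metastate
begin

text \<open>The local observable for the ergodic theorem: the contribution to the overlap of
  replicas \<open>i\<close> and \<open>j\<close> by the edges that leave the origin upward.\<close>

definition edge_fn :: "nat => nat => ('d edge => real) \<times> (nat => 'd config) => real" where
 "edge_fn i j z = (SUM k:UNIV. edge_spin (snd z i) {0, axis k 1} * edge_spin (snd z j) {0, axis k 1})"

lemma edge_fn_shift: "edge_fn i j (shift x z) = (SUM k:UNIV. edge_spin (snd z i) {x, x + axis k 1} * edge_spin (snd z j) {x, x + axis k 1})"
 by (simp add: edge_fn_def shift_def edge_spin_shift)

lemma configs_mem: "z : space M ==> snd z i : space cfg"
 using space_MD(2)[of z] by (auto simp: space_replicas_config)

lemma edge_fn_measurable: "edge_fn i j : bm M"
proof -
 have "edge_fn i j : bm (nu **M replicas cfg)"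
  unfolding edge_fn_def[abs_def] by measurable
 then show ?thesis using mcs[OF sets_M] by blast
qed

lemma spin_product_bound:
 assumes "z : space M" "e : edges"
 shows "\<bar>edge_spin (snd z i) e * edge_spin (snd z j) e\<bar> <= 1"
 using edge_spin_sign[OF configs_mem[OF assms(1), of i] assms(2)] edge_spin_sign[OF configs_mem[OF assms(1), of j] assms(2)] by auto

lemma edge_fn_bound: "z : space M ==> \<bar>edge_fn i j z\<bar> <= real CARD('d)"
proof -
 assume z: "z : space M"
 have "\<bar>edge_fn i j z\<bar> <= (SUM k:(UNIV :: 'd set). 1)"
  unfolding edge_fn_def
  using spin_product_bound[OF z] step_edge[of 0] by (intro order_trans[OF sum_abs] sum_mono) auto
 then show ?thesis by simp
qed

lemma overlap_avg_tendsto: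
 assumes z: "z : space M" and L: "(%n. shift.avg n (edge_fn i j) z) ----> L"
 shows "(%n. overlap_avg n (snd z i) (snd z j)) ----> L / real CARD('d)"
 unfolding overlap_avg_def
proof (rule edge_average_tendsto)
 show "(%n. (SUM x:cube n. SUM k:UNIV. edge_spin (snd z i) {x, x + axis k 1} * edge_spin (snd z j) {x, x + axis k 1}) / real (card (cube n :: 'd site set))) ----> L"
  using L unfolding shift.avg_def edge_fn_shift .
qed (rule spin_product_bound[OF z])

text \<open>The ergodic theorem applies to each of the countably many pairs of replicas, and the
  limit is invariant because averages are asymptotically invariant.\<close>

lemma AE_overlap_converges:
 "AE z in M. \<forall>i j. (%n. overlap_avg n (snd z i) (snd z j)) ----> edge_overlap (snd z i) (snd z j)
  & (\<forall>x. edge_overlap (snd (shift x z) i) (snd (shift x z) j) = edge_overlap (snd z i) (snd z j))"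
proof -
 have "AE z in M. \<forall>i j. convergent (%n. shift.avg n (edge_fn i j) z)"
  unfolding AE_all_countable
  using shift.pointwise_ergodic[OF edge_fn_measurable edge_fn_bound] by blast
 then show ?thesis using AE_space
 proof eventually_elim
  case (elim z)
  show ?case
  proof (intro allI conjI)
   fix i j
   obtain L where L: "(%n. shift.avg n (edge_fn i j) z) ----> L" using elim(1) by (auto simp: convergent_def)
   note 1 = overlap_avg_tendsto[OF elim(2) L]
   have eo: "edge_overlap (snd z i) (snd z j) = L / real CARD('d)"
    unfolding edge_overlap_eq by (rule limI[OF 1])
   show "(%n. overlap_avg n (snd z i) (snd z j)) ----> edge_overlap (snd z i) (snd z j)" unfolding eo by (rule 1)
   fix x
   have "(%n. shift.avg n (edge_fn i j) (shift x z) - shift.avg n (edge_fn i j) z) ----> 0"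
    by (rule shift.avg_shift_tendsto[OF edge_fn_bound elim(2)])
   from tendsto_add[OF this L] have "(%n. shift.avg n (edge_fn i j) (shift x z)) ----> L" by simp
   from overlap_avg_tendsto[OF shift.T_space[OF elim(2)] this]
   show "edge_overlap (snd (shift x z) i) (snd (shift x z) j) = edge_overlap (snd z i) (snd z j)"
    unfolding eo unfolding edge_overlap_eq by (rule limI)
  qed
 qed
qed

lemma AE_ov_shift: "AE z in M. \<forall>x. ov (snd (shift x z)) = ov (snd z)"
 using AE_overlap_converges by eventually_elim (auto simp: ov_def overlap_array_def fun_eq_iff)

text \<open>The overlap law averaged over the couplings. It turns out to be the overlap law for
  almost every fixed \<open>J\<close>.\<close>

definition Qbar :: "(nat \<times> nat => real) measure" where "Qbar = distr M array_space (%z. ov (snd z))"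

lemma ov_snd_measurable [measurable]: "(%z. ov (snd z)) : M ->M array_space"
proof -
 have "(%z. ov (snd z)) : nu **M replicas cfg ->M array_space" by measurable
 then show ?thesis using mcs[OF sets_M] by blast
qed

lemma prob_Qbar: "prob_space Qbar" unfolding Qbar_def by (rule M.prob_space_distr) measurable

lemma integral_M_fst:
 assumes g: "g : bm nu" and B: "!!J. \<bar>g J\<bar> <= (B::real)"
 shows "(LINT z|M. g (fst z)) = (LINT J|nu. g J)"
proof -
 have "(LINT z|M. g (fst z)) = (LINT J|nu. (LINT sg|K J. g (fst (J, sg))))"
  unfolding M_def by (rule integral_joint_law[OF prob_nu K_kernel mcomp[OF measurable_fst g] B])
 also have "... = (LINT J|nu. g J)"
 proof (intro integral_cong refl)
  fix J assume "J : space nu"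
  then interpret K: prob_space "K J" using measurable_space[OF K_kernel] by (auto simp: space_prob_algebra)
  show "(LINT sg|K J. g (fst (J, sg))) = g J" by (simp add: K.prob_space)
 qed
 finally show ?thesis .
qed

lemma shift_couplings_invariant: "distr nu nu (shift_couplings x) = nu"
proof -
 have "bij_betw ((`) ((+) x)) edges edges"
 proof (rule bij_betw_imageI)
  show "inj_on ((`) ((+) x)) edges" by (rule inj_on_subset[OF inj_shift_edge]) simp
  show "(`) ((+) x) ` edges = edges"
  proof
   show "(`) ((+) x) ` edges \<subseteq> edges" using shift_edge_mem by blast
   show "edges \<subseteq> (`) ((+) x) ` edges"
   proof
    fix e :: "'d edge" assume "e : edges"
    then have "(+) (- x) ` e : edges" by (rule shift_edge_mem)
    moreover have "e = (+) x ` (+) (- x) ` e" by (simp add: image_image)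
    ultimately show "e : (`) ((+) x) ` edges" by blast
   qed
  qed
 qed
 from distr_permute_couplings[OF this] show ?thesis by (simp add: shift_couplings_def[abs_def])
qed

text \<open>The indicator \<open>I\<close> of an overlap event is translation invariant, so the
  covariance \<open>a\<close> of the centered product \<open>X\<close> with \<open>I\<close> does
  not change when \<open>X\<close> is replaced by a translate. Translates by sufficiently separated
  vectors are independent and centered; the sum of \<open>m * m\<close> of them has first absolute
  moment at most \<open>m\<close>, whence \<open>m * \<bar>a\<bar> <= 1\<close> for all
  \<open>m\<close>.\<close>

lemma integral_M_overlap:
 assumes E: "finite E" "E \<subseteq> edges" and u: "!!e. e : E ==> u e : bump" and D[measurable]: "D : sets array_space"
 shows "(LINT z|M. (PROD e:E. u e (fst z e)) * indicator D (ov (snd z))) = (LINT J|nu. (PROD e:E. u e (J e))) * measure Qbar D"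
proof -
 define U where "U J = (PROD e:E. u e (J e))" for J
 define c where "c = (LINT J|nu. U J)"
 define X where "X J = U J - c" for J
 have Um[measurable]: "U : bm nu"
  unfolding U_def[abs_def] using E u by (intro borel_measurable_prod mcomp[OF coupling_measurable bump_measurable]) auto
 have Ub: "0 <= U J" "U J <= 1" for J
  unfolding U_def using bump_bounds[OF u] by (auto intro!: prod_nonneg prod_le_1)
 have Ui: "integrable nu U" using Ub by (intro nu.integrable_const_bound[of _ 1]) auto
 have cb: "0 <= c" "c <= 1"
  unfolding c_def using Ub nu.integral_le_const[OF Ui, of 1] by auto
 have Xm[measurable]: "X : bm nu" unfolding X_def[abs_def] by measurable
 have Xb: "\<bar>X J\<bar> <= 1" for J using Ub[of J] cb by (auto simp: X_def abs_le_iff)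
 have X0: "(LINT J|nu. X J) = 0" using Ui by (simp add: X_def c_def nu.prob_space)
 have "finite e" if "e : E" for e using subsetD[OF E(2) that] by (auto elim: edgeE)
 then have fV: "finite (\<Union>E)" using E(1) by auto
 obtain r where r: "\<Union>E \<subseteq> cube r"
 proof -
  have "\<exists>r. \<forall>y\<in>\<Union>E. y : cube r"
   using fV
  proof (induction rule: finite_induct)
   case (insert y F)
   then obtain r s where "\<forall>y\<in>F. y : cube r" "y : cube s" using ex_mem_cube by blast
   then show ?case using cube_mono[of r "r + s"] cube_mono[of s "r + s"] by (intro exI[of _ "r + s"]) auto
  qed simp
  then show ?thesis using that by blast
 qed
 define j :: 'd where "j = undefined"
 \<comment> \<open>All endpoints of \<open>E\<close> have coordinates between \<open>- r\<close> and
   \<open>r\<close>; shifts by multiples of \<open>2 * int r + 1\<close> along one axis make the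
   translates of \<open>E\<close> disjoint.\<close>
 define x where "x n = axis j (int n * (2 * int r + 1))" for n :: nat
 define Y where "Y n J = X (shift_couplings (x n) J)" for n J
 define A where "A n = (`) ((+) (x n)) ` E" for n
 have Ae: "A n \<subseteq> edges" for n using E shift_edge_mem by (auto simp: A_def)
 have disj: "A n \<inter> A m = {}" if "n ~= m" for n m
 proof (rule ccontr)
  assume "A n \<inter> A m ~= {}"
  then obtain e e' where e: "e : E" "e' : E" "(+) (x n) ` e = (+) (x m) ` e'" by (auto simp: A_def)
  obtain y i where "e = {y, y + axis i 1}" using e(1) E(2) edgeE[of e] by auto
  then have y: "y : e" by simp
  then have "x n + y : (+) (x m) ` e'" using e(3) by blast
  then obtain y' where y': "y' : e'" "x n + y = x m + y'" by auto
  have "y : cube r" "y' : cube r" using r e y y' by auto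
  then have b: "\<bar>y $ j\<bar> <= int r" "\<bar>y' $ j\<bar> <= int r" by (auto simp: mem_cube)
  have "(x n + y) $ j = (x m + y') $ j" using y' by simp
  then have eq: "(int n - int m) * (2 * int r + 1) = y' $ j - y $ j" by (simp add: x_def axis_def algebra_simps)
  have "\<bar>int n - int m\<bar> >= 1" using that by linarith
  then have "1 * (2 * int r + 1) <= \<bar>int n - int m\<bar> * (2 * int r + 1)" by (intro mult_right_mono) auto
  also have "... = \<bar>y' $ j - y $ j\<bar>" unfolding eq[symmetric] by (simp add: abs_mult)
  also have "... <= 2 * int r" using b by linarith
  finally show False by simp
 qed
 \<comment> \<open>\<open>Y n\<close> as a function of the couplings on \<open>A n\<close> only, the
   form in which independence applies.\<close>
 define f where "f n J = (PROD e:E. u e (J ((+) (x n) ` e))) - c" for n and J :: "'d edge => real"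
 have Yf: "Y n J = f n (restrict J (A n))" for n J
  using E by (auto simp: Y_def X_def U_def f_def shift_couplings_def A_def intro!: prod.cong)
 have fb: "\<bar>f n J\<bar> <= 1" for n J
 proof -
  have "0 <= (PROD e:E. u e (J ((+) (x n) ` e)))" "(PROD e:E. u e (J ((+) (x n) ` e))) <= 1"
   using bump_bounds[OF u] by (auto intro!: prod_nonneg prod_le_1)
  then show ?thesis using cb by (auto simp: f_def abs_le_iff)
 qed
 have fm: "f n : bm (PiM (A n) (%_. borel))" for n
  unfolding f_def[abs_def]
 proof (intro borel_measurable_diff borel_measurable_prod borel_measurable_const)
  fix e assume "e : E"
  then have "(%J. J ((+) (x n) ` e)) : bm (PiM (A n) (%_. borel))"
   by (intro measurable_component_singleton) (auto simp: A_def)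
  then show "(%J. u e (J ((+) (x n) ` e))) : bm (PiM (A n) (%_. borel))"
   by (rule mcomp[OF _ bump_measurable[OF u[OF \<open>e : E\<close>]]])
 qed
 have Ym[measurable]: "Y n : bm nu" for n unfolding Y_def[abs_def] by measurable
 have Yb: "\<bar>Y n J\<bar> <= 1" for n J unfolding Y_def by (rule Xb)
 have Y0: "(LINT J|nu. Y n J) = 0" for n
 proof -
  have "(LINT J|nu. X J) = (LINT J|distr nu nu (shift_couplings (x n)). X J)" by (simp add: shift_couplings_invariant)
  also have "... = (LINT J|nu. Y n J)" unfolding Y_def by (rule integral_distr) measurable
  finally show ?thesis using X0 by simp
 qed
 have YY: "(LINT J|nu. Y n J * Y m J) = 0" if "n ~= m" for n m
 proof -
  have "(LINT J|nu. Y n J * Y m J) = (LINT J|nu. Y n J) * (LINT J|nu. Y m J)"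
   unfolding Yf by (rule integral_indep_couplings[OF disj[OF that] Ae Ae fm fb fm fb])
  then show ?thesis using Y0 by simp
 qed
 have intYY: "integrable nu (%J. Y n J * Y m J)" for n m
  using Yb by (intro nu.integrable_const_bound[of _ 1]) (auto simp: abs_mult intro!: mult_le_one)
 have S2: "(LINT J|nu. (SUM n<N. Y n J)\<^sup>2) <= real N" for N
 proof -
  have "(LINT J|nu. (SUM n<N. Y n J)\<^sup>2) = (SUM n<N. SUM m<N. \<integral>J. Y n J * Y m J \<partial>nu)"
   unfolding power2_eq_square sum_product using intYY by simp
  also have "... = (SUM n<N. \<integral>J. Y n J * Y n J \<partial>nu)"
   using YY by (intro sum.cong refl) (subst sum.remove, auto intro!: sum.neutral)
  also have "... <= (SUM n<N. 1)"
  proof (intro sum_mono)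
   fix n
   have "Y n J * Y n J <= 1" for J 
    using mult_mono[OF Yb[of n J] Yb[of n J]] by simp
   then show "(LINT J|nu. Y n J * Y n J) <= 1" using intYY by (intro nu.integral_le_const) auto
  qed
  finally show ?thesis by simp
 qed
 have fstm: "fst : M ->M nu" using measurable_fst mcs[OF sets_M] by blast
 note fstm[measurable]
 define I where "I z = (indicator D (ov (snd z)) :: real)" for z :: "('d edge => real) \<times> (nat => 'd config)"
 have Im[measurable]: "I : bm M" unfolding I_def[abs_def] by measurable
 have Ib: "0 <= I z" "I z <= 1" for z by (auto simp: I_def)
 define a where "a = (LINT z|M. X (fst z) * I z)"
 \<comment> \<open>Invariance of \<open>M\<close>, together with \<open>AE_ov_shift\<close> for the
   overlaps.\<close>
 have an: "(LINT z|M. Y n (fst z) * I z) = a" for n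
 proof -
  have "a = (LINT z|M. X (fst (shift (x n) z)) * I (shift (x n) z))"
   unfolding a_def by (rule shift.integral_T[symmetric]) measurable
  also have "... = (LINT z|M. Y n (fst z) * I z)"
  proof (rule integral_cong_AE)
   show "AE z in M. X (fst (shift (x n) z)) * I (shift (x n) z) = Y n (fst z) * I z"
    using AE_ov_shift by eventually_elim (simp add: I_def Y_def shift_def)
  qed measurable
  finally show ?thesis by simp
 qed
 have bound: "real m * \<bar>a\<bar> <= 1" if "m > 0" for m :: nat
 proof -
  let ?S = "%J. SUM n<m * m. Y n J"
  have intS: "integrable M (%z. Y n (fst z) * I z)" for n
   using Yb Ib by (intro M.integrable_const_bound[of _ 1]) (auto simp: abs_mult intro!: mult_le_one)
  have Sb: "\<bar>?S J\<bar> <= real (m * m)" for J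
  proof -
   have "(SUM n<m * m. \<bar>Y n J\<bar>) <= (SUM n<m * m. 1)" using Yb by (intro sum_mono)
   also have "... = real (m * m)" by simp
   finally show ?thesis by (rule order_trans[OF sum_abs])
  qed
  have "real (m * m) * a = (LINT z|M. ?S (fst z) * I z)"
   unfolding sum_distrib_right using intS an by simp
  then have "\<bar>real (m * m) * a\<bar> <= (LINT z|M. \<bar>?S (fst z) * I z\<bar>)"
   using integral_abs_bound by simp
  \<comment> \<open>The inequality \<open>\<bar>S\<bar> <= (m + S^2 / m) / 2\<close> is balanced for
    a sum \<open>S\<close> of \<open>m * m\<close> terms whose second moment is at most
    \<open>m * m\<close>.\<close>
  also have "... <= (LINT z|M. (real m + (?S (fst z))\<^sup>2 / real m) / 2)"
  proof (rule integral_mono)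
   show "integrable M (%z. \<bar>?S (fst z) * I z\<bar>)"
    unfolding sum_distrib_right using intS by auto
   show "integrable M (%z. (real m + (?S (fst z))\<^sup>2 / real m) / 2)"
   proof (rule M.integrable_const_bound[of _ "(real m + (real (m * m))\<^sup>2 / real m) / 2"])
    have "(?S J)\<^sup>2 <= (real (m * m))\<^sup>2" for J
     using Sb[of J] by (simp add: abs_le_square_iff[symmetric])
    then show "AE z in M. norm ((real m + (?S (fst z))\<^sup>2 / real m) / 2) <= (real m + (real (m * m))\<^sup>2 / real m) / 2"
     using that by (intro AE_I2) (auto intro!: divide_right_mono)
   qed measurable
   fix z
   have "\<bar>?S (fst z) * I z\<bar> <= \<bar>?S (fst z)\<bar> * 1" unfolding abs_mult using Ib[of z] by (intro mult_left_mono) auto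
   also have "... <= (real m + (?S (fst z))\<^sup>2 / real m) / 2"
   proof -
    have "0 <= (\<bar>?S (fst z)\<bar> - real m)\<^sup>2" by simp
    then have "2 * \<bar>?S (fst z)\<bar> * real m <= real m * real m + (?S (fst z))\<^sup>2"
     by (simp add: power2_diff power2_eq_square algebra_simps)
    then show ?thesis using that by (simp add: field_simps)
   qed
   finally show "\<bar>?S (fst z) * I z\<bar> <= (real m + (?S (fst z))\<^sup>2 / real m) / 2" .
  qed
  also have "... = (LINT J|nu. (real m + (?S J)\<^sup>2 / real m) / 2)"
  proof (rule integral_M_fst[where B = "(real m + (real (m * m))\<^sup>2 / real m) / 2"])
   fix J
   have "(?S J)\<^sup>2 <= (real (m * m))\<^sup>2" using Sb[of J] by (simp add: abs_le_square_iff[symmetric])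
   then show "\<bar>(real m + (?S J)\<^sup>2 / real m) / 2\<bar> <= (real m + (real (m * m))\<^sup>2 / real m) / 2"
    using that by (auto intro!: divide_right_mono)
  qed measurable
  also have "... = (real m + (LINT J|nu. (?S J)\<^sup>2) / real m) / 2"
  proof -
   have "integrable nu (%J. (?S J)\<^sup>2)" unfolding power2_eq_square sum_product using intYY by auto
   then show ?thesis by (simp add: nu.prob_space)
  qed
  also have "... <= (real m + real (m * m) / real m) / 2"
   using S2[of "m * m"] by (intro divide_right_mono add_left_mono) auto
  also have "... = real m" using that by simp
  finally have "real m * (real m * \<bar>a\<bar>) <= real m * 1" by (simp add: abs_mult mult.assoc)
  then show ?thesis using that by simp
 qed
 have "a = 0"
 proof (rule ccontr)
  assume "a ~= 0"
  then obtain m :: nat where m: "real m > 1 / \<bar>a\<bar>" using reals_Archimedean2 by blast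
  then have "m > 0" using \<open>a ~= 0\<close> by (cases m) auto
  from bound[OF this] m \<open>a ~= 0\<close> show False by (simp add: field_simps)
 qed
 moreover have "a = (LINT z|M. U (fst z) * I z) - c * (LINT z|M. I z)"
 proof -
  have "norm (U (fst z) * I z) <= 1" for z
   using mult_le_one[OF Ub(2)[of "fst z"] Ib(1)[of z] Ib(2)[of z]] Ub(1)[of "fst z"] Ib(1)[of z] by simp
  then have "integrable M (%z. U (fst z) * I z)" by (intro M.integrable_const_bound[of _ 1] AE_I2) auto
  moreover have "integrable M I" using Ib by (intro M.integrable_const_bound[of _ 1] AE_I2) auto
  ultimately show ?thesis by (simp add: a_def X_def left_diff_distrib)
 qed
 moreover have "(LINT z|M. I z) = measure Qbar D"
 proof -
  have "(LINT z|M. I z) = (LINT q|Qbar. indicator D q)"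
   unfolding I_def Qbar_def by (rule integral_distr[symmetric]) measurable
  also have "... = measure Qbar D"
   using sets.sets_into_space[OF D] by (simp add: Qbar_def Int_absorb2)
  finally show ?thesis .
 qed
 ultimately show ?thesis by (simp add: U_def c_def I_def)
qed

end

section \<open>Tilting the couplings\<close>

lemma integral_bind_prob:
 fixes f :: "'b => real"
 assumes P: "prob_space P" and L: "L : P ->M prob_algebra N" and f: "f : bm N"
  and B: "!!x. x : space N ==> \<bar>f x\<bar> <= B"
 shows "(LINT x|(P \<bind> L). f x) = (LINT y|P. (LINT x|L y. f x))"
proof (rule integral_bind[OF f B measurable_prob_algebraD[OF L], where B' = 1])
 show "finite_measure P" using P by (rule prob_space.finite_measure)
 show "AE y in P. emeasure (L y) (space (L y)) <= ennreal 1"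
  using measurable_space[OF L] by (intro AE_I2) (auto simp: space_prob_algebra prob_space.emeasure_space_1)
qed

lemma prod_lessThan_add_const:
 fixes f :: "nat => real"
 assumes "!!i. i >= N ==> f i = c"
 shows "(PROD i<N + j. f i) = (PROD i<N. f i) * c ^ j"
 using assms by (induction j) auto

context metastate
begin

definition weight :: "'d edge set => ('d edge => real) => ('d edge => real) => 'd config => real" where
 "weight A k J = edge_weight \<beta> A (%e. k e - J e)"

text \<open>Replicas after the couplings on \<open>A\<close> have been moved to \<open>k\<close>. In
  infinite volume no Hamiltonian is at hand, and reweighting of the random measure takes its
  place.\<close>

definition tilted :: "'d edge set => ('d edge => real) => ('d edge => real) => (nat => 'd config) measure" where
 "tilted A k J = \<kappa> J \<bind> (%GA. replicas (reweight (weight A k J) GA))"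

lemma weight_pos [simp]: "weight A k J sg > 0" by (simp add: weight_def)

lemma weight_measurable [measurable]: "weight A k J : bm (cfg :: 'd config measure)"
 unfolding weight_def by measurable

lemma weight_kernel:
 assumes A: "A \<subseteq> edges"
 shows "(%z. reweight (weight A k (fst z)) (snd z)) : nu **M prob_algebra cfg ->M prob_algebra cfg"
proof (rule measurable_reweight)
 have c: "(%y. fst (fst y) e) : bm ((nu **M prob_algebra cfg) **M (cfg :: 'd config measure))" if "e : A" for e
  using A that by (intro mcomp[OF mcomp[OF measurable_fst measurable_fst] coupling_measurable]) auto
 have s: "(%y. edge_spin (snd y) e) : bm ((nu **M prob_algebra cfg) **M (cfg :: 'd config measure))" for e
  by (rule mcomp[OF measurable_snd edge_spin_measurable])
 show "(%(z, sg). weight A k (fst z) sg) : bm ((nu **M prob_algebra cfg) **M cfg)"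
  unfolding weight_def edge_weight_def case_prod_beta
  by (intro mcomp[OF _ borel_measurable_exp] borel_measurable_times borel_measurable_sum borel_measurable_diff
    borel_measurable_const c s)
 show "snd : nu **M prob_algebra cfg ->M prob_algebra (cfg :: 'd config measure)" by simp
 show "integrable (snd z) (weight A k (fst z))" if "z : space (nu **M prob_algebra cfg)" for z
  unfolding weight_def using that A
  by (intro edge_weight_integrable) (auto simp: space_pair_measure space_prob_algebra)
qed simp

lemma reweight_mem:
 assumes "J : space nu" "GA : space (prob_algebra cfg)" "A \<subseteq> edges"
 shows "reweight (weight A k J) GA : space (prob_algebra cfg)"
 using measurable_space[OF weight_kernel[OF assms(3), of k], of "(J, GA)"] assms by (simp add: space_pair_measure)

lemma weight_kernel_\<kappa>:
 assumes J: "J : space nu" and A: "A \<subseteq> edges"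
 shows "(%GA. replicas (reweight (weight A k J) GA)) : \<kappa> J ->M prob_algebra (replicas cfg)"
proof -
 have "(%GA. reweight (weight A k J) GA) : prob_algebra cfg ->M prob_algebra cfg"
  using mcomp[OF measurable_Pair1'[OF J] weight_kernel[OF A, of k]] by simp
 from mcomp[OF this replicas_kernel] show ?thesis
  using \<kappa>_prob[OF J] measurable_cong_sets[of "\<kappa> J" "prob_algebra cfg"] by (auto simp: space_prob_algebra)
qed

lemma tilted_kernel: "A \<subseteq> edges ==> tilted A k : nu ->M prob_algebra (replicas cfg)"
 unfolding tilted_def[abs_def]
 by (rule measurable_bind_prob_space2[OF \<kappa>])
  (use mcomp[OF weight_kernel replicas_kernel] in \<open>simp add: case_prod_beta\<close>)

lemma \<kappa>_prob_space: "J : space nu ==> prob_space (\<kappa> J)"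
 and sets_\<kappa>: "J : space nu ==> sets (\<kappa> J) = sets (prob_algebra cfg)"
 using \<kappa>_prob by (auto simp: space_prob_algebra)

lemma space_\<kappa>: "J : space nu ==> space (\<kappa> J) = space (prob_algebra cfg)"
 by (rule space_eqI[OF sets_\<kappa>])

lemma integral_tilted:
 assumes J: "J : space nu" and A: "A \<subseteq> edges" and f: "f : bm (replicas cfg)"
  and B: "!!x. x : space (replicas cfg) ==> \<bar>f x\<bar> <= (B::real)"
 shows "(LINT sg|tilted A k J. f sg) = (LINT GA|\<kappa> J. (LINT sg|replicas (reweight (weight A k J) GA). f sg))"
 unfolding tilted_def by (rule integral_bind_prob[OF \<kappa>_prob_space[OF J] weight_kernel_\<kappa>[OF J A] f B])

definition TM :: "'d edge set => ('d edge => real) => (('d edge => real) \<times> (nat => 'd config)) measure" where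
 "TM A k = joint_law nu (tilted A k)"

lemma TM_sets: "A \<subseteq> edges ==> sets (TM A k) = sets (nu **M replicas cfg)"
 and TM_prob: "A \<subseteq> edges ==> prob_space (TM A k)"
 unfolding TM_def by (rule sets_joint_law[OF prob_nu tilted_kernel], simp) (rule prob_space_joint_law[OF prob_nu tilted_kernel], simp)

lemma integral_TM:
 assumes A: "A \<subseteq> edges" and P[measurable]: "P : bm nu" and PB: "!!J. 0 <= P J & P J <= (1::real)" and H[measurable]: "H : sets (replicas cfg)"
 shows "(LINT z|TM A k. P (fst z) * indicator H (snd z))
  = (LINT J|nu. P J * (LINT GA|\<kappa> J. (LINT sg|replicas (reweight (weight A k J) GA). indicator H sg)))"
proof -
 have "(LINT z|TM A k. P (fst z) * indicator H (snd z)) = (LINT J|nu. (LINT sg|tilted A k J. P (fst (J, sg)) * indicator H (snd (J, sg))))"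
  unfolding TM_def
 proof (rule integral_joint_law[OF prob_nu tilted_kernel[OF A]])
  show "\<bar>P (fst z) * indicator H (snd z)\<bar> <= 1" for z
   using PB[of "fst z"] by (simp add: indicator_def)
 qed measurable
 also have "... = (LINT J|nu. P J * (LINT GA|\<kappa> J. (LINT sg|replicas (reweight (weight A k J) GA). indicator H sg)))"
 proof (rule integral_cong[OF refl])
  fix J assume J: "J : space nu"
  have "(LINT sg|tilted A k J. P (fst (J, sg)) * indicator H (snd (J, sg))) = P J * (LINT sg|tilted A k J. indicator H sg)" by simp
  also have "(LINT sg|tilted A k J. indicator H sg) = (LINT GA|\<kappa> J. (LINT sg|replicas (reweight (weight A k J) GA). (indicator H sg :: real)))"
   by (rule integral_tilted[OF J A, where B = 1]) (auto simp: indicator_def)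
  finally show "(LINT sg|tilted A k J. P (fst (J, sg)) * indicator H (snd (J, sg)))
   = P J * (LINT GA|\<kappa> J. (LINT sg|replicas (reweight (weight A k J) GA). indicator H sg))" .
 qed
 finally show ?thesis .
qed

lemma integral_cyl_replicas:
 assumes GA: "GA : space (prob_algebra cfg)" and D: "finite D" "fst ` D \<subseteq> {..<N::nat}"
 shows "(LINT sg|replicas GA. indicator (cyl D) sg) = (PROD i<N. \<integral>sg. up (D `` {i}) sg \<partial>GA)"
proof -
 note GA' = in_prob_config[OF GA]
 interpret GA: prob_space GA by (rule GA')
 have sp: "space (replicas GA) = space (replicas cfg)" unfolding space_PiM GA' ..
 have "(LINT sg|replicas GA. indicator (cyl D) sg) = (LINT sg|replicas GA. (PROD i<N. up (D `` {i}) (sg i)))"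
  using sp by (intro integral_cong refl cyl_indicator[OF _ D(2)]) auto
 also have "... = (PROD i<N. \<integral>sg. up (D `` {i}) sg \<partial>GA)"
 proof (rule integral_replicas_prod[OF GA'(1)])
  fix i
  have "finite (D `` {i})" using D by auto
  then have "up (D `` {i}) : bm GA" using up_measurable mcs[OF GA'(2)] by blast
  then show "integrable GA (up (D `` {i}))"
   using up_bounds[of "D `` {i}"] by (intro GA.integrable_const_bound[of _ 1] AE_I2) auto
 qed auto
 finally show ?thesis .
qed

lemma bump_support:
 assumes "finite A" "!!e. e : A ==> u e : bump"
 shows "\<exists>Q\<ge>0. \<forall>e\<in>A. \<forall>x. \<bar>x\<bar> > Q --> u e x = 0"
 using assms
proof (induction A rule: finite_induct)
 case (insert e A)
 obtain Q where Q: "Q >= 0" "\<forall>e\<in>A. \<forall>x. \<bar>x\<bar> > Q --> u e x = 0" using insert by auto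
 obtain R where R: "\<forall>x. \<bar>x\<bar> > R --> u e x = 0" using insert(4)[of e] by (auto simp: bump_def)
 show ?case using Q R by (intro exI[of _ "max Q R"]) auto
qed auto

lemma cylinder_product:
 assumes "E \<subseteq> edges" "!!e. e : E ==> u e : bump"
 shows "(%J. PROD e:E. u e (J e)) : bm nu" "0 <= (PROD e:E. u e (J e)) & (PROD e:E. u e (J e)) <= 1"
proof -
 show "(%J. PROD e:E. u e (J e)) : bm nu"
  using assms by (intro borel_measurable_prod mcomp[OF coupling_measurable bump_measurable]) auto
 show "0 <= (PROD e:E. u e (J e)) & (PROD e:E. u e (J e)) <= 1"
  using bump_bounds[OF assms(2)] by (auto intro!: prod_nonneg prod_le_1)
qed

text \<open>Where the bump product is nonzero, the couplings on \<open>A\<close> are at most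
  \<open>Q\<close> in absolute value, so \<open>tilt_weight Q\<close> is the true weight. The
  quotient of integrals is not an expectation of a cylinder function; its limit comes from
  \<open>moments_limit\<close>, with couplings and random measure under \<open>kprod\<close> as the
  limiting object.\<close>

lemma TM_limit:
 assumes A: "finite A" "A \<subseteq> edges" and E: "finite E" "A \<subseteq> E" "E \<subseteq> edges" and u: "!!e. e : E ==> u e : bump"
  and Q: "Q >= 0" "!!e x. e : A ==> \<bar>x\<bar> > Q ==> u e x = 0" and D: "finite D" "fst ` D \<subseteq> {..<N::nat}"
 shows "(%n. \<integral>J. (PROD e:E. u e (J e)) * (PROD i<N. \<integral>sg. up (D `` {i}) sg * tilt_weight Q A k J sg \<partial>G n J)
    / (LINT sg|G n J. tilt_weight Q A k J sg) ^ N \<partial>nu)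
  ----> (LINT z|TM A k. (PROD e:E. u e (fst z e)) * indicator (cyl D) (snd z))"
proof -
 let ?PA = "prob_algebra (cfg :: 'd config measure)"
 let ?N' = "kprod nu \<kappa> ?PA"
 let ?W = "exp (\<beta> * (SUM e:A. \<bar>k e\<bar> + Q))"
 let ?w = "tilt_weight Q A k"
 define P where "P J = (PROD e:E. u e (J e))" for J
 have Pm[measurable]: "P : bm nu" and Pb: "0 <= P J & P J <= 1" for J
  unfolding P_def[abs_def] using cylinder_product[OF E(3) u] by auto
 have Df: "finite (D `` {i})" for i using D by auto
 define a where "a i J GA = (LINT sg|GA. up (D `` {i}) sg * ?w J sg)" for i J and GA :: "'d config measure"
 define z where "z J GA = (LINT sg|GA. ?w J sg)" for J and GA :: "'d config measure"
 have wm: "(%(x, sg). ?w (fst x) sg) : bm ((nu **M ?PA) **M cfg)"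
 proof -
  have c: "(%y. clip Q (fst (fst y) e)) : bm ((nu **M ?PA) **M (cfg :: 'd config measure))" if "e : A" for e
   using A that by (intro mcomp[OF mcomp[OF mcomp[OF measurable_fst measurable_fst] coupling_measurable] clip_measurable]) auto
  have s: "(%y. edge_spin (snd y) e) : bm ((nu **M ?PA) **M (cfg :: 'd config measure))" for e
   by (rule mcomp[OF measurable_snd edge_spin_measurable])
  show ?thesis
   unfolding tilt_weight_def edge_weight_def case_prod_beta
   by (intro mcomp[OF _ borel_measurable_exp] borel_measurable_times borel_measurable_sum borel_measurable_diff
     borel_measurable_const c s)
 qed
 have am: "(%x. a i (fst x) (snd x)) : bm (nu **M ?PA)" for i
  unfolding a_def
 proof (rule measurable_integral_kernel)
  show "(%(x, sg). up (D `` {i}) sg * ?w (fst x) sg) : bm ((nu **M ?PA) **M cfg)"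
   unfolding case_prod_beta
   by (intro borel_measurable_times mcomp[OF measurable_snd up_measurable[OF Df]] wm[unfolded case_prod_beta])
 qed simp
 have zm: "(%x. z (fst x) (snd x)) : bm (nu **M ?PA)"
  unfolding z_def by (rule measurable_integral_kernel[OF wm]) simp
 have bounds: "\<bar>a i J GA\<bar> <= ?W" "exp (- (\<beta> * (SUM e:A. \<bar>k e\<bar> + Q))) <= z J GA" "z J GA <= ?W"
  if GA: "GA : space ?PA" for i J GA
 proof -
  note GA' = in_prob_config[OF GA]
  interpret GA: prob_space GA by (rule GA')
  have m: "?w J : bm GA" "up (D `` {i}) : bm GA"
   using tilt_weight_measurable up_measurable[OF Df] mcs[OF GA'(2)] by blast+
  have b1: "0 <= up (D `` {i}) sg * ?w J sg & up (D `` {i}) sg * ?w J sg <= ?W" if "sg : space GA" for sg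
   using up_tilt_bounds[of sg A Q "D `` {i}" k J] that A Q unfolding GA'(3) by simp
  have b2: "exp (- (\<beta> * (SUM e:A. \<bar>k e\<bar> + Q))) <= ?w J sg & ?w J sg <= ?W" if "sg : space GA" for sg
   using tilt_weight_bounds[of sg A Q k J] that A Q unfolding GA'(3) by simp
  have i1: "integrable GA (%sg. up (D `` {i}) sg * ?w J sg)"
   using b1 m by (intro GA.integrable_const_bound[of _ ?W] AE_I2) auto
  have i2: "integrable GA (?w J)"
  proof (rule GA.integrable_const_bound[of _ ?W, OF AE_I2 m(1)])
   fix sg assume "sg : space GA"
   from b2[OF this] show "norm (?w J sg) <= ?W" by (simp add: tilt_weight_def less_imp_le)
  qed
  have "0 <= a i J GA" unfolding a_def using b1 by (intro integral_nonneg_AE AE_I2) auto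
  moreover have "a i J GA <= ?W" unfolding a_def using b1 by (intro GA.integral_le_const[OF i1] AE_I2) auto
  ultimately show "\<bar>a i J GA\<bar> <= ?W" by simp
  show "exp (- (\<beta> * (SUM e:A. \<bar>k e\<bar> + Q))) <= z J GA" unfolding z_def using b2 by (intro GA.integral_ge_const[OF i2] AE_I2) auto
  show "z J GA <= ?W" unfolding z_def using b2 by (intro GA.integral_le_const[OF i2] AE_I2) auto
 qed
 have bA: "\<bar>P J * (PROD i<N. a i J GA)\<bar> <= ?W ^ N" if "GA : space ?PA" for J GA
 proof -
  have "\<bar>PROD i<N. a i J GA\<bar> <= (PROD i<N. ?W)" unfolding abs_prod using bounds(1)[OF that] by (intro prod_mono) auto
  then have "\<bar>P J\<bar> * \<bar>PROD i<N. a i J GA\<bar> <= 1 * ?W ^ N" using Pb[of J] by (intro mult_mono) auto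
  then show ?thesis by (simp add: abs_mult)
 qed
 have GP: "G n J : space ?PA" for n J using G_prob by (simp add: space_prob_algebra)
 have pairG: "(%J. (J, G n J)) : nu ->M nu **M ?PA" for n
  by (rule measurable_Pair[OF measurable_ident_sets[OF refl] G_kernel])
 \<comment> \<open>The power \<open>z J GA ^ j\<close> appears as \<open>j\<close> further replicas
   with the empty set of sites, for which \<open>up\<close> is \<open>1\<close>.\<close>
 define D' where "D' i = (if i < N then D `` {i} else {})" for i
 have D'f: "finite (D' i)" for i using Df by (simp add: D'_def)
 have mom_prod: "P J * (PROD i<N. a i J GA) * z J GA ^ j = P J * (PROD i<N + j. \<integral>sg. up (D' i) sg * ?w J sg \<partial>GA)" for J GA j
 proof -
  have "(PROD i<N + j. \<integral>sg. up (D' i) sg * ?w J sg \<partial>GA) = (PROD i<N. \<integral>sg. up (D' i) sg * ?w J sg \<partial>GA) * z J GA ^ j"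
   by (rule prod_lessThan_add_const) (simp add: D'_def up_def z_def)
  moreover have "(PROD i<N. \<integral>sg. up (D' i) sg * ?w J sg \<partial>GA) = (PROD i<N. a i J GA)"
   by (intro prod.cong refl) (simp add: D'_def a_def)
  ultimately show ?thesis by (simp add: mult.assoc)
 qed
 have lim: "(%n. \<integral>J. (P J * (PROD i<N. a i J (G n J))) / z J (G n J) ^ N \<partial>nu)
  ----> (LINT x|?N'. (P (fst x) * (PROD i<N. a i (fst x) (snd x))) / z (fst x) (snd x) ^ N)"
 proof (rule moments_limit[where C = "?W ^ N" and k = "exp (- (\<beta> * (SUM e:A. \<bar>k e\<bar> + Q)))" and K = ?W])
  show "prob_space nu" by (rule prob_nu)
  show "prob_space ?N'" by (rule prob_space_kprod[OF prob_nu \<kappa>])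
  show "(%J. P J * (PROD i<N. a i J (G n J))) : bm nu" for n
   using mcomp[OF pairG am] by (intro borel_measurable_times borel_measurable_prod Pm) auto
  show "(%J. z J (G n J)) : bm nu" for n
   using mcomp[OF pairG zm] by simp
  have s: "sets ?N' = sets (nu **M ?PA)" by (rule sets_kprod[OF prob_nu \<kappa>])
  have mm: "(%x. P (fst x) * (PROD i<N. a i (fst x) (snd x))) : bm (nu **M ?PA)"
   by (intro borel_measurable_times borel_measurable_prod am mcomp[OF measurable_fst Pm])
  then show "(%x. P (fst x) * (PROD i<N. a i (fst x) (snd x))) : bm ?N'"
   using mcs[OF s] by blast
  show "(%x. z (fst x) (snd x)) : bm ?N'" using zm mcs[OF s] by blast
  show "\<bar>P J * (PROD i<N. a i J (G n J))\<bar> <= ?W ^ N" for n J by (rule bA[OF GP])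
  have sp: "space ?N' = space nu \<times> space ?PA" using space_eqI[OF s] unfolding space_pair_measure .
  have spD: "snd x : space ?PA" if "x : space ?N'" for x
   using that unfolding sp mem_Times_iff by (rule conjunct2)
  show "\<bar>P (fst x) * (PROD i<N. a i (fst x) (snd x))\<bar> <= ?W ^ N" if "x : space ?N'" for x
   by (rule bA[OF spD[OF that]])
  show "exp (- (\<beta> * (SUM e:A. \<bar>k e\<bar> + Q))) <= z J (G n J) & z J (G n J) <= ?W" for n J
   using bounds(2,3)[OF GP] by simp
  show "exp (- (\<beta> * (SUM e:A. \<bar>k e\<bar> + Q))) <= z (fst x) (snd x) & z (fst x) (snd x) <= ?W" if "x : space ?N'" for x
   using bounds(2,3)[OF spD[OF that]] by (intro conjI)
  fix j
  have "(LINT x|?N'. (P (fst x) * (PROD i<N. a i (fst x) (snd x))) * z (fst x) (snd x) ^ j)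
   = (LINT J|nu. (LINT GA|\<kappa> J. (P (fst (J, GA)) * (PROD i<N. a i (fst (J, GA)) (snd (J, GA)))) * z (fst (J, GA)) (snd (J, GA)) ^ j))"
  proof (rule integral_kprod[OF prob_nu \<kappa>, where B = "?W ^ N * ?W ^ j"])
   show "(%x. (P (fst x) * (PROD i<N. a i (fst x) (snd x))) * z (fst x) (snd x) ^ j) : bm (nu **M ?PA)"
    by (intro borel_measurable_times mm borel_measurable_power zm)
   fix x assume "x : space (nu **M ?PA)"
   then have g: "snd x : space ?PA" unfolding space_pair_measure mem_Times_iff by (rule conjunct2)
   have "0 < z (fst x) (snd x)" using bounds(2)[OF g, of "fst x"] by (rule less_le_trans[rotated]) simp
   then show "\<bar>(P (fst x) * (PROD i<N. a i (fst x) (snd x))) * z (fst x) (snd x) ^ j\<bar> <= ?W ^ N * ?W ^ j"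
    unfolding abs_mult[of _ "z _ _ ^ j"] using bA[OF g] bounds(3)[OF g]
    by (intro mult_mono) (auto simp: power_abs intro!: power_mono)
  qed
  also have "... = (LINT J|nu. P J * (LINT GA|\<kappa> J. (PROD i<N + j. \<integral>sg. up (D' i) sg * ?w J sg \<partial>GA)))"
   unfolding fst_conv snd_conv mom_prod by simp
  finally have R: "(LINT x|?N'. (P (fst x) * (PROD i<N. a i (fst x) (snd x))) * z (fst x) (snd x) ^ j)
   = (LINT J|nu. P J * (LINT GA|\<kappa> J. (PROD i<N + j. \<integral>sg. up (D' i) sg * ?w J sg \<partial>GA)))" .
  show "(%n. \<integral>J. (P J * (PROD i<N. a i J (G n J))) * z J (G n J) ^ j \<partial>nu)
   ----> (LINT x|?N'. (P (fst x) * (PROD i<N. a i (fst x) (snd x))) * z (fst x) (snd x) ^ j)"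
   unfolding R unfolding mom_prod unfolding P_def
   by (rule test_limit[OF E(1) A(1) D'f E(3) A(2) u Q(1)])
 qed simp
 have "(LINT x|?N'. (P (fst x) * (PROD i<N. a i (fst x) (snd x))) / z (fst x) (snd x) ^ N)
  = (LINT J|nu. (LINT GA|\<kappa> J. (P (fst (J, GA)) * (PROD i<N. a i (fst (J, GA)) (snd (J, GA)))) / z (fst (J, GA)) (snd (J, GA)) ^ N))"
 proof (rule integral_kprod[OF prob_nu \<kappa>, where B = "?W ^ N * (1 / exp (- (\<beta> * (SUM e:A. \<bar>k e\<bar> + Q))) ^ N)"])
  show "(%x. (P (fst x) * (PROD i<N. a i (fst x) (snd x))) / z (fst x) (snd x) ^ N) : bm (nu **M ?PA)"
   by (intro borel_measurable_divide borel_measurable_times borel_measurable_prod am mcomp[OF measurable_fst Pm] borel_measurable_power zm)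
  fix x assume "x : space (nu **M ?PA)"
  then have g: "snd x : space ?PA" unfolding space_pair_measure mem_Times_iff by (rule conjunct2)
  have z0: "0 < z (fst x) (snd x)" using bounds(2)[OF g, of "fst x"] by (rule less_le_trans[rotated]) simp
  have "\<bar>P (fst x) * (PROD i<N. a i (fst x) (snd x))\<bar> * (1 / z (fst x) (snd x) ^ N) <= ?W ^ N * (1 / exp (- (\<beta> * (SUM e:A. \<bar>k e\<bar> + Q))) ^ N)"
   using bA[OF g] bounds(2)[OF g] z0 by (intro mult_mono divide_left_mono power_mono) auto
  then show "\<bar>(P (fst x) * (PROD i<N. a i (fst x) (snd x))) / z (fst x) (snd x) ^ N\<bar> <= ?W ^ N * (1 / exp (- (\<beta> * (SUM e:A. \<bar>k e\<bar> + Q))) ^ N)"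
   using z0 by (simp add: abs_divide)
 qed
 also have "... = (LINT J|nu. P J * (LINT GA|\<kappa> J. (LINT sg|replicas (reweight (weight A k J) GA). indicator (cyl D) sg)))"
 proof (rule integral_cong[OF refl])
  fix J assume J: "J : space nu"
  have "(LINT GA|\<kappa> J. (P J * (PROD i<N. a i J GA)) / z J GA ^ N) = (LINT GA|\<kappa> J. P J * (LINT sg|replicas (reweight (weight A k J) GA). indicator (cyl D) sg))"
  proof (rule integral_cong[OF refl])
   fix GA assume "GA : space (\<kappa> J)"
   then have GA: "GA : space ?PA" by (simp add: space_\<kappa>[OF J])
   show "(P J * (PROD i<N. a i J GA)) / z J GA ^ N = P J * (LINT sg|replicas (reweight (weight A k J) GA). indicator (cyl D) sg)"
   \<comment> \<open>Where the bump product vanishes, both sides are \<open>0\<close>; elsewhere the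
     couplings on \<open>A\<close> are not affected by truncation.\<close>
   proof (cases "P J = 0")
    case False
    have c: "clip Q (J e) = J e" if "e : A" for e
    proof -
     have "u e (J e) ~= 0" using False E that by (auto simp: P_def)
     then have "~ \<bar>J e\<bar> > Q" using Q(2)[OF that] by blast
     then show ?thesis by (intro clip_id) auto
    qed
    have w: "?w J = weight A k J"
     unfolding tilt_weight_def weight_def edge_weight_def by (intro ext arg_cong[where f = exp] arg_cong2[where f = "(*)"] refl sum.cong) (simp add: c)
    note GA' = in_prob_config[OF GA]
    have "(LINT sg|reweight (weight A k J) GA. up (D `` {i}) sg) = a i J GA / z J GA" for i
     unfolding a_def z_def w
    proof (rule integral_reweight[OF GA'(1)])
     show "integrable GA (weight A k J)" unfolding weight_def by (rule edge_weight_integrable[OF GA'(1,2) A(2)])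
     show "up (D `` {i}) : bm GA" using up_measurable[OF Df] mcs[OF GA'(2)] by blast
    qed simp
    then show ?thesis
     unfolding integral_cyl_replicas[OF reweight_mem[OF J GA A(2)] D] by (simp add: prod_dividef)
   qed simp
  qed
  then show "(LINT GA|\<kappa> J. (P (fst (J, GA)) * (PROD i<N. a i (fst (J, GA)) (snd (J, GA)))) / z (fst (J, GA)) (snd (J, GA)) ^ N)
   = P J * (LINT GA|\<kappa> J. (LINT sg|replicas (reweight (weight A k J) GA). indicator (cyl D) sg))" by simp
 qed
 also have "... = (LINT z|TM A k. P (fst z) * indicator (cyl D) (snd z))"
  by (rule integral_TM[OF A(2) Pm Pb, symmetric]) (use replica_config_generator(1)[where 'd = 'd] D(1) in auto)
 finally show ?thesis using lim unfolding P_def a_def z_def by simp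
qed

end

section \<open>The tilted law does not see the fixed couplings\<close>

lemma integral_indicator_extend:
 fixes g1 :: "'a => real" and g2 :: "'b => real"
 assumes M: "prob_space M1" "prob_space M2" and X[measurable]: "X1 : M1 ->M Y" "X2 : M2 ->M Y"
  and g[measurable]: "g1 : bm M1" "g2 : bm M2" and gb: "!!z. 0 <= g1 z & g1 z <= 1" "!!z. 0 <= g2 z & g2 z <= 1"
  and Y: "sets Y = sigma_sets (space Y) \<C>" "Int_stable \<C>" "\<C> \<subseteq> Pow (space Y)" "space Y : \<C>"
  and eq: "!!C. C : \<C> ==> (LINT z|M1. g1 z * indicator C (X1 z)) = (LINT z|M2. g2 z * indicator C (X2 z))"
  and H: "H : sets Y"
 shows "(LINT z|M1. g1 z * indicator H (X1 z)) = (LINT z|M2. g2 z * indicator H (X2 z))"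
proof -
 interpret M1: prob_space M1 by fact
 interpret M2: prob_space M2 by fact
 define D1 where "D1 = distr (density M1 g1) Y X1"
 define D2 where "D2 = distr (density M2 g2) Y X2"
 have e1: "emeasure D1 C = ennreal (LINT z|M1. g1 z * indicator C (X1 z))" if C[measurable]: "C : sets Y" for C
 proof -
  have "emeasure D1 C = (\<integral>\<^sup>+z. ennreal (g1 z) * indicator (X1 -` C \<inter> space M1) z \<partial>M1)"
   unfolding D1_def by (subst emeasure_distr) (auto simp: emeasure_density)
  also have "... = (\<integral>\<^sup>+z. ennreal (g1 z * indicator C (X1 z)) \<partial>M1)"
   by (intro nn_integral_cong) (auto simp: indicator_def)
  also have "... = ennreal (LINT z|M1. g1 z * indicator C (X1 z))"
   using gb by (intro nn_integral_eq_integral M1.integrable_const_bound[of _ 1] AE_I2) (auto simp: indicator_def)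
  finally show ?thesis .
 qed
 have e2: "emeasure D2 C = ennreal (LINT z|M2. g2 z * indicator C (X2 z))" if C[measurable]: "C : sets Y" for C
 proof -
  have "emeasure D2 C = (\<integral>\<^sup>+z. ennreal (g2 z) * indicator (X2 -` C \<inter> space M2) z \<partial>M2)"
   unfolding D2_def by (subst emeasure_distr) (auto simp: emeasure_density)
  also have "... = (\<integral>\<^sup>+z. ennreal (g2 z * indicator C (X2 z)) \<partial>M2)"
   by (intro nn_integral_cong) (auto simp: indicator_def)
  also have "... = ennreal (LINT z|M2. g2 z * indicator C (X2 z))"
   using gb by (intro nn_integral_eq_integral M2.integrable_const_bound[of _ 1] AE_I2) (auto simp: indicator_def)
  finally show ?thesis .
 qed
 have CY: "C : sets Y" if "C : \<C>" for C using that Y by auto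
 have "D1 = D2"
 proof (rule measure_eqI_generator_eq[OF Y(2,3)])
  show "sets D1 = sigma_sets (space Y) \<C>" "sets D2 = sigma_sets (space Y) \<C>" using Y(1) by (auto simp: D1_def D2_def)
  show "emeasure D1 C = emeasure D2 C" if "C : \<C>" for C using eq[OF that] e1[OF CY[OF that]] e2[OF CY[OF that]] by simp
  show "range (%_::nat. space Y) \<subseteq> \<C>" using Y(4) by auto
  show "(\<Union>i::nat. space Y) = space Y" by simp
  show "emeasure D1 (space Y) ~= \<infinity>" by (simp add: e1)
 qed
 then have "ennreal (LINT z|M1. g1 z * indicator H (X1 z)) = ennreal (LINT z|M2. g2 z * indicator H (X2 z))"
  using e1[OF H] e2[OF H] by simp
 then show ?thesis
  using gb by (subst (asm) ennreal_inj) (auto intro!: integral_nonneg_AE)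
qed

text \<open>The corner of the overlap array that \<open>s\<close> replicas determine. Filling up
  with \<open>0\<close> makes it a function on the finite product, where the total variation bounds
  are available.\<close>

definition fin_overlap :: "nat => ('a => 'a => real) => (nat => 'a) => nat \<times> nat => real" where
 "fin_overlap s R x = (%(i, j). if i < s & j < s then if i = j then 1 else R (x i) (x j) else 0)"

definition finite_dim :: "nat => (nat \<times> nat => real) set => bool" where
 "finite_dim s H \<longleftrightarrow> (\<forall>q q'. (\<forall>i<s. \<forall>j<s. q (i, j) = q' (i, j)) --> (q : H \<longleftrightarrow> q' : H))"

lemma finite_dim_restrict:
 assumes "finite_dim s H"
 shows "overlap_array R x : H \<longleftrightarrow> fin_overlap s R (restrict x {..<s}) : H"
 using assms unfolding finite_dim_def by (auto simp: overlap_array_def fin_overlap_def)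

lemma fin_overlap_measurable:
 assumes R: "(%(x, y). R x y) : bm (X **M X)"
 shows "fin_overlap s R : PiM {..<s} (%_. X) ->M array_space"
 unfolding array_space_def
proof (rule measurable_PiM_single')
 fix p :: "nat \<times> nat"
 show "(%x. fin_overlap s R x p) : bm (PiM {..<s} (%_. X))"
 proof (cases "fst p < s & snd p < s")
  case True
  have pr: "(%x. (x (fst p), x (snd p))) : PiM {..<s} (%_. X) ->M X **M X"
   using True by (intro measurable_Pair measurable_component_singleton) auto
  have "(%x. if fst p = snd p then 1 else R (x (fst p)) (x (snd p))) : bm (PiM {..<s} (%_. X))"
   using mcomp[OF pr R] by simp
  then show ?thesis using True by (simp add: fin_overlap_def case_prod_beta)
 next
  case False
  then have "(%x. fin_overlap s R x p) = (%_. 0)" by (auto simp: fin_overlap_def case_prod_beta fun_eq_iff)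
  then show ?thesis by simp
 qed
qed auto

lemma override_measurable:
 "override A k : PiM (edges - A) (%_. borel) ->M PiM edges (%_. borel :: real measure)" if "A \<subseteq> edges"
proof (rule measurable_PiM_single')
 fix e :: "'a edge" assume e: "e : edges"
 show "(%J. override A k J e) : bm (PiM (edges - A) (%_. borel))"
 proof (cases "e : A")
  case False
  then have "e : edges - A" using e by simp
  from measurable_component_singleton[OF this, of "%_. borel :: real measure"] False show ?thesis by (simp add: override_def)
 qed (simp add: override_def)
next
 show "(%om e. override A k om e) : space (PiM (edges - A) (%_. borel)) \<rightarrow> edges \<rightarrow>\<^sub>E space borel"
  using that by (auto simp: override_def space_PiM PiE_iff extensional_def)
qed

context metastate
begin

text \<open>By \<open>gibbs_override\<close> the quotient in a box equals a Gibbs expectation with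
  the couplings on \<open>A\<close> set to \<open>k\<close>. This is a function of the couplings off
  \<open>A\<close>, hence independent of the bumps on \<open>A\<close>.\<close>

lemma TM_finite:
 assumes A: "finite A" "A \<subseteq> edges" and E: "finite E" "A \<subseteq> E" "E \<subseteq> edges" and u: "!!e. e : E ==> u e : bump"
  and Q: "Q >= 0" "!!e x. e : A ==> \<bar>x\<bar> > Q ==> u e x = 0" and D: "finite D"
  and n: "A \<subseteq> edges_in (lattice_box (a n) (b n))"
 shows "(LINT J|nu. (PROD e:E. u e (J e)) * (PROD i<N. \<integral>sg. up (D `` {i}) sg * tilt_weight Q A k J sg \<partial>G n J)
    / (LINT sg|G n J. tilt_weight Q A k J sg) ^ N)
  = (LINT J|nu. (PROD e:A. u e (J e)))
   * (LINT J|nu. (PROD e:E - A. u e (J e)) * (PROD i<N. \<integral>sg. up (D `` {i}) sg \<partial>gibbs_ext (a n) (b n) \<beta> (override A k J)))"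
proof -
 let ?\<Theta> = "%J. (PROD i<N. \<integral>sg. up (D `` {i}) sg \<partial>gibbs_ext (a n) (b n) \<beta> (override A k J))"
 have Df: "finite (D `` {i})" for i using D by auto
 let ?f = "%J. (PROD e:A. u e (J e))" and ?g = "%J. (PROD e:E - A. u e (J e)) * ?\<Theta> J"
 have split: "(PROD e:E. u e (J e)) = (PROD e:A. u e (J e)) * (PROD e:E - A. u e (J e))" for J
  using prod.subset_diff[OF E(2,1), of "%e. u e (J e)"] by (simp add: mult.commute)
 have "(LINT J|nu. (PROD e:E. u e (J e)) * (PROD i<N. \<integral>sg. up (D `` {i}) sg * tilt_weight Q A k J sg \<partial>G n J)
    / (LINT sg|G n J. tilt_weight Q A k J sg) ^ N) = (LINT J|nu. ?f (restrict J A) * ?g (restrict J (edges - A)))"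
 proof (rule integral_cong[OF refl])
  fix J assume J: "J : space nu"
  have ov: "override A k (restrict J (edges - A)) = override A k J"
   using J A(2) by (auto simp: override_def fun_eq_iff space_nu extensional_def)
  have f: "?f (restrict J A) = ?f J" by simp
  have g: "(PROD e:E - A. u e (restrict J (edges - A) e)) = (PROD e:E - A. u e (J e))"
   using E by (intro prod.cong) auto
  show "(PROD e:E. u e (J e)) * (PROD i<N. \<integral>sg. up (D `` {i}) sg * tilt_weight Q A k J sg \<partial>G n J)
    / (LINT sg|G n J. tilt_weight Q A k J sg) ^ N = ?f (restrict J A) * ?g (restrict J (edges - A))"
  proof (cases "(PROD e:E. u e (J e)) = 0")
   case True
   then have "?f J * (PROD e:E - A. u e (J e)) = 0" by (simp only: split)
   then show ?thesis unfolding True f g ov by auto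
  next
   case False
   have c: "clip Q (J e) = J e" if "e : A" for e
   proof -
    have "u e (J e) ~= 0" using False E that by auto
    then have "~ \<bar>J e\<bar> > Q" using Q(2)[OF that] by blast
    then show ?thesis by (intro clip_id) auto
   qed
   have w: "tilt_weight Q A k J = (%sg. exp (\<beta> * (SUM e:A. (k e - J e) * edge_spin sg e)))"
    unfolding tilt_weight_def edge_weight_def by (intro ext arg_cong[where f = exp] arg_cong2[where f = "(*)"] refl sum.cong) (simp add: c)
   have "(LINT sg|G n J. up (D `` {i}) sg * tilt_weight Q A k J sg) / (LINT sg|G n J. tilt_weight Q A k J sg)
     = (LINT sg|gibbs_ext (a n) (b n) \<beta> (override A k J). up (D `` {i}) sg)" for i
    unfolding w G_def by (rule gibbs_override[OF n up_measurable[OF Df]])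
   then have "?\<Theta> J = (PROD i<N. (LINT sg|G n J. up (D `` {i}) sg * tilt_weight Q A k J sg) / (LINT sg|G n J. tilt_weight Q A k J sg))"
    by (intro prod.cong) auto
   also have "... = (PROD i<N. \<integral>sg. up (D `` {i}) sg * tilt_weight Q A k J sg \<partial>G n J) / (LINT sg|G n J. tilt_weight Q A k J sg) ^ N"
    by (simp add: prod_dividef)
   finally show ?thesis unfolding f g ov split by simp
  qed
 qed
 also have "... = (LINT J|nu. ?f (restrict J A)) * (LINT J|nu. ?g (restrict J (edges - A)))"
 proof (rule integral_indep_couplings[where C = 1 and D = 1])
  have uA: "u e : bump" if "e : A" for e using u E that by auto
  have cm: "(%J. u e (J e)) : bm (PiM B (%_. borel))" if "e : B" "e : E" for e B
   by (rule mcomp[OF _ bump_measurable[OF u[OF that(2)]]]) (rule measurable_component_singleton[OF that(1)])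
  show "?f : bm (PiM A (%_. borel))"
   using E by (intro borel_measurable_prod cm) auto
  show "\<bar>?f J\<bar> <= 1" for J
   unfolding abs_prod using bump_bounds[OF uA] by (intro prod_le_1) auto
  have "(%J. \<integral>sg. up (D `` {i}) sg \<partial>gibbs_ext (a n) (b n) \<beta> (override A k J)) : bm (PiM (edges - A) (%_. borel))" for i
  proof (rule measurable_integral_kernel[OF _ mcomp[OF override_measurable[OF A(2)] gibbs_ext_kernel]])
   note [measurable] = up_measurable[OF Df]
   show "(%(x, y). up (D `` {i}) y) : bm (PiM (edges - A) (%_. borel) **M cfg)" by measurable
  qed
  moreover have "(%J. PROD e:E - A. u e (J e)) : bm (PiM (edges - A) (%_. borel))"
   using E by (intro borel_measurable_prod cm) auto
  ultimately show "?g : bm (PiM (edges - A) (%_. borel))"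
   by (intro borel_measurable_times[OF _ borel_measurable_prod]) auto
  have upb: "\<bar>\<integral>sg. up (D `` {i}) sg \<partial>gibbs_ext (a n) (b n) \<beta> J\<bar> <= 1" for i J
  proof -
   interpret g: prob_space "gibbs_ext (a n) (b n) \<beta> J" by (rule prob_space_gibbs_ext)
   have m: "up (D `` {i}) : bm (gibbs_ext (a n) (b n) \<beta> J)"
    using up_measurable[OF Df] mcs[OF sets_gibbs_ext] by blast
   have "integrable (gibbs_ext (a n) (b n) \<beta> J) (up (D `` {i}))"
    using up_bounds[of "D `` {i}"] by (intro g.integrable_const_bound[of _ 1, OF AE_I2 m]) auto
   then show ?thesis
    using up_bounds[of "D `` {i}"] g.integral_le_const[of "up (D `` {i})" 1] by (simp add: integral_nonneg_AE)
  qed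
  have uB: "u e : bump" if "e : E - A" for e using u that by auto
  show "\<bar>?g J\<bar> <= 1" for J
  proof -
   have "\<bar>PROD e:E - A. u e (J e)\<bar> <= 1" unfolding abs_prod using bump_bounds[OF uB] by (intro prod_le_1) auto
   moreover have "\<bar>?\<Theta> J\<bar> <= 1" unfolding abs_prod using upb by (intro prod_le_1) auto
   ultimately show ?thesis unfolding abs_mult by (intro mult_le_one) auto
  qed
 qed (use A in auto)
 also have "(LINT J|nu. ?f (restrict J A)) = (LINT J|nu. ?f J)" by simp
 also have "(LINT J|nu. ?g (restrict J (edges - A))) = (LINT J|nu. ?g J)"
 proof (rule integral_cong[OF refl])
  fix J assume J: "J : space nu"
  have ov: "override A k (restrict J (edges - A)) = override A k J"
   using J A(2) by (auto simp: override_def fun_eq_iff space_nu extensional_def)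
  have "(PROD e:E - A. u e (restrict J (edges - A) e)) = (PROD e:E - A. u e (J e))"
   using E by (intro prod.cong) auto
  then show "?g (restrict J (edges - A)) = ?g J" unfolding ov by simp
 qed
 finally show ?thesis .
qed

text \<open>Independence is expressed through two families of bumps that agree off \<open>A\<close>,
  with cross multiplication: in a large box both sides equal the same expression, and products pass
  to the limit without a division by a possibly vanishing integral.\<close>

lemma TM_indep_cyl:
 assumes A: "finite A" "A \<subseteq> edges" and E: "finite E" "A \<subseteq> E" "E \<subseteq> edges"
  and u: "!!e. e : E ==> u e : bump" and v: "!!e. e : E ==> v e : bump" and uv: "!!e. e : E - A ==> u e = v e"
  and D: "finite D"
 shows "(LINT z|TM A k. (PROD e:E. u e (fst z e)) * indicator (cyl D) (snd z)) * (LINT J|nu. (PROD e:A. v e (J e)))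
  = (LINT z|TM A k. (PROD e:E. v e (fst z e)) * indicator (cyl D) (snd z)) * (LINT J|nu. (PROD e:A. u e (J e)))"
proof -
 obtain N where N: "fst ` D \<subseteq> {..<N}"
  using D finite_nat_bounded[of "fst ` D"] by auto
 have uA: "u e : bump" "v e : bump" if "e : A" for e using u v E that by auto
 obtain Q1 where Q1: "Q1 >= 0" "\<forall>e\<in>A. \<forall>x. \<bar>x\<bar> > Q1 --> u e x = 0" using bump_support[of A u, OF A(1) uA(1)] by auto
 obtain Q2 where Q2: "Q2 >= 0" "\<forall>e\<in>A. \<forall>x. \<bar>x\<bar> > Q2 --> v e x = 0" using bump_support[of A v, OF A(1) uA(2)] by auto
 define Q where "Q = max Q1 Q2"
 have Q: "Q >= 0" "!!e x. e : A ==> \<bar>x\<bar> > Q ==> u e x = 0" "!!e x. e : A ==> \<bar>x\<bar> > Q ==> v e x = 0"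
  using Q1 Q2 by (auto simp: Q_def)
 define I where "I u n = (LINT J|nu. (PROD e:E. u e (J e)) * (PROD i<N. \<integral>sg. up (D `` {i}) sg * tilt_weight Q A k J sg \<partial>G n J)
    / (LINT sg|G n J. tilt_weight Q A k J sg) ^ N)" for u n
 have 1: "I u ----> (LINT z|TM A k. (PROD e:E. u e (fst z e)) * indicator (cyl D) (snd z))"
  unfolding I_def by (rule TM_limit[OF A E u Q(1,2) D N])
 have 2: "I v ----> (LINT z|TM A k. (PROD e:E. v e (fst z e)) * indicator (cyl D) (snd z))"
  unfolding I_def by (rule TM_limit[OF A E v Q(1,3) D N])
 have fA: "finite (\<Union>A)"
 proof -
  have "finite e" if "e : A" for e using subsetD[OF A(2) that] by (auto elim: edgeE)
  then show ?thesis using A(1) by auto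
 qed
 have "\<forall>\<^sub>F n in sequentially. \<forall>y\<in>\<Union>A. y : lattice_box (a n) (b n)"
  using boxes fA unfolding boxes_to_lattice_def by (subst eventually_ball_finite_distrib) auto
 then have "\<forall>\<^sub>F n in sequentially. I u n * (LINT J|nu. (PROD e:A. v e (J e))) = I v n * (LINT J|nu. (PROD e:A. u e (J e)))"
 proof eventually_elim
  case (elim n)
  have n: "A \<subseteq> edges_in (lattice_box (a n) (b n))" using elim A(2) by (auto simp: edges_in_def)
  have e: "(PROD e:E - A. u e (J e)) = (PROD e:E - A. v e (J e))" for J using uv by (intro prod.cong) auto
  have "I u n = (LINT J|nu. (PROD e:A. u e (J e)))
   * (LINT J|nu. (PROD e:E - A. u e (J e)) * (PROD i<N. \<integral>sg. up (D `` {i}) sg \<partial>gibbs_ext (a n) (b n) \<beta> (override A k J)))"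
   unfolding I_def by (rule TM_finite[OF A E u Q(1,2) D n])
  moreover have "I v n = (LINT J|nu. (PROD e:A. v e (J e)))
   * (LINT J|nu. (PROD e:E - A. v e (J e)) * (PROD i<N. \<integral>sg. up (D `` {i}) sg \<partial>gibbs_ext (a n) (b n) \<beta> (override A k J)))"
   unfolding I_def by (rule TM_finite[OF A E v Q(1,3) D n])
  ultimately show ?case unfolding e by simp
 qed
 from Lim_transform_eventually[OF tendsto_mult_right[OF 1] this] tendsto_mult_right[OF 2]
 show ?thesis by (rule LIMSEQ_unique)
qed

text \<open>The cylinder events form an intersection stable generator, and the bump products act as
  densities, so the identity extends to all events of the replicas.\<close>

lemma TM_indep:
 assumes A: "finite A" "A \<subseteq> edges" and E: "finite E" "A \<subseteq> E" "E \<subseteq> edges"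
  and u: "!!e. e : E ==> u e : bump" and v: "!!e. e : E ==> v e : bump" and uv: "!!e. e : E - A ==> u e = v e"
  and H: "H : sets (replicas cfg)"
 shows "(LINT z|TM A k. (PROD e:E. u e (fst z e)) * indicator H (snd z)) * (LINT J|nu. (PROD e:A. v e (J e)))
  = (LINT z|TM A k. (PROD e:E. v e (fst z e)) * indicator H (snd z)) * (LINT J|nu. (PROD e:A. u e (J e)))"
proof -
 have uA: "u e : bump" "v e : bump" if "e : A" for e using u v E that by auto
 define p where "p w = (LINT J|nu. (PROD e:A. w e (J e)))" for w :: "'d edge => real => real"
 have pb: "0 <= p w & p w <= 1" if w: "!!e. e : A ==> w e : bump" for w
 proof -
  have m: "(%J. PROD e:A. w e (J e)) : bm nu" by (rule cylinder_product(1)[OF A(2) w])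
  have b: "0 <= (PROD e:A. w e (J e)) & (PROD e:A. w e (J e)) <= 1" for J by (rule cylinder_product(2)[OF A(2) w])
  have "integrable nu (%J. PROD e:A. w e (J e))" using b by (intro nu.integrable_const_bound[of _ 1, OF AE_I2 m]) auto
  then show ?thesis unfolding p_def using b by (auto intro!: integral_nonneg_AE nu.integral_le_const)
 qed
 have P: "prob_space (TM A k)" by (rule TM_prob[OF A(2)])
 have s: "sets (TM A k) = sets (nu **M replicas cfg)" by (rule TM_sets[OF A(2)])
 have sm: "snd : TM A k ->M replicas cfg" using measurable_snd mcs[OF s] by blast
 have gm: "(%z. (PROD e:E. w e (fst z e)) * c) : bm (TM A k)" if "!!e. e : E ==> w e : bump" for w and c :: real
 proof -
  have "(%z. PROD e:E. w e (fst z e)) : bm (nu **M replicas (cfg :: 'd config measure))"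
   by (rule mcomp[OF measurable_fst cylinder_product(1)[OF E(3) that]])
  then have "(%z. PROD e:E. w e (fst z e)) : bm (TM A k)" using mcs[OF s] by blast
  then show ?thesis by measurable
 qed
 have gb: "0 <= (PROD e:E. w e (J e)) * c & (PROD e:E. w e (J e)) * c <= 1" if w: "!!e. e : E ==> w e : bump" and "0 <= c & c <= 1" for w J and c :: real
 proof -
  have "0 <= (PROD e:E. w e (J e)) & (PROD e:E. w e (J e)) <= 1" by (rule cylinder_product(2)[OF E(3) w])
  then show ?thesis using that(2) by (auto intro: mult_le_one)
 qed
 have pull: "(LINT z|TM A k. ((PROD e:E. w e (fst z e)) * c) * indicator C (snd z)) = (LINT z|TM A k. (PROD e:E. w e (fst z e)) * indicator C (snd z)) * c"
  for w and c :: real and C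
 proof -
  have "(LINT z|TM A k. ((PROD e:E. w e (fst z e)) * c) * indicator C (snd z)) = (LINT z|TM A k. ((PROD e:E. w e (fst z e)) * indicator C (snd z)) * c)"
   by (intro integral_cong refl) (simp only: mult_ac)
  then show ?thesis by simp
 qed
 have "(LINT z|TM A k. ((PROD e:E. u e (fst z e)) * p v) * indicator H (snd z))
   = (LINT z|TM A k. ((PROD e:E. v e (fst z e)) * p u) * indicator H (snd z))"
 proof (rule integral_indicator_extend[OF P P sm sm _ _ _ _ replica_config_generator _ H])
  have pp: "0 <= p v & p v <= 1" "0 <= p u & p u <= 1" by (rule pb[OF uA(2)], simp) (rule pb[OF uA(1)], simp)
  show "(%z. (PROD e:E. u e (fst z e)) * p v) : bm (TM A k)" by (rule gm[OF u])
  show "(%z. (PROD e:E. v e (fst z e)) * p u) : bm (TM A k)" by (rule gm[OF v])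
  show "0 <= (PROD e:E. u e (fst z e)) * p v & (PROD e:E. u e (fst z e)) * p v <= 1" for z :: "('d edge => real) \<times> (nat => 'd config)"
   by (rule gb[OF u pp(1)])
  show "0 <= (PROD e:E. v e (fst z e)) * p u & (PROD e:E. v e (fst z e)) * p u <= 1" for z :: "('d edge => real) \<times> (nat => 'd config)"
   by (rule gb[OF v pp(2)])
  fix C assume "C : {cyl D | D :: (nat \<times> 'd site) set. finite D}"
  then obtain D :: "(nat \<times> 'd site) set" where D: "C = cyl D" "finite D" by auto
  show "(LINT z|TM A k. ((PROD e:E. u e (fst z e)) * p v) * indicator C (snd z))
   = (LINT z|TM A k. ((PROD e:E. v e (fst z e)) * p u) * indicator C (snd z))"
   unfolding pull D(1) unfolding p_def by (rule TM_indep_cyl[OF A E u v uv D(2)])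
 qed
 then show ?thesis unfolding pull unfolding p_def .
qed

end

section \<open>Overlap events and continuity in the tilt\<close>

lemma reweight_const: "prob_space m ==> reweight (%_. 1) m = m"
 by (simp add: reweight_def prob_space.prob_space density_1)

text \<open>Finite-dimensional orthants with rational corners, encoded by lists: they are countably
  many, so that one null set of couplings serves them all, and appending lists intersects the
  events.\<close>

definition box_event :: "((nat \<times> nat) \<times> rat) list => (nat \<times> nat => real) set" where
 "box_event L = {q. \<forall>(p, r)\<in>set L. q p <= real_of_rat r}"

lemma box_event_generator:
 "sets array_space = sigma_sets (space array_space) (range box_event)" (is ?gen)
 "Int_stable (range box_event)" "range box_event \<subseteq> Pow (space array_space)" "space array_space : range box_event"
proof -
 have sp: "space array_space = UNIV" by (simp add: array_space_def space_PiM PiE_UNIV_domain)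
 show sub: "range box_event \<subseteq> Pow (space array_space)" by (simp add: sp)
 have "box_event [] = UNIV" by (simp add: box_event_def)
 then show "space array_space : range box_event" unfolding sp by (metis rangeI)
 show "Int_stable (range box_event)"
 proof (rule Int_stableI)
  fix x y assume "x : range box_event" "y : range box_event"
  then obtain L L' where "x = box_event L" "y = box_event L'" by auto
  then have "x \<inter> y = box_event (L @ L')" by (auto simp: box_event_def)
  then show "x \<inter> y : range box_event" by simp
 qed
 let ?S = "sigma (UNIV :: (nat \<times> nat => real) set) (range box_event)"
 show ?gen
 proof
  show "sigma_sets (space array_space) (range box_event) \<subseteq> sets array_space"
  proof (rule sets.sigma_sets_subset, safe)
   fix L
   have c: "{q : space array_space. case x of (p, r) => q p <= real_of_rat r} : sets array_space" for x :: "(nat \<times> nat) \<times> rat"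
    unfolding case_prod_beta array_space_def by measurable
   have "{q : space array_space. \<forall>x\<in>set L. case x of (p, r) => q p <= real_of_rat r} : sets array_space"
    by (intro sets.sets_Collect_finite_All c) simp
   then show "box_event L : sets array_space" by (simp add: box_event_def sp)
  qed
  have "(%q. q) : ?S ->M array_space"
   unfolding array_space_def
  proof (rule measurable_PiM_single')
   fix p :: "nat \<times> nat"
   have "(%q. q p) : ?S ->M sigma UNIV (range (%a :: rat. {..real_of_rat a}))"
   proof (rule measurable_sigma_sets[of _ UNIV "range (%a :: rat. {..real_of_rat a})"])
    fix y assume "y : range (%a :: rat. {..real_of_rat a})"
    then obtain r :: rat where "y = {..real_of_rat r}" by auto
    then have "(%q. q p) -` y \<inter> space ?S = box_event [(p, r)]" by (auto simp: box_event_def)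
    then show "(%q. q p) -` y \<inter> space ?S : sets ?S" by simp
   qed auto
   moreover have "borel = sigma UNIV (range (%a :: rat. {..real_of_rat a}))"
   proof -
    have ray: "{..x} : sets (sigma UNIV (range (%a :: rat. {..real_of_rat a})))" for x :: real
    proof -
     have eq: "{..x} = (\<Inter>r\<in>{r :: rat. x < real_of_rat r}. {..real_of_rat r})"
     proof (intro set_eqI iffI)
      fix y assume y: "y : (\<Inter>r\<in>{r :: rat. x < real_of_rat r}. {..real_of_rat r})"
      show "y : {..x}"
      proof (rule ccontr)
       assume "y \<notin> {..x}"
       then obtain r where "x < real_of_rat r" "real_of_rat r < y" using of_rat_dense[of x y] by auto
       then show False using y by auto
      qed
     qed auto
     have "UNIV : sigma_sets UNIV (range (%a :: rat. {..real_of_rat a}))" by (rule sigma_sets_top)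
     then show ?thesis unfolding eq by (intro sets.countable_INT'') auto
    qed
    show ?thesis by (rule borel_eq_sigmaI1[OF borel_eq_atMost]) (use ray in auto)
   qed
   ultimately show "(%q. q p) : bm ?S" by simp
  qed auto
  then have m: "(%q. q) -` X \<inter> space ?S : sets ?S" if "X : sets array_space" for X using that by (rule measurable_sets)
  show "sets array_space \<subseteq> sigma_sets (space array_space) (range box_event)"
   using m by (auto simp: sp)
 qed
qed

lemma box_event_finite_dim: "\<exists>s. finite_dim s (box_event L)"
proof (induction L)
 case Nil
 then show ?case by (auto simp: finite_dim_def box_event_def)
next
 case (Cons x L)
 then obtain s where s: "finite_dim s (box_event L)" by blast
 obtain i j r where x: "x = ((i, j), r)" by (metis surj_pair)
 define t where "t = max s (Suc (max i j))"
 have "finite_dim t (box_event (x # L))"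
  unfolding finite_dim_def
 proof (intro allI impI)
  fix q q' :: "nat \<times> nat => real" assume eq: "\<forall>i<t. \<forall>j<t. q (i, j) = q' (i, j)"
  then have "q : box_event L \<longleftrightarrow> q' : box_event L" using s by (auto simp: finite_dim_def t_def)
  moreover have "i < t" "j < t" by (auto simp: t_def)
  then have "q (i, j) = q' (i, j)" using eq by blast
  ultimately show "q : box_event (x # L) \<longleftrightarrow> q' : box_event (x # L)" by (auto simp: box_event_def x)
 qed
 then show ?case by blast
qed

lemma box_event_sets: "box_event L : sets array_space"
 using box_event_generator(1) by auto

context metastate
begin

text \<open>Edge spins are signs, so the quotient of the two weights is \<open>exp t\<close> with
  \<open>\<bar>t\<bar>\<close> at most \<open>\<beta>\<close> times the distance of the tilts. This
  is a relative error and hence uniform in the random measure.\<close>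

lemma tilt_close:
 assumes GA: "GA : space (prob_algebra cfg)" and A: "A \<subseteq> edges"
  and H: "H : sets array_space" "finite_dim s H"
 shows "\<bar>(LINT sg|replicas (reweight (weight A k J) GA). indicator H (ov sg)) - (LINT sg|replicas (reweight (weight A k' J') GA). indicator H (ov sg))\<bar>
  <= real s * (2 * (exp (\<beta> * (SUM e:A. \<bar>(k e - J e) - (k' e - J' e)\<bar>)) - 1))"
proof -
 note GA' = in_prob_config[OF GA]
 interpret GA: prob_space GA by (rule GA')
 let ?c = "exp (\<beta> * (SUM e:A. \<bar>(k e - J e) - (k' e - J' e)\<bar>)) - 1"
 have wi: "integrable GA (weight A k J)" for k J
  unfolding weight_def by (rule edge_weight_integrable[OF GA'(1,2) A])
 have om: "(%(sg, sg'). edge_overlap sg sg') : bm (GA **M GA)"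
  using edge_overlap_measurable measurable_cong_sets[OF sets_pair_measure_cong[OF GA'(2) GA'(2)] refl] by blast
 define F where "F x = (indicator H (fin_overlap s edge_overlap x) :: real)" for x :: "nat => 'd config"
 have Fm: "F : bm (PiM {..<s} (%_. GA))"
  unfolding F_def[abs_def] by (rule mcomp[OF fin_overlap_measurable[OF om] borel_measurable_indicator[OF H(1)]])
 have tr: "(LINT sg|replicas (reweight w GA). indicator H (ov sg)) = (LINT x|PiM {..<s} (%_. reweight w GA). F x)"
  if w: "integrable GA w" "!!x. w x > 0" for w
 proof -
  have "F : bm (PiM {..<s} (%_. reweight w GA))"
   using Fm measurable_cong_sets[of "PiM {..<s} (%_. reweight w GA)" "PiM {..<s} (%_. GA)" borel borel] sets_PiM_cong[of "{..<s}" "{..<s}" "%_. reweight w GA" "%_. GA"]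
   by auto
  from integral_replicas_restrict[OF prob_space_reweight[OF GA'(1) w] this, of UNIV]
  have "(LINT sg|replicas (reweight w GA). F (restrict sg {..<s})) = (LINT x|PiM {..<s} (%_. reweight w GA). F x)" by simp
  moreover have "indicator H (ov sg) = F (restrict sg {..<s})" for sg
   using finite_dim_restrict[OF H(2), of edge_overlap sg] by (simp add: F_def ov_def indicator_def)
  ultimately show ?thesis by simp
 qed
 have "\<bar>(LINT x|PiM {..<s} (%_. reweight (weight A k J) GA). F x) - (LINT x|PiM {..<s} (%_. reweight (weight A k' J') GA). F x)\<bar>
  <= 1 * real s * (2 * ?c)"
 proof (rule reweight_close[OF GA'(1) wi _ Fm])
  show "weight A k J x > 0" "weight A k' J' x > 0" for x by simp_all
  show "\<bar>F x\<bar> <= 1" for x by (simp add: F_def indicator_def)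
  show "weight A k' J' : bm GA" using wi by auto
  fix sg assume "sg : space GA"
  then have sg: "sg : space cfg" unfolding GA'(3) .
  define t where "t = \<beta> * (SUM e:A. ((k' e - J' e) - (k e - J e)) * edge_spin sg e)"
  have "\<bar>t\<bar> <= \<bar>\<beta>\<bar> * (SUM e:A. \<bar>(k e - J e) - (k' e - J' e)\<bar>)"
   unfolding t_def by (rule edge_weight_exponent_bound[OF sg A]) simp
  then have tb: "\<bar>t\<bar> <= \<beta> * (SUM e:A. \<bar>(k e - J e) - (k' e - J' e)\<bar>)" using \<beta> by simp
  have "weight A k' J' sg = weight A k J sg * exp t"
   by (simp add: weight_def edge_weight_def t_def exp_add[symmetric] sum_distrib_left[symmetric] algebra_simps sum.distrib sum_subtractf)
  then have "weight A k J sg - weight A k' J' sg = weight A k J sg * (1 - exp t)" by (simp add: algebra_simps)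
  also have "\<bar>...\<bar> = \<bar>1 - exp t\<bar> * weight A k J sg" by (simp add: abs_mult mult.commute less_imp_le)
  also have "\<bar>1 - exp t\<bar> <= exp \<bar>t\<bar> - 1"
  proof (cases "t >= 0")
   case False
   have "(exp t - 1)\<^sup>2 >= 0" by simp
   then have "2 * exp t <= exp t * exp t + 1" by (simp add: power2_eq_square algebra_simps)
   then have "2 <= exp t + exp (- t)" by (simp add: exp_minus field_simps)
   then show ?thesis using False by simp
  qed simp
  also have "exp \<bar>t\<bar> - 1 <= ?c" using tb by simp
  finally show "\<bar>weight A k J sg - weight A k' J' sg\<bar> <= ?c * weight A k J sg" by (simp add: mult_right_mono less_imp_le)
 qed
 then show ?thesis using tr[OF wi] by simp
qed

text \<open>Identifies the untilted replicas with a tilt whose target is \<open>J\<close> itself;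
  \<open>TM_overlap\<close> compares it with the tilt to a fixed \<open>k\<close> close to
  \<open>J\<close>.\<close>

lemma tilted_self: "J : space nu ==> tilted A J J = K J"
 unfolding tilted_def K_def
proof (rule bind_cong[OF refl])
 fix GA assume "J : space nu" "GA : space (\<kappa> J)"
 then have "prob_space GA" using space_\<kappa> in_prob_config by auto
 moreover have "weight A J J = (%_. 1)" by (simp add: weight_def edge_weight_def[abs_def])
 ultimately show "replicas (reweight (weight A J J) GA) = replicas GA" by (simp add: reweight_const)
qed

definition ov_event :: "(nat \<times> nat => real) set => (nat => 'd config) set" where
 "ov_event H = ov -` H \<inter> space (replicas cfg)"

lemma ov_event_sets: "H : sets array_space ==> ov_event H : sets (replicas cfg)"
 unfolding ov_event_def by (rule measurable_sets[OF ov_measurable])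

text \<open>The bound of \<open>tilt_close\<close> is the same for all random measures, so it
  survives the average over \<open>\<kappa> J\<close>.\<close>

lemma tilted_close:
 assumes J: "J : space nu" and A: "A \<subseteq> edges" and H: "H : sets array_space" "finite_dim s H"
 shows "\<bar>measure (tilted A k J) (ov_event H) - measure (tilted A k' J) (ov_event H)\<bar>
  <= real s * (2 * (exp (\<beta> * (SUM e:A. \<bar>k e - k' e\<bar>)) - 1))"
proof -
 let ?e = "real s * (2 * (exp (\<beta> * (SUM e:A. \<bar>k e - k' e\<bar>)) - 1))"
 interpret \<kappa>: prob_space "\<kappa> J" by (rule \<kappa>_prob_space[OF J])
 define f where "f k GA = (LINT sg|replicas (reweight (weight A k J) GA). (indicator (ov_event H) sg :: real))" for k GA
 have ind: "(indicator (ov_event H) :: _ => real) : bm (replicas cfg)"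
  using ov_event_sets[OF H(1)] by simp
 have m: "measure (tilted A k J) (ov_event H) = (LINT GA|\<kappa> J. f k GA)" for k
 proof -
  have "sets (tilted A k J) = sets (replicas cfg)"
   using measurable_space[OF tilted_kernel[OF A] J] by (auto simp: space_prob_algebra)
  then have "measure (tilted A k J) (ov_event H) = (LINT sg|tilted A k J. indicator (ov_event H) sg)"
   using ov_event_sets[OF H(1)] by (simp add: Int_absorb2 sets.sets_into_space)
  also have "... = (LINT GA|\<kappa> J. f k GA)"
   unfolding f_def by (rule integral_tilted[OF J A ind, where B = 1]) (simp add: indicator_def)
  finally show ?thesis .
 qed
 have fm: "f k : bm (\<kappa> J)" for k
  unfolding f_def[abs_def]
  by (rule mcomp[OF measurable_prob_algebraD[OF weight_kernel_\<kappa>[OF J A]] integral_measurable_subprob_algebra[OF ind]])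
 have fe: "f k GA = (LINT sg|replicas (reweight (weight A k J) GA). indicator H (ov sg)) & \<bar>f k GA\<bar> <= 1" if GA: "GA : space (prob_algebra cfg)" for k GA
 proof -
  note r = in_prob_config[OF reweight_mem[OF J GA A, of k]]
  have sp: "space (replicas (reweight (weight A k J) GA)) = space (replicas cfg)" unfolding space_PiM r(3) ..
  interpret R: prob_space "replicas (reweight (weight A k J) GA)" by (rule prob_space_PiM_const[OF r(1)])
  have "\<bar>f k GA\<bar> <= (LINT sg|replicas (reweight (weight A k J) GA). 1)"
   unfolding f_def by (intro order_trans[OF integral_abs_bound] integral_mono') (auto simp: indicator_def)
  moreover have "f k GA = (LINT sg|replicas (reweight (weight A k J) GA). indicator H (ov sg))"
   unfolding f_def
  proof (rule integral_cong[OF refl])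
   fix sg assume "sg : space (replicas (reweight (weight A k J) GA))"
   then have "sg : space (replicas cfg)" by (simp only: sp)
   then show "indicator (ov_event H) sg = (indicator H (ov sg) :: real)" unfolding ov_event_def by (simp add: indicator_def)
  qed
  ultimately show ?thesis by (simp add: R.prob_space)
 qed
 have fi: "integrable (\<kappa> J) (f k)" for k
 proof (rule \<kappa>.integrable_const_bound[OF AE_I2 fm])
  fix GA assume "GA : space (\<kappa> J)"
  then show "norm (f k GA) <= 1" using conjunct2[OF fe[of GA k]] by (simp add: space_\<kappa>[OF J])
 qed
 have d: "\<bar>f k GA - f k' GA\<bar> <= ?e" if "GA : space (\<kappa> J)" for GA
 proof -
  have GA: "GA : space (prob_algebra cfg)" using that by (simp add: space_\<kappa>[OF J])
  show ?thesis using tilt_close[OF GA A H, of k J k' J] fe[OF GA] by simp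
 qed
 have "\<bar>(LINT GA|\<kappa> J. f k GA) - (LINT GA|\<kappa> J. f k' GA)\<bar> = \<bar>\<integral>GA. f k GA - f k' GA \<partial>\<kappa> J\<bar>" using fi by simp
 also have "... <= (LINT GA|\<kappa> J. \<bar>f k GA - f k' GA\<bar>)" by (rule integral_abs_bound)
 also have "... <= (LINT GA|\<kappa> J. ?e)" using fi d by (intro integral_mono) auto
 finally show ?thesis unfolding m by (simp add: \<kappa>.prob_space)
qed

lemma tilted_event_measurable:
 assumes A: "A \<subseteq> edges" and H: "H : sets array_space"
 shows "(%J. measure (tilted A k J) (ov_event H)) : bm nu"
 by (rule mcomp[OF measurable_prob_algebraD[OF tilted_kernel[OF A]] measurable_measure_subprob_algebra[OF ov_event_sets[OF H]]])

lemma tilted_event_bounds: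
 assumes "J : space nu" "A \<subseteq> edges" shows "0 <= measure (tilted A k J) X" "measure (tilted A k J) X <= 1"
proof -
 interpret prob_space "tilted A k J" using measurable_space[OF tilted_kernel[OF assms(2)] assms(1)] by (auto simp: space_prob_algebra)
 show "0 <= measure (tilted A k J) X" "measure (tilted A k J) X <= 1" by auto
qed

lemma integral_TM_event:
 assumes A: "A \<subseteq> edges" and P: "P : bm nu" "!!J. 0 <= P J & P J <= (1::real)" and H: "H : sets array_space"
 shows "(LINT z|TM A k. P (fst z) * indicator (ov_event H) (snd z)) = (LINT J|nu. P J * measure (tilted A k J) (ov_event H))"
 unfolding integral_TM[OF A P ov_event_sets[OF H]]
proof (rule integral_cong[OF refl])
 fix J assume J: "J : space nu"
 have s: "sets (tilted A k J) = sets (replicas cfg)"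
  using measurable_space[OF tilted_kernel[OF A] J] by (auto simp: space_prob_algebra)
 have "measure (tilted A k J) (ov_event H) = (LINT sg|tilted A k J. indicator (ov_event H) sg)"
  using ov_event_sets[OF H] s by (simp add: Int_absorb2 sets.sets_into_space)
 also have "... = (LINT GA|\<kappa> J. (LINT sg|replicas (reweight (weight A k J) GA). (indicator (ov_event H) sg :: real)))"
  using ov_event_sets[OF H] by (intro integral_tilted[OF J A, where B = 1]) (auto simp: indicator_def)
 finally show "P J * (LINT GA|\<kappa> J. (LINT sg|replicas (reweight (weight A k J) GA). indicator (ov_event H) sg)) = P J * measure (tilted A k J) (ov_event H)" by simp
qed

lemma integral_M_event:
 assumes P: "P : bm nu" "!!J. 0 <= P J & P J <= (1::real)" and H: "H : sets array_space"
 shows "(LINT z|M. P (fst z) * indicator H (ov (snd z))) = (LINT J|nu. P J * measure (tilted A J J) (ov_event H))"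
proof -
 have "(LINT z|M. P (fst z) * indicator H (ov (snd z))) = (LINT J|nu. (LINT sg|K J. P (fst (J, sg)) * indicator H (ov (snd (J, sg)))))"
  unfolding M_def
 proof (rule integral_joint_law[OF prob_nu K_kernel])
  note P(1)[measurable] H[measurable]
  show "(%z. P (fst z) * indicator H (ov (snd z))) : bm (nu **M replicas cfg)" by measurable
  show "\<bar>P (fst z) * indicator H (ov (snd z))\<bar> <= 1" for z using P(2)[of "fst z"] by (simp add: indicator_def)
 qed
 also have "... = (LINT J|nu. P J * measure (tilted A J J) (ov_event H))"
 proof (rule integral_cong[OF refl])
  fix J assume J: "J : space nu"
  have s: "sets (K J) = sets (replicas cfg)" using measurable_space[OF K_kernel J] by (auto simp: space_prob_algebra)
  have "(LINT sg|K J. indicator H (ov sg)) = (LINT sg|K J. indicator (ov_event H) sg)"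
   using space_eqI[OF s] by (intro integral_cong refl) (auto simp: ov_event_def indicator_def)
  also have "... = measure (K J) (ov_event H)"
   using ov_event_sets[OF H] s by (simp add: Int_absorb2 sets.sets_into_space)
  finally show "(LINT sg|K J. P (fst (J, sg)) * indicator H (ov (snd (J, sg)))) = P J * measure (tilted A J J) (ov_event H)"
   by (simp add: tilted_self[OF J])
 qed
 finally show ?thesis .
qed

end

section \<open>Invariance of the overlap law under tilts\<close>

definition tent :: "real => real => real => real" where
 "tent a d x = max 0 (1 - \<bar>x - a\<bar> / d)"

lemma tent_bump:
 assumes "d > 0" shows "tent a d : bump"
proof -
 have "tent a d x = 0" if "\<bar>x\<bar> > \<bar>a\<bar> + d" for x
 proof -
  have "\<bar>x - a\<bar> >= d" using that by linarith
  then show ?thesis using assms by (simp add: tent_def le_divide_eq)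
 qed
 moreover have "continuous_on UNIV (tent a d)"
  unfolding tent_def[abs_def] using assms by (intro continuous_intros) auto
 moreover have "0 <= tent a d x & tent a d x <= 1" for x using assms by (simp add: tent_def)
 ultimately show ?thesis unfolding bump_def by blast
qed

lemma tent_nonzero: "d > 0 ==> tent a d x ~= 0 ==> \<bar>x - a\<bar> < d"
 by (simp add: tent_def max_def divide_less_eq split: if_splits)

lemma eq_0_of_exp_bound:
 fixes x b c :: real
 assumes "!!d. d > 0 ==> \<bar>x\<bar> <= c * (2 * (exp (b * d) - 1))"
 shows "x = 0"
proof -
 have "((%d. c * (2 * (exp (b * d) - 1))) \<longlongrightarrow> c * (2 * (exp (b * 0) - 1))) (at_right 0)"
  by (intro tendsto_intros)
 moreover have "\<forall>\<^sub>F d in at_right 0. \<bar>x\<bar> <= c * (2 * (exp (b * d) - 1))"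
  using eventually_at_right_less[of "0::real"] by eventually_elim (rule assms)
 ultimately have "\<bar>x\<bar> <= c * (2 * (exp (b * 0) - 1))" by (rule tendsto_lowerbound) simp
 then show ?thesis by simp
qed

context metastate
begin

lemma coupling_product_integrable:
 assumes "E \<subseteq> edges" "!!e. e : E ==> u e : bump"
 shows "integrable nu (%J. PROD e:E. u e (J e))"
proof (rule nu.integrable_const_bound[OF AE_I2])
 show "(%J. PROD e:E. u e (J e)) : bm nu" by (rule cylinder_product(1)[OF assms])
 fix J
 have "0 <= (PROD e:E. u e (J e)) & (PROD e:E. u e (J e)) <= 1" by (rule cylinder_product(2)[OF assms])
 then show "norm (PROD e:E. u e (J e)) <= 1" by simp
qed

lemma integral_coupling_product_bounds:
 assumes "E \<subseteq> edges" "!!e. e : E ==> u e : bump"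
 shows "0 <= (LINT J|nu. (PROD e:E. u e (J e))) & (LINT J|nu. (PROD e:E. u e (J e))) <= 1"
proof -
 have b: "0 <= (PROD e:E. u e (J e)) & (PROD e:E. u e (J e)) <= 1" for J by (rule cylinder_product(2)[OF assms])
 have i: "integrable nu (%J. PROD e:E. u e (J e))" by (rule coupling_product_integrable[OF assms])
 have "(LINT J|nu. (PROD e:E. u e (J e))) <= 1" using b by (intro nu.integral_le_const[OF i]) auto
 moreover have "0 <= (LINT J|nu. (PROD e:E. u e (J e)))" using b by (intro integral_nonneg_AE) auto
 ultimately show ?thesis by blast
qed

lemma integral_coupling_product_split:
 assumes E: "finite E" "A \<subseteq> E" "E \<subseteq> edges" and u: "!!e. e : E ==> u e : bump"
 shows "(LINT J|nu. (PROD e:E. u e (J e))) = (LINT J|nu. (PROD e:A. u e (J e))) * (LINT J|nu. (PROD e:E - A. u e (J e)))"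
proof -
 define f where "f B J = (PROD e:B. u e (J e))" for B and J :: "'d edge => real"
 have r: "f B (restrict J B) = f B J" for B J unfolding f_def by (intro prod.cong) auto
 have m: "f B : bm (PiM B (%_. borel))" if "B \<subseteq> E" for B
  unfolding f_def[abs_def]
 proof (rule borel_measurable_prod)
  fix e assume e: "e : B"
  then have ue: "u e : bump" using u that by blast
  show "(%J. u e (J e)) : bm (PiM B (%_. borel))"
   by (rule mcomp[OF _ bump_measurable[OF ue]]) (rule measurable_component_singleton[OF e])
 qed
 have b: "\<bar>f B J\<bar> <= 1" if "B \<subseteq> E" for B J
 proof -
  have "!!e. e : B ==> u e : bump" using u that by blast
  then have "0 <= f B J & f B J <= 1" unfolding f_def by (intro cylinder_product(2)) (use that E(3) in auto)
  then show ?thesis by simp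
 qed
 have "(LINT J|nu. f E J) = (LINT J|nu. f A (restrict J A) * f (E - A) (restrict J (E - A)))"
 proof (rule integral_cong[OF refl])
  fix J
  have "f E J = f (E - A) J * f A J" unfolding f_def by (rule prod.subset_diff[OF E(2,1)])
  then show "f E J = f A (restrict J A) * f (E - A) (restrict J (E - A))" by (simp add: r)
 qed
 also have "... = (LINT J|nu. f A (restrict J A)) * (LINT J|nu. f (E - A) (restrict J (E - A)))"
 proof (rule integral_indep_couplings[where A = A and B = "E - A" and f = "f A" and C = 1 and g = "f (E - A)" and D = 1])
  show "A \<inter> (E - A) = {}" "A \<subseteq> edges" "E - A \<subseteq> edges" using E by auto
  show "f A : bm (PiM A (%_. borel))" by (rule m[OF E(2)])
  show "f (E - A) : bm (PiM (E - A) (%_. borel))" by (rule m[OF Diff_subset])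
  show "\<bar>f A J\<bar> <= 1" for J by (rule b[OF E(2)])
  show "\<bar>f (E - A) J\<bar> <= 1" for J by (rule b[OF Diff_subset])
 qed
 finally show ?thesis by (simp add: r) (simp add: f_def)
qed

text \<open>Full support of \<open>\<rho>\<close> enters here: every interval around
  \<open>c\<close> has positive mass.\<close>

lemma integral_tent_pos:
 assumes e: "e : edges" and d: "d > 0"
 shows "0 < (LINT J|nu. tent c d (J e))"
proof -
 have t: "tent c d : bump" by (rule tent_bump[OF d])
 have m: "tent c d : bm \<rho>" using bump_measurable[OF t] measurable_cong_sets[OF sets_\<rho> refl] by blast
 interpret \<rho>: prob_space \<rho> by (rule prob_\<rho>)
 interpret pp: product_prob_space "%_ :: 'd edge. \<rho>" edges by unfold_locales
 have "distr nu \<rho> (%J. J e) = \<rho>"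
  unfolding nu_def coupling_law_def by (rule pp.PiM_component[OF e])
 moreover have em: "(%J. J e) : nu ->M \<rho>" using coupling_measurable[OF e] measurable_cong_sets[OF refl sets_\<rho>] by blast
 ultimately have eq: "(LINT J|nu. tent c d (J e)) = (LINT x|\<rho>. tent c d x)"
  using integral_distr[OF em m] by simp
 have b: "0 <= tent c d x" "tent c d x <= 1" for x using bump_bounds[OF t] by auto
 have i: "integrable \<rho> (tent c d)" using b by (intro \<rho>.integrable_const_bound[where B = 1, OF AE_I2 m]) auto
 have "(LINT x|\<rho>. tent c d x) ~= 0"
 proof
  assume "(LINT x|\<rho>. tent c d x) = 0"
  then have "AE x in \<rho>. tent c d x = 0" using integral_nonneg_eq_0_iff_AE[OF i] b by simp
  then have "AE x in \<rho>. x \<notin> ball c d"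
  proof eventually_elim
   fix x assume "tent c d x = 0"
   then show "x \<notin> ball c d" using d by (auto simp: tent_def dist_real_def max_def field_simps abs_minus_commute split: if_splits)
  qed
  then have "emeasure \<rho> {x : space \<rho>. x : ball c d} = 0" by (intro emeasure_eq_0_AE)
  then have "emeasure \<rho> (ball c d) = 0" using space_eqI[OF sets_\<rho>] by (simp add: ball_def)
  moreover have "c : topological_support \<rho>" using support by simp
  then have "0 < emeasure \<rho> (ball c d)" unfolding topological_support_def using d by (auto simp del: Elementary_Metric_Spaces.mem_ball)
  ultimately show False by simp
 qed
 moreover have "0 <= (LINT x|\<rho>. tent c d x)" using b by (intro integral_nonneg_AE) auto
 ultimately show ?thesis unfolding eq by simp
qed

lemma integral_tents_pos:
 assumes "finite A" "A \<subseteq> edges" and d: "d > 0"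
 shows "0 < (LINT J|nu. (PROD e:A. tent (k e) d (J e)))"
 using assms(1,2)
proof (induction A)
 case empty
 then show ?case by (simp add: nu.prob_space)
next
 case (insert e A)
 have "(LINT J|nu. (PROD x:insert e A. tent (k x) d (J x)))
   = (LINT J|nu. (PROD x:{e}. tent (k x) d (J x))) * (LINT J|nu. (PROD x:insert e A - {e}. tent (k x) d (J x)))"
  using insert by (intro integral_coupling_product_split tent_bump[OF d]) auto
 moreover have "insert e A - {e} = A" using insert by auto
 ultimately show ?case using insert integral_tent_pos[OF _ d, of e "k e"] by simp
qed

text \<open>Given the event that the couplings in \<open>A\<close> are close to \<open>k\<close>, tilting them to \<open>k\<close> changes
 little, so there the law of the overlaps is close to \<open>Qbar\<close>. But the tilted law does not see the
 couplings in \<open>A\<close>, so that this conditioning is void.\<close>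
lemma TM_overlap:
 assumes A: "finite A" "A \<subseteq> edges" and E: "finite E" "A \<subseteq> E" "E \<subseteq> edges"
  and u: "!!e. e : E ==> u e : bump"
  and H: "H : sets array_space" "finite_dim s H"
 shows "(LINT z|TM A k. (PROD e:E. u e (fst z e)) * indicator (ov_event H) (snd z))
  = (LINT J|nu. (PROD e:E. u e (J e))) * measure Qbar H"
proof -
 interpret Q: prob_space Qbar by (rule prob_Qbar)
 define c where "c = measure Qbar H"
 define I where "I w = (LINT z|TM A k. (PROD e:E. w e (fst z e)) * indicator (ov_event H) (snd z))" for w :: "'d edge => real => real"
 define p where "p B w = (LINT J|nu. (PROD e:B. w e (J e)))" for B and w :: "'d edge => real => real"
 have "\<bar>I u - p E u * c\<bar> <= real s * (2 * (exp ((\<beta> * real (card A)) * d) - 1))" if d: "d > 0" for d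
 proof -
  define eps where "eps = real s * (2 * (exp ((\<beta> * real (card A)) * d) - 1))"
  have eps0: "eps >= 0" using \<beta> d by (simp add: eps_def)
  \<comment> \<open>On \<open>A\<close> the bumps are replaced by tents around \<open>k\<close>, so
    that \<open>J\<close> is within \<open>d\<close> of \<open>k\<close> on \<open>A\<close>
    wherever \<open>P J\<close> is nonzero.\<close>
  define v where "v e = (if e : A then tent (k e) d else u e)" for e
  have v: "v e : bump" if "e : E" for e using u[OF that] tent_bump[OF d] by (simp add: v_def)
  define P where "P J = (PROD e:E. v e (J e))" for J
  have Pm: "P : bm nu" unfolding P_def[abs_def] by (rule cylinder_product(1)[OF E(3) v])
  have Pb: "0 <= P J & P J <= 1" for J unfolding P_def by (rule cylinder_product(2)[OF E(3) v])
  have Pi: "integrable nu P" unfolding P_def[abs_def] by (rule coupling_product_integrable[OF E(3) v])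
  define m where "m J = measure (tilted A k J) (ov_event H)" for J
  define m' where "m' J = measure (tilted A J J) (ov_event H)" for J
  have "I v = (LINT J|nu. P J * m J)"
   unfolding I_def m_def P_def[symmetric] by (rule integral_TM_event[OF A(2) Pm Pb H(1)])
  moreover have "p E v * c = (LINT J|nu. P J * m' J)"
  proof -
   have "p E v * c = (LINT z|M. P (fst z) * indicator H (ov (snd z)))"
    unfolding p_def c_def P_def by (rule integral_M_overlap[OF E(1,3) v H(1), symmetric])
   also have "... = (LINT J|nu. P J * m' J)" unfolding m'_def by (rule integral_M_event[OF Pm Pb H(1)])
   finally show ?thesis .
  qed
  moreover have "\<bar>(LINT J|nu. P J * m J) - (LINT J|nu. P J * m' J)\<bar> <= eps * (LINT J|nu. P J)"
  proof -
   have mm: "m : bm nu" unfolding m_def[abs_def] by (rule tilted_event_measurable[OF A(2) H(1)])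
   have mm': "m' : bm nu"
   proof -
    have "m' J = measure (K J) (ov_event H)" if "J : space nu" for J unfolding m'_def by (simp add: tilted_self[OF that])
    moreover have "(%J. measure (K J) (ov_event H)) : bm nu"
     by (rule mcomp[OF measurable_prob_algebraD[OF K_kernel] measurable_measure_subprob_algebra[OF ov_event_sets[OF H(1)]]])
    ultimately show ?thesis by (simp cong: measurable_cong)
   qed
   have mb: "0 <= m J" "m J <= 1" "0 <= m' J" "m' J <= 1" if "J : space nu" for J
    unfolding m_def m'_def by (rule tilted_event_bounds[OF that A(2)])+
   have i: "integrable nu (%J. P J * m J)" "integrable nu (%J. P J * m' J)"
    using Pm mm mm' Pb mb by (auto intro!: nu.integrable_const_bound[of _ 1] AE_I2 mult_le_one simp: abs_mult)
   have pw: "\<bar>P J * m J - P J * m' J\<bar> <= eps * P J" if J: "J : space nu" for J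
   proof (cases "P J = 0")
    case False
    have cl: "\<bar>k e - J e\<bar> <= d" if "e : A" for e
    proof -
     have "v e (J e) ~= 0" using False E that by (auto simp: P_def)
     then show ?thesis using tent_nonzero[OF d, of "k e" "J e"] that by (simp add: v_def abs_minus_commute)
    qed
    have "\<bar>m J - m' J\<bar> <= real s * (2 * (exp (\<beta> * (SUM e:A. \<bar>k e - J e\<bar>)) - 1))"
     unfolding m_def m'_def by (rule tilted_close[OF J A(2) H])
    also have "... <= eps"
    proof -
     have "(SUM e:A. \<bar>k e - J e\<bar>) <= real (card A) * d" using sum_bounded_above[of A "%e. \<bar>k e - J e\<bar>" d] cl by simp
     then have "\<beta> * (SUM e:A. \<bar>k e - J e\<bar>) <= (\<beta> * real (card A)) * d" using \<beta> by (simp add: mult.assoc)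
     then show ?thesis unfolding eps_def by (intro mult_left_mono) auto
    qed
    finally have "P J * \<bar>m J - m' J\<bar> <= P J * eps" using Pb[of J] by (intro mult_left_mono) auto
    moreover have "\<bar>P J * m J - P J * m' J\<bar> = P J * \<bar>m J - m' J\<bar>"
     using Pb[of J] by (simp add: abs_mult right_diff_distrib[symmetric])
    ultimately show ?thesis by (simp add: mult.commute)
   qed simp
   have "\<bar>(LINT J|nu. P J * m J) - (LINT J|nu. P J * m' J)\<bar> = \<bar>\<integral>J. P J * m J - P J * m' J \<partial>nu\<bar>" using i by simp
   also have "... <= (LINT J|nu. \<bar>P J * m J - P J * m' J\<bar>)" by (rule integral_abs_bound)
   also have "... <= (LINT J|nu. eps * P J)" using i Pi pw by (intro integral_mono) auto
   finally show ?thesis by simp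
  qed
  ultimately have d1: "\<bar>I v - p E v * c\<bar> <= eps * p E v" by (simp add: p_def P_def)
  have uv: "u e = v e" if "e : E - A" for e using that by (simp add: v_def)
  have d2: "I u * p A v = I v * p A u"
   unfolding I_def p_def by (rule TM_indep[OF A E u v uv ov_event_sets[OF H(1)]])
  have EA: "p (E - A) v = p (E - A) u" unfolding p_def v_def by (intro integral_cong refl prod.cong) auto
  have d3: "p E v = p A v * p (E - A) u" unfolding EA[symmetric] unfolding p_def by (rule integral_coupling_product_split[OF E v])
  have d4: "p E u = p A u * p (E - A) u" unfolding p_def by (rule integral_coupling_product_split[OF E u])
  have "p A v = (LINT J|nu. (PROD e:A. tent (k e) d (J e)))" unfolding p_def v_def by (intro integral_cong refl prod.cong) auto
  then have pos: "p A v > 0" using integral_tents_pos[OF A d, of k] by simp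
  have uA: "u e : bump" if "e : A" for e using u E that by auto
  have pA: "0 <= p A u & p A u <= 1" unfolding p_def by (rule integral_coupling_product_bounds[OF A(2) uA])
  have pE: "0 <= p E u & p E u <= 1" unfolding p_def by (rule integral_coupling_product_bounds[OF E(3) u])
  \<comment> \<open>The difference is multiplied by \<open>p A v\<close>, which is positive but
    without a lower bound as \<open>d\<close> shrinks. The factor occurs on both sides and cancels,
    so that a bound by \<open>eps\<close> remains, which vanishes with \<open>d\<close>.\<close>
  have "p A v * \<bar>I u - p E u * c\<bar> = \<bar>p A v * (I u - p E u * c)\<bar>" using pos by (simp add: abs_mult)
  also have "p A v * (I u - p E u * c) = I u * p A v - p A v * p E u * c" by (simp add: algebra_simps)
  also have "I u * p A v - p A v * p E u * c = p A u * (I v - p E v * c)" unfolding d2 d3 d4 by (simp add: algebra_simps)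
  also have "\<bar>p A u * (I v - p E v * c)\<bar> = p A u * \<bar>I v - p E v * c\<bar>" using pA by (simp add: abs_mult)
  also have "... <= p A u * (eps * p E v)" using d1 pA by (intro mult_left_mono) auto
  also have "... = p A v * (eps * p E u)" by (simp add: d3 d4)
  finally have "\<bar>I u - p E u * c\<bar> <= eps * p E u" using pos by (simp add: mult_le_cancel_left_pos)
  also have "... <= eps" using pE eps0 by (intro mult_left_le) auto
  finally show ?thesis by (simp add: eps_def)
 qed
 then have "I u - p E u * c = 0" by (rule eq_0_of_exp_bound)
 then show ?thesis by (simp add: I_def p_def c_def)
qed

text \<open>\<open>TM_overlap\<close> tests the tilted probability against all bump products and
  finds the constant \<open>measure Qbar H\<close> each time.\<close>

lemma AE_tilted_event:
 assumes A: "finite A" "A \<subseteq> edges" and H: "H : sets array_space" "finite_dim s H"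
 shows "AE J in nu. measure (tilted A k J) (ov_event H) = measure Qbar H"
proof -
 interpret Q: prob_space Qbar by (rule prob_Qbar)
 \<comment> \<open>Truncation gives values in \<open>[0, 1]\<close> at every argument, also outside
   \<open>space nu\<close>, as \<open>AE_const_from_bump\<close> asks.\<close>
 define g where "g J = max 0 (min 1 (measure (tilted A k J) (ov_event H)))" for J
 have g: "g J = measure (tilted A k J) (ov_event H)" if "J : space nu" for J
  using tilted_event_bounds[OF that A(2), of k "ov_event H"] by (simp add: g_def)
 have "AE J in nu. g J = measure Qbar H"
 proof (rule AE_const_from_bump[OF _ _ _ _ A])
  show "g : bm nu" unfolding g_def[abs_def] using tilted_event_measurable[OF A(2) H(1), of k] by measurable
  show "0 <= g J & g J <= 1" for J by (simp add: g_def)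
  fix E :: "'d edge set" and u assume E: "finite E" "A \<subseteq> E" "E \<subseteq> edges" and u: "!!e. e : E ==> u e : bump"
  define P where "P J = (PROD e:E. u e (J e))" for J
  have Pm: "P : bm nu" unfolding P_def[abs_def] by (rule cylinder_product(1)[OF E(3) u])
  have Pb: "0 <= P J & P J <= 1" for J unfolding P_def by (rule cylinder_product(2)[OF E(3) u])
  have "(LINT J|nu. P J * g J) = (LINT J|nu. P J * measure (tilted A k J) (ov_event H))"
   by (intro integral_cong refl) (simp add: g)
  also have "... = (LINT z|TM A k. P (fst z) * indicator (ov_event H) (snd z))"
   by (rule integral_TM_event[OF A(2) Pm Pb H(1), symmetric])
  also have "... = (LINT J|nu. P J) * measure Qbar H"
   unfolding P_def by (rule TM_overlap[OF A E u H])
  finally show "(LINT J|nu. (PROD e:E. u e (J e)) * g J) = (LINT J|nu. (PROD e:E. u e (J e))) * measure Qbar H" by (simp add: P_def)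
 qed auto
 then show ?thesis by (rule AE_mp) (use g in \<open>auto intro!: AE_I2\<close>)
qed

text \<open>One null set for all \<open>k\<close>: rational \<open>k\<close> on finite cubes and box
  events are countable, and \<open>tilted_close\<close> passes from rational to real
  \<open>k\<close> with a bound that does not depend on the couplings.\<close>

lemma AE_tilted_law:
 "AE J in nu. \<forall>n k. distr (tilted (cube_edges n) k J) array_space ov = Qbar"
proof -
 \<comment> \<open>\<open>PiE\<close> fixes the values off the finite set of edges, which keeps the
   family countable.\<close>
 define R :: "nat => ('d edge => real) set" where "R n = PiE (cube_edges n) (%_. \<rat>)" for n
 have "countable (R n)" for n unfolding R_def by (intro countable_PiE) (auto simp: countable_rat)
 have "AE J in nu. \<forall>n. \<forall>k\<in>R n. \<forall>L. measure (tilted (cube_edges n) k J) (ov_event (box_event L)) = measure Qbar (box_event L)"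
  unfolding AE_all_countable AE_ball_countable[OF \<open>countable (R _)\<close>]
 proof (intro allI ballI)
  fix n :: nat and k :: "'d edge => real" and L
  obtain s where s: "finite_dim s (box_event L)" using box_event_finite_dim by blast
  show "AE J in nu. measure (tilted (cube_edges n) k J) (ov_event (box_event L)) = measure Qbar (box_event L)"
   by (rule AE_tilted_event[OF finite_cube_edges cube_edges_subset box_event_sets s])
 qed
 then show ?thesis
 proof (rule AE_mp, intro AE_I2 impI allI)
  fix J n k
  assume J: "J : space nu"
   and *: "\<forall>n. \<forall>k\<in>R n. \<forall>L. measure (tilted (cube_edges n) k J) (ov_event (box_event L)) = measure Qbar (box_event L)"
  let ?A = "cube_edges n :: 'd edge set"
  have eq: "measure (tilted ?A k J) (ov_event (box_event L)) = measure Qbar (box_event L)" for L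
  proof -
   obtain s where s: "finite_dim s (box_event L)" using box_event_finite_dim by blast
   have "\<bar>measure (tilted ?A k J) (ov_event (box_event L)) - measure Qbar (box_event L)\<bar>
    <= real s * (2 * (exp ((\<beta> * real (card ?A)) * d) - 1))" if d: "d > 0" for d
   proof -
    have "\<exists>r\<in>\<rat>. \<bar>k e - r\<bar> <= d" for e
    proof -
     obtain r where "r : \<rat>" "k e < r" "r < k e + d" using Rats_dense_in_real[of "k e" "k e + d"] d by auto
     then show ?thesis by (intro bexI[of _ r]) auto
    qed
    then obtain r where r: "!!e. r e : \<rat>" "!!e. \<bar>k e - r e\<bar> <= d" by metis
    let ?r = "restrict r ?A"
    have "?r : R n" using r by (simp add: R_def)
    then have "measure (tilted ?A ?r J) (ov_event (box_event L)) = measure Qbar (box_event L)" using * by blast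
    moreover have "\<bar>measure (tilted ?A k J) (ov_event (box_event L)) - measure (tilted ?A ?r J) (ov_event (box_event L))\<bar>
      <= real s * (2 * (exp (\<beta> * (SUM e:?A. \<bar>k e - ?r e\<bar>)) - 1))"
     by (rule tilted_close[OF J cube_edges_subset box_event_sets s])
    moreover have "(SUM e:?A. \<bar>k e - ?r e\<bar>) <= real (card ?A) * d"
     using sum_bounded_above[of ?A "%e. \<bar>k e - ?r e\<bar>" d] r by simp
    then have "\<beta> * (SUM e:?A. \<bar>k e - ?r e\<bar>) <= (\<beta> * real (card ?A)) * d"
     unfolding mult.assoc using \<beta> by (intro mult_left_mono) auto
    then have "real s * (2 * (exp (\<beta> * (SUM e:?A. \<bar>k e - ?r e\<bar>)) - 1)) <= real s * (2 * (exp ((\<beta> * real (card ?A)) * d) - 1))"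
     by (intro mult_left_mono) auto
    ultimately show ?thesis by (simp only:)
   qed
   then have "measure (tilted ?A k J) (ov_event (box_event L)) - measure Qbar (box_event L) = 0" by (rule eq_0_of_exp_bound)
   then show ?thesis by simp
  qed
  have T: "tilted ?A k J : space (prob_algebra (replicas cfg))"
   by (rule measurable_space[OF tilted_kernel[OF cube_edges_subset] J])
  then have sT: "sets (tilted ?A k J) = sets (replicas cfg)" and pT: "prob_space (tilted ?A k J)"
   by (auto simp: space_prob_algebra)
  interpret T: prob_space "tilted ?A k J" by (rule pT)
  interpret Q: prob_space Qbar by (rule prob_Qbar)
  have om: "ov : tilted ?A k J ->M array_space" using ov_measurable mcs[OF sT] by blast
  have sQ: "sets Qbar = sets array_space" by (simp add: Qbar_def)
  show "distr (tilted ?A k J) array_space ov = Qbar"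
  proof (rule measure_eqI_generator_eq[OF box_event_generator(2,3), where A = "%_. space array_space"])
   fix X assume "X : range box_event"
   then obtain L where X: "X = box_event L" by auto
   have "emeasure (distr (tilted ?A k J) array_space ov) X = emeasure (tilted ?A k J) (ov_event X)"
    unfolding X ov_event_def using space_eqI[OF sT] by (simp add: emeasure_distr[OF om box_event_sets])
   then show "emeasure (distr (tilted ?A k J) array_space ov) X = emeasure Qbar X"
    by (simp add: T.emeasure_eq_measure Q.emeasure_eq_measure X eq)
  next
   show "sets (distr (tilted ?A k J) array_space ov) = sigma_sets (space array_space) (range box_event)"
    by (simp add: box_event_generator(1))
   show "sets Qbar = sigma_sets (space array_space) (range box_event)" by (simp add: sQ box_event_generator(1))
   show "range (%_. space array_space) \<subseteq> range box_event" using box_event_generator(4) by auto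
   show "emeasure (distr (tilted ?A k J) array_space ov) (space array_space) ~= \<infinity>" for i :: nat
    using prob_space.emeasure_space_1[OF T.prob_space_distr[OF om]] by simp
  qed auto
 qed
qed

text \<open>The exceptional set is uniform in \<open>k\<close>, so \<open>k\<close> may depend on
  \<open>J\<close>. With \<open>k = J + h / \<beta>\<close> the weight is that of \<open>h\<close>,
  and \<open>J\<close> and \<open>\<beta>\<close> drop out of it; with \<open>k = J\<close> there is
  no tilt, which identifies \<open>Qbar\<close> as the untilted law.\<close>

theorem AE_tilt_invariant:
 "AE J in nu. \<forall>n h. distr (\<kappa> J \<bind> (%GA. replicas (reweight (edge_weight 1 (cube_edges n) h) GA))) array_space ov
  = distr (\<kappa> J \<bind> replicas) array_space ov"
 using AE_tilted_law
proof (rule AE_mp, intro AE_I2 impI allI)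
 fix J n and h :: "'d edge => real"
 assume J: "J : space nu" and *: "\<forall>n k. distr (tilted (cube_edges n) k J) array_space ov = Qbar"
 have "edge_weight 1 (cube_edges n) h = weight (cube_edges n) (%e. J e + h e / \<beta>) J"
  using \<beta> by (simp add: weight_def edge_weight_def[abs_def] sum_distrib_left)
 then have "distr (\<kappa> J \<bind> (%GA. replicas (reweight (edge_weight 1 (cube_edges n) h) GA))) array_space ov = Qbar"
  using * by (simp add: tilted_def)
 moreover have "distr (K J) array_space ov = Qbar" using spec[OF spec[OF *], of 0 J] by (simp add: tilted_self[OF J])
 ultimately show "distr (\<kappa> J \<bind> (%GA. replicas (reweight (edge_weight 1 (cube_edges n) h) GA))) array_space ov
  = distr (\<kappa> J \<bind> replicas) array_space ov" by (simp add: K_def)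
qed

end

section \<open>Gaussian fields and trigonometric approximation\<close>

abbreviation "stdN \<equiv> std_normal_distribution"

lemma prob_space_stdN: "prob_space stdN" by (rule prob_space_normal_density) simp

lemma integral_cis_stdN: "(LINT z|stdN. cis (t * z)) = complex_of_real (exp (- t\<^sup>2 / 2))"
 using fun_cong[OF char_std_normal_distribution, of t] by (simp add: char_def cis_conv_exp)

lemma nn_integral_exp_stdN: "(\<integral>\<^sup>+z. ennreal (exp (u * z)) \<partial>stdN) = ennreal (exp (u\<^sup>2 / 2))"
proof -
 have e: "std_normal_density z * exp (u * z) = exp (u\<^sup>2 / 2) * normal_density u 1 z" for z
 proof -
  have "- z\<^sup>2 / 2 + u * z = u\<^sup>2 / 2 - (z - u)\<^sup>2 / 2" by (simp add: power2_eq_square field_simps)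
  then have "exp (- z\<^sup>2 / 2) * exp (u * z) = exp (u\<^sup>2 / 2) * exp (- (z - u)\<^sup>2 / 2)"
   by (simp add: exp_add[symmetric])
  then show ?thesis by (simp add: normal_density_def)
 qed
 have "(\<integral>\<^sup>+z. ennreal (exp (u * z)) \<partial>stdN) = (\<integral>\<^sup>+z. ennreal (std_normal_density z) * ennreal (exp (u * z)) \<partial>lborel)"
  by (rule nn_integral_density) auto
 also have "... = (\<integral>\<^sup>+z. ennreal (exp (u\<^sup>2 / 2)) * ennreal (normal_density u 1 z) \<partial>lborel)"
  by (intro nn_integral_cong) (simp add: ennreal_mult'[symmetric] e)
 also have "... = ennreal (exp (u\<^sup>2 / 2)) * (\<integral>\<^sup>+z. ennreal (normal_density u 1 z) \<partial>lborel)"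
  by (rule nn_integral_cmult) auto
 also have "(\<integral>\<^sup>+z. ennreal (normal_density u 1 z) \<partial>lborel) = 1"
  by (subst nn_integral_eq_integral) auto
 finally show ?thesis by simp
qed

lemma exp_stdN:
 "integrable stdN (%z. exp (u * z))" "(LINT z|stdN. exp (u * z)) = exp (u\<^sup>2 / 2)"
proof -
 have m: "(%z. exp (u * z)) : bm stdN" by simp
 show "integrable stdN (%z. exp (u * z))"
  by (rule integrableI_nn_integral_finite[OF m _ nn_integral_exp_stdN]) auto
 show "(LINT z|stdN. exp (u * z)) = exp (u\<^sup>2 / 2)"
  by (subst integral_eq_nn_integral[OF m]) (auto simp: nn_integral_exp_stdN)
qed

text \<open>Trigonometric polynomials as lists of complex coefficients with real frequencies; a
  Gaussian expectation of a product of them is a finite sum of exponentials of covariances.\<close>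

definition trig_sum :: "(complex \<times> real) list => real => complex" where
 "trig_sum L x = (\<Sum>(c, t)\<leftarrow>L. c * cis (t * x))"

definition trig_poly :: "(real => real) set" where
 "trig_poly = {f. \<exists>L. \<forall>x. complex_of_real (f x) = trig_sum L x}"

lemma trig_sum_simps [simp]:
 "trig_sum [] x = 0" "trig_sum (p # L) x = fst p * cis (snd p * x) + trig_sum L x"
 "trig_sum (L @ L') x = trig_sum L x + trig_sum L' x"
 by (simp_all add: trig_sum_def case_prod_beta)

lemma trig_sum_mult: "\<exists>L''. \<forall>x. trig_sum L x * trig_sum L' x = trig_sum L'' x"
proof (induction L)
 case Nil
 show ?case by (intro exI[of _ "[]"]) simp
next
 case (Cons p L)
 then obtain L'' where L'': "!!x. trig_sum L x * trig_sum L' x = trig_sum L'' x" by blast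
 have "trig_sum (map (%q. (fst p * fst q, snd p + snd q)) L') x = fst p * cis (snd p * x) * trig_sum L' x" for x
  by (induction L') (simp_all add: algebra_simps cis_mult[symmetric])
 then show ?case
  by (intro exI[of _ "map (%q. (fst p * fst q, snd p + snd q)) L' @ L''"]) (simp add: L''[symmetric] algebra_simps)
qed

lemma trig_poly_const: "(%x. a) : trig_poly"
 unfolding trig_poly_def by (intro CollectI exI[of _ "[(complex_of_real a, 0)]"]) simp

lemma trig_poly_add: "f : trig_poly ==> g : trig_poly ==> (%x. f x + g x) : trig_poly"
 unfolding trig_poly_def by (clarsimp, rule_tac x = "L @ La" in exI) simp

lemma trig_poly_mult: "f : trig_poly ==> g : trig_poly ==> (%x. f x * g x) : trig_poly"
 unfolding trig_poly_def using trig_sum_mult by fastforce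

lemma trig_poly_sin: "(%x. sin (b * x)) : trig_poly"
proof -
 have "complex_of_real (sin (b * x)) = trig_sum [(1 / (2 * \<i>), b), (- 1 / (2 * \<i>), - b)] x" for x
  by (simp add: complex_eq_iff)
 then show ?thesis unfolding trig_poly_def by blast
qed

lemma trig_poly_power: "f : trig_poly ==> (%x. f x ^ n) : trig_poly"
 by (induction n) (simp_all add: trig_poly_const trig_poly_mult)

lemma trig_poly_sum:
 assumes "!!j. f j : trig_poly" shows "(%x. SUM j<=(n::nat). f j x) : trig_poly"
 by (induction n) (simp_all add: assms trig_poly_add)

lemma scaled_sin_tendsto: "(%n. real (Suc n) * sin (x / real (Suc n))) ----> x"
proof (cases "x = 0")
 case False
 have "((%y. sin y / y) \<longlongrightarrow> 1) (at (0::real))"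
  using DERIV_sin[of "0::real"] by (simp add: DERIV_def)
 moreover have "filterlim (%n. x / real (Suc n)) (at 0) sequentially"
  using False real_tendsto_divide_at_top[OF tendsto_const filterlim_compose[OF filterlim_real_sequentially filterlim_Suc], of x]
  by (auto simp: filterlim_at)
 ultimately have "(%n. sin (x / real (Suc n)) / (x / real (Suc n))) ----> 1" by (rule filterlim_compose)
 from tendsto_mult_left[OF this, of x] have "(%n. x * (sin (x / real (Suc n)) / (x / real (Suc n)))) ----> x" by simp
 moreover have "x * (sin (x / real (Suc n)) / (x / real (Suc n))) = real (Suc n) * sin (x / real (Suc n))" for n
  using False by (simp del: of_nat_Suc)
 ultimately show ?thesis by (simp only:)
qed simp

text \<open>The exponent \<open>l * x\<close> is replaced by \<open>l * n * sin (x / n)\<close>,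
  which is bounded, converges to \<open>l * x\<close> and is dominated by
  \<open>\<bar>l\<bar> * \<bar>x\<bar>\<close>. A polynomial close to \<open>exp\<close> on the
  bounded range then gives a trigonometric polynomial; its error is kept below half of the minimum
  of \<open>exp\<close> there, so that \<open>ta\<close> stays away from \<open>0\<close>.\<close>

lemma trig_approx:
 fixes l e :: real
 assumes e: "e > 0"
 obtains ta k K where "ta : trig_poly" "0 < k" "!!x. k <= ta x & ta x <= K"
  "(\<integral>\<^sup>+x. ennreal ((exp (l * x - l\<^sup>2 / 2) - ta x)\<^sup>2) \<partial>stdN) <= ennreal e"
proof -
 interpret N: prob_space stdN by (rule prob_space_stdN)
 define E where "E = exp (- l\<^sup>2 / 2)"
 have E: "0 < E" "E <= 1" by (auto simp: E_def)
 define w where "w x = exp (l * x - l\<^sup>2 / 2)" for x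
 have wE: "w x = E * exp (l * x)" for x by (simp add: w_def E_def exp_add[symmetric])
 define y where "y n x = l * (real (Suc n) * sin (1 / real (Suc n) * x))" for n :: nat and x
 define f where "f n x = E * exp (y n x)" for n x
 have yb: "\<bar>y n x\<bar> <= \<bar>l\<bar> * \<bar>x\<bar>" for n x
 proof -
  have "\<bar>sin (1 / real (Suc n) * x)\<bar> <= \<bar>1 / real (Suc n) * x\<bar>" by (rule abs_sin_x_le_abs_x)
  then have "real (Suc n) * \<bar>sin (1 / real (Suc n) * x)\<bar> <= real (Suc n) * \<bar>1 / real (Suc n) * x\<bar>" by (intro mult_left_mono) auto
  also have "... = \<bar>x\<bar>" by (simp add: abs_mult)
  finally show ?thesis unfolding y_def abs_mult by (intro mult_left_mono) auto
 qed
 have ylim: "(%n. y n x) ----> l * x" for x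
  unfolding y_def using tendsto_mult_left[OF scaled_sin_tendsto, of l x] by (simp del: of_nat_Suc)
 \<comment> \<open>The envelope \<open>exp (2 * \<bar>l * x\<bar>)\<close> is split into two
   exponentials, whose Gaussian integrals are known.\<close>
 have bound: "(w x - f n x)\<^sup>2 <= 4 * (exp ((2 * l) * x) + exp ((- 2 * l) * x))" for n x
 proof -
  have b1: "exp t <= exp (\<bar>l\<bar> * \<bar>x\<bar>)" if "\<bar>t\<bar> <= \<bar>l\<bar> * \<bar>x\<bar>" for t using that by simp
  have "w x <= exp (\<bar>l\<bar> * \<bar>x\<bar>)" using E mult_mono[OF E(2) b1[of "l * x"]] by (simp add: wE abs_mult)
  moreover have "f n x <= exp (\<bar>l\<bar> * \<bar>x\<bar>)" using E mult_mono[OF E(2) b1[OF yb[of n x]]] by (simp add: f_def)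
  moreover have "0 <= w x" "0 <= f n x" using E by (simp_all add: wE f_def)
  ultimately have "\<bar>w x - f n x\<bar> <= 2 * exp (\<bar>l\<bar> * \<bar>x\<bar>)" by linarith
  then have "(w x - f n x)\<^sup>2 <= (2 * exp (\<bar>l\<bar> * \<bar>x\<bar>))\<^sup>2" by (intro abs_le_square_iff[THEN iffD1]) simp
  also have "... = 4 * exp (2 * \<bar>l * x\<bar>)" by (simp add: power2_eq_square exp_add[symmetric] abs_mult)
  also have "exp (2 * \<bar>l * x\<bar>) <= exp ((2 * l) * x) + exp ((- 2 * l) * x)"
  proof (cases "l * x >= 0")
   case True
   then have eq: "exp (2 * \<bar>l * x\<bar>) = exp ((2 * l) * x)" by (simp add: mult.assoc)
   show ?thesis unfolding eq by simp
  next
   case False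
   then have eq: "exp (2 * \<bar>l * x\<bar>) = exp ((- 2 * l) * x)" by (simp add: mult.assoc)
   show ?thesis unfolding eq by simp
  qed
  finally show ?thesis by simp
 qed
 have bi: "integrable stdN (%x. 4 * (exp ((2 * l) * x) + exp ((- 2 * l) * x)))"
  by (intro integrable_mult_right integrable_add exp_stdN(1))
 have fm: "(%x. (w x - f n x)\<^sup>2) : bm stdN" for n
  unfolding w_def f_def y_def by simp
 have "(%n. \<integral>x. (w x - f n x)\<^sup>2 \<partial>stdN) ----> (LINT x|stdN. 0)"
 proof (rule integral_dominated_convergence[OF _ fm bi])
  show "AE x in stdN. (%n. (w x - f n x)\<^sup>2) ----> 0"
  proof (rule AE_I2)
   fix x
   have "(%n. (w x - f n x)\<^sup>2) ----> (w x - E * exp (l * x))\<^sup>2" unfolding f_def by (intro tendsto_intros ylim)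
   then show "(%n. (w x - f n x)\<^sup>2) ----> 0" by (simp add: wE)
  qed
  show "AE x in stdN. norm ((w x - f n x)\<^sup>2) <= 4 * (exp ((2 * l) * x) + exp ((- 2 * l) * x))" for n
   using bound by simp
 qed simp
 then have "(%n. \<integral>x. (w x - f n x)\<^sup>2 \<partial>stdN) ----> 0" by simp
 from order_tendstoD(2)[OF this, of "e / 4"] e
 obtain n where n: "(LINT x|stdN. (w x - f n x)\<^sup>2) < e / 4" by (auto simp: eventually_sequentially)
 define B where "B = \<bar>l\<bar> * real (Suc n)"
 have B0: "0 <= B" by (simp add: B_def)
 have yB: "y n x : {- B..B}" for x
 proof -
  have "\<bar>y n x\<bar> <= B" unfolding y_def abs_mult B_def using abs_sin_le_one[of "1 / real (Suc n) * x"]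
   by (intro mult_left_mono) (auto intro: mult_left_le)
  then show ?thesis by auto
 qed
 \<comment> \<open>The first bound keeps the polynomial positive; the second makes the squared
   uniform error at most \<open>e / 4\<close>, which \<open>sq\<close> doubles.\<close>
 define \<eta> where "\<eta> = min (exp (- B) / 2) (sqrt e / 2)"
 have \<eta>: "\<eta> > 0" "\<eta> <= exp (- B) / 2" "\<eta> <= sqrt e / 2" using e by (auto simp: \<eta>_def)
 have "continuous_on {- B..B} (exp :: real => real)" by (intro continuous_intros)
 from Stone_Weierstrass_real_polynomial_function[OF compact_Icc this \<eta>(1)]
 obtain p where p: "real_polynomial_function p" "!!z. z : {- B..B} ==> \<bar>exp z - p z\<bar> < \<eta>" by auto
 then obtain a J where pa: "p = (%z. SUM j<=J. a j * z ^ j)" unfolding real_polynomial_function_iff_sum by auto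
 define ta where "ta x = E * p (y n x)" for x
 have close: "\<bar>f n x - ta x\<bar> <= \<eta>" for x
 proof -
  have "\<bar>f n x - ta x\<bar> = E * \<bar>exp (y n x) - p (y n x)\<bar>" using E by (simp add: f_def ta_def abs_mult right_diff_distrib[symmetric])
  also have "... <= 1 * \<eta>" by (rule mult_mono[OF E(2) less_imp_le[OF p(2)[OF yB]]]) auto
  finally show ?thesis by simp
 qed
 show ?thesis
 proof (rule that[of ta "E * (exp (- B) / 2)" "E * (exp B + 1)"])
  show "ta : trig_poly"
   unfolding ta_def[abs_def] pa y_def
   by (intro trig_poly_mult trig_poly_sum trig_poly_power trig_poly_const trig_poly_sin)
  show "0 < E * (exp (- B) / 2)" using E by simp
  show "E * (exp (- B) / 2) <= ta x & ta x <= E * (exp B + 1)" for x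
  proof -
   have "exp (- B) <= exp (y n x)" "exp (y n x) <= exp B" "exp (- B) <= 1" using yB[of x] B0 by auto
   then have "exp (- B) / 2 <= p (y n x)" "p (y n x) <= exp B + 1"
    using p(2)[OF yB[of x]] \<eta>(2) unfolding abs_less_iff by linarith+
   then show ?thesis unfolding ta_def using E by (intro conjI mult_left_mono) auto
  qed
  have sq: "(w x - ta x)\<^sup>2 <= 2 * (w x - f n x)\<^sup>2 + e / 2" for x
  proof -
   have "(w x - ta x)\<^sup>2 <= 2 * (w x - f n x)\<^sup>2 + 2 * (f n x - ta x)\<^sup>2"
    using sum_squares_bound[of "w x - f n x" "f n x - ta x"] by (simp add: power2_eq_square algebra_simps)
   moreover have "(f n x - ta x)\<^sup>2 <= (sqrt e / 2)\<^sup>2" using close[of x] \<eta>(3) e by (intro abs_le_square_iff[THEN iffD1]) simp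
   ultimately show ?thesis using e by (simp add: power_divide)
  qed
  have fi: "integrable stdN (%x. (w x - f n x)\<^sup>2)"
   by (rule integrable_bound[OF bi fm]) (use bound[of _ n] in \<open>auto simp: abs_of_nonneg add_nonneg_nonneg\<close>)
  have gi: "integrable stdN (%x. 2 * (w x - f n x)\<^sup>2 + e / 2)" using fi by simp
  have "(\<integral>\<^sup>+x. ennreal ((w x - ta x)\<^sup>2) \<partial>stdN) <= (\<integral>\<^sup>+x. ennreal (2 * (w x - f n x)\<^sup>2 + e / 2) \<partial>stdN)"
   by (intro nn_integral_mono ennreal_leI sq)
  also have "... = ennreal (LINT x|stdN. 2 * (w x - f n x)\<^sup>2 + e / 2)"
   by (rule nn_integral_eq_integral[OF gi]) (use e in auto)
  also have "(LINT x|stdN. 2 * (w x - f n x)\<^sup>2 + e / 2) = 2 * (LINT x|stdN. (w x - f n x)\<^sup>2) + e / 2"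
   using fi N.prob_space by simp
  also have "ennreal ... <= ennreal e" using n by (intro ennreal_leI) simp
  finally show "(\<integral>\<^sup>+x. ennreal ((exp (l * x - l\<^sup>2 / 2) - ta x)\<^sup>2) \<partial>stdN) <= ennreal e" by (simp add: w_def)
 qed
qed

section \<open>Ratios of integrals under a random measure\<close>

text \<open>For an integrable positive weight \<open>w\<close>, this is the expectation of
  \<open>G\<close> under \<open>s\<close> independent points of law
  \<open>reweight w m\<close>.\<close>

definition ratio :: "((nat => 'x) => real) => nat => ('x => real) => 'x measure => real" where
 "ratio G s w m = (LINT x|PiM {..<s} (%_. m). G x * (PROD i<s. w (x i))) / (LINT x|m. w x) ^ s"

lemma ratio_bound:
 assumes m: "prob_space m" and w: "!!x. w x > 0"
  and G: "G : bm (PiM {..<s} (%_. m))" "!!x. x : space (PiM {..<s} (%_. m)) ==> \<bar>G x\<bar> <= C"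
 shows "\<bar>ratio G s w m\<bar> <= C"
proof -
 have b: "\<bar>\<integral>x. G x \<partial>N\<bar> <= C" if N: "prob_space N" "sets N = sets (PiM {..<s} (%_. m))" for N
 proof -
  interpret N: prob_space N by fact
  have Gm: "G : bm N" using G(1) mcs[OF N(2)] by blast
  have Gb: "\<bar>G x\<bar> <= C" if "x : space N" for x using G(2) that space_eqI[OF N(2)] by auto
  have i: "integrable N (%x. \<bar>G x\<bar>)" using Gm Gb by (intro N.integrable_const_bound[where B = C] AE_I2) auto
  have "\<bar>\<integral>x. G x \<partial>N\<bar> <= (LINT x|N. \<bar>G x\<bar>)" by (rule integral_abs_bound)
  also have "... <= C" using Gb by (intro N.integral_le_const[OF i] AE_I2) auto
  finally show ?thesis .
 qed
 show ?thesis
 proof (cases "integrable m w")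
  case True
  have "ratio G s w m = (LINT x|PiM {..<s} (%_. reweight w m). G x)"
   unfolding ratio_def by (rule integral_PiM_reweight[OF m True w G(1), symmetric])
  then show ?thesis
   using b[OF prob_space_PiM_const[OF prob_space_reweight[OF m True w]] sets_PiM_cong[OF refl sets_reweight]] by simp
 next
  case False
  \<comment> \<open>The integral is \<open>0\<close> by convention, and so is the ratio unless
    \<open>s = 0\<close>.\<close>
  then have Z: "(LINT x|m. w x) = 0" by (rule not_integrable_integral_eq)
  interpret P: prob_space "PiM {..<s} (%_. m)" by (rule prob_space_PiM_const[OF m])
  have "C >= 0" using G(2) P.not_empty by (metis abs_ge_zero ex_in_conv order_trans)
  then show ?thesis using b[OF P.prob_space_axioms refl] by (cases s) (simp_all add: ratio_def Z)
 qed
qed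

text \<open>No lower bound on \<open>w\<close> or on its integral \<open>Z\<close> is at hand. The
  term \<open>\<bar>w - v\<bar> / Z\<close> is bounded by weighted arithmetic and geometric means by
  \<open>a * (w - v)^2 / 2 + 1 / (2 * a * Z^2)\<close>, and Jensen's inequality replaces
  \<open>1 / Z^2\<close> by the mean of \<open>1 / w^2\<close>. The resulting bound is linear in
  \<open>m\<close>, so it can be averaged over a random \<open>m\<close>.\<close>

lemma ratio_close:
 fixes w v :: "'x => real"
 assumes m: "prob_space m" and w: "w : bm m" "!!x. w x > 0"
  and v: "v : bm m" "!!x. v x > 0" "!!x. x : space m ==> v x <= K"
  and G: "G : bm (PiM {..<s} (%_. m))" "!!x. x : space (PiM {..<s} (%_. m)) ==> \<bar>G x\<bar> <= C"
  and C: "C > 0" and a: "a > 0"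
 shows "ennreal \<bar>ratio G s w m - ratio G s v m\<bar>
  <= ennreal (C * real s * 2) * (\<integral>\<^sup>+x. ennreal ((a * (w x - v x)\<^sup>2 + 1 / (a * (w x)\<^sup>2)) / 2) \<partial>m)"
proof -
 interpret m: prob_space m by fact
 define e where "e x = (a * (w x - v x)\<^sup>2 + 1 / (a * (w x)\<^sup>2)) / 2" for x
 have e0: "e x >= 0" for x using a by (simp add: e_def)
 have em: "e : bm m" unfolding e_def[abs_def] using w v by measurable
 have vi: "integrable m v" using v by (intro m.integrable_const_bound[where B = K] AE_I2) (auto simp: abs_of_pos)
 \<comment> \<open>An infinite right-hand side settles the claim; a finite one makes both
   \<open>w\<close> and \<open>1 / w^2\<close> integrable.\<close>
 consider "s = 0" | "s > 0" "(\<integral>\<^sup>+x. ennreal (e x) \<partial>m) = \<infinity>" | "s > 0" "(\<integral>\<^sup>+x. ennreal (e x) \<partial>m) < \<infinity>"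
  using less_top by fastforce
 then have "ennreal \<bar>ratio G s w m - ratio G s v m\<bar> <= ennreal (C * real s * 2) * (\<integral>\<^sup>+x. ennreal (e x) \<partial>m)" (is ?claim)
 proof cases
  case 1
  then show ?claim by (simp add: ratio_def)
 next
  case 2
  then have "ennreal (C * real s * 2) * (\<integral>\<^sup>+x. ennreal (e x) \<partial>m) = \<infinity>" using C by (simp add: ennreal_mult_top)
  then show ?claim by simp
 next
  case 3
  then have ei: "integrable m e" using em e0 by (intro integrableI_nonneg) auto
  have dle: "\<bar>w x - v x\<bar> <= 1 + 2 * e x / a" for x
  proof -
   have "(\<bar>w x - v x\<bar> - 1)\<^sup>2 >= 0" by simp
   then have "\<bar>w x - v x\<bar> <= 1 + (w x - v x)\<^sup>2" by (simp add: power2_eq_square algebra_simps) (smt (verit) mult_nonneg_nonneg)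
   also have "(w x - v x)\<^sup>2 <= 2 * e x / a" using a by (simp add: e_def field_simps)
   finally show ?thesis by simp
  qed
  have di: "integrable m (%x. w x - v x)"
  proof (rule integrable_bound[of _ "%x. 1 + 2 * e x / a"])
   show "integrable m (%x. 1 + 2 * e x / a)" using ei by simp
   show "AE x in m. norm (w x - v x) <= norm (1 + 2 * e x / a)" using dle by (intro AE_I2) (smt (verit) real_norm_def)
  qed (use w v in measurable)
  have wi: "integrable m w" using integrable_add[OF di vi] by simp
  define Z where "Z = (LINT x|m. w x)"
  have Z: "Z > 0" unfolding Z_def by (rule integral_pos_of_pos[OF m wi w(2)])
  define q where "q x = 1 / (w x)\<^sup>2" for x
  have q: "q x <= 2 * a * e x" "q x >= 0" for x using a by (simp_all add: q_def e_def field_simps)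
  have qi: "integrable m q"
  proof (rule integrable_bound[of _ "%x. 2 * a * e x"])
   show "AE x in m. norm (q x) <= norm (2 * a * e x)" using q by (intro AE_I2) (smt (verit) real_norm_def)
  qed (use ei w in \<open>auto simp: q_def[abs_def]\<close>)
  \<comment> \<open>The tangent of \<open>y \<mapsto> 1 / y^2\<close> at \<open>Z\<close> lies below
    the graph; integrated, this is Jensen's inequality.\<close>
  have "3 / Z\<^sup>2 - 2 / Z ^ 3 * w x <= q x" for x
  proof -
   have y: "w x > 0" by (rule w(2))
   have "0 <= (w x - Z)\<^sup>2 * (2 * w x + Z)" using y Z by simp
   also have "... = 2 * w x ^ 3 - 3 * Z * (w x)\<^sup>2 + Z ^ 3" by (simp add: power2_eq_square power3_eq_cube algebra_simps)
   finally have "3 * Z * (w x)\<^sup>2 - 2 * w x ^ 3 <= Z ^ 3" by simp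
   then have "(3 * Z * (w x)\<^sup>2 - 2 * w x ^ 3) / (Z ^ 3 * (w x)\<^sup>2) <= Z ^ 3 / (Z ^ 3 * (w x)\<^sup>2)"
    using y Z by (intro divide_right_mono) auto
   moreover have "(3 * Z * (w x)\<^sup>2 - 2 * w x ^ 3) / (Z ^ 3 * (w x)\<^sup>2) = 3 / Z\<^sup>2 - 2 / Z ^ 3 * w x"
    using y Z by (simp add: field_simps power2_eq_square power3_eq_cube)
   moreover have "Z ^ 3 / (Z ^ 3 * (w x)\<^sup>2) = q x" using Z by (simp add: q_def)
   ultimately show ?thesis by simp
  qed
  then have "(LINT x|m. 3 / Z\<^sup>2 - 2 / Z ^ 3 * w x) <= (LINT x|m. q x)" using wi qi by (intro integral_mono) auto
  then have "3 / Z\<^sup>2 - 2 / Z ^ 3 * Z <= (LINT x|m. q x)" using wi by (simp add: Z_def[symmetric] m.prob_space)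
  moreover have "3 / Z\<^sup>2 - 2 / Z ^ 3 * Z = 1 / Z\<^sup>2" using Z by (simp add: field_simps power2_eq_square power3_eq_cube)
  ultimately have qZ: "1 / Z\<^sup>2 <= (LINT x|m. q x)" by simp
  have "(LINT x|m. \<bar>w x - v x\<bar>) / Z <= (LINT x|m. e x)"
  proof -
   have pw: "\<bar>w x - v x\<bar> / Z <= e x - q x / (2 * a) + 1 / (2 * a * Z\<^sup>2)" for x
   proof -
    have "0 <= (a * \<bar>w x - v x\<bar> - 1 / Z)\<^sup>2 / (2 * a)" using a by simp
    also have "... = a * (w x - v x)\<^sup>2 / 2 + 1 / (2 * a * Z\<^sup>2) - \<bar>w x - v x\<bar> / Z"
    proof -
     have "\<bar>w x - v x\<bar> * \<bar>w x - v x\<bar> = (w x - v x) * (w x - v x)" by (rule abs_mult_self)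
     then show ?thesis using a Z by (simp add: power2_eq_square field_simps)
    qed
    finally have "\<bar>w x - v x\<bar> / Z <= a * (w x - v x)\<^sup>2 / 2 + 1 / (2 * a * Z\<^sup>2)" by simp
    moreover have "e x - q x / (2 * a) = a * (w x - v x)\<^sup>2 / 2" by (simp add: e_def q_def add_divide_distrib)
    ultimately show ?thesis by simp
   qed
   have "(LINT x|m. \<bar>w x - v x\<bar> / Z) <= (LINT x|m. e x - q x / (2 * a) + 1 / (2 * a * Z\<^sup>2))"
    using di ei qi pw by (intro integral_mono) auto
   also have "... = (LINT x|m. e x) - (LINT x|m. q x) / (2 * a) + 1 / (2 * a * Z\<^sup>2)" using ei qi by (simp add: m.prob_space)
   also have "... <= (LINT x|m. e x)"
   proof -
    have "1 / (2 * a * Z\<^sup>2) = (1 / Z\<^sup>2) / (2 * a)" by simp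
    also have "... <= (LINT x|m. q x) / (2 * a)" using a qZ by (intro divide_right_mono) auto
    finally show ?thesis by simp
   qed
   finally show ?thesis by simp
  qed
  moreover have "\<bar>ratio G s w m - ratio G s v m\<bar> <= C * real s * (2 * (LINT x|m. \<bar>w x - v x\<bar>) / Z)"
   using reweight_tv[OF m wi w(2) G vi v(2)]
    integral_PiM_reweight[OF m wi w(2) G(1)] integral_PiM_reweight[OF m vi v(2) G(1)] unfolding ratio_def Z_def by simp
  ultimately have "\<bar>ratio G s w m - ratio G s v m\<bar> <= (C * real s * 2) * (LINT x|m. e x)"
   using C mult_left_mono[of "(LINT x|m. \<bar>w x - v x\<bar>) / Z" "\<integral>x. e x \<partial>m" "C * real s * 2"] by simp
  then have "ennreal \<bar>ratio G s w m - ratio G s v m\<bar> <= ennreal ((C * real s * 2) * (LINT x|m. e x))" by (rule ennreal_leI)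
  also have "... = ennreal (C * real s * 2) * ennreal (LINT x|m. e x)" using C by (simp add: ennreal_mult')
  also have "ennreal (LINT x|m. e x) = (\<integral>\<^sup>+x. ennreal (e x) \<partial>m)"
   using ei e0 by (intro nn_integral_eq_integral[symmetric]) auto
  finally show ?claim .
 qed
 then show ?thesis by (simp only: e_def)
qed

lemma ratio_measurable:
 fixes w :: "'x => 'w => real"
 assumes w[measurable]: "(%(x, om). w x om) : bm (X **M OM)"
  and G[measurable]: "G : bm (PiM {..<s} (%_. X))"
 shows "(%(om, m). ratio G s (%x. w x om) m) : bm (OM **M prob_algebra X)"
proof -
 have K: "(%z. PiM {..<s} (%_. snd z)) : OM **M prob_algebra X ->M prob_algebra (PiM {..<s} (%_. X))"
  by (rule mcomp[OF measurable_snd measurable_PiM_kernel])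
 have "(%z. \<integral>x. G x * (PROD i<s. w (x i) (fst z)) \<partial>PiM {..<s} (%_. snd z)) : bm (OM **M prob_algebra X)"
  by (rule measurable_integral_kernel[OF _ K]) measurable
 moreover have "(%z. \<integral>x. w x (fst z) \<partial>snd z) : bm (OM **M prob_algebra X)"
  by (rule measurable_integral_kernel[OF _ measurable_snd]) measurable
 ultimately show ?thesis unfolding ratio_def case_prod_beta by measurable
qed

text \<open>The bound of \<open>ratio_close\<close> is linear in \<open>m\<close>, so its average
  over \<open>P\<close> is an integral over the barycenter \<open>D\<close> of \<open>P\<close>. By
  Fubini's theorem the error at each point \<open>x\<close> can then be averaged over
  \<open>OM\<close> first, which is what the assumption \<open>e\<close> bounds.\<close>

lemma integral_ratio_close:
 fixes w v :: "'x => 'w => real"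
 assumes OM: "prob_space OM" and P: "P : space (prob_algebra (prob_algebra X))"
  and w: "(%(x, om). w x om) : bm (X **M OM)" "!!x om. w x om > 0"
  and v: "(%(x, om). v x om) : bm (X **M OM)" "!!x om. v x om > 0" "!!x om. v x om <= K"
  and G: "G : bm (PiM {..<s} (%_. X))" "!!x. x : space (PiM {..<s} (%_. X)) ==> \<bar>G x\<bar> <= C"
  and C: "C > 0" and a: "a > 0" and de: "de >= 0"
  and e: "!!x. x : space X ==> (\<integral>\<^sup>+om. ennreal ((a * (w x om - v x om)\<^sup>2 + 1 / (a * (w x om)\<^sup>2)) / 2) \<partial>OM) <= ennreal de"
 shows "\<bar>(LINT om|OM. (LINT m|P. ratio G s (%x. w x om) m)) - (LINT om|OM. (LINT m|P. ratio G s (%x. v x om) m))\<bar>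
  <= C * real s * 2 * de"
proof -
 interpret OM: prob_space OM by fact
 from P have PP: "prob_space P" "sets P = sets (prob_algebra X)" by (auto simp: space_prob_algebra)
 interpret P: prob_space P by (rule PP)
 interpret OMP: pair_prob_space OM P ..
 have sp: "space P = space (prob_algebra X)" by (rule space_eqI[OF PP(2)])
 have pX: "prob_space m" "sets m = sets X" if "m : space P" for m using that unfolding sp by (auto simp: space_prob_algebra)
 have Pm: "sets (OM **M P) = sets (OM **M prob_algebra X)" by (rule sets_pair_measure_cong[OF refl PP(2)])
 have Gm: "G : bm (PiM {..<s} (%_. m))" "!!x. x : space (PiM {..<s} (%_. m)) ==> \<bar>G x\<bar> <= C"
  if "m : space P" for m
 proof -
  have eq: "sets (PiM {..<s} (%_. m)) = sets (PiM {..<s} (%_. X))" by (intro sets_PiM_cong refl) (rule pX(2)[OF that])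
  show "G : bm (PiM {..<s} (%_. m))" using G(1) mcs[OF eq] by blast
  show "\<bar>G x\<bar> <= C" if "x : space (PiM {..<s} (%_. m))" for x using G(2) that space_eqI[OF eq] by simp
 qed
 have rm: "(%(om, m). ratio G s (%x. u x om) m) : bm (OM **M P)"
  if "(%(x, om). u x om) : bm (X **M OM)" for u :: "'x => 'w => real"
  using ratio_measurable[OF that G(1)] mcs[OF Pm] by blast
 define r where "r u z = ratio G s (%x. u x (fst z)) (snd z)" for u :: "'x => 'w => real" and z
 have rb: "\<bar>r u z\<bar> <= C" if "!!x om. u x om > 0" "snd z : space P" for u z
  unfolding r_def by (rule ratio_bound[OF pX(1)[OF that(2)] that(1) Gm[OF that(2)]])
 have ri: "integrable (OM **M P) (r u)" if "(%(x, om). u x om) : bm (X **M OM)" "!!x om. u x om > 0" for u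
 proof (rule OMP.integrable_const_bound[OF AE_I2])
  show "norm (r u z) <= C" if "z : space (OM **M P)" for z
   using rb[of u z, OF \<open>!!x om. u x om > 0\<close>] that by (auto simp: space_pair_measure)
  show "r u : bm (OM **M P)" using rm[OF \<open>(%(x, om). u x om) : _\<close>] by (simp add: r_def[abs_def] case_prod_beta)
 qed
 have it: "(LINT om|OM. (LINT m|P. ratio G s (%x. u x om) m)) = (LINT z|(OM **M P). r u z)"
  if "(%(x, om). u x om) : bm (X **M OM)" "!!x om. u x om > 0" for u
  using OMP.integral_fst'[OF ri[OF that]] by (simp add: r_def[abs_def])
 define ee where "ee x om = ennreal ((a * (w x om - v x om)\<^sup>2 + 1 / (a * (w x om)\<^sup>2)) / 2)" for x om
 define D where "D = P \<bind> (%m. m)"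
 have idk: "(%m. m) : P ->M prob_algebra X" using measurable_ident_sets[OF PP(2)] by (simp add: id_def)
 note idk' = measurable_prob_algebraD[OF idk]
 have D: "sets D = sets X" "prob_space D"
  unfolding D_def using sets_bind'[OF P measurable_ident_sets[OF refl]] prob_space_bind'[OF P measurable_ident_sets[OF refl]] by simp_all
 interpret D: prob_space D by (rule D)
 interpret DOM: pair_prob_space D OM ..
 have eem: "(%(x, om). ee x om) : bm (X **M OM)"
  unfolding ee_def using w(1) v(1) by measurable
 have eeD: "(%(x, om). ee x om) : bm (D **M OM)"
  using eem measurable_cong_sets[OF sets_pair_measure_cong[OF D(1) refl] refl] by blast
 have "ennreal \<bar>(LINT z|(OM **M P). r w z) - (LINT z|(OM **M P). r v z)\<bar> = ennreal \<bar>\<integral>z. r w z - r v z \<partial>(OM **M P)\<bar>"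
  using ri[OF w] ri[OF v(1,2)] by simp
 also have "... <= ennreal (LINT z|(OM **M P). \<bar>r w z - r v z\<bar>)" by (intro ennreal_leI integral_abs_bound)
 also have "... = (\<integral>\<^sup>+z. ennreal \<bar>r w z - r v z\<bar> \<partial>(OM **M P))"
  using ri[OF w] ri[OF v(1,2)] by (intro nn_integral_eq_integral[symmetric]) auto
 also have "... = (\<integral>\<^sup>+om. \<integral>\<^sup>+m. ennreal \<bar>r w (om, m) - r v (om, m)\<bar> \<partial>P \<partial>OM)"
  using ri[OF w] ri[OF v(1,2)] by (intro P.nn_integral_fst[symmetric]) auto
 also have "... <= (\<integral>\<^sup>+om. ennreal (C * real s * 2) * (\<integral>\<^sup>+x. ee x om \<partial>D) \<partial>OM)"
 proof (rule nn_integral_mono)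
  fix om assume om: "om : space OM"
  have sec: "(%x. u x om) : bm X" if "(%(x, om). u x om) : bm (X **M OM)" for u :: "'x => 'w => real"
   using mcomp[OF measurable_Pair2'[OF om] that] by simp
  have sece: "(%x. ee x om) : bm X" using mcomp[OF measurable_Pair2'[OF om] eem] by simp
  have "(\<integral>\<^sup>+m. ennreal \<bar>r w (om, m) - r v (om, m)\<bar> \<partial>P) <= (\<integral>\<^sup>+m. ennreal (C * real s * 2) * (\<integral>\<^sup>+x. ee x om \<partial>m) \<partial>P)"
  proof (rule nn_integral_mono)
   fix m assume m: "m : space P"
   have mm: "(%x. w x om) : bm m" "(%x. v x om) : bm m"
    using sec[OF w(1)] sec[OF v(1)] measurable_cong_sets[OF pX(2)[OF m] refl] by blast+
   show "ennreal \<bar>r w (om, m) - r v (om, m)\<bar> <= ennreal (C * real s * 2) * (\<integral>\<^sup>+x. ee x om \<partial>m)"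
    unfolding r_def ee_def fst_conv snd_conv
    by (rule ratio_close[OF pX(1)[OF m] mm(1) w(2) mm(2) v(2) v(3) Gm[OF m] C a])
  qed
  also have "... = ennreal (C * real s * 2) * (\<integral>\<^sup>+m. (\<integral>\<^sup>+x. ee x om \<partial>m) \<partial>P)"
   by (rule nn_integral_cmult) (rule mcomp[OF idk' nn_integral_measurable_subprob_algebra[OF sece]])
  also have "(\<integral>\<^sup>+m. (\<integral>\<^sup>+x. ee x om \<partial>m) \<partial>P) = (\<integral>\<^sup>+x. ee x om \<partial>D)"
   unfolding D_def by (rule nn_integral_bind[OF sece idk', symmetric])
  finally show "(\<integral>\<^sup>+m. ennreal \<bar>r w (om, m) - r v (om, m)\<bar> \<partial>P) <= ennreal (C * real s * 2) * (\<integral>\<^sup>+x. ee x om \<partial>D)" .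
 qed
 also have "... = ennreal (C * real s * 2) * (\<integral>\<^sup>+om. (\<integral>\<^sup>+x. ee x om \<partial>D) \<partial>OM)"
 proof (rule nn_integral_cmult[OF D.borel_measurable_nn_integral])
  show "(%(om, x). ee x om) : bm (OM **M D)"
   using measurable_pair_swap[OF eeD] by (simp add: case_prod_beta)
 qed
 also have "(\<integral>\<^sup>+om. (\<integral>\<^sup>+x. ee x om \<partial>D) \<partial>OM) = (\<integral>\<^sup>+x. (\<integral>\<^sup>+om. ee x om \<partial>OM) \<partial>D)"
  by (rule DOM.Fubini'[OF eeD])
 also have "... <= (\<integral>\<^sup>+x. ennreal de \<partial>D)"
  using e space_eqI[OF D(1)] unfolding ee_def by (intro nn_integral_mono) auto
 also have "... = ennreal de" by (simp add: D.emeasure_space_1)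
 also have "ennreal (C * real s * 2) * ennreal de = ennreal (C * real s * 2 * de)" using C by (simp add: ennreal_mult')
 finally have "ennreal \<bar>(LINT z|(OM **M P). r w z) - (LINT z|(OM **M P). r v z)\<bar> <= ennreal (C * real s * 2 * de)"
  by (simp add: mult_left_mono)
 then have "\<bar>(LINT z|(OM **M P). r w z) - (LINT z|(OM **M P). r v z)\<bar> <= C * real s * 2 * de"
  using C de by (subst (asm) ennreal_le_iff) auto
 then show ?thesis by (simp only: it[OF w] it[OF v(1,2)])
qed

lemma cis_measurable [measurable]: "cis : bm borel"
 by (intro borel_measurable_continuous_onI continuous_intros)

lemma trig_sum_nth: "trig_sum L x = (SUM k<length L. fst (L ! k) * cis (snd (L ! k) * x))"
 by (simp add: trig_sum_def sum_list_sum_nth case_prod_beta atLeast0LessThan)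

lemma trig_poly_measurable: "ta : trig_poly ==> ta : bm borel"
proof -
 assume "ta : trig_poly"
 then obtain L where L: "!!x. complex_of_real (ta x) = trig_sum L x" by (auto simp: trig_poly_def)
 have "ta = (%x. Re (trig_sum L x))" by (rule ext) (metis L Re_complex_of_real)
 then show ?thesis unfolding trig_sum_nth by simp
qed

section \<open>Gaussian fields completed to unit variance\<close>

text \<open>If \<open>y\<close> is centered Gaussian of variance \<open>q <= 1\<close> and
  \<open>z\<close> is independent, then \<open>y + sqrt (1 - q) * z\<close> is standard normal.
  Averaging over \<open>z\<close> thus treats all points of a field alike although their variances
  differ.\<close>

definition smooth :: "(real => real) => real => real => real" where
 "smooth ta q y = (LINT z|stdN. ta (y + sqrt (1 - q) * z))"

lemma smooth_measurable:
 assumes [measurable]: "ta : bm borel"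
 shows "(%(q, y). smooth ta q y) : bm (borel **M borel)"
proof -
 interpret N: prob_space stdN by (rule prob_space_stdN)
 show ?thesis unfolding smooth_def case_prod_beta
  by (rule N.borel_measurable_lebesgue_integral) measurable
qed

lemma smooth_bounds:
 assumes m: "ta : bm borel" and b: "!!x. k <= ta x & ta x <= K"
 shows "k <= smooth ta q y & smooth ta q y <= K"
proof -
 interpret N: prob_space stdN by (rule prob_space_stdN)
 have "integrable stdN (%z. ta (y + sqrt (1 - q) * z))"
 proof (rule N.integrable_const_bound[where B = "max \<bar>k\<bar> \<bar>K\<bar>", OF AE_I2])
  show "norm (ta (y + sqrt (1 - q) * z)) <= max \<bar>k\<bar> \<bar>K\<bar>" for z
   using b[of "y + sqrt (1 - q) * z"] by auto
  show "(%z. ta (y + sqrt (1 - q) * z)) : bm stdN" using m by simp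
 qed
 then show ?thesis unfolding smooth_def using b
  by (auto intro!: N.integral_le_const N.integral_ge_const)
qed

lemma smooth_trig:
 assumes L: "!!x. complex_of_real (ta x) = trig_sum L x" and q: "q <= 1"
 shows "complex_of_real (smooth ta q y)
  = (SUM k<length L. fst (L ! k) * of_real (exp (- (snd (L ! k))\<^sup>2 * (1 - q) / 2)) * cis (snd (L ! k) * y))"
proof -
 interpret N: prob_space stdN by (rule prob_space_stdN)
 let ?c = "sqrt (1 - q)"
 have i: "integrable stdN (%z. cis (b * z))" for b by (intro N.integrable_const_bound[where B = 1]) auto
 have "complex_of_real (smooth ta q y) = (LINT z|stdN. complex_of_real (ta (y + ?c * z)))"
  by (simp add: smooth_def)
 also have "... = (LINT z|stdN. (SUM k<length L. fst (L ! k) * cis (snd (L ! k) * y) * cis ((snd (L ! k) * ?c) * z)))"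
  by (intro integral_cong refl) (simp add: L trig_sum_nth algebra_simps cis_mult[symmetric])
 also have "... = (SUM k<length L. (LINT z|stdN. fst (L ! k) * cis (snd (L ! k) * y) * cis ((snd (L ! k) * ?c) * z)))"
  by (intro integral_sum integrable_mult_right i)
 also have "... = (SUM k<length L. fst (L ! k) * cis (snd (L ! k) * y) * of_real (exp (- (snd (L ! k) * ?c)\<^sup>2 / 2)))"
  by (intro sum.cong refl) (simp only: integral_mult_right_zero integral_cis_stdN)
 also have "... = (SUM k<length L. fst (L ! k) * of_real (exp (- (snd (L ! k))\<^sup>2 * (1 - q) / 2)) * cis (snd (L ! k) * y))"
  using q by (intro sum.cong refl) (simp add: power_mult_distrib mult_ac)
 finally show ?thesis .
qed

text \<open>The expectation of a product of \<open>N\<close> smoothed trigonometric polynomials of a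
  Gaussian field with covariance \<open>q\<close>, as \<open>field_moment\<close> shows. The
  completion of variances to \<open>1\<close> replaces the diagonal of \<open>q\<close>, so only
  off-diagonal entries occur.\<close>

definition gen :: "(complex \<times> real) list => nat => (nat \<times> nat => real) => real" where
 "gen L N q = Re (SUM f:{..<N} \<rightarrow>\<^sub>E {..<length L}. (PROD i<N. fst (L ! f i)) *
  of_real (exp (- (SUM i<N. (snd (L ! f i))\<^sup>2 + (SUM j:{..<N} - {i}. snd (L ! f i) * snd (L ! f j) * q (i, j))) / 2)))"

lemma gen_cong: "(!!i j. i < N ==> j < N ==> i ~= j ==> q (i, j) = q' (i, j)) ==> gen L N q = gen L N q'"
 unfolding gen_def by (intro arg_cong[where f = Re] sum.cong refl arg_cong2[where f = "(*)"] arg_cong[where f = of_real]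
   arg_cong[where f = exp] arg_cong[where f = "%x. - x / 2"] arg_cong2[where f = "(+)"]) auto

lemma gen_tendsto:
 assumes "!!i j. (%n. q n (i, j)) ----> q' (i, j)" shows "(%n. gen L N (q n)) ----> gen L N q'"
 unfolding gen_def by (intro tendsto_intros assms) simp

lemma gen_measurable [measurable]: "gen L N : bm array_space"
 unfolding gen_def[abs_def] array_space_def by measurable

lemma gen_bounded: "\<exists>B. \<forall>q. (\<forall>p. \<bar>q p\<bar> <= 1) --> \<bar>gen L N q\<bar> <= B"
proof -
 define b where "b f = norm (PROD i<N. fst (L ! f i)) * exp ((SUM i<N. SUM j:{..<N} - {i}. \<bar>snd (L ! f i)\<bar> * \<bar>snd (L ! f j)\<bar>) / 2)" for f :: "nat => nat"
 have "\<bar>gen L N q\<bar> <= (SUM f:{..<N} \<rightarrow>\<^sub>E {..<length L}. b f)" if q: "!!p. \<bar>q p\<bar> <= 1" for q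
 proof -
  have *: "- (SUM i<N. (snd (L ! f i))\<^sup>2 + (SUM j:{..<N} - {i}. snd (L ! f i) * snd (L ! f j) * q (i, j))) / 2
   <= (SUM i<N. SUM j:{..<N} - {i}. \<bar>snd (L ! f i)\<bar> * \<bar>snd (L ! f j)\<bar>) / 2" for f
  proof -
   have "- (snd (L ! f i) * snd (L ! f j) * q (i, j)) <= \<bar>snd (L ! f i)\<bar> * \<bar>snd (L ! f j)\<bar>" for i j
   proof -
    have "- (snd (L ! f i) * snd (L ! f j) * q (i, j)) <= \<bar>snd (L ! f i) * snd (L ! f j) * q (i, j)\<bar>" by simp
    also have "... <= \<bar>snd (L ! f i)\<bar> * \<bar>snd (L ! f j)\<bar>" unfolding abs_mult using q by (intro mult_left_le) auto
    finally show ?thesis .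
   qed
   then have s1: "(SUM j:{..<N} - {i}. - (snd (L ! f i) * snd (L ! f j) * q (i, j))) <= (SUM j:{..<N} - {i}. \<bar>snd (L ! f i)\<bar> * \<bar>snd (L ! f j)\<bar>)" for i
    by (intro sum_mono)
   have "- ((snd (L ! f i))\<^sup>2 + (SUM j:{..<N} - {i}. snd (L ! f i) * snd (L ! f j) * q (i, j))) <= (SUM j:{..<N} - {i}. \<bar>snd (L ! f i)\<bar> * \<bar>snd (L ! f j)\<bar>)" for i
    using zero_le_power2[of "snd (L ! f i)"] s1[of i] unfolding sum_negf by linarith
   then have "(SUM i<N. - ((snd (L ! f i))\<^sup>2 + (SUM j:{..<N} - {i}. snd (L ! f i) * snd (L ! f j) * q (i, j)))) <= (SUM i<N. SUM j:{..<N} - {i}. \<bar>snd (L ! f i)\<bar> * \<bar>snd (L ! f j)\<bar>)"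
    by (intro sum_mono)
   then show ?thesis unfolding sum_negf by linarith
  qed
  have "\<bar>gen L N q\<bar> <= norm (SUM f:{..<N} \<rightarrow>\<^sub>E {..<length L}. (PROD i<N. fst (L ! f i)) *
  complex_of_real (exp (- (SUM i<N. (snd (L ! f i))\<^sup>2 + (SUM j:{..<N} - {i}. snd (L ! f i) * snd (L ! f j) * q (i, j))) / 2)))"
   unfolding gen_def by (rule abs_Re_le_cmod)
  also have "... <= (SUM f:{..<N} \<rightarrow>\<^sub>E {..<length L}. b f)"
  proof (rule sum_norm_le)
   fix f
   show "norm ((PROD i<N. fst (L ! f i)) *
    complex_of_real (exp (- (SUM i<N. (snd (L ! f i))\<^sup>2 + (SUM j:{..<N} - {i}. snd (L ! f i) * snd (L ! f j) * q (i, j))) / 2))) <= b f"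
    unfolding b_def norm_mult norm_of_real abs_exp_cancel by (intro mult_left_mono) (use * in \<open>simp_all only: exp_le_cancel_iff norm_ge_zero\<close>)
  qed
  finally show ?thesis .
 qed
 then show ?thesis by blast
qed

text \<open>Each power of the normalization is the contribution of one more independent point with
  weight \<open>v\<close>.\<close>

lemma integral_prod_power:
 fixes v :: "'x => real"
 assumes m: "prob_space m" and v: "integrable m v" "!!x. v x > 0"
  and G[measurable]: "G : bm (PiM {..<s} (%_. m))"
 shows "(LINT x|PiM {..<s} (%_. m). G x * (PROD i<s. v (x i))) * (LINT x|m. v x) ^ j
  = (LINT x|replicas m. G (restrict x {..<s}) * (PROD i<s + j. v (x i)))"
proof -
 let ?R = "reweight v m"
 let ?Z = "\<integral>x. v x \<partial>m"
 have Z: "?Z > 0" using integral_pos_of_pos[OF m v(1)] v(2) by blast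
 have [measurable]: "v : bm m" using v by auto
 have rm[measurable]: "(%x. restrict x {..<s}) : PiM {..<s + j} (%_. m) ->M PiM {..<s} (%_. m)"
  by (rule measurable_restrict_subset) auto
 have fm: "(%x. G (restrict x {..<s}) * (PROD i<s + j. v (x i))) : bm (PiM {..<s + j} (%_. m))"
  by measurable
 have GR: "G : bm (PiM {..<s} (%_. ?R))"
 proof -
  have eq: "sets (PiM {..<s} (%_. ?R)) = sets (PiM {..<s} (%_. m))" by (intro sets_PiM_cong refl) simp
  show ?thesis unfolding mcs[OF eq] by (rule G)
 qed
 have "(LINT x|replicas m. G (restrict x {..<s}) * (PROD i<s + j. v (x i)))
   = (LINT x|replicas m. G (restrict (restrict x {..<s + j}) {..<s}) * (PROD i<s + j. v (restrict x {..<s + j} i)))"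
  by (intro integral_cong refl) (simp add: restrict_restrict Int_absorb1 lessThan_subset_iff)
 also have "... = (LINT x|PiM {..<s + j} (%_. m). G (restrict x {..<s}) * (PROD i<s + j. v (x i)))"
  by (rule integral_replicas_restrict[OF m fm subset_UNIV])
 \<comment> \<open>Under the reweighted law the last \<open>j\<close> coordinates integrate out, and
   only their normalization remains.\<close>
 also have "... = ?Z ^ (s + j) * (LINT x|PiM {..<s + j} (%_. ?R). G (restrict x {..<s}))"
  using Z integral_PiM_reweight[OF m v, of "%x. G (restrict x {..<s})" "s + j"] mcomp[OF rm G] by simp
 also have "(LINT x|PiM {..<s + j} (%_. ?R). G (restrict x {..<s})) = (LINT x|PiM {..<s} (%_. ?R). G x)"
  by (rule integral_replicas_restrict[OF prob_space_reweight[OF m v] GR]) auto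
 also have "... = (LINT x|PiM {..<s} (%_. m). G x * (PROD i<s. v (x i))) / ?Z ^ s"
  by (rule integral_PiM_reweight[OF m v G])
 also have "?Z ^ (s + j) * ((LINT x|PiM {..<s} (%_. m). G x * (PROD i<s. v (x i))) / ?Z ^ s)
   = (LINT x|PiM {..<s} (%_. m). G x * (PROD i<s. v (x i))) * ?Z ^ j"
  using Z by (simp add: power_add)
 finally show ?thesis by (rule sym)
qed

text \<open>The two halves of the error are balanced by \<open>a\<close>: the square contributes at
  most \<open>a / 2 * (de / a) = de / 2\<close>, and the mean of the inverse square of
  \<open>exp (l * z - l^2 / 2)\<close> is \<open>B = exp (3 * l^2)\<close>, which contributes
  \<open>B / (2 * a) = de / 2\<close>.\<close>

lemma gauss_approx:
 fixes l de :: real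
 assumes de: "de > 0"
 obtains a ta k K L where "a > 0" "ta : bm borel" "!!x. complex_of_real (ta x) = trig_sum L x"
  "0 < k" "!!x. k <= ta x & ta x <= K"
  "(\<integral>\<^sup>+z. ennreal ((a * (exp (l * z - l\<^sup>2 / 2) - ta z)\<^sup>2 + 1 / (a * (exp (l * z - l\<^sup>2 / 2))\<^sup>2)) / 2) \<partial>stdN) <= ennreal de"
proof -
 interpret N: prob_space stdN by (rule prob_space_stdN)
 define B where "B = exp (3 * l\<^sup>2)"
 define a where "a = B / de"
 have B: "B > 0" by (simp add: B_def)
 have a: "a > 0" using B de by (simp add: a_def)
 obtain ta k K where ta: "ta : trig_poly" "0 < k" "!!x. k <= ta x & ta x <= K"
  and err: "(\<integral>\<^sup>+x. ennreal ((exp (l * x - l\<^sup>2 / 2) - ta x)\<^sup>2) \<partial>stdN) <= ennreal (de / a)"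
  using trig_approx[of "de / a" l] a de by auto
 obtain L where L: "!!x. complex_of_real (ta x) = trig_sum L x" using ta(1) by (auto simp: trig_poly_def)
 have m[measurable]: "ta : bm borel" by (rule trig_poly_measurable[OF ta(1)])
 define d where "d z = (exp (l * z - l\<^sup>2 / 2) - ta z)\<^sup>2" for z
 have inv: "1 / (a * (exp (l * z - l\<^sup>2 / 2))\<^sup>2) = (exp (l\<^sup>2) / a) * exp (- 2 * l * z)" for z
 proof -
  have "exp (l\<^sup>2) * exp (- 2 * l * z) * (exp (l * z - l\<^sup>2 / 2))\<^sup>2 = 1"
   by (simp add: power2_eq_square exp_add[symmetric])
  then show ?thesis using a by (simp add: field_simps)
 qed
 have "(\<integral>\<^sup>+z. ennreal ((a * d z + 1 / (a * (exp (l * z - l\<^sup>2 / 2))\<^sup>2)) / 2) \<partial>stdN)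
   = (\<integral>\<^sup>+z. ennreal (a / 2) * ennreal (d z) + ennreal (exp (l\<^sup>2) / (2 * a)) * ennreal (exp (- 2 * l * z)) \<partial>stdN)"
  unfolding inv using a by (intro nn_integral_cong) (simp add: ennreal_mult'[symmetric] ennreal_plus[symmetric] d_def add_divide_distrib del: ennreal_plus)
 also have "... = (\<integral>\<^sup>+z. ennreal (a / 2) * ennreal (d z) \<partial>stdN) + (\<integral>\<^sup>+z. ennreal (exp (l\<^sup>2) / (2 * a)) * ennreal (exp (- 2 * l * z)) \<partial>stdN)"
  unfolding d_def by (rule nn_integral_add) simp_all
 also have "... = ennreal (a / 2) * (\<integral>\<^sup>+z. ennreal (d z) \<partial>stdN) + ennreal (exp (l\<^sup>2) / (2 * a)) * (\<integral>\<^sup>+z. ennreal (exp (- 2 * l * z)) \<partial>stdN)"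
  unfolding d_def by (intro arg_cong2[where f = "(+)"] nn_integral_cmult) simp_all
 also have "(\<integral>\<^sup>+z. ennreal (exp (- 2 * l * z)) \<partial>stdN) = ennreal (exp (2 * l\<^sup>2))"
  using nn_integral_exp_stdN[of "- 2 * l"] by (simp add: power2_eq_square)
 also have "ennreal (a / 2) * (\<integral>\<^sup>+z. ennreal (d z) \<partial>stdN) + ennreal (exp (l\<^sup>2) / (2 * a)) * ennreal (exp (2 * l\<^sup>2))
   <= ennreal (a / 2) * ennreal (de / a) + ennreal (exp (l\<^sup>2) / (2 * a)) * ennreal (exp (2 * l\<^sup>2))"
  using err unfolding d_def by (intro add_mono mult_left_mono) auto
 also have "... = ennreal (a / 2 * (de / a) + exp (l\<^sup>2) / (2 * a) * exp (2 * l\<^sup>2))"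
  using a de by (simp add: ennreal_mult'[symmetric] ennreal_plus[symmetric] del: ennreal_plus)
 also have "exp (l\<^sup>2) / (2 * a) * exp (2 * l\<^sup>2) = B / (2 * a)" by (simp add: B_def exp_add[symmetric])
 also have "a / 2 * (de / a) + B / (2 * a) = de" using a de B by (simp add: a_def)
 finally show ?thesis using that[OF a m L ta(2,3)] by (simp add: d_def)
qed

text \<open>The field is described by characteristic functions of finite linear combinations. This
  covers degenerate covariances and repeated points, and it gives the moments of trigonometric
  polynomials at once. Both the field on the edges of a finite cube and the isonormal field are
  instances.\<close>

locale gaussian_field =
 fixes OM :: "'w measure" and X :: "'x measure" and Y :: "'x => 'w => real" and r :: "'x => 'x => real"
 assumes prob_OM: "prob_space OM"
  and Y_measurable [measurable]: "(%(x, om). Y x om) : bm (X **M OM)"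
  and r_measurable [measurable]: "(%(x, y). r x y) : bm (X **M X)"
  and r_diag: "!!x. x : space X ==> 0 <= r x x & r x x <= 1"
  and char_field: "!!(N :: nat) t x. (!!i. i < N ==> x i : space X) ==>
   (LINT om|OM. cis (SUM i<N. t i * Y (x i) om)) = complex_of_real (exp (- (SUM i<N. SUM j<N. t i * t j * r (x i) (x j)) / 2))"
begin

sublocale OM: prob_space OM by (rule prob_OM)

lemma Y_section: "x : space X ==> Y x : bm OM"
 using mcomp[OF measurable_Pair1' Y_measurable] by simp

lemma char_single:
 assumes "x : space X" shows "(LINT om|OM. cis (t * Y x om)) = complex_of_real (exp (- (t\<^sup>2 * r x x) / 2))"
 using char_field[of 1 "%_. x" "%_. t"] assms by (simp add: power2_eq_square)

lemma distr_completed: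
 assumes x: "x : space X"
 shows "distr (OM **M stdN) borel (%(om, z). Y x om + sqrt (1 - r x x) * z) = stdN"
proof -
 interpret N: prob_space stdN by (rule prob_space_stdN)
 interpret OMN: pair_prob_space OM stdN ..
 note Yx[measurable] = Y_section[OF x]
 let ?c = "sqrt (1 - r x x)"
 let ?D = "distr (OM **M stdN) borel (%(om, z). Y x om + ?c * z)"
 have m: "(%(om, z). Y x om + ?c * z) : bm (OM **M stdN)" by measurable
 interpret D: prob_space ?D by (rule OMN.prob_space_distr[OF m])
 have "real_distribution ?D" by (intro real_distribution.intro D.prob_space_axioms real_distribution_axioms.intro) simp
 moreover have "char ?D = char stdN"
 proof (rule ext)
  fix t
  have "char ?D t = (LINT p|(OM **M stdN). cis (t * (Y x (fst p) + ?c * snd p)))"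
   unfolding char_def cis_conv_exp[symmetric] by (subst integral_distr[OF m]) (simp_all add: case_prod_beta)
  also have "... = (\<integral>om. \<integral>z. cis (t * (Y x om + ?c * z)) \<partial>stdN \<partial>OM)"
   by (subst OMN.integral_fst'[symmetric]) (auto intro!: OMN.integrable_const_bound[where B = 1])
  also have "... = (LINT om|OM. cis (t * Y x om) * complex_of_real (exp (- (t * ?c)\<^sup>2 / 2)))"
  proof (intro integral_cong refl)
   fix om
   have "(LINT z|stdN. cis (t * (Y x om + ?c * z))) = (LINT z|stdN. cis (t * Y x om) * cis ((t * ?c) * z))"
    by (intro integral_cong refl) (simp add: cis_mult algebra_simps)
   then show "(LINT z|stdN. cis (t * (Y x om + ?c * z))) = cis (t * Y x om) * complex_of_real (exp (- (t * ?c)\<^sup>2 / 2))"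
    by (simp only: integral_mult_right_zero integral_cis_stdN)
  qed
  also have "... = complex_of_real (exp (- (t\<^sup>2 * r x x) / 2)) * complex_of_real (exp (- (t * ?c)\<^sup>2 / 2))"
   by (simp only: integral_mult_left_zero char_single[OF x])
  also have "... = complex_of_real (exp (- t\<^sup>2 / 2))"
   using r_diag[OF x] unfolding of_real_mult[symmetric] exp_add[symmetric]
   by (intro arg_cong[where f = complex_of_real] arg_cong[where f = exp]) (simp add: power_mult_distrib field_simps)
  finally show "char ?D t = char stdN t" by (simp add: char_std_normal_distribution)
 qed
 ultimately show ?thesis by (intro Levy_uniqueness real_dist_normal_dist)
qed

lemma smooth_field_measurable:
 assumes "ta : bm borel"
 shows "(%(x, om). smooth ta (r x x) (Y x om)) : bm (X **M OM)"
proof -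
 have "(%x. r x x) : bm X"
  using mcomp[OF measurable_Pair[OF measurable_ident measurable_ident] r_measurable] by simp
 from mcomp[OF measurable_fst this]
 have 1: "(%p. r (fst p) (fst p)) : bm (X **M OM)" by simp
 have 2: "(%p. Y (fst p) (snd p)) : bm (X **M OM)" using Y_measurable by (simp add: case_prod_beta)
 show ?thesis using mcomp[OF measurable_Pair[OF 1 2] smooth_measurable[OF assms]] by (simp add: case_prod_beta)
qed

text \<open>The tilted weight is the smoothing of \<open>exp (l * x - l\<^sup>2 / 2)\<close>, so that Jensen's inequality
 bounds the error of smoothing an approximation instead.\<close>
lemma smooth_error:
 fixes l :: real
 assumes x: "x : space X" and a: "a > 0" and ta: "ta : bm borel" "!!y. k <= ta y & ta y <= K"
  and err: "(\<integral>\<^sup>+z. ennreal ((a * (exp (l * z - l\<^sup>2 / 2) - ta z)\<^sup>2 + 1 / (a * (exp (l * z - l\<^sup>2 / 2))\<^sup>2)) / 2) \<partial>stdN) <= ennreal de"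
 shows "(\<integral>\<^sup>+om. ennreal ((a * (exp (l * Y x om - l\<^sup>2 / 2 * r x x) - smooth ta (r x x) (Y x om))\<^sup>2
   + 1 / (a * (exp (l * Y x om - l\<^sup>2 / 2 * r x x))\<^sup>2)) / 2) \<partial>OM) <= ennreal de"
proof -
 interpret N: prob_space stdN by (rule prob_space_stdN)
 note [measurable] = Y_section[OF x] ta(1)
 define c where "c = sqrt (1 - r x x)"
 have c2: "c\<^sup>2 = 1 - r x x" using r_diag[OF x] by (simp add: c_def)
 define w where "w z = exp (l * z - l\<^sup>2 / 2)" for z
 define e where "e z = (a * (w z - ta z)\<^sup>2 + 1 / (a * (w z)\<^sup>2)) / 2" for z
 have [measurable]: "w : bm borel" "e : bm borel" unfolding w_def[abs_def] e_def[abs_def] by measurable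
 have pw: "ennreal ((a * (exp (l * y - l\<^sup>2 / 2 * r x x) - smooth ta (r x x) y)\<^sup>2
   + 1 / (a * (exp (l * y - l\<^sup>2 / 2 * r x x))\<^sup>2)) / 2) <= (\<integral>\<^sup>+z. ennreal (e (y + c * z)) \<partial>stdN)" for y
 proof -
  define W where "W = exp (l * y - l\<^sup>2 / 2 * r x x)"
  define f where "f z = w (y + c * z) - ta (y + c * z)" for z
  define mu where "mu = (LINT z|stdN. f z)"
  have w1: "w (y + c * z) = exp (l * y - l\<^sup>2 / 2) * exp ((l * c) * z)" for z
   by (simp add: w_def exp_add[symmetric] algebra_simps)
  have w2: "1 / (w (y + c * z))\<^sup>2 = exp (l\<^sup>2 - 2 * l * y) * exp ((- 2 * l * c) * z)" for z
  proof -
   have "exp (l\<^sup>2 - 2 * l * y) * exp ((- 2 * l * c) * z) * (w (y + c * z))\<^sup>2 = 1"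
    by (simp add: w_def power2_eq_square exp_add[symmetric]) (simp add: algebra_simps)
   then show ?thesis by (simp add: field_simps w_def)
  qed
  have wi: "integrable stdN (%z. w (y + c * z))" unfolding w1 by (intro integrable_mult_right exp_stdN)
  \<comment> \<open>The weight at a point of variance \<open>r x x\<close> is the average of the
    weight for variance \<open>1\<close>, because \<open>c^2 = 1 - r x x\<close>.\<close>
  have wI: "(LINT z|stdN. w (y + c * z)) = W"
  proof -
   have "(LINT z|stdN. w (y + c * z)) = exp (l * y - l\<^sup>2 / 2) * exp ((l * c)\<^sup>2 / 2)" unfolding w1 by (simp only: integral_mult_right_zero exp_stdN(2))
   also have "... = W" unfolding W_def exp_add[symmetric] power_mult_distrib c2 by (simp add: algebra_simps add_divide_distrib diff_divide_distrib)
   finally show ?thesis .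
  qed
  have tai: "integrable stdN (%z. ta (y + c * z))"
  proof (rule N.integrable_const_bound[where B = "max \<bar>k\<bar> \<bar>K\<bar>", OF AE_I2])
   show "norm (ta (y + c * z)) <= max \<bar>k\<bar> \<bar>K\<bar>" for z using ta(2)[of "y + c * z"] by auto
   show "(%z. ta (y + c * z)) : bm stdN" using ta(1) by simp
  qed
  have fi: "integrable stdN f" unfolding f_def[abs_def] using wi tai by simp
  have mu: "mu = W - smooth ta (r x x) y" unfolding mu_def f_def using wi tai wI by (simp add: smooth_def c_def)
  have qi: "integrable stdN (%z. 1 / (w (y + c * z))\<^sup>2)" unfolding w2 by (intro integrable_mult_right exp_stdN)
  \<comment> \<open>Jensen's inequality for the inverse square, here read off from explicit Gaussian
    integrals.\<close>
  have qI: "(LINT z|stdN. 1 / (w (y + c * z))\<^sup>2) >= 1 / W\<^sup>2"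
  proof -
   have "(LINT z|stdN. 1 / (w (y + c * z))\<^sup>2) = exp (l\<^sup>2 - 2 * l * y) * exp ((- 2 * l * c)\<^sup>2 / 2)" unfolding w2 by (simp only: integral_mult_right_zero exp_stdN(2))
   also have "... = exp (l\<^sup>2 - 2 * l * y + (- 2 * l * c)\<^sup>2 / 2)" by (simp add: exp_add)
   also have "... >= exp (l\<^sup>2 * r x x - 2 * l * y)"
   proof -
    have "l\<^sup>2 * r x x <= l\<^sup>2 * 1" using r_diag[OF x] by (intro mult_left_mono) auto
    moreover have "0 <= (- 2 * l * c)\<^sup>2 / 2" by simp
    ultimately have "l\<^sup>2 * r x x - 2 * l * y <= l\<^sup>2 - 2 * l * y + (- 2 * l * c)\<^sup>2 / 2" by linarith
    then show ?thesis unfolding exp_le_cancel_iff .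
   qed
   also have "exp (l\<^sup>2 * r x x - 2 * l * y) = 1 / W\<^sup>2"
   proof -
    have "exp (l\<^sup>2 * r x x - 2 * l * y) * W\<^sup>2 = 1" by (simp add: W_def power2_eq_square exp_add[symmetric])
    then show ?thesis by (simp add: W_def field_simps)
   qed
   finally show ?thesis by simp
  qed
  \<comment> \<open>The square of \<open>f\<close> is replaced by its tangent at the mean
    \<open>mu\<close>, so that integrability of \<open>f\<close> is enough; the tangent integrates
    to \<open>mu^2\<close>.\<close>
  define h where "h z = (a * (2 * mu * f z - mu\<^sup>2) + (1 / (w (y + c * z))\<^sup>2) / a) / 2" for z
  have hi: "integrable stdN h" unfolding h_def[abs_def] using fi qi by (intro integrable_divide_zero integrable_add integrable_mult_right integrable_diff) auto
  have hI: "(LINT z|stdN. h z) = (a * mu\<^sup>2 + (LINT z|stdN. 1 / (w (y + c * z))\<^sup>2) / a) / 2"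
  proof -
   have "(LINT z|stdN. 2 * mu * f z - mu\<^sup>2) = mu\<^sup>2" using fi N.prob_space by (simp add: mu_def[symmetric] power2_eq_square)
   moreover have "integrable stdN (%z. a * (2 * mu * f z - mu\<^sup>2))" using fi by simp
   moreover have "integrable stdN (%z. (1 / (w (y + c * z))\<^sup>2) / a)" using qi by (rule integrable_divide_zero) 
   ultimately show ?thesis unfolding h_def by (simp only: integral_divide_zero integral_add integral_mult_right_zero)
  qed
  have he: "h z <= e (y + c * z)" for z
  proof -
   have "0 <= (f z - mu)\<^sup>2" by simp
   then have "2 * mu * f z - mu\<^sup>2 <= (f z)\<^sup>2" by (simp add: power2_eq_square algebra_simps)
   then have "a * (2 * mu * f z - mu\<^sup>2) <= a * (f z)\<^sup>2" using a by (intro mult_left_mono) auto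
   then show ?thesis unfolding h_def e_def f_def by (simp add: mult.commute)
  qed
  have e0: "e z >= 0" for z using a by (simp add: e_def)
  have "(a * mu\<^sup>2 + 1 / (a * W\<^sup>2)) / 2 <= (LINT z|stdN. h z)"
   unfolding hI using divide_right_mono[OF qI, of a] a by (simp add: mult.commute)
  \<comment> \<open>\<open>h\<close> may be negative, while the comparison with \<open>e\<close> is
    made for integrals of nonnegative functions.\<close>
  also have "... <= (LINT z|stdN. max 0 (h z))" using hi by (intro integral_mono) auto
  finally have "ennreal ((a * mu\<^sup>2 + 1 / (a * W\<^sup>2)) / 2) <= ennreal (LINT z|stdN. max 0 (h z))" by (rule ennreal_leI)
  also have "... = (\<integral>\<^sup>+z. ennreal (max 0 (h z)) \<partial>stdN)" using hi by (intro nn_integral_eq_integral[symmetric]) auto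
  also have "... <= (\<integral>\<^sup>+z. ennreal (e (y + c * z)) \<partial>stdN)" using he e0 by (intro nn_integral_mono ennreal_leI) auto
  finally show ?thesis by (simp add: mu W_def)
 qed
 have "(\<integral>\<^sup>+om. ennreal ((a * (exp (l * Y x om - l\<^sup>2 / 2 * r x x) - smooth ta (r x x) (Y x om))\<^sup>2
   + 1 / (a * (exp (l * Y x om - l\<^sup>2 / 2 * r x x))\<^sup>2)) / 2) \<partial>OM)
   <= (\<integral>\<^sup>+om. (\<integral>\<^sup>+z. ennreal (e (Y x om + c * z)) \<partial>stdN) \<partial>OM)"
  by (intro nn_integral_mono pw)
 also have "... = (\<integral>\<^sup>+p. ennreal (e (Y x (fst p) + c * snd p)) \<partial>(OM **M stdN))"
  by (subst N.nn_integral_fst[symmetric]) simp_all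
 also have "... = (\<integral>\<^sup>+z. ennreal (e z) \<partial>distr (OM **M stdN) borel (%(om, z). Y x om + c * z))"
  by (subst nn_integral_distr) (simp_all add: case_prod_beta)
 also have "... = (\<integral>\<^sup>+z. ennreal (e z) \<partial>stdN)" unfolding c_def distr_completed[OF x] ..
 also have "... <= ennreal de" using err by (simp add: e_def w_def)
 finally show ?thesis .
qed

text \<open>The product of sums is expanded into choices \<open>f\<close> of one frequency per
  point. Each term is a characteristic function of the field, and the smoothing factors complete the
  diagonal of the covariance.\<close>

lemma field_moment:
 assumes L: "!!y. complex_of_real (ta y) = trig_sum L y" and x: "!!i. i < N ==> x i : space X"
 shows "(LINT om|OM. (PROD i<N. smooth ta (r (x i) (x i)) (Y (x i) om))) = gen L N (%(i, j). r (x i) (x j))"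
proof -
 let ?F = "{..<N} \<rightarrow>\<^sub>E {..<length L}"
 define t where "t k = snd (L ! k)" for k
 define d where "d f = (PROD i<N. fst (L ! f i)) * complex_of_real (PROD i<N. exp (- (t (f i))\<^sup>2 * (1 - r (x i) (x i)) / 2))" for f :: "nat => nat"
 have Ym: "Y (x i) : bm OM" if "i < N" for i by (rule Y_section[OF x[OF that]])
 have ci: "integrable OM (%om. cis (SUM i<N. t (f i) * Y (x i) om))" for f
  using Ym by (intro OM.integrable_const_bound[where B = 1]) auto
 have "complex_of_real (LINT om|OM. (PROD i<N. smooth ta (r (x i) (x i)) (Y (x i) om)))
   = (LINT om|OM. complex_of_real (PROD i<N. smooth ta (r (x i) (x i)) (Y (x i) om)))"
  by (simp only: integral_complex_of_real)
 also have "... = (LINT om|OM. (SUM f:?F. d f * cis (SUM i<N. t (f i) * Y (x i) om)))"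
 proof (intro integral_cong refl)
  fix om
  have "complex_of_real (PROD i<N. smooth ta (r (x i) (x i)) (Y (x i) om))
   = (PROD i<N. SUM k<length L. fst (L ! k) * of_real (exp (- (t k)\<^sup>2 * (1 - r (x i) (x i)) / 2)) * cis (t k * Y (x i) om))"
   unfolding of_real_prod t_def using r_diag[OF x] by (intro prod.cong refl smooth_trig[OF L]) auto
  also have "... = (SUM f:?F. PROD i<N. fst (L ! f i) * of_real (exp (- (t (f i))\<^sup>2 * (1 - r (x i) (x i)) / 2)) * cis (t (f i) * Y (x i) om))"
   by (rule prod_sum_PiE) auto
  also have "... = (SUM f:?F. d f * cis (SUM i<N. t (f i) * Y (x i) om))"
  proof (intro sum.cong refl)
   fix f
   have "cis (SUM i<n. t (f i) * Y (x i) om) = (PROD i<n. cis (t (f i) * Y (x i) om))" for n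
    by (induction n) (simp_all add: cis_mult[symmetric] add.commute mult.commute)
   then show "(PROD i<N. fst (L ! f i) * of_real (exp (- (t (f i))\<^sup>2 * (1 - r (x i) (x i)) / 2)) * cis (t (f i) * Y (x i) om))
    = d f * cis (SUM i<N. t (f i) * Y (x i) om)"
    by (simp add: d_def prod.distrib)
  qed
  finally show "complex_of_real (PROD i<N. smooth ta (r (x i) (x i)) (Y (x i) om)) = (SUM f:?F. d f * cis (SUM i<N. t (f i) * Y (x i) om))" .
 qed
 also have "... = (SUM f:?F. (LINT om|OM. d f * cis (SUM i<N. t (f i) * Y (x i) om)))"
  by (intro integral_sum integrable_mult_right ci)
 also have "... = (SUM f:?F. (PROD i<N. fst (L ! f i)) *
  of_real (exp (- (SUM i<N. (t (f i))\<^sup>2 + (SUM j:{..<N} - {i}. t (f i) * t (f j) * r (x i) (x j))) / 2)))"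
 proof (intro sum.cong refl)
  fix f
  have "(SUM i<N. (t (f i))\<^sup>2 * (1 - r (x i) (x i))) + (SUM i<N. SUM j<N. t (f i) * t (f j) * r (x i) (x j))
   = (SUM i<N. (t (f i))\<^sup>2 + (SUM j:{..<N} - {i}. t (f i) * t (f j) * r (x i) (x j)))"
   unfolding sum.distrib[symmetric]
   by (intro sum.cong refl) (simp add: sum.remove[of "{..<N}"] power2_eq_square algebra_simps)
  moreover have "(PROD i<N. exp (- (t (f i))\<^sup>2 * (1 - r (x i) (x i)) / 2)) = exp (- (SUM i<N. (t (f i))\<^sup>2 * (1 - r (x i) (x i))) / 2)"
   by (simp add: exp_sum[symmetric] sum_negf[symmetric] sum_divide_distrib)
  ultimately have "(PROD i<N. exp (- (t (f i))\<^sup>2 * (1 - r (x i) (x i)) / 2)) * exp (- (SUM i<N. SUM j<N. t (f i) * t (f j) * r (x i) (x j)) / 2)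
   = exp (- (SUM i<N. (t (f i))\<^sup>2 + (SUM j:{..<N} - {i}. t (f i) * t (f j) * r (x i) (x j))) / 2)"
   by (simp add: exp_add[symmetric] add_divide_distrib[symmetric])
  moreover have "(LINT om|OM. d f * cis (SUM i<N. t (f i) * Y (x i) om)) = d f * of_real (exp (- (SUM i<N. SUM j<N. t (f i) * t (f j) * r (x i) (x j)) / 2))"
   by (simp only: integral_mult_right_zero char_field[OF x])
  ultimately show "(LINT om|OM. d f * cis (SUM i<N. t (f i) * Y (x i) om)) = (PROD i<N. fst (L ! f i)) *
  of_real (exp (- (SUM i<N. (t (f i))\<^sup>2 + (SUM j:{..<N} - {i}. t (f i) * t (f j) * r (x i) (x j))) / 2))"
   by (simp only: d_def mult.assoc of_real_mult[symmetric])
 qed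
 finally have "(LINT om|OM. (PROD i<N. smooth ta (r (x i) (x i)) (Y (x i) om)))
  = Re (SUM f:?F. (PROD i<N. fst (L ! f i)) *
  of_real (exp (- (SUM i<N. (t (f i))\<^sup>2 + (SUM j:{..<N} - {i}. t (f i) * t (f j) * r (x i) (x j))) / 2)))"
  by (metis Re_complex_of_real)
 then show ?thesis by (simp add: gen_def t_def)
qed

end

section \<open>Convergence of ratios along Gaussian fields\<close>

lemma integral_ratio_pair:
 fixes w :: "'x => 'w => real"
 assumes OM: "prob_space OM" and P: "P : space (prob_algebra (prob_algebra X))"
  and w: "(%(x, om). w x om) : bm (X **M OM)" "!!x om. w x om > 0"
  and G: "G : bm (PiM {..<s} (%_. X))" "!!x. x : space (PiM {..<s} (%_. X)) ==> \<bar>G x\<bar> <= C"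
 shows "(LINT om|OM. (LINT m|P. ratio G s (%x. w x om) m)) = (LINT z|(OM **M P). ratio G s (%x. w x (fst z)) (snd z))"
proof -
 interpret OM: prob_space OM by fact
 from P have PP: "prob_space P" "sets P = sets (prob_algebra X)" by (auto simp: space_prob_algebra)
 interpret P: prob_space P by (rule PP)
 interpret OMP: pair_prob_space OM P ..
 have Pm: "sets (OM **M P) = sets (OM **M prob_algebra X)" by (rule sets_pair_measure_cong[OF refl PP(2)])
 have rm: "(%z. ratio G s (%x. w x (fst z)) (snd z)) : bm (OM **M P)"
  using ratio_measurable[OF w(1) G(1)] unfolding mcs[OF Pm] by (simp add: case_prod_beta)
 have "integrable (OM **M P) (%z. ratio G s (%x. w x (fst z)) (snd z))"
 proof (rule OMP.integrable_const_bound[OF AE_I2 rm])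
  fix z assume "z : space (OM **M P)"
  then have "snd z : space (prob_algebra X)" unfolding space_eqI[OF PP(2), symmetric] by (simp only: space_pair_measure mem_Times_iff)
  then have m: "prob_space (snd z)" "sets (snd z) = sets X" by (auto simp: space_prob_algebra)
  have eq: "sets (PiM {..<s} (%_. snd z)) = sets (PiM {..<s} (%_. X))" by (intro sets_PiM_cong refl m)
  have "G : bm (PiM {..<s} (%_. snd z))" unfolding mcs[OF eq] by (rule G(1))
  moreover have "\<bar>G x\<bar> <= C" if "x : space (PiM {..<s} (%_. snd z))" for x
   using that unfolding space_eqI[OF eq] by (rule G(2))
  ultimately have "\<bar>ratio G s (%x. w x (fst z)) (snd z)\<bar> <= C" by (intro ratio_bound m(1) w(2))
  then show "norm (ratio G s (%x. w x (fst z)) (snd z)) <= C" by simp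
 qed
 from OMP.integral_fst'[OF this] show ?thesis by simp
qed

context gaussian_field
begin

text \<open>Both factors together are one integral over \<open>s + j\<close> replicas. Fubini's
  theorem moves the expectation of the field inside, where \<open>field_moment\<close> leaves a
  function of the covariances alone.\<close>

lemma pair_moment:
 assumes P: "P : space (prob_algebra (prob_algebra X))"
  and ta: "ta : bm borel" "0 < k" "!!y. k <= ta y & ta y <= K" and L: "!!y. complex_of_real (ta y) = trig_sum L y"
  and G[measurable]: "G : bm (PiM {..<s} (%_. X))" and GC: "!!x. x : space (PiM {..<s} (%_. X)) ==> \<bar>G x\<bar> <= C"
 defines "v \<equiv> %x om. smooth ta (r x x) (Y x om)"
 shows "(LINT z|(OM **M P). (LINT x|PiM {..<s} (%_. snd z). G x * (PROD i<s. v (x i) (fst z))) * (LINT x|snd z. v x (fst z)) ^ j)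
  = (LINT x|(P \<bind> (%m. replicas m)). G (restrict x {..<s}) * gen L (s + j) (%(i, k). r (x i) (x k)))"
proof -
 from P have PP: "prob_space P" "sets P = sets (prob_algebra X)" by (auto simp: space_prob_algebra)
 interpret P: prob_space P by (rule PP)
 interpret OMP: pair_prob_space OM P ..
 define PR where "PR = P \<bind> (%m. replicas m)"
 have sPR: "sets PR = sets (replicas X)" and pPR: "prob_space PR"
  unfolding PR_def by (rule sets_bind_replicas[OF P], rule prob_space_bind_replicas[OF P])
 interpret PR: prob_space PR by (rule pPR)
 interpret OMPR: pair_prob_space OM PR ..
 have vm[measurable]: "(%(x, om). v x om) : bm (X **M OM)" unfolding v_def by (rule smooth_field_measurable[OF ta(1)])
 have vb: "k <= v x om & v x om <= K" for x om unfolding v_def by (rule smooth_bounds[OF ta(1,3)])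
 have vpos: "v x om > 0" for x om using vb[of x om] ta(2) by linarith
 have K0: "K >= 0" using ta(2) ta(3)[of 0] by linarith
 have rs[measurable]: "(%x. restrict x {..<s}) : replicas X ->M PiM {..<s} (%_. X)"
  by (rule measurable_restrict_subset) auto
 define H where "H om x = G (restrict x {..<s}) * (PROD i<s + j. v (x i) om)" for om x
 have Hm[measurable]: "(%(om, x). H om x) : bm (OM **M replicas X)"
  unfolding H_def case_prod_beta
 proof (intro borel_measurable_times borel_measurable_prod)
  show "(%p. G (restrict (snd p) {..<s})) : bm (OM **M replicas X)"
   by (rule mcomp[OF measurable_snd mcomp[OF rs G]])
  fix i
  have "(%p. (snd p i, fst p)) : OM **M replicas X ->M X **M OM" by measurable
  from mcomp[OF this vm] show "(%p. v (snd p i) (fst p)) : bm (OM **M replicas X)" by simp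
 qed
 have Hb: "\<bar>H om x\<bar> <= C * K ^ (s + j)" if "x : space (replicas X)" for om x
 proof -
  have "\<bar>G (restrict x {..<s})\<bar> <= C" using GC measurable_space[OF rs that] by blast
  moreover have "\<bar>PROD i<s + j. v (x i) om\<bar> <= K ^ (s + j)"
  proof -
   have "(PROD i<s + j. v (x i) om) <= (PROD i<s + j. K)" using vb vpos by (intro prod_mono) (auto intro: less_imp_le)
   moreover have "0 <= (PROD i<s + j. v (x i) om)" using vpos by (intro prod_nonneg) (auto intro: less_imp_le)
   ultimately show ?thesis by simp
  qed
  ultimately show ?thesis unfolding H_def abs_mult by (intro mult_mono) auto
 qed
 have step1: "(LINT x|PiM {..<s} (%_. m). G x * (PROD i<s. v (x i) om)) * (LINT x|m. v x om) ^ j = (LINT x|replicas m. H om x)"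
  if om: "om : space OM" and m: "m : space (prob_algebra X)" for om m
 proof -
  have mm: "prob_space m" "sets m = sets X" using m by (auto simp: space_prob_algebra)
  interpret m: prob_space m by (rule mm)
  have "(%x. v x om) : bm X" using mcomp[OF measurable_Pair2'[OF om] vm] by simp
  then have "(%x. v x om) : bm m" unfolding mcs[OF mm(2)] .
  then have vi: "integrable m (%x. v x om)"
   using vb vpos by (intro m.integrable_const_bound[where B = K] AE_I2) (auto simp: abs_of_pos)
  have eq: "sets (PiM {..<s} (%_. m)) = sets (PiM {..<s} (%_. X))" by (intro sets_PiM_cong refl mm)
  have "G : bm (PiM {..<s} (%_. m))" unfolding mcs[OF eq] by (rule G)
  from integral_prod_power[OF mm(1) vi vpos this, of j] show ?thesis unfolding H_def .
 qed
 have Hsec: "H om : bm (replicas X)" if "om : space OM" for om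
  using mcomp[OF measurable_Pair1'[OF that] Hm] by simp
 have Pm: "sets (OM **M P) = sets (OM **M prob_algebra X)" by (rule sets_pair_measure_cong[OF refl PP(2)])
 have spP: "space P = space (prob_algebra X)" by (rule space_eqI[OF PP(2)])
 have repl: "prob_space (replicas m)" "space (replicas m) = space (replicas X)" "sets (replicas m) = sets (replicas X)" if "m : space (prob_algebra X)" for m
 proof -
  have mm: "prob_space m" "sets m = sets X" using that by (auto simp: space_prob_algebra)
  show "prob_space (replicas m)" by (rule prob_space_PiM_const[OF mm(1)])
  show s: "sets (replicas m) = sets (replicas X)" by (intro sets_PiM_cong refl mm)
  show "space (replicas m) = space (replicas X)" by (rule space_eqI[OF s])
 qed
 have f_int: "integrable (OM **M P) (%z. \<integral>x. H (fst z) x \<partial>replicas (snd z))"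
 proof (rule OMP.integrable_const_bound[OF AE_I2])
  have kern: "(%z. replicas (snd z)) : OM **M prob_algebra X ->M prob_algebra (replicas X)"
   by (rule mcomp[OF measurable_snd measurable_PiM_kernel])
  have "(%p. (fst (fst p), snd p)) : (OM **M prob_algebra X) **M replicas X ->M OM **M replicas X" by measurable
  from mcomp[OF this Hm]
  have "(%(z, x). H (fst z) x) : bm ((OM **M prob_algebra X) **M replicas X)" by (simp add: case_prod_beta)
  from measurable_integral_kernel[OF this kern]
  show "(%z. \<integral>x. H (fst z) x \<partial>replicas (snd z)) : bm (OM **M P)"
   unfolding mcs[OF Pm] .
  fix z assume z: "z : space (OM **M P)"
  then have m: "snd z : space (prob_algebra X)" and om: "fst z : space OM" unfolding spP[symmetric] by (auto simp: space_pair_measure)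
  interpret R: prob_space "replicas (snd z)" by (rule repl(1)[OF m])
  have Hm': "H (fst z) : bm (replicas (snd z))" unfolding measurable_cong_sets[OF repl(3)[OF m] refl] by (rule Hsec[OF om])
  have hb: "\<bar>H (fst z) x\<bar> <= C * K ^ (s + j)" if "x : space (replicas (snd z))" for x using Hb that unfolding repl(2)[OF m] .
  have hi: "integrable (replicas (snd z)) (%x. \<bar>H (fst z) x\<bar>)"
   using Hm' hb by (intro R.integrable_const_bound[where B = "C * K ^ (s + j)"] AE_I2) auto
  have "\<bar>\<integral>x. H (fst z) x \<partial>replicas (snd z)\<bar> <= (LINT x|replicas (snd z). \<bar>H (fst z) x\<bar>)" by (rule integral_abs_bound)
  also have "... <= C * K ^ (s + j)" using hb by (intro R.integral_le_const[OF hi] AE_I2) auto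
  finally show "norm (LINT x|replicas (snd z). H (fst z) x) <= C * K ^ (s + j)" by simp
 qed
 have sPR': "sets (OM **M PR) = sets (OM **M replicas X)" by (rule sets_pair_measure_cong[OF refl sPR])
 have Hint: "integrable (OM **M PR) (%(om, x). H om x)"
 proof (rule OMPR.integrable_const_bound[OF AE_I2])
  show "(%(om, x). H om x) : bm (OM **M PR)" unfolding mcs[OF sPR'] by (rule Hm)
  fix p assume "p : space (OM **M PR)"
  then have "snd p : space (replicas X)" unfolding space_eqI[OF sPR, symmetric] by (auto simp only: space_pair_measure mem_Times_iff)
  from Hb[OF this] show "norm (case p of (om, x) => H om x) <= C * K ^ (s + j)" by (simp add: case_prod_beta)
 qed
 have "(LINT z|(OM **M P). (LINT x|PiM {..<s} (%_. snd z). G x * (PROD i<s. v (x i) (fst z))) * (LINT x|snd z. v x (fst z)) ^ j)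
   = (LINT z|(OM **M P). (LINT x|replicas (snd z). H (fst z) x))"
 proof (rule integral_cong[OF refl])
  fix z assume "z : space (OM **M P)"
  then have "snd z : space (prob_algebra X)" "fst z : space OM" unfolding spP[symmetric] by (auto simp: space_pair_measure)
  then show "(LINT x|PiM {..<s} (%_. snd z). G x * (PROD i<s. v (x i) (fst z))) * (LINT x|snd z. v x (fst z)) ^ j
   = (LINT x|replicas (snd z). H (fst z) x)" by (intro step1)
 qed
 also have "... = (LINT om|OM. (LINT m|P. (LINT x|replicas m. H om x)))"
  using OMP.integral_fst'[OF f_int] by simp
 also have "... = (LINT om|OM. (LINT x|PR. H om x))"
 proof (rule integral_cong[OF refl])
  fix om assume om: "om : space OM"
  show "(LINT m|P. (LINT x|replicas m. H om x)) = (LINT x|PR. H om x)"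
   unfolding PR_def by (rule integral_bind_replicas[OF P Hsec[OF om] Hb, symmetric])
 qed
 also have "... = (LINT x|PR. (LINT om|OM. H om x))"
  using OMPR.Fubini_integral[OF Hint] by simp
 also have "... = (LINT x|PR. G (restrict x {..<s}) * gen L (s + j) (%(i, k). r (x i) (x k)))"
 proof (rule integral_cong[OF refl])
  fix x assume "x : space PR"
  then have x: "x i : space X" for i unfolding space_eqI[OF sPR] by (auto simp: space_PiM)
  have "(LINT om|OM. H om x) = G (restrict x {..<s}) * (LINT om|OM. (PROD i<s + j. v (x i) om))"
   unfolding H_def by (rule integral_mult_right_zero)
  then show "(LINT om|OM. H om x) = G (restrict x {..<s}) * gen L (s + j) (%(i, k). r (x i) (x k))"
   unfolding v_def field_moment[OF L x] .
 qed
 finally show ?thesis by (simp only: PR_def)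
qed

lemma pair_integrands:
 assumes P: "P : space (prob_algebra (prob_algebra X))"
  and ta: "ta : bm borel" "0 < k" "!!y. k <= ta y & ta y <= K"
  and G[measurable]: "G : bm (PiM {..<s} (%_. X))" and GC: "!!x. x : space (PiM {..<s} (%_. X)) ==> \<bar>G x\<bar> <= C"
 defines "v \<equiv> %x om. smooth ta (r x x) (Y x om)"
 defines "A \<equiv> %z. \<integral>x. G x * (PROD i<s. v (x i) (fst z)) \<partial>PiM {..<s} (%_. snd z)"
  and "Z \<equiv> %z. \<integral>x. v x (fst z) \<partial>snd z"
 shows "A : bm (OM **M P)" "Z : bm (OM **M P)"
  and "!!z. z : space (OM **M P) ==> \<bar>A z\<bar> <= C * K ^ s" "!!z. z : space (OM **M P) ==> k <= Z z & Z z <= K"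
proof -
 have vm[measurable]: "(%(x, om). v x om) : bm (X **M OM)" unfolding v_def by (rule smooth_field_measurable[OF ta(1)])
 have vb: "k <= v x om & v x om <= K" for x om unfolding v_def by (rule smooth_bounds[OF ta(1,3)])
 have vpos: "v x om > 0" for x om using vb[of x om] ta(2) by linarith
 from P have PP: "prob_space P" "sets P = sets (prob_algebra X)" by (auto simp: space_prob_algebra)
 have Pm: "sets (OM **M P) = sets (OM **M prob_algebra X)" by (rule sets_pair_measure_cong[OF refl PP(2)])
 have K: "(%z. PiM {..<s} (%_. snd z)) : OM **M prob_algebra X ->M prob_algebra (PiM {..<s} (%_. X))"
  by (rule mcomp[OF measurable_snd measurable_PiM_kernel])
 show "A : bm (OM **M P)" unfolding A_def mcs[OF Pm]
  by (rule measurable_integral_kernel[OF _ K]) measurable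
 show "Z : bm (OM **M P)" unfolding Z_def mcs[OF Pm]
  by (rule measurable_integral_kernel[OF _ measurable_snd]) measurable
 fix z assume "z : space (OM **M P)"
 then have z: "snd z : space (prob_algebra X)" "fst z : space OM" unfolding space_eqI[OF PP(2), symmetric] by (simp_all only: space_pair_measure mem_Times_iff)
 then have mm: "prob_space (snd z)" "sets (snd z) = sets X" by (auto simp: space_prob_algebra)
 interpret m: prob_space "snd z" by (rule mm)
 have "(%x. v x (fst z)) : bm X" using mcomp[OF measurable_Pair2'[OF z(2)] vm] by simp
 then have v1: "(%x. v x (fst z)) : bm (snd z)" unfolding mcs[OF mm(2)] .
 then have vi: "integrable (snd z) (%x. v x (fst z))"
  using vb vpos by (intro m.integrable_const_bound[where B = K] AE_I2) (auto simp: abs_of_pos)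
 show "k <= Z z & Z z <= K" unfolding Z_def using vb by (auto intro!: m.integral_ge_const m.integral_le_const vi)
 interpret PS: prob_space "PiM {..<s} (%_. snd z)" by (rule prob_space_PiM_const[OF mm(1)])
 have eq: "sets (PiM {..<s} (%_. snd z)) = sets (PiM {..<s} (%_. X))" by (intro sets_PiM_cong refl mm)
 define h where "h x = G x * (PROD i<s. v (x i) (fst z))" for x
 have hm: "h : bm (PiM {..<s} (%_. snd z))"
  unfolding h_def
 proof (intro borel_measurable_times borel_measurable_prod)
  show "G : bm (PiM {..<s} (%_. snd z))" unfolding mcs[OF eq] by (rule G)
  fix i assume "i : {..<s}"
  then have "(%x. x i) : PiM {..<s} (%_. snd z) ->M snd z" by (rule measurable_component_singleton)
  from mcomp[OF this v1] show "(%x. v (x i) (fst z)) : bm (PiM {..<s} (%_. snd z))" .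
 qed
 have hb: "\<bar>h x\<bar> <= C * K ^ s" if "x : space (PiM {..<s} (%_. snd z))" for x
 proof -
  have "\<bar>G x\<bar> <= C" using that unfolding space_eqI[OF eq] by (rule GC)
  moreover have "\<bar>PROD i<s. v (x i) (fst z)\<bar> <= K ^ s"
  proof -
   have "(PROD i<s. v (x i) (fst z)) <= (PROD i<s. K)" using vb vpos by (intro prod_mono) (auto intro: less_imp_le)
   moreover have "0 <= (PROD i<s. v (x i) (fst z))" using vpos by (intro prod_nonneg) (auto intro: less_imp_le)
   ultimately show ?thesis by simp
  qed
  ultimately show ?thesis unfolding h_def abs_mult by (intro mult_mono) auto
 qed
 have hi: "integrable (PiM {..<s} (%_. snd z)) (%x. \<bar>h x\<bar>)"
  using hm hb by (intro PS.integrable_const_bound[where B = "C * K ^ s"] AE_I2) auto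
 have "\<bar>\<integral>x. h x \<partial>PiM {..<s} (%_. snd z)\<bar> <= (LINT x|PiM {..<s} (%_. snd z). \<bar>h x\<bar>)" by (rule integral_abs_bound)
 also have "... <= C * K ^ s" using hb by (intro PS.integral_le_const[OF hi] AE_I2) auto
 finally show "\<bar>A z\<bar> <= C * K ^ s" unfolding A_def h_def .
qed

end

text \<open>The two fields live on different probability spaces and have different index sets; only
  mixed moments are compared, and by \<open>pair_moment\<close> these are expectations over
  replicas.\<close>

lemma field_ratio_limit:
 fixes OM :: "nat => 'w measure" and X :: "'x measure" and OM' :: "'u measure" and X' :: "'y measure"
 assumes f: "!!n. gaussian_field (OM n) X (Y n) (r n)" and f': "gaussian_field OM' X' Y' r'"
  and P: "P : space (prob_algebra (prob_algebra X))" and P': "P' : space (prob_algebra (prob_algebra X'))"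
  and ta: "ta : bm borel" "0 < k" "!!y. k <= ta y & ta y <= K" and L: "!!y. complex_of_real (ta y) = trig_sum L y"
  and G: "G : bm (PiM {..<s} (%_. X))" "!!x. x : space (PiM {..<s} (%_. X)) ==> \<bar>G x\<bar> <= C"
  and G': "G' : bm (PiM {..<s} (%_. X'))" "!!x. x : space (PiM {..<s} (%_. X')) ==> \<bar>G' x\<bar> <= C"
  and lim: "!!N. (%n. \<integral>x. G (restrict x {..<s}) * gen L N (%(i, k). r n (x i) (x k)) \<partial>(P \<bind> (%m. replicas m)))
   ----> (LINT x|(P' \<bind> (%m. replicas m)). G' (restrict x {..<s}) * gen L N (%(i, k). r' (x i) (x k)))"
 shows "(%n. \<integral>om. (LINT m|P. ratio G s (%x. smooth ta (r n x x) (Y n x om)) m) \<partial>OM n)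
  ----> (LINT om|OM'. (LINT m|P'. ratio G' s (%x. smooth ta (r' x x) (Y' x om)) m))"
proof -
 have pos: "smooth ta q y > 0" for q y using smooth_bounds[OF ta(1,3), of q y] ta(2) by linarith
 note pairs = gaussian_field.pair_integrands[OF f P ta G]
 note pairs' = gaussian_field.pair_integrands[OF f' P' ta G']
 have e: "(LINT om|OM n. (LINT m|P. ratio G s (%x. smooth ta (r n x x) (Y n x om)) m))
  = (LINT z|(OM n **M P). ratio G s (%x. smooth ta (r n x x) (Y n x (fst z))) (snd z))" for n
  by (rule integral_ratio_pair[OF gaussian_field.prob_OM[OF f] P gaussian_field.smooth_field_measurable[OF f ta(1)] pos G])
 have e': "(LINT om|OM'. (LINT m|P'. ratio G' s (%x. smooth ta (r' x x) (Y' x om)) m))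
  = (LINT z|(OM' **M P'). ratio G' s (%x. smooth ta (r' x x) (Y' x (fst z))) (snd z))"
  by (rule integral_ratio_pair[OF gaussian_field.prob_OM[OF f'] P' gaussian_field.smooth_field_measurable[OF f' ta(1)] pos G'])
 have pr: "prob_space (OM n **M P)" for n
  using gaussian_field.prob_OM[OF f] P by (intro prob_space_pair) (auto simp: space_prob_algebra)
 have pr': "prob_space (OM' **M P')"
  using gaussian_field.prob_OM[OF f'] P' by (intro prob_space_pair) (auto simp: space_prob_algebra)
 show ?thesis unfolding e e' unfolding ratio_def
 proof (rule moments_limit[OF pr pr' pairs(1,2) pairs'(1,2) pairs(3) pairs'(3) ta(2) pairs(4) pairs'(4)])
  show "(%n. \<integral>z. (LINT x|PiM {..<s} (%_. snd z). G x * (PROD i<s. smooth ta (r n (x i) (x i)) (Y n (x i) (fst z))))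
     * (LINT x|snd z. smooth ta (r n x x) (Y n x (fst z))) ^ j \<partial>(OM n **M P))
   ----> (LINT z|(OM' **M P'). (LINT x|PiM {..<s} (%_. snd z). G' x * (PROD i<s. smooth ta (r' (x i) (x i)) (Y' (x i) (fst z))))
     * (LINT x|snd z. smooth ta (r' x x) (Y' x (fst z))) ^ j)" for j
  proof -
   have "(LINT z|(OM n **M P). (LINT x|PiM {..<s} (%_. snd z). G x * (PROD i<s. smooth ta (r n (x i) (x i)) (Y n (x i) (fst z))))
     * (LINT x|snd z. smooth ta (r n x x) (Y n x (fst z))) ^ j)
    = (LINT x|(P \<bind> (%m. replicas m)). G (restrict x {..<s}) * gen L (s + j) (%(i, k). r n (x i) (x k)))" for n
    by (rule gaussian_field.pair_moment[OF f P ta L G])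
   moreover have "(LINT z|(OM' **M P'). (LINT x|PiM {..<s} (%_. snd z). G' x * (PROD i<s. smooth ta (r' (x i) (x i)) (Y' (x i) (fst z))))
     * (LINT x|snd z. smooth ta (r' x x) (Y' x (fst z))) ^ j)
    = (LINT x|(P' \<bind> (%m. replicas m)). G' (restrict x {..<s}) * gen L (s + j) (%(i, k). r' (x i) (x k)))"
    by (rule gaussian_field.pair_moment[OF f' P' ta L G'])
   ultimately show ?thesis using lim[of "s + j"] by (simp only:)
  qed
 qed
qed

section \<open>The field on edges and the isonormal field\<close>

text \<open>\<open>F\<close> is continuous for the product topology, in which the cube is compact by
  Tychonoff's theorem.\<close>

lemma bounded_on_cube:
 fixes F :: "('i => real) => real"
 assumes "continuous_on UNIV F"
 shows "\<exists>C>0. \<forall>q. (\<forall>p. \<bar>q p\<bar> <= 1) --> \<bar>F q\<bar> <= C"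
proof -
 let ?K = "PiE UNIV (%_ :: 'i. {-1..1 :: real})"
 have "compactin (product_topology (%_ :: 'i. euclidean :: real topology) UNIV) ?K"
  by (simp add: compactin_PiE)
 then have "compact ?K" by (simp add: euclidean_product_topology)
 then have "compact (F ` ?K)" by (intro compact_continuous_image continuous_on_subset[OF assms]) auto
 then obtain C where C: "C > 0" "!!y. y : F ` ?K ==> norm y <= C" using compact_imp_bounded bounded_pos by metis
 have "\<bar>F q\<bar> <= C" if "!!p. \<bar>q p\<bar> <= 1" for q
 proof -
  have "q : ?K" using that by (auto simp: abs_le_iff)
  then show ?thesis using C(2)[of "F q"] by auto
 qed
 then show ?thesis using C(1) by blast
qed

text \<open>A normalized sum of independent standard Gaussians with the edge spins as coefficients;
  its covariance is the overlap in the cube, and each realization is a tilt of the kind in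
  \<open>AE_tilt_invariant\<close>.\<close>

lemma ea_field:
 fixes n :: nat
 assumes n: "n > 0"
 shows "gaussian_field (PiM (cube_edges n :: ('d::finite) edge set) (%_. stdN)) (cfg :: 'd config measure)
  (%sg g. (SUM e:cube_edges n. g e * edge_spin sg e) / sqrt (real (card (cube_edges n :: 'd edge set)))) (overlap_avg n)"
proof (rule gaussian_field.intro)
 let ?E = "cube_edges n :: 'd edge set"
 let ?c = "real (card ?E)"
 interpret N: prob_space stdN by (rule prob_space_stdN)
 interpret PN: product_sigma_finite "%_ :: 'd edge. stdN" by unfold_locales
 show "prob_space (PiM ?E (%_. stdN))" by (rule prob_space_PiM_const[OF prob_space_stdN])
 show "(%(sg, g). (SUM e:?E. g e * edge_spin sg e) / sqrt ?c) : bm (cfg **M PiM ?E (%_. stdN))"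
  unfolding case_prod_beta
 proof (intro borel_measurable_divide borel_measurable_sum borel_measurable_times borel_measurable_const)
  fix e assume e: "e : ?E"
  have "(%g. g e) : PiM ?E (%_. stdN) ->M stdN" by (rule measurable_component_singleton[OF e])
  then have "(%g. g e) : bm (PiM ?E (%_. stdN))" by simp
  from mcomp[OF measurable_snd this]
  show "(%p. snd p e) : bm (cfg **M PiM ?E (%_. stdN))" .
  show "(%p. edge_spin (fst p) e) : bm (cfg **M PiM ?E (%_. stdN))"
   by (rule mcomp[OF measurable_fst edge_spin_measurable])
 qed
 show "(%(sg, sg'). overlap_avg n sg sg') : bm (cfg **M (cfg :: 'd config measure))"
  by (rule overlap_avg_measurable)
 show "0 <= overlap_avg n sg sg & overlap_avg n sg sg <= 1" if "sg : space cfg" for sg :: "'d config"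
  using overlap_avg_self[OF that n] by simp
 fix N :: nat and t :: "nat => real" and x :: "nat => 'd config"
 \<comment> \<open>A linear combination of values of the field is regrouped as one sum over
   independent Gaussians; \<open>b e\<close> is the coefficient of \<open>g e\<close>.\<close>
 define b where "b e = (SUM i<N. t i * edge_spin (x i) e) / sqrt ?c" for e
 have "(SUM i<N. t i * ((SUM e:?E. g e * edge_spin (x i) e) / sqrt ?c)) = (SUM e:?E. b e * g e)" for g
 proof -
  have "(SUM i<N. t i * ((SUM e:?E. g e * edge_spin (x i) e) / sqrt ?c)) = (SUM i<N. SUM e:?E. t i * edge_spin (x i) e / sqrt ?c * g e)"
   by (intro sum.cong refl) (simp add: sum_distrib_left sum_divide_distrib mult_ac)
  also have "... = (SUM e:?E. SUM i<N. t i * edge_spin (x i) e / sqrt ?c * g e)" by (rule sum.swap)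
  finally show ?thesis by (simp add: b_def sum_distrib_right sum_divide_distrib)
 qed
 moreover have "cis (SUM e:A. b e * g e) = (PROD e:A. cis (b e * g e))" if "finite A" for g and A :: "'d edge set"
  using that by (induction A) (simp_all add: cis_mult[symmetric])
 ultimately have "(LINT g|PiM ?E (%_. stdN). cis (SUM i<N. t i * ((SUM e:?E. g e * edge_spin (x i) e) / sqrt ?c)))
   = (LINT g|PiM ?E (%_. stdN). (PROD e:?E. cis (b e * g e)))" by simp
 also have "... = (PROD e:?E. \<integral>z. cis (b e * z) \<partial>stdN)"
  by (rule PN.product_integral_prod) (auto intro!: N.integrable_const_bound[where B = 1])
 also have "... = complex_of_real (exp (- (SUM e:?E. (b e)\<^sup>2) / 2))"
  by (simp only: integral_cis_stdN of_real_prod[symmetric] exp_sum[symmetric, OF finite_cube_edges] sum_negf[symmetric] sum_divide_distrib)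
 also have "(SUM e:?E. (b e)\<^sup>2) = (SUM i<N. SUM j<N. t i * t j * overlap_avg n (x i) (x j))"
 proof -
  have "(SUM e:?E. (b e)\<^sup>2) = (SUM e:?E. SUM i<N. SUM j<N. t i * t j * (edge_spin (x i) e * edge_spin (x j) e) / ?c)"
   unfolding b_def power_divide
   by (intro sum.cong refl) (simp add: power2_eq_square sum_product sum_divide_distrib mult_ac)
  also have "... = (SUM i<N. SUM e:?E. SUM j<N. t i * t j * (edge_spin (x i) e * edge_spin (x j) e) / ?c)" by (rule sum.swap)
  also have "... = (SUM i<N. SUM j<N. SUM e:?E. t i * t j * (edge_spin (x i) e * edge_spin (x j) e) / ?c)"
   by (intro sum.cong refl) (rule sum.swap)
  finally show ?thesis by (simp add: overlap_avg_def sum_distrib_left sum_divide_distrib)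
 qed
 finally show "(LINT g|PiM ?E (%_. stdN). cis (SUM i<N. t i * ((SUM e:?E. g e * edge_spin (x i) e) / sqrt ?c)))
  = complex_of_real (exp (- (SUM i<N. SUM j<N. t i * t j * overlap_avg n (x i) (x j)) / 2))" .
qed

lemma centered_normal_char:
 assumes "centered_normal D"
 shows "integrable D (%y. y\<^sup>2)" "(LINT y|D. cis y) = complex_of_real (exp (- (LINT y|D. y\<^sup>2) / 2))"
proof -
 interpret N: prob_space stdN by (rule prob_space_stdN)
 have "integrable D (%y. y\<^sup>2) & (LINT y|D. cis y) = complex_of_real (exp (- (LINT y|D. y\<^sup>2) / 2))"
  using assms unfolding centered_normal_def
 proof (elim disjE exE conjE)
  assume D: "D = return borel 0"
  have "integrable D (%y. y\<^sup>2)"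
   unfolding D by (rule integrableI_bounded) (auto simp: nn_integral_return)
  then show ?thesis by (simp add: D integral_return)
 next
  fix s :: real assume s: "s > 0" and D: "D = density lborel (%x. ennreal (normal_density 0 s x))"
  have "distributed stdN lborel (%x. x) std_normal_density"
   unfolding distributed_def using distr_id2[of lborel stdN] by simp
  from N.normal_density_affine[OF this, of s 0] s
  have "distr stdN lborel (%x. s * x) = density lborel (%x. ennreal (normal_density 0 s x))"
   by (simp add: distributed_def)
  then have D': "D = distr stdN borel (%x. s * x)" unfolding D by (metis distr_cong sets_lborel)
  have i2: "integrable stdN (%x. x\<^sup>2)" by (rule integrable_std_normal_distribution_moment)
  have v: "(LINT y|D. y\<^sup>2) = s\<^sup>2"
   unfolding D' using std_normal_distribution_even_moments(1)[of 1] by (subst integral_distr) (simp_all add: power_mult_distrib fact_numeral)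
  have "integrable D (%y. y\<^sup>2)" unfolding D' using i2 by (subst integrable_distr_eq) (simp_all add: power_mult_distrib)
  moreover have "(LINT y|D. cis y) = complex_of_real (exp (- s\<^sup>2 / 2))"
   unfolding D' using integral_cis_stdN[of s] by (subst integral_distr) simp_all
  ultimately show ?thesis by (simp add: v)
 qed
 then show "integrable D (%y. y\<^sup>2)" "(LINT y|D. cis y) = complex_of_real (exp (- (LINT y|D. y\<^sup>2) / 2))" by auto
qed

lemma isonormal_gaussian_field:
 fixes l :: "'h::{real_inner, polish_space} => 'w => real"
 assumes "isonormal_field OM l"
 shows "gaussian_field OM (restrict_space borel (cball 0 1)) l (\<bullet>)"
proof (rule gaussian_field.intro)
 let ?X = "restrict_space borel (cball 0 1) :: 'h measure"
 have sp: "space ?X = cball 0 1" by (simp add: space_restrict_space)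
 from assms have OM: "prob_space OM" and lm: "(%(v, om). l v om) : bm (?X **M OM)"
  and nrm: "!!S c. finite S ==> S \<subseteq> cball 0 1 ==> centered_normal (distr OM borel (%om. SUM v:S. c v * l v om))"
  and cov: "!!v v'. v : cball 0 1 ==> v' : cball 0 1 ==> (LINT om|OM. l v om * l v' om) = v \<bullet> v'"
  unfolding isonormal_field_def by blast+
 show "prob_space OM" by fact
 show "(%(v, om). l v om) : bm (?X **M OM)" by fact
 have idm: "(%v. v) : ?X ->M borel" by (rule measurable_restrict_space1) simp
 show "(%(x, y). x \<bullet> y) : bm (?X **M ?X)"
  unfolding case_prod_beta
  by (rule borel_measurable_inner[OF mcomp[OF measurable_fst idm] mcomp[OF measurable_snd idm]])
 show "0 <= x \<bullet> x & x \<bullet> x <= 1" if "x : space ?X" for x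
  using that unfolding sp by (simp add: power2_norm_eq_inner[symmetric] power_le_one)
 fix N :: nat and t :: "nat => real" and x :: "nat => 'h"
 assume "!!i. i < N ==> x i : space ?X"
 then have x: "x i : cball 0 1" if "i < N" for i using that unfolding sp by blast
 have lv: "l v : bm OM" if "v : cball 0 1" for v
  using mcomp[OF measurable_Pair1' lm, of v] that unfolding sp by simp
 have sq: "integrable OM (%om. (l v om)\<^sup>2)" if v: "v : cball 0 1" for v
 proof -
  have "centered_normal (distr OM borel (l v))" using nrm[of "{v}" "%_. 1"] v by simp
  from centered_normal_char(1)[OF this] show ?thesis by (subst (asm) integrable_distr_eq) (auto intro: lv[OF v])
 qed
 have pi: "integrable OM (%om. l v om * l v' om)" if v: "v : cball 0 1" "v' : cball 0 1" for v v'
 proof (rule integrable_bound[of _ "%om. (l v om)\<^sup>2 + (l v' om)\<^sup>2"])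
  show "integrable OM (%om. (l v om)\<^sup>2 + (l v' om)\<^sup>2)" by (intro integrable_add sq v)
  show "(%om. l v om * l v' om) : bm OM" by (intro borel_measurable_times lv v)
  have "\<bar>a * b\<bar> <= a\<^sup>2 + b\<^sup>2" for a b :: real
  proof -
   have "2 * \<bar>a\<bar> * \<bar>b\<bar> <= a\<^sup>2 + b\<^sup>2" using sum_squares_bound[of "\<bar>a\<bar>" "\<bar>b\<bar>"] by simp
   then show ?thesis unfolding abs_mult using mult_nonneg_nonneg[OF abs_ge_zero[of a] abs_ge_zero[of b]] by linarith
  qed
  then show "AE om in OM. norm (l v om * l v' om) <= norm ((l v om)\<^sup>2 + (l v' om)\<^sup>2)" by (intro AE_I2) simp
 qed
 define S where "S = x ` {..<N}"
 \<comment> \<open>\<open>isonormal_field\<close> speaks of sets of points, so the coefficients of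
   repeated points are collected.\<close>
 define c where "c v = (SUM i:{i\<in>{..<N}. x i = v}. t i)" for v
 define Z where "Z om = (SUM i<N. t i * l (x i) om)" for om
 have Zc: "Z om = (SUM v:S. c v * l v om)" for om
 proof -
  have "Z om = (SUM v:S. SUM i:{i\<in>{..<N}. x i = v}. t i * l (x i) om)" unfolding Z_def S_def by (rule sum.image_gen) simp
  then show ?thesis by (simp add: c_def sum_distrib_right)
 qed
 have Zm: "Z : bm OM" unfolding Z_def[abs_def] by (intro borel_measurable_sum borel_measurable_times borel_measurable_const lv x) auto
 have "centered_normal (distr OM borel Z)" unfolding Zc[abs_def] using x by (intro nrm) (auto simp: S_def)
 from centered_normal_char(2)[OF this]
 have "(LINT om|OM. cis (Z om)) = complex_of_real (exp (- (LINT om|OM. (Z om)\<^sup>2) / 2))"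
  by (simp add: integral_distr[OF Zm])
 also have "(LINT om|OM. (Z om)\<^sup>2) = (SUM i<N. SUM j<N. t i * t j * (x i \<bullet> x j))"
 proof -
  have "(LINT om|OM. (Z om)\<^sup>2) = (LINT om|OM. (SUM i<N. SUM j<N. t i * t j * (l (x i) om * l (x j) om)))"
   by (intro integral_cong refl) (simp add: Z_def power2_eq_square sum_product mult_ac)
  also have "... = (SUM i<N. SUM j<N. t i * t j * (LINT om|OM. l (x i) om * l (x j) om))"
   using x by (subst integral_sum; (intro integrable_sum integrable_mult_right pi)?)
    (auto simp: integral_sum pi)
  also have "... = (SUM i<N. SUM j<N. t i * t j * (x i \<bullet> x j))" using x by (intro sum.cong refl) (simp add: cov)
  finally show ?thesis .
 qed
 finally show "(LINT om|OM. cis (SUM i<N. t i * l (x i) om)) = complex_of_real (exp (- (SUM i<N. SUM j<N. t i * t j * (x i \<bullet> x j)) / 2))"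
  by (simp add: Z_def)
qed

lemma overlap_array_law_distr:
 assumes P: "P : space (prob_algebra (prob_algebra X))" and R: "(%(x, y). R x y) : bm (X **M X)"
 shows "overlap_array_law R P = distr (P \<bind> (%m. replicas m)) array_space (overlap_array R)"
proof -
 from P have PP: "sets P = sets (prob_algebra X)" by (auto simp: space_prob_algebra)
 have K: "(%m. replicas m) : P ->M subprob_algebra (replicas X)"
  unfolding mcs[OF PP] by (rule measurable_prob_algebraD[OF replicas_kernel])
 have m: "overlap_array R : replicas X ->M array_space" by (rule overlap_array_measurable[OF R])
 have g: "(%x. return array_space (overlap_array R x)) : replicas X ->M subprob_algebra array_space"
  by (rule mcomp[OF m return_measurable])
 have "overlap_array_law R P = (P \<bind> (%m. replicas m)) \<bind> (%x. return array_space (overlap_array R x))"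
  unfolding overlap_array_law_def by (rule bind_assoc[OF K g, symmetric])
 also have "... = distr (P \<bind> (%m. replicas m)) array_space (overlap_array R)"
 proof (rule bind_return_distr')
  show "space (P \<bind> (%m. replicas m)) ~= {}" by (rule prob_space.not_empty[OF prob_space_bind_replicas[OF P]])
  show "overlap_array R : (P \<bind> (%m. replicas m)) ->M array_space"
   unfolding measurable_cong_sets[OF sets_bind_replicas[OF P] refl] by (rule m)
 qed
 finally show ?thesis .
qed

lemma array_map_measurable:
 assumes R: "(%(x, y). R x y) : bm (X **M X)"
 shows "(%x. %(i, k). R (x i) (x k)) : replicas X ->M array_space"
 unfolding array_space_def
proof (rule measurable_PiM_single')
 fix p :: "nat \<times> nat"
 have pr: "(%x. (x (fst p), x (snd p))) : replicas X ->M X **M X" by measurable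
 show "(%x. (case p of (i, k) => R (x i) (x k))) : bm (replicas X)"
  using mcomp[OF pr R] by (simp add: case_prod_beta)
qed auto

lemma ratio_scale:
 assumes w: "!!x. x : space m ==> w x = c * w' x" and c: "c ~= 0"
 shows "ratio G s w m = ratio G s w' m"
proof -
 have "(LINT x|PiM {..<s} (%_. m). G x * (PROD i<s. w (x i))) = (LINT x|PiM {..<s} (%_. m). c ^ s * (G x * (PROD i<s. w' (x i))))"
 proof (rule integral_cong[OF refl])
  fix x assume "x : space (PiM {..<s} (%_. m))"
  then have "x i : space m" if "i < s" for i using that by (auto simp: space_PiM)
  then have "(PROD i<s. w (x i)) = (PROD i<s. c * w' (x i))" using w by (intro prod.cong) auto
  then show "G x * (PROD i<s. w (x i)) = c ^ s * (G x * (PROD i<s. w' (x i)))" by (simp add: prod.distrib)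
 qed
 moreover have "(LINT x|m. w x) = c * (LINT x|m. w' x)"
  using w by (simp cong: integral_cong)
 ultimately show ?thesis using c by (simp add: ratio_def power_mult_distrib)
qed

section \<open>Transfer of stability to the sampling measure\<close>

text \<open>For the field on a finite cube stability is exact, as each realization is a tilt covered
  by \<open>inv\<close>. Replacing the exponential by a smoothed trigonometric polynomial costs the
  same small amount for all cubes and for the isonormal field, since the error is always measured
  against a standard normal variable. For trigonometric weights the ratios converge as the cube
  grows, because their moments in the limit depend only on the law of the overlaps, which both sides
  share.\<close>

lemma stability_transfer:
 fixes P0 :: "('d::finite) config measure measure" and l :: "'h::{real_inner, polish_space} => 'w => real"
 assumes P0: "P0 : space (prob_algebra (prob_algebra cfg))"
  and inv: "!!n h. distr (P0 \<bind> (%GA. replicas (reweight (edge_weight 1 (cube_edges n) h) GA))) array_space ov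
   = distr (P0 \<bind> (%GA. replicas GA)) array_space ov"
  and conv: "AE sg in P0 \<bind> (%GA. replicas GA). \<forall>i j. (%n. overlap_avg n (sg i) (sg j)) ----> edge_overlap (sg i) (sg j)"
  and sampling: "is_sampling_measure P (overlap_array_law edge_overlap P0)"
  and l: "isonormal_field OM l"
  and F: "continuous_on UNIV F" and dep: "!!q q'. (!!i j. i < j ==> j < s ==> q (i, j) = q' (i, j)) ==> F q = F q'"
 shows "(LINT om|OM. (LINT mu|P. (LINT v|PiM {..<s} (%_. mu). F (%(i, j). v i \<bullet> v j) * (PROD i<s. tilt t l om (v i)))
   / (LINT v|mu. tilt t l om v) ^ s))
  = (LINT mu|P. (LINT v|PiM {..<s} (%_. mu). F (%(i, j). v i \<bullet> v j)))"
proof -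
 let ?X = "cfg :: 'd config measure" and ?X' = "restrict_space borel (cball 0 1) :: 'h measure"
 have spX': "space ?X' = cball 0 1" by (simp add: space_restrict_space)
 interpret H: gaussian_field OM ?X' l "(\<bullet>)" by (rule isonormal_gaussian_field[OF l])
 have P: "P : space (prob_algebra (prob_algebra ?X'))" and law: "overlap_array_law (\<bullet>) P = overlap_array_law edge_overlap P0"
  using sampling unfolding is_sampling_measure_def by auto
 define PR0 where "PR0 = P0 \<bind> (%GA. replicas GA)"
 define PR where "PR = P \<bind> (%GA. replicas GA)"
 interpret PR0: prob_space PR0 unfolding PR0_def by (rule prob_space_bind_replicas[OF P0])
 have sPR0: "sets PR0 = sets (replicas ?X)" unfolding PR0_def by (rule sets_bind_replicas[OF P0])
 have sPR: "sets PR = sets (replicas ?X')" unfolding PR_def by (rule sets_bind_replicas[OF P])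
 interpret P0: prob_space P0 using P0 by (auto simp: space_prob_algebra)
 have sP0: "sets P0 = sets (prob_algebra ?X)" using P0 by (auto simp: space_prob_algebra)
 have sP: "sets P = sets (prob_algebra ?X')" using P by (auto simp: space_prob_algebra)
 define Q where "Q = distr PR0 array_space ov"
 have Q': "Q = distr PR array_space (overlap_array (\<bullet>))"
  unfolding Q_def PR0_def PR_def ov_def overlap_array_law_distr[OF P0 edge_overlap_measurable, symmetric]
   overlap_array_law_distr[OF P H.r_measurable, symmetric] by (rule law[symmetric])
 have ov0: "ov : PR0 ->M array_space" unfolding mcs[OF sPR0] by (rule ov_measurable)
 have ov1: "overlap_array (\<bullet>) : PR ->M array_space"
  unfolding mcs[OF sPR] by (rule overlap_array_measurable[OF H.r_measurable])
 \<comment> \<open>Truncation makes the function bounded everywhere; inner products of points of the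
   unit ball are in \<open>[-1, 1]\<close>, where it agrees with \<open>F\<close>.\<close>
 define Fc where "Fc q = F (%p. clip 1 (q p))" for q
 have "continuous_on UNIV (%q :: nat \<times> nat => real. (%p. clip 1 (q p)))"
  by (intro continuous_on_coordinatewise_then_product continuous_on_clip continuous_on_product_coordinates)
 then have "continuous_on UNIV Fc" unfolding Fc_def[abs_def] using continuous_on_compose2[OF F] by blast
 then have "Fc : bm borel" by (rule borel_measurable_continuous_onI)
 moreover have sb: "sets array_space = sets (borel :: (nat \<times> nat => real) measure)"
  unfolding array_space_def by (rule sets_PiM_equal_borel)
 ultimately have Fcm: "Fc : bm array_space" unfolding mcs[OF sb] by simp
 obtain C where C: "C > 0" "!!q. (\<forall>p. \<bar>q p\<bar> <= 1) ==> \<bar>F q\<bar> <= C" using bounded_on_cube[OF F] by blast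
 have FcC: "\<bar>Fc q\<bar> <= C" for q unfolding Fc_def by (rule C(2)) (simp add: clip_abs)
 have Fc_dep: "Fc q = Fc q'" if "!!i j. i < j ==> j < s ==> q (i, j) = q' (i, j)" for q q'
  unfolding Fc_def by (rule dep) (simp add: that)
 define G0 where "G0 x = Fc (fin_overlap s edge_overlap x)" for x :: "nat => 'd config"
 define G where "G x = Fc (fin_overlap s (\<bullet>) x)" for x :: "nat => 'h"
 have G0m: "G0 : bm (PiM {..<s} (%_. ?X))"
  unfolding G0_def[abs_def] by (rule mcomp[OF fin_overlap_measurable[OF edge_overlap_measurable] Fcm])
 have Gm: "G : bm (PiM {..<s} (%_. ?X'))"
  unfolding G_def[abs_def] by (rule mcomp[OF fin_overlap_measurable[OF H.r_measurable] Fcm])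
 have G0C: "\<bar>G0 x\<bar> <= C" and GC: "\<bar>G y\<bar> <= C" for x y unfolding G0_def G_def by (rule FcC)+
 have G0r: "G0 (restrict x {..<s}) = Fc (ov x)" for x
  unfolding G0_def by (rule Fc_dep) (simp add: fin_overlap_def ov_def overlap_array_def)
 have Gr: "G (restrict x {..<s}) = Fc (overlap_array (\<bullet>) x)" for x
  unfolding G_def by (rule Fc_dep) (simp add: fin_overlap_def overlap_array_def)
 define q0 where "q0 = (LINT q|Q. Fc q)"
 define w where "w x om = exp (t * l x om - t\<^sup>2 / 2 * (x \<bullet> x))" for x om
 have GF: "F (%(i, j). v i \<bullet> v j) = G v" if mu: "mu : space P" and v: "v : space (PiM {..<s} (%_. mu))" for mu v
 proof -
  have "sets mu = sets ?X'" using mu unfolding space_eqI[OF sP] by (auto simp: space_prob_algebra)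
  then have "space mu = cball 0 1" using space_eqI[of mu ?X'] spX' by simp
  then have "norm (v i) <= 1" if "i < s" for i using v that by (auto simp: space_PiM PiE_iff)
  then have "\<bar>v i \<bullet> v j\<bar> <= 1" if "i < s" "j < s" for i j
   using order_trans[OF Cauchy_Schwarz_ineq2[of "v i" "v j"] mult_le_one[of "norm (v i)" "norm (v j)"]] that by simp
  then show ?thesis unfolding G_def Fc_def by (intro dep) (simp add: fin_overlap_def clip_id)
 qed
 have RHS: "(LINT mu|P. (LINT v|PiM {..<s} (%_. mu). F (%(i, j). v i \<bullet> v j))) = q0"
 proof -
  have "(LINT mu|P. (LINT v|PiM {..<s} (%_. mu). F (%(i, j). v i \<bullet> v j))) = (LINT mu|P. (LINT x|replicas mu. Fc (overlap_array (\<bullet>) x)))"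
  proof (rule integral_cong[OF refl])
   fix mu assume mu: "mu : space P"
   then have mu': "prob_space mu" "sets mu = sets ?X'" unfolding space_eqI[OF sP] by (auto simp: space_prob_algebra)
   have eq: "sets (PiM {..<s} (%_. mu)) = sets (PiM {..<s} (%_. ?X'))" by (intro sets_PiM_cong refl mu')
   have "(LINT v|PiM {..<s} (%_. mu). F (%(i, j). v i \<bullet> v j)) = (LINT v|PiM {..<s} (%_. mu). G v)"
    by (rule integral_cong[OF refl GF[OF mu]])
   also have "... = (LINT x|replicas mu. G (restrict x {..<s}))"
    by (rule integral_replicas_restrict[OF mu'(1) _ subset_UNIV, symmetric]) (simp only: mcs[OF eq] Gm)
   finally show "(LINT v|PiM {..<s} (%_. mu). F (%(i, j). v i \<bullet> v j)) = (LINT x|replicas mu. Fc (overlap_array (\<bullet>) x))"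
    by (simp only: Gr)
  qed
  also have "... = (LINT x|PR. Fc (overlap_array (\<bullet>) x))"
   unfolding PR_def
   by (rule integral_bind_replicas[OF P mcomp[OF overlap_array_measurable[OF H.r_measurable] Fcm] FcC, symmetric])
  also have "... = q0" unfolding q0_def Q' by (rule integral_distr[OF ov1 Fcm, symmetric])
  finally show ?thesis .
 qed
 have LHS: "(LINT om|OM. (LINT mu|P. (LINT v|PiM {..<s} (%_. mu). F (%(i, j). v i \<bullet> v j) * (PROD i<s. tilt t l om (v i)))
   / (LINT v|mu. tilt t l om v) ^ s)) = (LINT om|OM. (LINT mu|P. ratio G s (%v. w v om) mu))"
 proof (rule integral_cong[OF refl], rule integral_cong[OF refl])
  fix om mu assume mu: "mu : space P"
  have tw: "tilt t l om v = w v om" for v by (simp add: tilt_def w_def power2_norm_eq_inner)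
  have "(LINT v|PiM {..<s} (%_. mu). F (%(i, j). v i \<bullet> v j) * (PROD i<s. w (v i) om)) = (LINT v|PiM {..<s} (%_. mu). G v * (PROD i<s. w (v i) om))"
  proof (rule integral_cong[OF refl])
   fix v assume "v : space (PiM {..<s} (%_. mu))"
   from GF[OF mu this] show "F (%(i, j). v i \<bullet> v j) * (PROD i<s. w (v i) om) = G v * (PROD i<s. w (v i) om)" by (simp only:)
  qed
  then show "(LINT v|PiM {..<s} (%_. mu). F (%(i, j). v i \<bullet> v j) * (PROD i<s. tilt t l om (v i))) / (LINT v|mu. tilt t l om v) ^ s
   = ratio G s (%v. w v om) mu" unfolding tw ratio_def by (simp only:)
 qed
 \<comment> \<open>\<open>Suc n\<close> excludes the cube of radius \<open>0\<close>, which has no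
   edge.\<close>
 define E where "E n = (cube_edges (Suc n) :: 'd edge set)" for n
 define Om where "Om n = PiM (E n) (%_. stdN)" for n
 define Y where "Y n sg g = (SUM e:E n. g e * edge_spin sg e) / sqrt (real (card (E n)))" for n sg and g :: "'d edge => real"
 have ea: "gaussian_field (Om n) ?X (Y n) (overlap_avg (Suc n))" for n
  unfolding Om_def E_def Y_def[abs_def] by (rule ea_field) simp
 define u where "u n sg g = exp (t * Y n sg g - t\<^sup>2 / 2 * overlap_avg (Suc n) sg sg)" for n sg g
 \<comment> \<open>This holds already for each fixed realization \<open>g\<close> of the
   field.\<close>
 have exact: "(LINT g|Om n. (LINT m|P0. ratio G0 s (%sg. u n sg g) m)) = q0" for n
 proof -
  have "(LINT m|P0. ratio G0 s (%sg. u n sg g) m) = q0" for g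
  proof -
   define h where "h e = t * g e / sqrt (real (card (E n)))" for e
   define ew where "ew = edge_weight 1 (E n) h"
   have ewp: "ew sg > 0" for sg by (simp add: ew_def)
   have ewi: "integrable m ew" if "m : space (prob_algebra ?X)" for m
    using that unfolding ew_def E_def by (intro edge_weight_integrable cube_edges_subset) (auto simp: space_prob_algebra)
   \<comment> \<open>All configurations have self-overlap \<open>1\<close>, so the correction
     \<open>t^2 / 2\<close> is a constant factor and cancels in the ratio.\<close>
   have uw: "u n sg g = exp (- t\<^sup>2 / 2) * ew sg" if "sg : space ?X" for sg
   proof -
    have "t * Y n sg g = (SUM e:E n. h e * edge_spin sg e)" by (simp add: Y_def h_def sum_distrib_left sum_divide_distrib mult_ac)
    then show ?thesis using overlap_avg_self[OF that, of "Suc n"]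
     by (simp add: u_def ew_def edge_weight_def exp_add[symmetric])
   qed
   have rk: "(%GA. reweight ew GA) : prob_algebra ?X ->M prob_algebra ?X"
   proof (rule measurable_reweight[where w = "%_. ew" and L = "%GA. GA"])
    show "(%(x, y). ew y) : bm (prob_algebra ?X **M ?X)" unfolding ew_def by measurable
   qed (auto intro: ewp ewi)
   have rrk: "(%GA. replicas (reweight ew GA)) : P0 ->M prob_algebra (replicas ?X)"
    unfolding mcs[OF sP0] by (rule mcomp[OF rk replicas_kernel])
   have "(LINT m|P0. ratio G0 s (%sg. u n sg g) m) = (LINT m|P0. (LINT x|replicas (reweight ew m). Fc (ov x)))"
   proof (rule integral_cong[OF refl])
    fix m assume "m : space P0"
    then have m: "m : space (prob_algebra ?X)" unfolding space_eqI[OF sP0] .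
    then have m': "prob_space m" "sets m = sets ?X" by (auto simp: space_prob_algebra)
    have "ratio G0 s (%sg. u n sg g) m = ratio G0 s ew m"
    proof (rule ratio_scale[where c = "exp (- t\<^sup>2 / 2)"])
     show "u n sg g = exp (- t\<^sup>2 / 2) * ew sg" if "sg : space m" for sg
      using that unfolding space_eqI[OF m'(2)] by (rule uw)
    qed simp
    also have "... = (LINT x|PiM {..<s} (%_. reweight ew m). G0 x)"
    proof -
     have eq: "sets (PiM {..<s} (%_. m)) = sets (PiM {..<s} (%_. ?X))" by (intro sets_PiM_cong refl m')
     have "G0 : bm (PiM {..<s} (%_. m))" unfolding mcs[OF eq] by (rule G0m)
     from integral_PiM_reweight[OF m'(1) ewi[OF m] ewp this] show ?thesis by (simp only: ratio_def)
    qed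
    also have "... = (LINT x|replicas (reweight ew m). G0 (restrict x {..<s}))"
    proof (rule integral_replicas_restrict[OF prob_space_reweight[OF m'(1) ewi[OF m] ewp] _ subset_UNIV, symmetric])
     have eq: "sets (PiM {..<s} (%_. reweight ew m)) = sets (PiM {..<s} (%_. ?X))"
      by (intro sets_PiM_cong refl) (simp only: sets_reweight m'(2))
     show "G0 : bm (PiM {..<s} (%_. reweight ew m))" unfolding mcs[OF eq] by (rule G0m)
    qed
    finally show "ratio G0 s (%sg. u n sg g) m = (LINT x|replicas (reweight ew m). Fc (ov x))" by (simp only: G0r)
   qed
   also have "... = (LINT x|(P0 \<bind> (%m. replicas (reweight ew m))). Fc (ov x))"
    by (rule integral_bind_prob[OF P0.prob_space_axioms rrk mcomp[OF ov_measurable Fcm] FcC, symmetric])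
   also have "... = (LINT q|distr (P0 \<bind> (%m. replicas (reweight ew m))) array_space ov. Fc q)"
   proof (rule integral_distr[OF _ Fcm, symmetric])
    have "sets (P0 \<bind> (%m. replicas (reweight ew m))) = sets (replicas ?X)"
     by (rule sets_bind'[OF P0]) (rule mcomp[OF rk replicas_kernel])
    then show "ov : (P0 \<bind> (%m. replicas (reweight ew m))) ->M array_space"
     using ov_measurable measurable_cong_sets by blast
   qed
   also have "... = q0" unfolding ew_def E_def inv q0_def Q_def PR0_def ..
   finally show ?thesis .
  qed
  then show ?thesis using prob_space.prob_space[OF gaussian_field.prob_OM[OF ea]] by simp
 qed
 \<comment> \<open>One error \<open>C * real s * 2 * de\<close> for each of the two fields; the
   trigonometric weights in between contribute none in the limit.\<close>
 have main: "\<bar>(LINT om|OM. (LINT mu|P. ratio G s (%v. w v om) mu)) - q0\<bar> <= 2 * (C * real s * 2 * de)" if de: "de > 0" for de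
 proof -
  obtain a ta k K L where a: "a > 0" and ta1: "ta : bm borel"
   and L: "!!x. complex_of_real (ta x) = trig_sum L x"
   and ta2: "0 < k" and ta3: "!!x. k <= ta x & ta x <= K"
   and err: "(\<integral>\<^sup>+z. ennreal ((a * (exp (t * z - t\<^sup>2 / 2) - ta z)\<^sup>2 + 1 / (a * (exp (t * z - t\<^sup>2 / 2))\<^sup>2)) / 2) \<partial>stdN) <= ennreal de"
   by (rule gauss_approx[OF de, where l = t], rule that)
  note ta = ta1 ta2 ta3
  have pos: "smooth ta q y > 0" and le: "smooth ta q y <= K" for q y using smooth_bounds[OF ta(1,3), of q y] ta(2) by linarith+
  have expm: "(%(x, om). exp (t * Y' x om - t\<^sup>2 / 2 * r' x x)) : bm (X **M W)"
   if "gaussian_field W X Y' r'" for W :: "'z measure" and X :: "'x measure" and Y' r'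
  proof -
   interpret gaussian_field W X Y' r' by fact
   have "(%p. r' (fst p) (fst p)) : bm (X **M W)"
    using mcomp[OF measurable_Pair[OF measurable_fst measurable_fst] r_measurable] by simp
   moreover have "(%p. Y' (fst p) (snd p)) : bm (X **M W)" using Y_measurable by (simp add: case_prod_beta)
   ultimately show ?thesis unfolding case_prod_beta by measurable
  qed
  have d1: "\<bar>(LINT om|OM. (LINT m|P. ratio G s (%x. w x om) m)) - (LINT om|OM. (LINT m|P. ratio G s (%x. smooth ta (x \<bullet> x) (l x om)) m))\<bar>
   <= C * real s * 2 * de"
   unfolding w_def
   by (rule integral_ratio_close[OF H.prob_OM P expm[OF H.gaussian_field_axioms] exp_gt_zero H.smooth_field_measurable[OF ta(1)] pos le Gm GC C(1) a less_imp_le[OF de]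
     H.smooth_error[OF _ a ta(1,3) err]])
  have d2: "\<bar>q0 - (LINT g|Om n. (LINT m|P0. ratio G0 s (%x. smooth ta (overlap_avg (Suc n) x x) (Y n x g)) m))\<bar> <= C * real s * 2 * de" for n
   unfolding exact[of n, symmetric] u_def
   by (rule integral_ratio_close[OF gaussian_field.prob_OM[OF ea] P0 expm[OF ea] exp_gt_zero gaussian_field.smooth_field_measurable[OF ea ta(1)] pos le G0m G0C C(1) a less_imp_le[OF de]
     gaussian_field.smooth_error[OF ea _ a ta(1,3) err]])
  have "(%n. \<integral>g. (LINT m|P0. ratio G0 s (%x. smooth ta (overlap_avg (Suc n) x x) (Y n x g)) m) \<partial>Om n)
   ----> (LINT om|OM. (LINT m|P. ratio G s (%x. smooth ta (x \<bullet> x) (l x om)) m))"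
  proof (rule field_ratio_limit[OF ea H.gaussian_field_axioms P0 P ta L G0m G0C Gm GC])
   fix N
   obtain B where B: "!!q. (\<forall>p. \<bar>q p\<bar> <= 1) ==> \<bar>gen L N q\<bar> <= B" using gen_bounded by blast
   have FgQ: "(%q. Fc q * gen L N q) : bm array_space" by (intro borel_measurable_times Fcm gen_measurable)
   \<comment> \<open>The overlaps in cubes converge almost surely by \<open>conv\<close>, and
     \<open>gen\<close> is continuous in them and bounded.\<close>
   have "(%n. \<integral>x. Fc (ov x) * gen L N (%(i, k). overlap_avg (Suc n) (x i) (x k)) \<partial>PR0)
    ----> (LINT x|PR0. Fc (ov x) * gen L N (ov x))"
   proof (rule integral_dominated_convergence[where w = "%_. C * B"])
    have Fov: "(%x. Fc (ov x)) : bm PR0" by (rule mcomp[OF ov0 Fcm])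
    show "(%x. Fc (ov x) * gen L N (ov x)) : bm PR0" by (rule mcomp[OF ov0 FgQ])
    show "(%x. Fc (ov x) * gen L N (%(i, k). overlap_avg (Suc n) (x i) (x k))) : bm PR0" for n
     using mcomp[OF array_map_measurable[OF overlap_avg_measurable] gen_measurable]
     by (intro borel_measurable_times Fov) (simp only: mcs[OF sPR0])
    show "AE x in PR0. (%n. Fc (ov x) * gen L N (%(i, k). overlap_avg (Suc n) (x i) (x k))) ----> Fc (ov x) * gen L N (ov x)"
     using conv unfolding PR0_def[symmetric]
    proof eventually_elim
     fix x :: "nat => 'd config" assume x: "\<forall>i j. (%n. overlap_avg n (x i) (x j)) ----> edge_overlap (x i) (x j)"
     have "(%n. gen L N (%(i, k). overlap_avg (Suc n) (x i) (x k))) ----> gen L N (%(i, k). edge_overlap (x i) (x k))"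
     proof (rule gen_tendsto)
      fix i j
      have "(%n. overlap_avg (Suc n) (x i) (x j)) ----> edge_overlap (x i) (x j)"
       using x by (intro LIMSEQ_Suc) blast
      then show "(%n. (case (i, j) of (i, k) => overlap_avg (Suc n) (x i) (x k))) ----> (case (i, j) of (i, k) => edge_overlap (x i) (x k))" by simp
     qed
     moreover have "gen L N (%(i, k). edge_overlap (x i) (x k)) = gen L N (ov x)"
      by (rule gen_cong) (simp add: ov_def overlap_array_def)
     ultimately show "(%n. Fc (ov x) * gen L N (%(i, k). overlap_avg (Suc n) (x i) (x k))) ----> Fc (ov x) * gen L N (ov x)"
      by (intro tendsto_mult_left) simp
    qed
    show "AE x in PR0. norm (Fc (ov x) * gen L N (%(i, k). overlap_avg (Suc n) (x i) (x k))) <= C * B" for n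
    proof (rule AE_I2)
     fix x assume "x : space PR0"
     then have xi: "x i : space ?X" for i unfolding space_eqI[OF sPR0] by (auto simp: space_PiM simp del: space_config)
     have "\<forall>p. \<bar>case p of (i, k) => overlap_avg (Suc n) (x i) (x k)\<bar> <= 1"
      using overlap_avg_bound[OF xi xi] by (simp only: case_prod_beta) blast
     then have "\<bar>gen L N (%(i, k). overlap_avg (Suc n) (x i) (x k))\<bar> <= B" by (rule B)
     then show "norm (Fc (ov x) * gen L N (%(i, k). overlap_avg (Suc n) (x i) (x k))) <= C * B"
      unfolding real_norm_def abs_mult using FcC C(1) by (intro mult_mono) auto
    qed
   qed simp
   \<comment> \<open>The integrand is a function of the overlap array, whose law \<open>Q\<close> is
     common to the metastate and the sampling measure.\<close>
   also have "(LINT x|PR0. Fc (ov x) * gen L N (ov x)) = (LINT q|Q. Fc q * gen L N q)"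
    unfolding Q_def by (rule integral_distr[OF ov0 FgQ, symmetric])
   also have "... = (LINT x|PR. Fc (overlap_array (\<bullet>) x) * gen L N (overlap_array (\<bullet>) x))"
    unfolding Q' by (rule integral_distr[OF ov1 FgQ])
   also have "... = (LINT x|PR. G (restrict x {..<s}) * gen L N (%(i, k). x i \<bullet> x k))"
   proof (rule integral_cong[OF refl])
    fix x :: "nat => 'h"
    have "gen L N (overlap_array (\<bullet>) x) = gen L N (%(i, k). x i \<bullet> x k)" by (rule gen_cong) (simp add: overlap_array_def)
    then show "Fc (overlap_array (\<bullet>) x) * gen L N (overlap_array (\<bullet>) x) = G (restrict x {..<s}) * gen L N (%(i, k). x i \<bullet> x k)"
     by (simp only: Gr)
   qed
   finally show "(%n. \<integral>x. G0 (restrict x {..<s}) * gen L N (%(i, k). overlap_avg (Suc n) (x i) (x k)) \<partial>(P0 \<bind> (%m. replicas m)))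
    ----> (LINT x|(P \<bind> (%m. replicas m)). G (restrict x {..<s}) * gen L N (%(i, k). x i \<bullet> x k))"
    by (simp only: G0r PR0_def PR_def)
  qed
  then have "(%n. \<bar>q0 - (LINT g|Om n. (LINT m|P0. ratio G0 s (%x. smooth ta (overlap_avg (Suc n) x x) (Y n x g)) m))\<bar>)
   ----> \<bar>q0 - (LINT om|OM. (LINT m|P. ratio G s (%x. smooth ta (x \<bullet> x) (l x om)) m))\<bar>"
   by (intro tendsto_intros)
  then have "\<bar>q0 - (LINT om|OM. (LINT m|P. ratio G s (%x. smooth ta (x \<bullet> x) (l x om)) m))\<bar> <= C * real s * 2 * de"
   by (rule LIMSEQ_le_const2) (use d2 in blast)
  then show ?thesis using d1 by linarith
 qed
 have "\<bar>(LINT om|OM. (LINT mu|P. ratio G s (%v. w v om) mu)) - q0\<bar> <= 0 + e" if e: "e > 0" for e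
 proof -
  \<comment> \<open>The summand \<open>1\<close> keeps the denominator positive when
    \<open>s = 0\<close>.\<close>
  define de where "de = e / (4 * C * real s + 1)"
  have den: "4 * C * real s + 1 > 0" using C(1) by (intro add_nonneg_pos) auto
  have "de > 0" unfolding de_def using e den by simp
  from main[OF this] have "\<bar>(LINT om|OM. (LINT mu|P. ratio G s (%v. w v om) mu)) - q0\<bar> <= 4 * C * real s * de" by simp
  also have "... <= (4 * C * real s + 1) * de" using \<open>de > 0\<close> by (intro mult_right_mono) auto
  also have "... = e" unfolding de_def using den by simp
  finally show ?thesis by simp
 qed
 then have "\<bar>(LINT om|OM. (LINT mu|P. ratio G s (%v. w v om) mu)) - q0\<bar> <= 0" by (rule field_le_epsilon)
 then show ?thesis unfolding LHS RHS by simp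
qed

section \<open>Stochastic stability\<close>

text \<open>The overlap in a cube is a normalized scalar product of vectors of edge spins, so the
  form is a mean of squares.\<close>

lemma overlap_avg_psd: "0 <= (SUM i<n. SUM j<n. c i * c j * overlap_avg m (x i) (x j))" for n :: nat and x :: "nat => ('d::finite) config"
proof -
 let ?E = "cube_edges m :: 'd edge set"
 have "(SUM i<n. SUM j<n. c i * c j * overlap_avg m (x i) (x j))
   = (SUM i<n. SUM j<n. SUM e:?E. (c i * edge_spin (x i) e) * (c j * edge_spin (x j) e) / real (card ?E))"
  by (simp add: overlap_avg_def sum_distrib_left sum_divide_distrib mult_ac)
 also have "... = (SUM i<n. SUM e:?E. SUM j<n. (c i * edge_spin (x i) e) * (c j * edge_spin (x j) e) / real (card ?E))"
  by (intro sum.cong refl) (rule sum.swap)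
 also have "... = (SUM e:?E. SUM i<n. SUM j<n. (c i * edge_spin (x i) e) * (c j * edge_spin (x j) e) / real (card ?E))"
  by (rule sum.swap)
 also have "... = (SUM e:?E. (SUM i<n. c i * edge_spin (x i) e)\<^sup>2 / real (card ?E))"
  by (intro sum.cong refl) (simp add: power2_eq_square sum_product sum_divide_distrib)
 also have "... >= 0" by (intro sum_nonneg) simp
 finally show ?thesis .
qed

text \<open>Positivity passes to the limit from finite cubes, and exchangeability holds because the
  replicas are i.i.d. given the random measure.\<close>

lemma is_rost_edge_overlap:
 fixes P0 :: "('d::finite) config measure measure"
 assumes P0: "P0 : space (prob_algebra (prob_algebra cfg))"
  and conv: "AE sg in P0 \<bind> (%GA. replicas GA). \<forall>i j. (%n. overlap_avg n (sg i) (sg j)) ----> edge_overlap (sg i) (sg j)"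
 shows "is_rost (overlap_array_law edge_overlap P0)"
proof -
 let ?X = "cfg :: 'd config measure"
 define PR where "PR = P0 \<bind> (%GA. replicas GA)"
 interpret PR: prob_space PR unfolding PR_def by (rule prob_space_bind_replicas[OF P0])
 have sPR: "sets PR = sets (replicas ?X)" unfolding PR_def by (rule sets_bind_replicas[OF P0])
 have ov0: "ov : PR ->M array_space" unfolding mcs[OF sPR] by (rule ov_measurable)
 have Q: "overlap_array_law edge_overlap P0 = distr PR array_space ov"
  unfolding ov_def PR_def by (rule overlap_array_law_distr[OF P0 edge_overlap_measurable])
 \<comment> \<open>Lists of rational coefficients make positivity a countable conjunction of
   measurable conditions; real coefficients follow by density.\<close>
 define good where "good q \<longleftrightarrow> (\<forall>i. q (i, i) = 1) & (\<forall>i j. q (i, j) = q (j, i)) \<and>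
   (\<forall>C :: rat list. 0 <= (SUM i<length C. SUM j<length C. of_rat (C ! i) * of_rat (C ! j) * q (i, j)))" for q :: "nat \<times> nat => real"
 have gm: "{q : space array_space. good q} : sets array_space"
 proof -
  have c: "(%q. q p) : bm array_space" for p :: "nat \<times> nat"
   unfolding array_space_def by (rule measurable_component_singleton) simp
  show ?thesis unfolding good_def
   by (intro sets.sets_Collect_conj sets.sets_Collect_countable_All borel_measurable_eq borel_measurable_le
     borel_measurable_sum borel_measurable_times borel_measurable_const c)
 qed
 have "AE x in PR. good (ov x)"
 proof -
  have "AE x in PR. x : space PR" by (rule AE_space)
  with conv[folded PR_def] show ?thesis
  proof eventually_elim
   fix x :: "nat => 'd config" assume lim: "\<forall>i j. (%n. overlap_avg n (x i) (x j)) ----> edge_overlap (x i) (x j)" and x: "x : space PR"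
   then have xi: "x i : space ?X" for i unfolding space_eqI[OF sPR] by (auto simp: space_PiM simp del: space_config)
   \<comment> \<open>The diagonal of \<open>ov\<close> is set to \<open>1\<close>, the value of
     self-overlaps in cubes of positive radius.\<close>
   have lim': "(%n. overlap_avg (Suc n) (x i) (x j)) ----> ov x (i, j)" for i j
   proof (cases "i = j")
    case True
    then show ?thesis by (simp add: overlap_avg_self[OF xi] ov_def overlap_array_def)
   next
    case False
    then show ?thesis using LIMSEQ_Suc[OF lim[rule_format, of i j]] by (simp add: ov_def overlap_array_def)
   qed
   have "0 <= (SUM i<n. SUM j<n. c i * c j * ov x (i, j))" for n and c :: "nat => real"
   proof (rule LIMSEQ_le_const)
    show "(%m. SUM i<n. SUM j<n. c i * c j * overlap_avg (Suc m) (x i) (x j)) ----> (SUM i<n. SUM j<n. c i * c j * ov x (i, j))"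
     by (intro tendsto_sum tendsto_mult_left lim')
   qed (use overlap_avg_psd in blast)
   then show "good (ov x)" unfolding good_def by (auto simp: ov_def overlap_array_def edge_overlap_commute)
  qed
 qed
 then have AEg: "AE q in distr PR array_space ov. good q" unfolding AE_distr_iff[OF ov0 gm] .
 have good: "0 <= (SUM i<n. SUM j<n. c i * c j * q (i, j))" if q: "good q" for q n and c :: "nat => real"
 proof -
  have "\<exists>r :: rat. \<bar>of_rat r - c i\<bar> < 1 / real (Suc m)" for i m
  proof -
   obtain r :: rat where "c i < of_rat r" "of_rat r < c i + 1 / real (Suc m)"
    using of_rat_dense[of "c i" "c i + 1 / real (Suc m)"] by auto
   then show ?thesis by (intro exI[of _ r]) (simp del: of_nat_Suc)
  qed
  then obtain r :: "nat => nat => rat" where r: "!!i m. \<bar>of_rat (r i m) - c i\<bar> < 1 / real (Suc m)" by metis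
  have "(%m. of_rat (r i m) - c i) ----> 0" for i
  proof (rule Lim_null_comparison)
   show "\<forall>\<^sub>F m in sequentially. norm (of_rat (r i m) - c i) <= 1 / real (Suc m)"
    using r by (intro always_eventually allI) (simp add: less_imp_le del: of_nat_Suc)
   show "(%m. 1 / real (Suc m)) ----> 0" by (rule lim_1_over_real_power[of 1, simplified, THEN LIMSEQ_Suc])
  qed
  then have rl: "(%m. of_rat (r i m)) ----> c i" for i by (rule LIM_zero_cancel)
  show ?thesis
  proof (rule LIMSEQ_le_const)
   show "(%m. SUM i<n. SUM j<n. of_rat (r i m) * of_rat (r j m) * q (i, j)) ----> (SUM i<n. SUM j<n. c i * c j * q (i, j))"
    by (intro tendsto_intros rl)
   have "0 <= (SUM i<n. SUM j<n. of_rat (r i m) * of_rat (r j m) * q (i, j))" for m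
   proof -
    let ?C = "map (%i. r i m) [0..<n]"
    have "0 <= (SUM i<length ?C. SUM j<length ?C. of_rat (?C ! i) * of_rat (?C ! j) * q (i, j))"
     using q unfolding good_def by blast
    then show ?thesis by simp
   qed
   then show "\<exists>N. \<forall>m\<ge>N. 0 <= (SUM i<n. SUM j<n. of_rat (r i m) * of_rat (r j m) * q (i, j))" by blast
  qed
 qed
 have perm: "distr (distr PR array_space ov) array_space (%q (i, j). q (\<pi> i, \<pi> j)) = distr PR array_space ov"
  if \<pi>: "inj \<pi>" for \<pi> :: "nat => nat"
 proof -
  define p where "p q = (%(i, j). q (\<pi> i, \<pi> j))" for q :: "nat \<times> nat => real"
  have pm: "p : array_space ->M array_space"
   unfolding array_space_def
  proof (rule measurable_PiM_single')
   fix ij :: "nat \<times> nat"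
   show "(%q. p q ij) : bm (PiM UNIV (%_. borel))"
    unfolding p_def case_prod_beta by measurable
  qed auto
  have P0s: "sets P0 = sets (prob_algebra ?X)" using P0 by (auto simp: space_prob_algebra)
  have P0n: "space P0 ~= {}" using P0 by (auto simp: space_prob_algebra dest: prob_space.not_empty)
  have K: "(%GA. replicas GA) : P0 ->M subprob_algebra (replicas ?X)"
   unfolding mcs[OF P0s] by (rule measurable_prob_algebraD[OF replicas_kernel])
  have "distr (distr PR array_space ov) array_space p = distr PR array_space (p \<circ> ov)" by (rule distr_distr[OF pm ov0])
  also have "... = P0 \<bind> (%GA. distr (replicas GA) array_space (p \<circ> ov))"
   unfolding PR_def by (rule distr_bind[OF K P0n measurable_comp[OF ov_measurable pm]])
  also have "... = P0 \<bind> (%GA. distr (replicas GA) array_space ov)"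
  proof (rule bind_cong[OF refl])
   fix GA assume "GA : space P0"
   then have GA: "prob_space GA" "sets GA = sets ?X" unfolding space_eqI[OF P0s] by (auto simp: space_prob_algebra)
   have s: "sets (replicas GA) = sets (replicas ?X)" by (intro sets_PiM_cong refl GA)
   have re: "distr (replicas GA) (replicas GA) (%x i. x (\<pi> i)) = replicas GA"
    using distr_PiM_reindex[of UNIV "%_. GA" \<pi> UNIV] GA(1) \<pi> by (simp add: restrict_def)
   have rem: "(%x i. x (\<pi> i)) : replicas GA ->M replicas GA"
   proof (rule measurable_PiM_single')
    show "(%x. x (\<pi> i)) : replicas GA ->M GA" for i by (rule measurable_component_singleton) simp
   qed (auto simp: space_PiM PiE_iff)
   have ovG: "ov : replicas GA ->M array_space" unfolding mcs[OF s] by (rule ov_measurable)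
   \<comment> \<open>Injectivity of \<open>\<pi>\<close> keeps distinct indices distinct, so the
     unit diagonal is respected.\<close>
   have "p \<circ> ov = ov \<circ> (%(x :: nat => 'd config) i. x (\<pi> i))"
    using \<pi> by (auto simp: fun_eq_iff p_def ov_def overlap_array_def inj_eq)
   then have "distr (replicas GA) array_space (p \<circ> ov) = distr (distr (replicas GA) (replicas GA) (%x i. x (\<pi> i))) array_space ov"
    by (simp only: distr_distr[OF ovG rem])
   then show "distr (replicas GA) array_space (p \<circ> ov) = distr (replicas GA) array_space ov" by (simp only: re)
  qed
  also have "... = distr PR array_space ov"
   unfolding PR_def by (rule distr_bind[OF K P0n ov_measurable, symmetric])
  finally show ?thesis unfolding p_def[abs_def] .
 qed
 show ?thesis unfolding is_rost_def Q
 proof (intro conjI allI impI)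
  show "distr PR array_space ov : space (prob_algebra array_space)"
   using PR.prob_space_distr[OF ov0] by (simp add: space_prob_algebra)
  show "AE q in distr PR array_space ov. (\<forall>i. q (i, i) = 1) & (\<forall>i j. q (i, j) = q (j, i)) \<and>
    (\<forall>n c. 0 <= (SUM i<n. SUM j<n. c i * c j * q (i, j)))"
   using AEg
  proof eventually_elim
   fix q :: "nat \<times> nat => real" assume q: "good q"
   then show "(\<forall>i. q (i, i) = 1) & (\<forall>i j. q (i, j) = q (j, i)) & (\<forall>n c. 0 <= (SUM i<n. SUM j<n. c i * c j * q (i, j)))"
    using good[OF q] unfolding good_def by blast
  qed
  fix \<pi> :: "nat => nat" and A assume "finite A & \<pi> permutes A"
  then have "inj \<pi>" using permutes_inj by blast
  then show "distr (distr PR array_space ov) array_space (%q (i, j). q (\<pi> i, \<pi> j)) = distr PR array_space ov" by (rule perm)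
 qed
qed

text \<open>The almost sure convergence under the joint law \<open>M\<close> is disintegrated over
  the couplings, which requires a measurable event.\<close>

lemma (in metastate) AE_overlaps_converge:
 "AE J in nu. AE sg in \<kappa> J \<bind> (%GA. replicas GA). \<forall>i j. (%n. overlap_avg n (sg i) (sg j)) ----> edge_overlap (sg i) (sg j)"
proof -
 define L where "L z \<longleftrightarrow> (\<forall>i j. (%n. overlap_avg n (snd z i) (snd z j)) ----> edge_overlap (snd z i) (snd z j))"
  for z :: "('d edge => real) \<times> (nat => 'd config)"
 have am: "(%x. R (x i) (x j)) : bm (replicas cfg)"
  if "(%(sg, sg'). R sg sg') : bm (cfg **M (cfg :: 'd config measure))"
  for R :: "'d config => 'd config => real" and i j :: nat
 proof -
  have "(%x. (x i, x j)) : replicas cfg ->M cfg **M (cfg :: 'd config measure)" by measurable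
  from mcomp[OF this that] show ?thesis by simp
 qed
 have Lm: "Measurable.pred (nu **M replicas cfg) L"
 proof -
  have "Measurable.pred (replicas cfg) (%sg. (%n. overlap_avg n (sg i) (sg j)) ----> edge_overlap (sg i) (sg (j :: nat)))"
   for i :: nat and j
  proof -
   \<comment> \<open>The edge overlap is a \<open>lim\<close>, so convergence to it is the Cauchy
     property, which is a measurable condition.\<close>
   have "(%n. overlap_avg n (sg i) (sg j)) ----> edge_overlap (sg i) (sg j) \<longleftrightarrow> Cauchy (%n. overlap_avg n (sg i) (sg j))"
    for sg :: "nat => 'd config"
    unfolding edge_overlap_eq by (simp add: convergent_LIMSEQ_iff[symmetric] Cauchy_convergent_iff)
   moreover have "Measurable.pred (replicas cfg) (%sg. Cauchy (%n. overlap_avg n (sg i) (sg (j :: nat) :: 'd config)))"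
    unfolding pred_def by (rule sets_Collect_Cauchy[OF am[OF overlap_avg_measurable]])
   ultimately show ?thesis by simp
  qed
  note [measurable] = this
  have "Measurable.pred (replicas cfg) (%sg. \<forall>i j. (%n. overlap_avg n (sg i) (sg j)) ----> edge_overlap (sg i) (sg (j :: nat) :: 'd config))"
   by measurable
  from mcomp[OF measurable_snd this] show ?thesis unfolding L_def .
 qed
 have "AE z in M. L z" using AE_overlap_converges unfolding L_def by eventually_elim blast
 then have "AE J in nu. AE sg in K J. L (J, sg)"
  unfolding M_def AE_joint_law[OF prob_nu K_kernel Lm] .
 then show ?thesis unfolding L_def K_def snd_conv .
qed

theorem theorem4p3:
  fixes \<rho> :: "real measure" and \<beta> :: real
    and \<kappa> :: "(('d::finite) edge \<Rightarrow> real) \<Rightarrow> 'd config measure measure"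
  assumes "\<beta> > 0"
    and "real_distribution \<rho>"
    and "distr \<rho> borel uminus = \<rho>"
    and "continuous_on UNIV (cdf \<rho>)"
    and "topological_support \<rho> = UNIV"
    and "is_metastate \<rho> \<beta> \<kappa>"
  shows "AE J in coupling_law \<rho>.
    stochastically_stable TYPE('h::{real_inner, polish_space}) TYPE('w) (ea_rost \<kappa> J)"
proof -
 interpret coupling \<rho> "TYPE('d)" by (rule coupling.intro) fact
 obtain a b where ab: "boxes_to_lattice a b"
  "fdd_tendsto (%n. joint_law nu (%J. replicas (gibbs_ext (a n) (b n) \<beta> J))) (joint_law nu (%J. \<kappa> J \<bind> (%GA. replicas GA)))"
  and \<kappa>: "\<kappa> : nu ->M prob_algebra (prob_algebra cfg)"
  using assms(6) unfolding is_metastate_def nu_def by blast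
 interpret metastate \<rho> "TYPE('d)" \<beta> \<kappa> a b
  by (rule metastate.intro[OF coupling_axioms metastate_axioms.intro]) (fact assms ab \<kappa>)+
 \<comment> \<open>The null sets are fixed before the sampling measure, the field, the parameter
   \<open>t\<close> and the function \<open>F\<close> are chosen, so one set of couplings serves
   them all.\<close>
 show ?thesis unfolding nu_def[symmetric]
  using AE_overlaps_converge AE_tilt_invariant AE_space
 proof eventually_elim
  fix J assume J: "J : space nu"
   and conv: "AE sg in \<kappa> J \<bind> (%GA. replicas GA). \<forall>i j. (%n. overlap_avg n (sg i) (sg j)) ----> edge_overlap (sg i) (sg j)"
   and inv: "\<forall>n h. distr (\<kappa> J \<bind> (%GA. replicas (reweight (edge_weight 1 (cube_edges n) h) GA))) array_space ov
    = distr (\<kappa> J \<bind> replicas) array_space ov"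
  note P0 = \<kappa>_prob[OF J]
  show "stochastically_stable TYPE('h) TYPE('w) (ea_rost \<kappa> J)"
   unfolding stochastically_stable_def ea_rost_def
  proof (intro conjI allI impI)
   show "is_rost (overlap_array_law edge_overlap (\<kappa> J))" by (rule is_rost_edge_overlap[OF P0 conv])
   fix P :: "'h measure measure" and OM :: "'w measure" and l :: "'h => 'w => real" and t :: real and s :: nat and F :: "(nat \<times> nat => real) => real"
   assume PO: "is_sampling_measure P (overlap_array_law edge_overlap (\<kappa> J)) & isonormal_field OM l"
    and F: "continuous_on UNIV F & (\<forall>q q'. (\<forall>i j. i < j & j < s --> q (i, j) = q' (i, j)) --> F q = F q')"
   have dep: "F q = F q'" if "!!i j. i < j ==> j < s ==> q (i, j) = q' (i, j)" for q q'
    using F that by blast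
   show "(LINT om|OM. (LINT mu|P. (LINT v|PiM {..<s} (%_. mu). F (%(i, j). v i \<bullet> v j) * (PROD i<s. tilt t l om (v i)))
     / (LINT v|mu. tilt t l om v) ^ s))
    = (LINT mu|P. (LINT v|PiM {..<s} (%_. mu). F (%(i, j). v i \<bullet> v j)))"
    by (rule stability_transfer[OF P0 inv[rule_format] conv conjunct1[OF PO] conjunct2[OF PO] conjunct1[OF F] dep])
  qed
 qed
qed

end
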